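(* Let $\widehat X\to X$ be a normal covering of a connected graph $X$ of genus $n\ge 2$ with abelian Galois group $A$. The action of $\mathrm{Out}(F_n)$ by homotopy equivalences on $X$ lifts to an action by fiber-preserving homotopy equivalences on $\widehat X$ if and only if $A\cong(\mathbb{Z}/r)^n$ with $r$ coprime to $n-1$.
   Context: The genus of a connected graph $X$ is the rank of $H_1(X)$, so here $\pi_1(X)\cong F_n$, the free group of rank $n$. Write $p\colon\widehat X\to X$ for the covering map ($\widehat X$ is connected); the Galois group is the group of deck transformations. $\mathrm{HE}(X)$ denotes the group of free homotopy classes of self-homotopy equivalences of $X$; since $X$ is a $K(F_n,1)$, $\mathrm{HE}(X)\cong\mathrm{Out}(F_n)$, and this isomorphism is the "action of $\mathrm{Out}(F_n)$ by homotopy equivalences on $X$". A self-homotopy equivalence $\hat h$ of $\widehat X$ is fiber-preserving if $p(x)=p(y)$ implies $p\hat h(x)=p\hat h(y)$. $\mathrm{FHE}(\widehat X)$ is the group of fiber-preserving homotopy classes of fiber-preserving self-homotopy equivalences of $\widehat X$. Each such $\hat h$ induces a self-homotopy equivalence of $X$, giving a homomorphism $p_*\colon\mathrm{FHE}(\widehat X)\to\mathrm{HE}(X)$. The action of $\mathrm{Out}(F_n)$ on $X$ is said to lift to an action on $\widehat X$ by fiber-preserving homotopy equivalences if there is a homomorphism $s\colon\mathrm{HE}(X)\to\mathrm{FHE}(\widehat X)$ with $p_*\circ s=\mathrm{id}$. *)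

theory Defs
  imports "HOL-Homology.Homology" "HOL-Algebra.Bij"
begin

text \<open>A graph is a one-dimensional CW complex: a discrete vertex set \<open>V\<close> to which a family of
  copies of the unit interval is attached along their end points. The set \<open>E\<close> consists of the
  characteristic maps of the edges; loops, multiple edges and infinite \<open>V\<close> and \<open>E\<close> are allowed.
  The last clause is the weak topology, which also makes \<open>V\<close> closed and discrete and the
  characteristic maps continuous.\<close>

definition topological_graph :: "'a topology \<Rightarrow> bool" where
  "topological_graph X \<longleftrightarrow>
     (\<exists>(V :: 'a set) (E :: (real \<Rightarrow> 'a) set).
        V \<subseteq> topspace X \<and>
        (\<forall>e\<in>E. e 0 \<in> V \<and> e 1 \<in> V) \<and>
        bij_betw (\<lambda>(e, t). e t) (E \<times> {0<..<1}) (topspace X - V) \<and>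
        (\<forall>U. openin X U \<longleftrightarrow>
           U \<subseteq> topspace X \<and>
           (\<forall>e\<in>E. openin (top_of_set {0..1}) {t \<in> {0..1}. e t \<in> U})))"

text \<open>The first homology group of a graph is free abelian, so having rank \<open>n\<close> means having a basis
  with \<open>n\<close> elements. A predicate is used because the rank may be infinite.\<close>

definition has_genus :: "'a topology \<Rightarrow> nat \<Rightarrow> bool" where
  "has_genus X n \<longleftrightarrow> homology_group 1 X \<cong> free_Abelian_group {..<n}"

text \<open>As in \<^const>\<open>BijGroup\<close>, deck transformations are taken to be extensional, so that each one is
  represented by exactly one function.\<close>

definition deck_transformations ::
    "'b::topological_space set \<Rightarrow> ('b \<Rightarrow> 'a) \<Rightarrow> ('b \<Rightarrow> 'b) set" where
  "deck_transformations Xhat p =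
     {f \<in> Bij Xhat. homeomorphic_map (top_of_set Xhat) (top_of_set Xhat) f \<and>
                    (\<forall>x\<in>Xhat. p (f x) = p x)}"

definition deck_group :: "'b::topological_space set \<Rightarrow> ('b \<Rightarrow> 'a) \<Rightarrow> ('b \<Rightarrow> 'b) monoid" where
  "deck_group Xhat p = (BijGroup Xhat)\<lparr>carrier := deck_transformations Xhat p\<rparr>"

definition normal_covering ::
    "'b::topological_space set \<Rightarrow> ('b \<Rightarrow> 'a::topological_space) \<Rightarrow> 'a set \<Rightarrow> bool" where
  "normal_covering Xhat p X \<longleftrightarrow>
     covering_space Xhat p X \<and>
     (\<forall>x\<in>Xhat. \<forall>y\<in>Xhat. p x = p y \<longrightarrow> (\<exists>f\<in>deck_transformations Xhat p. f x = y))"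

definition self_homotopy_equivalence :: "'a topology \<Rightarrow> ('a \<Rightarrow> 'a) \<Rightarrow> bool" where
  "self_homotopy_equivalence X f \<longleftrightarrow>
     continuous_map X X f \<and>
     (\<exists>g. continuous_map X X g \<and>
          homotopic_with (\<lambda>_. True) X X (g \<circ> f) id \<and>
          homotopic_with (\<lambda>_. True) X X (f \<circ> g) id)"

text \<open>Self-homotopy equivalences with property \<open>P\<close>, up to homotopies through maps with property
  \<open>P\<close>. The product is induced by composition and written without choosing representatives.\<close>

definition HE_with :: "(('a \<Rightarrow> 'a) \<Rightarrow> bool) \<Rightarrow> 'a topology \<Rightarrow> ('a \<Rightarrow> 'a) set monoid" where
  "HE_with P X =
     \<lparr>carrier = {f. self_homotopy_equivalence X f \<and> P f} // {(f, g). homotopic_with P X X f g},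
      monoid.mult = (\<lambda>C D. {h. \<exists>f\<in>C. \<exists>g\<in>D. homotopic_with P X X (f \<circ> g) h}),
      one = {f. homotopic_with P X X id f}\<rparr>"

definition HE :: "'a::topological_space set \<Rightarrow> ('a \<Rightarrow> 'a) set monoid" where
  "HE X = HE_with (\<lambda>_. True) (top_of_set X)"

definition fiber_preserving :: "'b set \<Rightarrow> ('b \<Rightarrow> 'a) \<Rightarrow> ('b \<Rightarrow> 'b) \<Rightarrow> bool" where
  "fiber_preserving Xhat p f \<longleftrightarrow>
     (\<forall>x\<in>Xhat. \<forall>y\<in>Xhat. p x = p y \<longrightarrow> p (f x) = p (f y))"

definition FHE :: "'b::topological_space set \<Rightarrow> ('b \<Rightarrow> 'a) \<Rightarrow> ('b \<Rightarrow> 'b) set monoid" where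
  "FHE Xhat p = HE_with (fiber_preserving Xhat p) (top_of_set Xhat)"

text \<open>The map \<open>p\<^sub>*\<close> sends the class of \<open>f\<close> to the class of the map \<open>h\<close> on the base with
  \<open>h \<circ> p = p \<circ> f\<close>, which is unique on \<open>X\<close> because \<open>p\<close> is onto.\<close>

definition FHE_to_HE ::
    "'b set \<Rightarrow> ('b \<Rightarrow> 'a) \<Rightarrow> 'a::topological_space set \<Rightarrow> ('b \<Rightarrow> 'b) set \<Rightarrow> ('a \<Rightarrow> 'a) set" where
  "FHE_to_HE Xhat p X C =
     {g. \<exists>f\<in>C. \<exists>h. (\<forall>x\<in>Xhat. h (p x) = p (f x)) \<and>
                   homotopic_with (\<lambda>_. True) (top_of_set X) (top_of_set X) h g}"

definition Out_action_lifts ::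
    "'b::topological_space set \<Rightarrow> ('b \<Rightarrow> 'a::topological_space) \<Rightarrow> 'a set \<Rightarrow> bool" where
  "Out_action_lifts Xhat p X \<longleftrightarrow>
     (\<exists>s \<in> hom (HE X) (FHE Xhat p). \<forall>c \<in> carrier (HE X). FHE_to_HE Xhat p X (s c) = c)"

end

theory Submission
  imports Defs
begin

text \<open>Let \<open>A\<close> be the Galois group, so that the covering is classified by an epimorphism
  \<open>\<pi>\<^sub>1(X) = F\<^sub>n \<rightarrow> A\<close>.

  If the action lifts, then every automorphism of \<open>F\<^sub>n\<close> preserves the kernel of this epimorphism.
  Invariance under transvections makes it the kernel of \<open>F\<^sub>n \<rightarrow> (\<int>/r)\<^sup>n\<close> for some \<open>r\<close>. For the
  coprimality, take the automorphism that fixes one generator and permutes the other \<open>n - 1\<close>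
  cyclically up to a conjugation by the fixed one; its power \<open>n - 1\<close> is inner. The same
  power of its lift is therefore a lift of the identity in the class of the section at \<open>1\<close>, and
  such a lift is fiber-preservingly homotopic to its square, hence trivial because \<open>F\<^sub>n\<close> has no
  centre. The translation part of the lift, counted \<open>n - 1\<close> times, must thus cancel a generator
  of \<open>(\<int>/r)\<^sup>n\<close>.

  Conversely, if the kernel is that of \<open>F\<^sub>n \<rightarrow> (\<int>/r)\<^sup>n\<close>, then lifts of a homotopy equivalence
  correspond to representing automorphisms of \<open>F\<^sub>n\<close> modulo conjugation by that kernel. The
  contraction of the quadratic part of an automorphism (with respect to the Magnus expansion) is a
  crossed homomorphism with values in \<open>\<int>\<^sup>n\<close> that takes conjugation by \<open>g\<close> to \<open>1 - n\<close> times the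
  class of \<open>g\<close>. When \<open>n - 1\<close> is invertible modulo \<open>r\<close>, exactly one lift makes it vanish modulo
  \<open>r\<close>, and these lifts form the section.

  The freeness of \<open>\<pi>\<^sub>1(X)\<close> enters only through three consequences of contracting a maximal tree: the
  \<open>n\<close> handles generate, they can be mapped to arbitrary loops, and the linear and quadratic
  parts are well defined. The last are read off from coverings of \<open>X\<close> with the integral
  Heisenberg group as fibre.\<close>

section \<open>Covering spaces of arbitrary topological spaces\<close>

text \<open>Three points lie behind the overview. The isomorphism type of \<open>A\<close> is given
  abstractly, whereas the construction of lifts needs the kernel of the monodromy; the surjection
  from (Z/r)^n through which the monodromy factors has to be shown injective, by counting for r > 0
  and by a determinant for r = 0. The value r = 0 stands for Z^n, and coprimality with n - 1 then
  leaves only n = 2. Secondly, equivalences are given up to free homotopy, so every self-map is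
  accompanied by a path from the base point to its image. Changing this path by a loop conjugates
  the induced endomorphism and moves the lift by the monodromy of the same loop; this dictionary
  turns the choice of lifts into algebra. Finally, the factor 1 - n is a trace: the diagonal of the
  quadratic part of a conjugation contains the class of g once with sign plus and n times with sign
  minus. A central element enters through its abelian class alone: the quadratic invariants force
  that class to vanish, and an abelian Galois group sees no more of a loop.\<close>

lemma continuous_on_local:
  fixes f :: "'a::topological_space \<Rightarrow> 'b::topological_space"
  assumes "\<And>x. x \<in> S \<Longrightarrow> \<exists>U. openin (top_of_set S) U \<and> x \<in> U \<and> continuous_on U f"
  shows "continuous_on S f"
proof (subst continuous_on_def, rule ballI)
  fix x assume x: "x \<in> S"
  then obtain U where U: "openin (top_of_set S) U" "x \<in> U" "continuous_on U f"
    using assms by blast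
  then obtain O' where O': "open O'" "U = S \<inter> O'"
    by (meson openin_open)
  have "at x within S = at x within U"
    by (rule at_within_nhd[of _ O']) (use U O' in auto)
  with U show "(f \<longlongrightarrow> f x) (at x within S)"
    by (metis continuous_on_def)
qed

text \<open>A choice-function form of an evenly covered set: \<open>\<sigma> y\<close> is the sheet
  through \<open>y\<close>. Constancy of \<open>\<sigma>\<close> on each sheet stands for the
  disjointness of the sheets.\<close>

definition sheets ::
    "'b::topological_space set \<Rightarrow> ('b \<Rightarrow> 'a::topological_space) \<Rightarrow> 'a set \<Rightarrow> 'a set \<Rightarrow> ('b \<Rightarrow> 'b set) \<Rightarrow> bool" where
  "sheets C p S T \<sigma> \<longleftrightarrow> openin (top_of_set S) T \<and>
     (\<forall>y. y \<in> C \<longrightarrow> p y \<in> T \<longrightarrow> openin (top_of_set C) (\<sigma> y) \<and> y \<in> \<sigma> y \<and> \<sigma> y \<subseteq> C \<and>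
        (\<exists>q. homeomorphism (\<sigma> y) T p q) \<and> (\<forall>z\<in>\<sigma> y. \<sigma> z = \<sigma> y))"

lemma sheetsD:
  assumes "sheets C p S T \<sigma>" "y \<in> C" "p y \<in> T"
  shows "openin (top_of_set C) (\<sigma> y)" "y \<in> \<sigma> y" "\<sigma> y \<subseteq> C" "\<exists>q. homeomorphism (\<sigma> y) T p q"
    "\<And>z. z \<in> \<sigma> y \<Longrightarrow> \<sigma> z = \<sigma> y"
  using assms unfolding sheets_def by blast+

lemma sheets_openin: "sheets C p S T \<sigma> \<Longrightarrow> openin (top_of_set S) T"
  unfolding sheets_def by blast

lemma covering_sheets:
  assumes cov: "covering_space C p S" and x: "x \<in> S"
  obtains T \<sigma> where "x \<in> T" "sheets C p S T \<sigma>"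
proof -
  obtain T v where T: "x \<in> T" "openin (top_of_set S) T"
    and v: "\<Union>v = C \<inter> p -` T" "\<And>u. u \<in> v \<Longrightarrow> openin (top_of_set C) u" "pairwise disjnt v"
      "\<And>u. u \<in> v \<Longrightarrow> \<exists>q. homeomorphism u T p q"
    using cov x unfolding covering_space_def by metis
  define \<sigma> where "\<sigma> y = (SOME u. u \<in> v \<and> y \<in> u)" for y
  have \<sigma>: "\<sigma> y \<in> v \<and> y \<in> \<sigma> y" if "y \<in> C" "p y \<in> T" for y
    unfolding \<sigma>_def by (rule someI_ex) (use v(1) that in blast)
  have sub: "\<sigma> y \<subseteq> C \<inter> p -` T" if "y \<in> C" "p y \<in> T" for y
    using \<sigma>[OF that] v(1) by blast
  have eq: "\<sigma> z = \<sigma> y" if y: "y \<in> C" "p y \<in> T" and z: "z \<in> \<sigma> y" for y z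
  proof -
    have z': "z \<in> C" "p z \<in> T"
      using sub[OF y] z by auto
    have "\<not> disjnt (\<sigma> z) (\<sigma> y)"
      using \<sigma>[OF z'] z by (auto simp: disjnt_def)
    then show ?thesis
      using \<sigma>[OF z'] \<sigma>[OF y] v(3) by (auto simp: pairwise_def)
  qed
  have "sheets C p S T \<sigma>"
    unfolding sheets_def
  proof (intro conjI allI impI T(2))
    fix y assume y: "y \<in> C" "p y \<in> T"
    show "openin (top_of_set C) (\<sigma> y)" "y \<in> \<sigma> y" "\<exists>q. homeomorphism (\<sigma> y) T p q"
      using \<sigma>[OF y] v(2,4) by auto
    show "\<sigma> y \<subseteq> C"
      using sub[OF y] by auto
    show "\<forall>z\<in>\<sigma> y. \<sigma> z = \<sigma> y"
      using eq[OF y] by auto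
  qed
  with T(1) show ?thesis by (rule that)
qed

lemma sheet_inj:
  assumes "sheets C p S T \<sigma>" "y \<in> C" "p y \<in> T" "u \<in> \<sigma> y" "w \<in> \<sigma> y" "p u = p w"
  shows "u = w"
  using sheetsD(4)[OF assms(1-3)] assms(4-6) unfolding homeomorphism_def by metis

text \<open>The set where the two lifts agree is clopen. The spaces are arbitrary, so its closedness
  does not come from a Hausdorff axiom but from the sheets: different points over the same base
  point lie in different, hence disjoint, sheets.\<close>

lemma covering_lift_unique:
  fixes p :: "'b::topological_space \<Rightarrow> 'a::topological_space"
    and f :: "'c::topological_space \<Rightarrow> 'b"
  assumes cov: "covering_space C p S" and Y: "connected Y"
    and f: "continuous_on Y f" "f \<in> Y \<rightarrow> C" and g: "continuous_on Y g" "g \<in> Y \<rightarrow> C"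
    and eq: "\<And>y. y \<in> Y \<Longrightarrow> p (f y) = p (g y)" and a: "a \<in> Y" "f a = g a" and y: "y \<in> Y"
  shows "f y = g y"
proof -
  let ?E = "{z\<in>Y. f z = g z}"
  have loc: "\<exists>N. openin (top_of_set Y) N \<and> z \<in> N \<and>
      (if f z = g z then N \<subseteq> ?E else N \<subseteq> Y - ?E)" if z: "z \<in> Y" for z
  proof -
    have "p (f z) \<in> S"
      using cov f(2) z by (auto simp: covering_space_def)
    then obtain T \<sigma> where T: "p (f z) \<in> T" "sheets C p S T \<sigma>"
      by (rule covering_sheets[OF cov])
    have fz: "f z \<in> C" "g z \<in> C" "p (g z) \<in> T"
      using funcset_mem[OF f(2) z] funcset_mem[OF g(2) z] eq[OF z] T(1) by simp_all
    note sf = sheetsD[OF T(2) fz(1) T(1)] and sg = sheetsD[OF T(2) fz(2,3)]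
    let ?N = "(Y \<inter> f -` \<sigma> (f z)) \<inter> (Y \<inter> g -` \<sigma> (g z))"
    have "openin (top_of_set Y) ?N"
      by (intro openin_Int continuous_openin_preimage[of _ _ C] f g sf(1) sg(1))
    moreover have "z \<in> ?N"
      using z sf(2) sg(2) by auto
    moreover have "?N \<subseteq> ?E" if "f z = g z"
      using that sheet_inj[OF T(2) fz(1) T(1)] eq by auto
    moreover have "?N \<subseteq> Y - ?E" if ne: "f z \<noteq> g z"
    proof
      fix w assume w: "w \<in> ?N"
      show "w \<in> Y - ?E"
      proof (rule ccontr)
        assume "w \<notin> Y - ?E"
        with w have "f w \<in> \<sigma> (f z)" "f w \<in> \<sigma> (g z)"
          by auto
        then have "\<sigma> (f z) = \<sigma> (g z)"
          using sf(5) sg(5) by metis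
        then have "f z = g z"
          using sheet_inj[OF T(2) fz(1) T(1)] sf(2) sg(2) eq[OF z] by auto
        with ne show False ..
      qed
    qed
    ultimately show ?thesis
      by (intro exI[of _ ?N]) auto
  qed
  have "openin (top_of_set Y) ?E"
    by (subst openin_subopen) (use loc in \<open>fastforce split: if_splits\<close>)
  moreover have "openin (top_of_set Y) (Y - ?E)"
  proof (subst openin_subopen, intro ballI)
    fix w assume "w \<in> Y - ?E"
    then show "\<exists>T. openin (top_of_set Y) T \<and> w \<in> T \<and> T \<subseteq> Y - ?E"
      using loc[of w] by (auto split: if_splits)
  qed
  then have "closedin (top_of_set Y) ?E"
    by (auto simp: closedin_def)
  ultimately have "?E = {} \<or> ?E = Y"
    using Y by (metis (lifting) connected_clopen)
  then show ?thesis
    using a y by blast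
qed

text \<open>For a short time and near \<open>y\<close> the homotopy stays in one evenly covered set,
  where a local inverse of \<open>p\<close> lifts it. Finitely many short times are glued while the
  neighbourhood of \<open>y\<close> shrinks.\<close>

lemma covering_lift_homotopy_local:
  fixes p :: "'b::topological_space \<Rightarrow> 'a::topological_space"
    and H :: "real \<times> 'c::topological_space \<Rightarrow> 'a"
  assumes cov: "covering_space C p S" and H: "continuous_on ({0..1} \<times> Y) H" "H \<in> ({0..1} \<times> Y) \<rightarrow> S"
    and f: "continuous_on Y f" "f \<in> Y \<rightarrow> C" "\<And>y. y \<in> Y \<Longrightarrow> p (f y) = H (0,y)" and y: "y \<in> Y"
  shows "\<exists>N k. openin (top_of_set Y) N \<and> y \<in> N \<and> continuous_on ({0..1} \<times> N) k
    \<and> k \<in> ({0..1} \<times> N) \<rightarrow> C \<and> (\<forall>z\<in>N. k (0,z) = f z) \<and> (\<forall>w\<in>{0..1} \<times> N. p (k w) = H w)"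
proof -
  define L where "L a b N k \<longleftrightarrow> openin (top_of_set Y) N \<and> y \<in> N \<and> continuous_on ({a..b} \<times> N) k
    \<and> k \<in> ({a..b} \<times> N) \<rightarrow> C \<and> (\<forall>w\<in>{a..b} \<times> N. p (k w) = H w)" for a b N k
  \<comment> \<open>Neighbourhood and initial lift are quantified inside, so that
    \<open>P a b\<close> and \<open>P b c\<close> compose: the end of the first lift is the initial
    value of the second. The premises on \<open>a\<close> and \<open>b\<close> make \<open>P\<close>
    vacuous outside the unit interval, since \<open>Bolzano\<close> lets the short intervals stick
    out of it.\<close>
  define P where "P a b \<longleftrightarrow> (0 \<le> a \<longrightarrow> b \<le> 1 \<longrightarrow> (\<forall>N f. openin (top_of_set Y) N \<and> y \<in> N \<and>
     continuous_on N f \<and> f \<in> N \<rightarrow> C \<and> (\<forall>z\<in>N. p (f z) = H (a,z)) \<longrightarrow>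
     (\<exists>N' k. N' \<subseteq> N \<and> L a b N' k \<and> (\<forall>z\<in>N'. k (a,z) = f z))))" for a b :: real
  have "P 0 1"
  proof (rule Bolzano)
    fix a b c :: real
    assume P: "P a b" "P b c" and ab: "a \<le> b" "b \<le> c"
    show "P a c"
      unfolding P_def
    proof (intro impI allI, elim conjE)
      fix N f
      assume a: "0 \<le> a" "c \<le> 1" "openin (top_of_set Y) N" "y \<in> N" "continuous_on N f"
        "f \<in> N \<rightarrow> C" "\<forall>z\<in>N. p (f z) = H (a,z)"
      obtain N1 k1 where 1: "N1 \<subseteq> N" "L a b N1 k1" "\<forall>z\<in>N1. k1 (a,z) = f z"
        using P(1) a ab unfolding P_def by (meson order_trans)
      have c1: "continuous_on N1 (\<lambda>z. k1 (b,z))" "(\<lambda>z. k1 (b,z)) \<in> N1 \<rightarrow> C"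
        using 1 ab unfolding L_def
        by (auto intro!: continuous_on_compose2[of "{a..b} \<times> N1" k1] continuous_intros)
      obtain N2 k2 where 2: "N2 \<subseteq> N1" "L b c N2 k2" "\<forall>z\<in>N2. k2 (b,z) = k1 (b,z)"
        using P(2) a(1,2) ab 1 c1 unfolding P_def L_def
        by (smt (verit) SigmaI atLeastAtMost_iff)
      define k where "k w = (if fst w \<le> b then k1 w else k2 w)" for w
      have "continuous_on ({a..c} \<times> N2) k"
        unfolding k_def
      proof (rule continuous_on_cases_le)
        show "continuous_on {x \<in> {a..c} \<times> N2. fst x \<le> b} k1"
          by (rule continuous_on_subset[of "{a..b} \<times> N1"]) (use 1 2 in \<open>auto simp: L_def\<close>)
        show "continuous_on {x \<in> {a..c} \<times> N2. b \<le> fst x} k2"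
          by (rule continuous_on_subset[of "{b..c} \<times> N2"]) (use 1 2 in \<open>auto simp: L_def\<close>)
        show "continuous_on ({a..c} \<times> N2) fst"
          by (intro continuous_intros)
      qed (use 2 in auto)
      moreover have "k w \<in> C \<and> p (k w) = H w" if w: "w \<in> {a..c} \<times> N2" for w
      proof (cases "fst w \<le> b")
        case True
        then have "w \<in> {a..b} \<times> N1" using w 2(1) by (auto simp: mem_Times_iff)
        then show ?thesis
          using 1(2) True unfolding L_def k_def by (auto simp: Pi_iff)
      next
        case False
        then have "w \<in> {b..c} \<times> N2" using w by (auto simp: mem_Times_iff)
        then show ?thesis
          using 2(2) False unfolding L_def k_def by (auto simp: Pi_iff)
      qed
      moreover have "\<forall>z\<in>N2. k (a,z) = f z"
        using 1 2 ab by (auto simp: k_def)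
      ultimately show "\<exists>N' k. N' \<subseteq> N \<and> L a c N' k \<and> (\<forall>z\<in>N'. k (a,z) = f z)"
        using 1 2 unfolding L_def by (intro exI[of _ N2] exI[of _ k]) auto
    qed
  next
    fix x :: real
    assume x: "0 \<le> x" "x \<le> 1"
    then have "H (x,y) \<in> S"
      using H y by auto
    then obtain T \<sigma> where T: "H (x,y) \<in> T" "sheets C p S T \<sigma>"
      by (rule covering_sheets[OF cov])
    have HT: "openin (top_of_set ({0..1} \<times> Y)) (({0..1} \<times> Y) \<inter> H -` T)"
      by (rule continuous_openin_preimage[OF H sheets_openin[OF T(2)]])
    have "(x, y) \<in> ({0..1} \<times> Y) \<inter> H -` T"
      using x y T(1) by auto
    then obtain V N0 where V: "openin (top_of_set {0..1}) V" "x \<in> V" "openin (top_of_set Y) N0" "y \<in> N0"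
        "V \<times> N0 \<subseteq> ({0..1} \<times> Y) \<inter> H -` T"
      by (rule Times_in_interior_subtopology[OF _ HT])
    then obtain d where d: "d > 0" "\<And>t. t \<in> {0..1} \<Longrightarrow> dist t x < d \<Longrightarrow> t \<in> V"
      by (auto simp: openin_euclidean_subtopology_iff)
    show "\<exists>d>0. \<forall>a b. a \<le> x \<and> x \<le> b \<and> b - a < d \<longrightarrow> P a b"
    proof (intro exI[of _ d] conjI allI impI d(1))
      fix a b assume ab: "a \<le> x \<and> x \<le> b \<and> b - a < d"
      show "P a b"
        unfolding P_def
      proof (intro impI allI, elim conjE)
        fix N f
        assume a: "0 \<le> a" "b \<le> 1" "openin (top_of_set Y) N" "y \<in> N" "continuous_on N f"
          "f \<in> N \<rightarrow> C" "\<forall>z\<in>N. p (f z) = H (a,z)"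
        have abV: "{a..b} \<subseteq> V"
          using d(2) ab a by (auto simp: dist_real_def)
        have "(a, y) \<in> V \<times> N0"
          using abV V(4) ab by auto
        then have fy: "f y \<in> C" "p (f y) \<in> T"
          using a(4,6,7) V(5) by auto
        note sf = sheetsD[OF T(2) fy]
        obtain q where q: "homeomorphism (\<sigma> (f y)) T p q"
          using sf(4) by blast
        define N' where "N' = N0 \<inter> (N \<inter> f -` \<sigma> (f y))"
        have N': "openin (top_of_set Y) N'"
          unfolding N'_def
          by (rule openin_Int[OF V(3) openin_trans[OF continuous_openin_preimage[OF a(5,6) sf(1)] a(3)]])
        have HT: "H \<in> ({a..b} \<times> N') \<rightarrow> T"
          using V(5) abV by (auto simp: N'_def)
        have sub: "{a..b} \<times> N' \<subseteq> {0..1} \<times> Y"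
          using V(5) abV by (auto simp: N'_def)
        have "L a b N' (\<lambda>w. q (H w))"
          unfolding L_def
        proof (intro conjI N')
          show "y \<in> N'"
            using a V sf(2) by (auto simp: N'_def)
          show "continuous_on ({a..b} \<times> N') (\<lambda>w. q (H w))"
            by (rule continuous_on_compose2[of T q])
              (use q HT continuous_on_subset[OF H(1) sub] in \<open>auto simp: homeomorphism_def\<close>)
          have qC: "q x \<in> C" "p (q x) = x" if "x \<in> T" for x
            using q sf(3) that unfolding homeomorphism_def by blast+
          show "(\<lambda>w. q (H w)) \<in> {a..b} \<times> N' \<rightarrow> C" "\<forall>w\<in>{a..b} \<times> N'. p (q (H w)) = H w"
            using qC HT by (blast intro: funcset_mem Pi_I)+
        qed
        moreover have "\<forall>z\<in>N'. q (H (a,z)) = f z"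
        proof
          fix z assume "z \<in> N'"
          then have "f z \<in> \<sigma> (f y)" "p (f z) = H (a, z)"
            using a(7) by (auto simp: N'_def)
          then show "q (H (a,z)) = f z"
            using q by (metis homeomorphism_def)
        qed
        ultimately show "\<exists>N' k. N' \<subseteq> N \<and> L a b N' k \<and> (\<forall>z\<in>N'. k (a,z) = f z)"
          by (intro exI[of _ N'] exI[of _ "\<lambda>w. q (H w)"]) (auto simp: N'_def)
      qed
    qed
  qed auto
  then show ?thesis
    using f y unfolding P_def L_def by (smt (verit, best) openin_subtopology_self order_refl)
qed

text \<open>Local lifts on overlapping tubes agree, because over each fixed point both lift the same
  path from the same start. So they form one function, which is continuous since the tubes are
  open.\<close>

proposition covering_lift_homotopy:
  fixes p :: "'b::topological_space \<Rightarrow> 'a::topological_space"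
    and H :: "real \<times> 'c::topological_space \<Rightarrow> 'a"
  assumes cov: "covering_space C p S" and H: "continuous_on ({0..1} \<times> Y) H" "H \<in> ({0..1} \<times> Y) \<rightarrow> S"
    and f: "continuous_on Y f" "f \<in> Y \<rightarrow> C" "\<And>y. y \<in> Y \<Longrightarrow> p (f y) = H (0,y)"
  obtains k where "continuous_on ({0..1} \<times> Y) k" "k \<in> ({0..1} \<times> Y) \<rightarrow> C"
    "\<And>y. y \<in> Y \<Longrightarrow> k (0,y) = f y" "\<And>t y. t \<in> {0..1} \<Longrightarrow> y \<in> Y \<Longrightarrow> p (k (t,y)) = H (t,y)"
proof -
  define G where "G y N k \<longleftrightarrow> openin (top_of_set Y) N \<and> y \<in> N \<and> continuous_on ({0..1} \<times> N) k
    \<and> k \<in> ({0..1} \<times> N) \<rightarrow> C \<and> (\<forall>z\<in>N. k (0,z) = f z) \<and> (\<forall>w\<in>{0..1} \<times> N. p (k w) = H w)" for y N k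
  have "\<forall>y. \<exists>N k. y \<in> Y \<longrightarrow> G y N k"
    unfolding G_def using covering_lift_homotopy_local[OF assms] by metis
  then obtain N k where Nk: "\<And>y. y \<in> Y \<Longrightarrow> G y (N y) (k y)"
    by metis
  have agree: "k z (t,w) = k y (t,w)" if "y \<in> Y" "z \<in> Y" "w \<in> N y" "w \<in> N z" "t \<in> {0..1}" for y z w t
  proof (rule covering_lift_unique[OF cov, where Y = "{0..1::real}" and a = 0
        and f = "\<lambda>t. k z (t,w)" and g = "\<lambda>t. k y (t,w)"])
    show "continuous_on {0..1} (\<lambda>t. k z (t,w))" "continuous_on {0..1} (\<lambda>t. k y (t,w))"
      using Nk[OF that(1)] Nk[OF that(2)] that unfolding G_def
      by (auto intro!: continuous_on_compose2[of "{0..1} \<times> N z" "k z"]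
          continuous_on_compose2[of "{0..1} \<times> N y" "k y"] continuous_intros)
  qed (use Nk[OF that(1)] Nk[OF that(2)] that in \<open>auto simp: G_def\<close>)
  define K where "K w = k (snd w) w" for w
  have "continuous_on ({0..1} \<times> Y) K"
  proof (rule continuous_on_local)
    fix w :: "real \<times> 'c" assume w: "w \<in> {0..1} \<times> Y"
    then have y: "snd w \<in> Y" by auto
    note n = Nk[OF y, unfolded G_def]
    have ss: "N (snd w) \<subseteq> Y"
      using n by (meson openin_imp_subset)
    have "continuous_on ({0..1} \<times> N (snd w)) K"
      by (rule continuous_on_eq[of _ "k (snd w)"])
        (use n ss Nk agree[OF y] in \<open>auto simp: K_def G_def\<close>)
    moreover have "openin (top_of_set ({0..1} \<times> Y)) ({0..1} \<times> N (snd w))"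
      using n by (auto intro!: openin_Times)
    ultimately show "\<exists>U. openin (top_of_set ({0..1} \<times> Y)) U \<and> w \<in> U \<and> continuous_on U K"
      using n w by (intro exI[of _ "{0..1} \<times> N (snd w)"]) (auto simp: mem_Times_iff)
  qed
  then show ?thesis
    by (rule that) (use Nk in \<open>force simp: K_def G_def\<close>)+
qed

section \<open>Path lifting and the monodromy of paths\<close>

lemma covering_lift_path:
  fixes p :: "'b::topological_space \<Rightarrow> 'a::topological_space"
  assumes cov: "covering_space C p S" and g: "path g" "path_image g \<subseteq> S" and a: "a \<in> C" "p a = pathstart g"
  shows "\<exists>h. path h \<and> path_image h \<subseteq> C \<and> pathstart h = a \<and> (\<forall>t\<in>{0..1}. p (h t) = g t)"
proof -
  \<comment> \<open>A path is a homotopy of maps from a one-point space; \<open>{0::real}\<close> is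
    that space.\<close>
  obtain k where k: "continuous_on ({0..1} \<times> {0::real}) k" "k \<in> ({0..1} \<times> {0}) \<rightarrow> C"
    "k (0,0) = a" "\<And>t y. t \<in> {0..1} \<Longrightarrow> y = 0 \<Longrightarrow> p (k (t,y)) = g t"
  proof (rule covering_lift_homotopy[OF cov, of "{0::real}" "\<lambda>w. g (fst w)" "\<lambda>_. a"])
    show "continuous_on ({0..1} \<times> {0::real}) (\<lambda>w. g (fst w))"
      by (rule continuous_on_compose2[of "{0..1}" g])
        (use g in \<open>auto simp: path_def intro!: continuous_intros\<close>)
  qed (use g a in \<open>auto simp: path_image_def pathstart_def\<close>)
  have "continuous_on {0..1} (\<lambda>t. k (t,0))"
    by (rule continuous_on_compose2[OF k(1)]) (auto intro!: continuous_intros)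
  then show ?thesis
    using k by (intro exI[of _ "\<lambda>t. k (t,0)"]) (auto simp: path_def path_image_def pathstart_def)
qed

text \<open>The monodromy of a path as a function on the fibre over its start. Unique lifting makes
  the choice immaterial; where no lift exists the value is arbitrary.\<close>

definition lift_end :: "'b::topological_space set \<Rightarrow> ('b \<Rightarrow> 'a) \<Rightarrow> (real \<Rightarrow> 'a) \<Rightarrow> 'b \<Rightarrow> 'b" where
  "lift_end C p g a =
     pathfinish (SOME h. path h \<and> path_image h \<subseteq> C \<and> pathstart h = a \<and> (\<forall>t\<in>{0..1}. p (h t) = g t))"

lemma lift_end_eq:
  fixes p :: "'b::topological_space \<Rightarrow> 'a::topological_space"
  assumes cov: "covering_space C p S"
    and h: "path h" "path_image h \<subseteq> C" "pathstart h = a" "\<And>t. t \<in> {0..1} \<Longrightarrow> p (h t) = g t"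
  shows "lift_end C p g a = pathfinish h"
proof -
  let ?P = "\<lambda>h. path h \<and> path_image h \<subseteq> C \<and> pathstart h = a \<and> (\<forall>t\<in>{0..1}. p (h t) = g t)"
  define h' where "h' = (SOME h. ?P h)"
  have "?P h'"
    unfolding h'_def by (rule someI[of ?P h]) (use h in auto)
  then have h': "path h'" "path_image h' \<subseteq> C" "pathstart h' = a" "\<And>t. t \<in> {0..1} \<Longrightarrow> p (h' t) = g t"
    by blast+
  have "h' 1 = h 1"
    by (rule covering_lift_unique[OF cov, where Y = "{0..1::real}" and a = 0])
      (use h h' in \<open>auto simp: path_def path_image_def pathstart_def\<close>)
  then show ?thesis
    by (simp add: lift_end_def h'_def pathfinish_def)
qed

lemma lift_end_obtain:
  fixes p :: "'b::topological_space \<Rightarrow> 'a::topological_space"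
  assumes cov: "covering_space C p S" and g: "path g" "path_image g \<subseteq> S" and a: "a \<in> C" "p a = pathstart g"
  obtains h where "path h" "path_image h \<subseteq> C" "pathstart h = a" "pathfinish h = lift_end C p g a"
    "\<And>t. t \<in> {0..1} \<Longrightarrow> p (h t) = g t"
  using covering_lift_path[OF assms] lift_end_eq[OF cov] by metis

lemma lift_end_in:
  fixes p :: "'b::topological_space \<Rightarrow> 'a::topological_space"
  assumes cov: "covering_space C p S" and g: "path g" "path_image g \<subseteq> S" and a: "a \<in> C" "p a = pathstart g"
  shows "lift_end C p g a \<in> C" "p (lift_end C p g a) = pathfinish g"
proof -
  obtain h where "path h" "path_image h \<subseteq> C" "pathstart h = a" "pathfinish h = lift_end C p g a"
    "\<And>t. t \<in> {0..1} \<Longrightarrow> p (h t) = g t"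
    by (rule lift_end_obtain[OF assms]) blast
  then show "lift_end C p g a \<in> C" "p (lift_end C p g a) = pathfinish g"
    by (metis pathfinish_def pathfinish_in_path_image subsetD,
        metis pathfinish_def atLeastAtMost_iff order_refl zero_le_one)
qed

lemma lift_end_join:
  fixes p :: "'b::topological_space \<Rightarrow> 'a::topological_space"
  assumes cov: "covering_space C p S" and g: "path g" "path_image g \<subseteq> S" and a: "a \<in> C" "p a = pathstart g"
    and g': "path g'" "path_image g' \<subseteq> S" "pathfinish g = pathstart g'"
  shows "lift_end C p (g +++ g') a = lift_end C p g' (lift_end C p g a)"
proof -
  obtain h where h: "path h" "path_image h \<subseteq> C" "pathstart h = a" "pathfinish h = lift_end C p g a"
    "\<And>t. t \<in> {0..1} \<Longrightarrow> p (h t) = g t"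
    by (rule lift_end_obtain[OF cov g a]) blast
  obtain h' where h': "path h'" "path_image h' \<subseteq> C" "pathstart h' = pathfinish h"
    "pathfinish h' = lift_end C p g' (pathfinish h)" "\<And>t. t \<in> {0..1} \<Longrightarrow> p (h' t) = g' t"
    using lift_end_obtain[OF cov g'(1,2)] lift_end_in[OF cov g a] g'(3) h(4) by metis
  have "lift_end C p (g +++ g') a = pathfinish (h +++ h')"
  proof (rule lift_end_eq[OF cov])
    show "p ((h +++ h') t) = (g +++ g') t" if "t \<in> {0..1}" for t
      using that h(5)[of "2 * t"] h'(5)[of "2 * t - 1"] by (auto simp: joinpaths_def)
  qed (use h(1-4) h'(1-4) in \<open>auto simp: path_image_join\<close>)
  then show ?thesis
    using h h' by simp
qed

lemma lift_end_reversepath: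
  fixes p :: "'b::topological_space \<Rightarrow> 'a::topological_space"
  assumes cov: "covering_space C p S" and g: "path g" "path_image g \<subseteq> S" and a: "a \<in> C" "p a = pathstart g"
  shows "lift_end C p (reversepath g) (lift_end C p g a) = a"
proof -
  obtain h where h: "path h" "path_image h \<subseteq> C" "pathstart h = a" "pathfinish h = lift_end C p g a"
    "\<And>t. t \<in> {0..1} \<Longrightarrow> p (h t) = g t"
    by (rule lift_end_obtain[OF cov g a]) blast
  have "lift_end C p (reversepath g) (lift_end C p g a) = pathfinish (reversepath h)"
  proof (rule lift_end_eq[OF cov])
    show "p (reversepath h t) = reversepath g t" if "t \<in> {0..1}" for t
      using that h(5)[of "1 - t"] by (auto simp: reversepath_def)
  qed (use h(1-4) in auto)
  with h show ?thesis by simp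
qed

lemma lift_end_const:
  fixes p :: "'b::topological_space \<Rightarrow> 'a::topological_space"
  assumes cov: "covering_space C p S" and a: "a \<in> C" "\<And>t. t \<in> {0..1} \<Longrightarrow> g t = p a"
  shows "lift_end C p g a = a"
  by (subst lift_end_eq[OF cov, of "\<lambda>_. a"]) (use a in \<open>auto simp: path_def path_image_def pathstart_def pathfinish_def\<close>)

lemma lift_end_homotopic:
  fixes p :: "'b::topological_space \<Rightarrow> 'a::topological_space"
  assumes cov: "covering_space C p S" and hom: "homotopic_paths S g g'" and a: "a \<in> C" "p a = pathstart g"
  shows "lift_end C p g a = lift_end C p g' a"
proof -
  have g: "path g" "path_image g \<subseteq> S" and g': "path g'"
    using hom homotopic_paths_imp_path homotopic_paths_imp_subset by blast+
  obtain h where h: "path h" "path_image h \<subseteq> C" "pathstart h = a" "pathfinish h = lift_end C p g a"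
    "\<And>t. t \<in> {0..1} \<Longrightarrow> p (h t) = g t"
    by (rule lift_end_obtain[OF cov g a]) blast
  obtain H where H: "continuous_on ({0..1} \<times> {0..1}) H" "H \<in> ({0..1} \<times> {0..1}) \<rightarrow> S"
      "\<And>x. x \<in> {0..1} \<Longrightarrow> H (0,x) = g x" "\<And>x. x \<in> {0..1} \<Longrightarrow> H (1,x) = g' x"
      "\<And>t. t \<in> {0..1::real} \<Longrightarrow> H (t,0) = g 0 \<and> H (t,1) = g 1"
    using hom unfolding homotopic_paths by (auto simp: pathstart_def pathfinish_def)
  obtain k where k: "continuous_on ({0..1} \<times> {0..1}) k" "k \<in> ({0..1} \<times> {0..1}) \<rightarrow> C"
      "\<And>y. y \<in> {0..1} \<Longrightarrow> k (0,y) = h y"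
      "\<And>t y. t \<in> {0..1} \<Longrightarrow> y \<in> {0..1} \<Longrightarrow> p (k (t,y)) = H (t,y)"
    by (rule covering_lift_homotopy[OF cov H(1,2), of h])
      (use h H in \<open>auto simp: path_def path_image_def\<close>)
  \<comment> \<open>The sides of the lifted square lie over constant paths and are therefore
    constant; so the far edge also starts at \<open>a\<close> and ends where \<open>h\<close>
    does.\<close>
  have side: "k (1,y) = h y" if "y = 0 \<or> y = 1" for y
  proof (rule covering_lift_unique[OF cov, where Y = "{0..1::real}" and a = 0
        and f = "\<lambda>t. k (t,y)" and g = "\<lambda>t. h y"])
    show "continuous_on {0..1} (\<lambda>t. k (t,y))"
      by (rule continuous_on_compose2[OF k(1)]) (use that in \<open>auto intro!: continuous_intros\<close>)
    show "(\<lambda>t. h y) \<in> {0..1} \<rightarrow> C" "(\<lambda>t. k (t,y)) \<in> {0..1} \<rightarrow> C"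
      using h k(2) that by (auto simp: path_image_def)
    show "p (k (t,y)) = p (h y)" if "t \<in> {0..1}" for t
      using that k(4)[OF that, of y] H(5)[OF that] h(5)[of y] \<open>y = 0 \<or> y = 1\<close> by auto
  qed (use k(3) that in auto)
  have "lift_end C p g' a = pathfinish (\<lambda>y. k (1,y))"
  proof (rule lift_end_eq[OF cov])
    show "path (\<lambda>y. k (1,y))"
      unfolding path_def by (rule continuous_on_compose2[OF k(1)]) (auto intro!: continuous_intros)
  qed (use k side H h in \<open>auto simp: path_image_def pathstart_def\<close>)
  then show ?thesis
    using side[of 1] h(4) by (simp add: pathfinish_def)
qed

text \<open>The classical lifting criterion, with the condition on fundamental groups expressed
  through the action of loops on \<open>a\<close>. The lift is transport along paths from
  \<open>z\<close>; near each point it is a local inverse of \<open>p\<close> composed with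
  \<open>f\<close>, hence continuous.\<close>

proposition covering_lift_general:
  fixes p :: "'b::topological_space \<Rightarrow> 'a::topological_space"
    and f :: "'c::topological_space \<Rightarrow> 'a"
  assumes cov: "covering_space C p S" and a: "a \<in> C" and z: "z \<in> U"
    and U: "path_connected U" "locally path_connected U"
    and f: "continuous_on U f" "f \<in> U \<rightarrow> S" "f z = p a"
    and loops: "\<And>r. \<lbrakk>path r; path_image r \<subseteq> U; pathstart r = z; pathfinish r = z\<rbrakk>
       \<Longrightarrow> lift_end C p (f \<circ> r) a = a"
  obtains g where "continuous_on U g" "g \<in> U \<rightarrow> C" "g z = a" "\<And>y. y \<in> U \<Longrightarrow> p (g y) = f y"
proof -
  have fr: "path (f \<circ> r)" "path_image (f \<circ> r) \<subseteq> S" if "path r" "path_image r \<subseteq> U" for r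
    using that f continuous_on_subset by (auto simp: path_image_compose intro!: path_continuous_image)
  have indep: "lift_end C p (f \<circ> r) a = lift_end C p (f \<circ> r') a"
    if r: "path r" "path_image r \<subseteq> U" "pathstart r = z" and r': "path r'" "path_image r' \<subseteq> U" "pathstart r' = z"
      and e: "pathfinish r = pathfinish r'" for r r'
  proof -
    let ?b = "lift_end C p (f \<circ> r) a"
    have "lift_end C p (f \<circ> (r +++ reversepath r')) a = a"
      by (rule loops) (use r r' e in \<open>auto simp: path_image_join\<close>)
    then have "lift_end C p ((f \<circ> r) +++ reversepath (f \<circ> r')) a = a"
      by (simp add: path_compose_join path_compose_reversepath)
    then have 1: "lift_end C p (reversepath (f \<circ> r')) ?b = a"
      by (subst (asm) lift_end_join[OF cov fr[OF r(1,2)] a])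
        (use fr[OF r'(1,2)] r r' e f in \<open>auto simp: pathstart_compose pathfinish_compose\<close>)
    have "lift_end C p (reversepath (reversepath (f \<circ> r'))) (lift_end C p (reversepath (f \<circ> r')) ?b) = ?b"
      by (rule lift_end_reversepath[OF cov])
        (use fr[OF r'(1,2)] r r' e f lift_end_in[OF cov fr[OF r(1,2)] a] in \<open>auto simp: pathstart_compose pathfinish_compose\<close>)
    with 1 show ?thesis by simp
  qed
  have "\<forall>y. \<exists>r. y \<in> U \<longrightarrow> path r \<and> path_image r \<subseteq> U \<and> pathstart r = z \<and> pathfinish r = y"
    using U(1) z unfolding path_connected_def by blast
  then obtain r where r: "\<And>y. y \<in> U \<Longrightarrow> path (r y)" "\<And>y. y \<in> U \<Longrightarrow> path_image (r y) \<subseteq> U"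
     "\<And>y. y \<in> U \<Longrightarrow> pathstart (r y) = z" "\<And>y. y \<in> U \<Longrightarrow> pathfinish (r y) = y"
    by metis
  define g where "g y = lift_end C p (f \<circ> r y) a" for y
  have gC: "g y \<in> C" "p (g y) = f y" if "y \<in> U" for y
    using lift_end_in[OF cov fr[OF r(1,2)[OF that]] a] r[OF that] f
    by (auto simp: g_def pathstart_compose pathfinish_compose)
  have "g z = a"
    unfolding g_def by (rule loops) (use r[OF z] in auto)
  moreover have "continuous_on U g"
  proof (rule continuous_on_local)
    fix y assume y: "y \<in> U"
    then have "f y \<in> S" using f by auto
    then obtain T \<sigma> where T: "f y \<in> T" "sheets C p S T \<sigma>"
      by (rule covering_sheets[OF cov])
    have gT: "p (g y) \<in> T"
      using gC(2)[OF y] T(1) by simp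
    note sg = sheetsD[OF T(2) gC(1)[OF y] gT]
    obtain q where q: "homeomorphism (\<sigma> (g y)) T p q"
      using sg(4) by blast
    have "openin (top_of_set U) (U \<inter> f -` T)"
      by (rule continuous_openin_preimage[OF f(1,2) sheets_openin[OF T(2)]])
    then obtain V where V: "openin (top_of_set U) V" "path_connected V" "y \<in> V" "V \<subseteq> U \<inter> f -` T"
      using U(2) y T(1) unfolding locally_path_connected by (metis (no_types, lifting) IntI vimageI2)
    \<comment> \<open>Within a path-connected neighbourhood that \<open>f\<close> maps into one
      evenly covered set, the path to \<open>w\<close> may pass through \<open>y\<close>, and its
      last part lifts inside one sheet.\<close>
    have qeq: "g w = q (f w)" if w: "w \<in> V" for w
    proof -
      obtain s where s: "path s" "path_image s \<subseteq> V" "pathstart s = y" "pathfinish s = w"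
        using V w unfolding path_connected_def by blast
      have wU: "w \<in> U" and sU: "path_image s \<subseteq> U" using w V s by auto
      have "g w = lift_end C p (f \<circ> (r y +++ s)) a"
        unfolding g_def by (rule indep) (use r[OF wU] r[OF y] s V sU in \<open>auto simp: path_image_join\<close>)
      also have "\<dots> = lift_end C p ((f \<circ> r y) +++ (f \<circ> s)) a"
        by (simp add: path_compose_join)
      also have "\<dots> = lift_end C p (f \<circ> s) (g y)"
        unfolding g_def
        by (rule lift_end_join[OF cov fr[OF r(1,2)[OF y]] a])
          (use fr[OF s(1) sU] r[OF y] s f in \<open>auto simp: pathstart_compose pathfinish_compose\<close>)
      also have "\<dots> = pathfinish (q \<circ> (f \<circ> s))"
      proof (rule lift_end_eq[OF cov])
        have sT: "path_image (f \<circ> s) \<subseteq> T"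
          using s V by (auto simp: path_image_def)
        show "path (q \<circ> (f \<circ> s))"
          by (rule path_continuous_image[OF fr(1)[OF s(1) sU]])
            (use q sT continuous_on_subset in \<open>auto simp: homeomorphism_def\<close>)
        show "path_image (q \<circ> (f \<circ> s)) \<subseteq> C"
          using sT q sg(3) by (fastforce simp: path_image_compose homeomorphism_def)
        show "pathstart (q \<circ> (f \<circ> s)) = g y"
          using s(3) gC(2)[OF y] homeomorphism_apply1[OF q sg(2)] by (simp add: pathstart_compose)
        show "p ((q \<circ> (f \<circ> s)) t) = (f \<circ> s) t" if "t \<in> {0..1}" for t
        proof -
          have "f (s t) \<in> T"
            using sT that by (auto simp: path_image_def)
          then show ?thesis
            using homeomorphism_apply2[OF q] by simp
        qed
      qed
      also have "\<dots> = q (f w)"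
        using s by (simp add: pathfinish_compose)
      finally show ?thesis .
    qed
    have "continuous_on V (\<lambda>w. q (f w))"
      by (rule continuous_on_compose2[of T q]) (use V f q in \<open>auto simp: homeomorphism_def intro: continuous_on_subset\<close>)
    then have "continuous_on V g"
      by (rule continuous_on_eq) (simp add: qeq)
    with V show "\<exists>V. openin (top_of_set U) V \<and> y \<in> V \<and> continuous_on V g"
      by blast
  qed
  ultimately show ?thesis
    using that gC by (metis Pi_I)
qed

lemma covering_open_map:
  fixes p :: "'b::topological_space \<Rightarrow> 'a::topological_space"
  assumes cov: "covering_space C p S" and W: "openin (top_of_set C) W"
  shows "openin (top_of_set S) (p ` W)"
proof (subst openin_subopen, intro ballI)
  fix x assume "x \<in> p ` W"
  then obtain y where y: "y \<in> W" "x = p y" "y \<in> C"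
    using W openin_imp_subset by fastforce
  then have "x \<in> S" using cov by (auto simp: covering_space_def)
  then obtain T \<sigma> where T: "x \<in> T" "sheets C p S T \<sigma>"
    by (rule covering_sheets[OF cov])
  then have pT: "p y \<in> T" using y by simp
  note sy = sheetsD[OF T(2) y(3) pT]
  obtain q where q: "homeomorphism (\<sigma> y) T p q"
    using sy(4) by blast
  have "openin (top_of_set (\<sigma> y)) (\<sigma> y \<inter> W)"
    using W sy(3) by (auto simp: openin_open)
  then have "openin (top_of_set T) (p ` (\<sigma> y \<inter> W))"
    by (rule homeomorphism_imp_open_map[OF q])
  then have "openin (top_of_set S) (p ` (\<sigma> y \<inter> W))"
    by (rule openin_trans[OF _ sheets_openin[OF T(2)]])
  then show "\<exists>T. openin (top_of_set S) T \<and> x \<in> T \<and> T \<subseteq> p ` W"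
    using y sy(2) by blast
qed

lemma covering_locally_path_connected:
  fixes p :: "'b::topological_space \<Rightarrow> 'a::topological_space"
  assumes cov: "covering_space C p S" and S: "locally path_connected S"
  shows "locally path_connected C"
  unfolding locally_path_connected
proof (intro allI impI, elim conjE)
  fix v y assume v: "openin (top_of_set C) v" "y \<in> v"
  then have yC: "y \<in> C" using openin_imp_subset by blast
  then have "p y \<in> S" using cov by (auto simp: covering_space_def)
  then obtain T \<sigma> where T: "p y \<in> T" "sheets C p S T \<sigma>"
    by (rule covering_sheets[OF cov])
  note sy = sheetsD[OF T(2) yC T(1)]
  obtain q where q: "homeomorphism (\<sigma> y) T p q"
    using sy(4) by blast
  let ?W = "v \<inter> \<sigma> y"
  have "openin (top_of_set C) ?W"
    using v sy(1) by blast
  then have "openin (top_of_set S) (p ` ?W)"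
    by (rule covering_open_map[OF cov])
  then obtain u where u: "openin (top_of_set S) u" "path_connected u" "p y \<in> u" "u \<subseteq> p ` ?W"
    using S v sy(2) unfolding locally_path_connected by (metis (no_types, lifting) IntI image_eqI)
  have uT: "u \<subseteq> T"
    using u(4) q by (auto simp: homeomorphism_def)
  have qp: "q (p w) = w" if "w \<in> \<sigma> y" for w
    using that q by (auto simp: homeomorphism_def)
  have "q ` u \<subseteq> ?W"
    using u(4) qp by fastforce
  moreover have "y \<in> q ` u"
    using u(3) qp[of y] sy(2) by (metis image_eqI)
  moreover have "path_connected (q ` u)"
    by (rule path_connected_continuous_image[OF _ u(2)])
      (use q uT continuous_on_subset in \<open>auto simp: homeomorphism_def\<close>)
  moreover have "openin (top_of_set C) (q ` u)"
  proof (rule openin_trans[of "\<sigma> y"])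
    show "openin (top_of_set (\<sigma> y)) (q ` u)"
      by (rule homeomorphism_imp_open_map[OF homeomorphism_symD[OF q]])
        (use openin_subset_trans[OF u(1) uT] sheets_openin[OF T(2)] in \<open>auto simp: openin_open\<close>)
  qed (rule sy(1))
  ultimately show "\<exists>u. openin (top_of_set C) u \<and> path_connected u \<and> y \<in> u \<and> u \<subseteq> v"
    by blast
qed

section \<open>Graphs with the weak topology\<close>

locale top_graph =
  fixes X V :: "'a::topological_space set" and E :: "(real \<Rightarrow> 'a) set"
  assumes V_sub: "V \<subseteq> X" and ends: "e \<in> E \<Longrightarrow> e 0 \<in> V \<and> e 1 \<in> V"
    and bij: "bij_betw (\<lambda>(e, t). e t) (E \<times> {0<..<1}) (X - V)"
    and weak: "openin (top_of_set X) U \<longleftrightarrow>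
       U \<subseteq> X \<and> (\<forall>e\<in>E. openin (top_of_set {0..1}) {t \<in> {0..1}. e t \<in> U})"
    and conn: "connected X"
begin

lemma edge_interior: "e \<in> E \<Longrightarrow> 0 < t \<Longrightarrow> t < 1 \<Longrightarrow> e t \<in> X - V"
  using bij_betwE[OF bij] by fastforce

lemma edge_in: "e \<in> E \<Longrightarrow> 0 \<le> t \<Longrightarrow> t \<le> 1 \<Longrightarrow> e t \<in> X"
  using edge_interior[of e t] ends[of e] V_sub by (cases "t = 0"; cases "t = 1"; fastforce)

text \<open>Interiority of one parameter suffices: an interior point is no vertex, so the other
  parameter is interior too and injectivity on the open edges applies.\<close>

lemma edge_eqD:
  assumes "e t = e' t'" "e \<in> E" "e' \<in> E" "0 < t" "t < 1" "0 \<le> t'" "t' \<le> 1"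
  shows "e = e'" "t = t'"
proof -
  have "e' t' \<notin> V"
    using edge_interior[of e t] assms by auto
  then have "0 < t'" "t' < 1"
    using ends[OF assms(3)] assms(6,7) by (metis less_eq_real_def)+
  then have "(e,t) = (e',t')"
    using bij_betw_imp_inj_on[OF bij] assms by (auto simp: inj_on_def)
  then show "e = e'" "t = t'" by auto
qed

lemma edge_mem_iff:
  assumes e: "e \<in> E" "e' \<in> E" and U: "U \<subseteq> {0<..<1}" and t: "t \<in> {0..1}"
  shows "e' t \<in> e ` U \<longleftrightarrow> e' = e \<and> t \<in> U"
proof
  assume "e' t \<in> e ` U"
  then obtain u where u: "e' t = e u" "u \<in> U" by auto
  then have "0 < u" "u < 1" using U by auto
  then have "e = e'" "u = t"
    using edge_eqD[of e u e' t] e t u(1) by auto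
  with u show "e' = e \<and> t \<in> U" by simp
qed auto

lemma point_cases:
  assumes "x \<in> X"
  obtains "x \<in> V" | e t where "e \<in> E" "0 < t" "t < 1" "x = e t"
  using assms bij_betw_imp_surj_on[OF bij] by fastforce

lemma edge_continuous:
  assumes "e \<in> E"
  shows "continuous_on {0..1} e"
proof (subst continuous_on_open_gen[of e "{0..1}" X])
  show "e \<in> {0..1} \<rightarrow> X"
    using edge_in assms by auto
  show "\<forall>U. openin (top_of_set X) U \<longrightarrow> openin (top_of_set {0..1}) ({0..1} \<inter> e -` U)"
    using weak assms by (simp add: vimage_def Int_def)
qed

text \<open>The tube lemma makes the set \<open>?U\<close> below open in the weak topology.\<close>

lemma continuous_on_homotopy_edges:
  fixes H :: "real \<times> 'a \<Rightarrow> 'c::topological_space"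
  assumes H: "\<And>e. e \<in> E \<Longrightarrow> continuous_on ({0..1} \<times> {0..1}) (\<lambda>z. H (fst z, e (snd z)))"
    and HV: "\<And>v. v \<in> V \<Longrightarrow> continuous_on {0..1} (\<lambda>t. H (t,v))"
  shows "continuous_on ({0..1} \<times> X) H"
proof (subst continuous_openin_preimage_eq, intro allI impI)
  fix W :: "'c set" assume W: "open W"
  have Hx: "continuous_on {0..1} (\<lambda>t. H (t,x))" if "x \<in> X" for x
    using that
  proof (cases rule: point_cases)
    case (2 e s)
    have "continuous_on {0..1} (\<lambda>t. (\<lambda>z. H (fst z, e (snd z))) (t,s))"
      by (rule continuous_on_compose2[OF H[OF 2(1)]]) (use 2 in \<open>auto intro!: continuous_intros\<close>)
    with 2 show ?thesis by simp
  qed (rule HV)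
  show "openin (top_of_set ({0..1} \<times> X)) (({0..1} \<times> X) \<inter> H -` W)"
  proof (subst openin_subopen, intro ballI)
    fix z assume z: "z \<in> ({0..1} \<times> X) \<inter> H -` W"
    obtain t0 x0 where zt: "z = (t0,x0)" "t0 \<in> {0..1}" "x0 \<in> X" "H (t0,x0) \<in> W"
      using z by (cases z) auto
    have "openin (top_of_set {0..1}) ({0..1} \<inter> (\<lambda>t. H (t,x0)) -` W)"
      using Hx[OF zt(3)] W continuous_openin_preimage_eq by metis
    then obtain d where d: "d > 0" "\<And>t. t \<in> {0..1} \<Longrightarrow> dist t t0 < d \<Longrightarrow> H (t,x0) \<in> W"
      unfolding openin_euclidean_subtopology_iff using zt by (metis (no_types, lifting) IntE IntI vimageD vimageI)
    define N where "N = {0..1} \<inter> cball t0 (d/2)"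
    have cN: "compact N"
      unfolding N_def by (intro closed_Int_compact) auto
    let ?U = "{x \<in> X. \<forall>t\<in>N. H (t,x) \<in> W}"
    have "openin (top_of_set X) ?U"
    proof (subst weak, intro conjI ballI)
      fix e assume e: "e \<in> E"
      let ?K = "{z \<in> N \<times> {0..1}. H (fst z, e (snd z)) \<notin> W}"
      have "closedin (top_of_set (N \<times> {0..1})) ((N \<times> {0..1}) \<inter> (\<lambda>z. H (fst z, e (snd z))) -` (- W))"
        by (rule continuous_closedin_preimage)
          (use W in \<open>auto simp: N_def intro: continuous_on_subset[OF H[OF e]]\<close>)
      then have "closedin (top_of_set (N \<times> {0..1})) ?K"
        by (rule back_subst[of "closedin _"]) auto
      then have "compact ?K"
        by (rule closedin_compact[OF compact_Times[OF cN compact_Icc]])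
      then have "compact (snd ` ?K)"
        by (intro compact_continuous_image continuous_intros)
      then have "closed (snd ` ?K)"
        by (rule compact_imp_closed)
      then have "openin (top_of_set {0..1}) ({0..1} - snd ` ?K)"
        unfolding Diff_eq by (intro openin_open_Int open_Compl)
      also have "{0..1} - snd ` ?K = {t \<in> {0..1}. e t \<in> ?U}"
        using edge_in[OF e] by force
      finally show "openin (top_of_set {0..1}) {t \<in> {0..1}. e t \<in> ?U}" .
    qed auto
    then have "openin (top_of_set ({0..1} \<times> X)) (({0..1} \<inter> ball t0 (d/2)) \<times> ?U)"
      by (intro openin_Times openin_open_Int) auto
    moreover have "z \<in> ({0..1} \<inter> ball t0 (d/2)) \<times> ?U"
      using zt d by (auto simp: N_def dist_commute)
    moreover have "({0..1} \<inter> ball t0 (d/2)) \<times> ?U \<subseteq> ({0..1} \<times> X) \<inter> H -` W"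
      by (auto simp: N_def)
    ultimately show "\<exists>T. openin (top_of_set ({0..1} \<times> X)) T \<and> z \<in> T \<and> T \<subseteq> ({0..1} \<times> X) \<inter> H -` W"
      by blast
  qed
qed

text \<open>Neighbourhoods of a vertex are never described. A path component of an open set meets
  every edge in an open set of parameters, because a small interval around such a parameter is
  mapped into the same component; the weak topology then makes the component open.\<close>

lemma locally_path_connected_graph: "locally path_connected X"
  unfolding locally_path_connected
proof (intro allI impI, elim conjE)
  fix W x assume W: "openin (top_of_set X) W" "x \<in> W"
  let ?P = "path_component_set W x"
  have PW: "?P \<subseteq> W"
    by (rule path_component_subset)
  have "openin (top_of_set X) ?P"
  proof (subst weak, intro conjI ballI)
    show "?P \<subseteq> X"
      using PW W openin_imp_subset by blast
    fix e assume e: "e \<in> E"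
    have oW: "openin (top_of_set {0..1}) {t \<in> {0..1}. e t \<in> W}"
      using W(1) e weak by blast
    show "openin (top_of_set {0..1}) {t \<in> {0..1}. e t \<in> ?P}"
    proof (subst openin_subopen, intro ballI)
      fix t assume t: "t \<in> {t \<in> {0..1}. e t \<in> ?P}"
      then have "e t \<in> W" using PW by auto
      then obtain d where d: "d > 0" "\<And>s. s \<in> {0..1} \<Longrightarrow> dist s t < d \<Longrightarrow> e s \<in> W"
        using oW t unfolding openin_euclidean_subtopology_iff by (metis (mono_tags, lifting) mem_Collect_eq)
      let ?I = "{0..1} \<inter> ball t d"
      have eI: "e ` ?I \<subseteq> W"
        using d by (auto simp: dist_commute)
      have "path_connected (e ` ?I)"
        by (intro path_connected_continuous_image convex_imp_path_connected convex_Int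
            continuous_on_subset[OF edge_continuous[OF e]]) auto
      moreover have "t \<in> ?I" using t d by auto
      ultimately have "e s \<in> ?P" if "s \<in> ?I" for s
        using eI that t path_component_trans[of W x "e t" "e s"] path_component_of_subset[OF eI, of "e t" "e s"]
        unfolding path_connected_component by blast
      moreover have "openin (top_of_set {0..1}) ?I"
        by (intro openin_open_Int) auto
      ultimately show "\<exists>T. openin (top_of_set {0..1}) T \<and> t \<in> T \<and> T \<subseteq> {t \<in> {0..1}. e t \<in> ?P}"
        using \<open>t \<in> ?I\<close> by (intro exI[of _ ?I]) auto
    qed
  qed
  moreover have "path_connected ?P" "x \<in> ?P"
    using W by (auto intro: path_component_refl)
  ultimately show "\<exists>u. openin (top_of_set X) u \<and> path_connected u \<and> x \<in> u \<and> u \<subseteq> W"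
    using PW by blast
qed

lemma openin_edge_image:
  assumes "e \<in> E" "open U" "U \<subseteq> {0<..<1}"
  shows "openin (top_of_set X) (e ` U)"
proof (subst weak, intro conjI ballI)
  show "e ` U \<subseteq> X"
    using edge_in[OF assms(1)] assms(3) by fastforce
  fix e' assume e': "e' \<in> E"
  have "U \<subseteq> {0..1}"
    using assms(3) by auto
  then have "{t \<in> {0..1}. e' t \<in> e ` U} = (if e' = e then {0..1} \<inter> U else {})"
    using edge_mem_iff[OF assms(1) e' assms(3)] by auto
  then show "openin (top_of_set {0..1}) {t \<in> {0..1}. e' t \<in> e ` U}"
    using assms(2) by (simp add: openin_open_Int)
qed

lemma closedin_edge_image:
  assumes "e \<in> E" "closed D" "D \<subseteq> {0<..<1}"
  shows "closedin (top_of_set X) (e ` D)"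
proof -
  have "openin (top_of_set X) (X - e ` D)"
  proof (subst weak, intro conjI ballI)
    fix e' assume e': "e' \<in> E"
    have "{t \<in> {0..1}. e' t \<in> X - e ` D} = {t \<in> {0..1}. e' t \<in> X \<and> \<not> (e' t \<in> e ` D)}"
      by auto
    also have "\<dots> = (if e' = e then {0..1} \<inter> (- D) else {0..1})"
      using edge_mem_iff[OF assms(1) e' assms(3)] edge_in[OF e'] by (simp add: set_eq_iff cong: conj_cong)
    finally have "{t \<in> {0..1}. e' t \<in> X - e ` D} = (if e' = e then {0..1} \<inter> (- D) else {0..1})" .
    then show "openin (top_of_set {0..1}) {t \<in> {0..1}. e' t \<in> X - e ` D}"
      using assms(2) by (simp add: openin_open_Int open_Compl)
  qed auto
  moreover have "e ` D \<subseteq> X"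
    using edge_in[OF assms(1)] assms(3) by fastforce
  ultimately show ?thesis
    by (auto simp: closedin_def)
qed

section \<open>Maximal trees and their contraction\<close>

definition adj :: "('a \<times> 'a) set" where
  "adj = {(v,w). \<exists>e\<in>E. (e 0 = v \<and> e 1 = w) \<or> (e 1 = v \<and> e 0 = w)}"

text \<open>No edge joins a reachable vertex to an unreachable one, so the reachable vertices and
  the open edges at them form a clopen set, which connectedness makes equal to
  \<open>X\<close>.\<close>

lemma adj_reachable:
  assumes v0: "v0 \<in> V" and v: "v \<in> V"
  shows "(v0, v) \<in> adj\<^sup>*"
proof -
  define R where "R = {v \<in> V. (v0,v) \<in> adj\<^sup>*}"
  define W where "W = R \<union> {e s |e s. e \<in> E \<and> e 0 \<in> R \<and> 0 < s \<and> s < 1}"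
  have R: "e 0 \<in> R \<longleftrightarrow> e 1 \<in> R" if "e \<in> E" for e
  proof -
    have "(e 0, e 1) \<in> adj" "(e 1, e 0) \<in> adj"
      using that by (auto simp: adj_def)
    then show ?thesis
      using ends[OF that] unfolding R_def by (auto intro: rtrancl_into_rtrancl)
  qed
  have W: "e t \<in> W \<longleftrightarrow> e 0 \<in> R" if e: "e \<in> E" and t: "t \<in> {0..1}" for e t
  proof (cases "t = 0 \<or> t = 1")
    case True
    have "x \<in> W \<longleftrightarrow> x \<in> R" if "x \<in> V" for x
      using that edge_interior unfolding W_def by fastforce
    then show ?thesis
      using True R[OF e] ends[OF e] by auto
  next
    case False
    then have t': "0 < t" "t < 1" using t by auto
    show ?thesis
    proof
      assume "e t \<in> W"
      moreover have "e t \<notin> R" using edge_interior[OF e t'] R_def by auto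
      ultimately obtain e' s where "e' \<in> E" "e' 0 \<in> R" "0 < s" "s < 1" "e t = e' s"
        unfolding W_def by auto
      then show "e 0 \<in> R" using edge_eqD(1)[of e t e' s] e t' by auto
    qed (use e t' W_def in auto)
  qed
  have WX: "W \<subseteq> X"
    using V_sub edge_in unfolding W_def R_def by fastforce
  have "openin (top_of_set X) W"
  proof (subst weak, intro conjI ballI WX)
    fix e assume e: "e \<in> E"
    have "{t \<in> {0..1}. e t \<in> W} = (if e 0 \<in> R then {0..1} else {})"
      using W[OF e] by auto
    then show "openin (top_of_set {0..1}) {t \<in> {0..1}. e t \<in> W}"
      by simp
  qed
  moreover have "openin (top_of_set X) (X - W)"
  proof (subst weak, intro conjI ballI)
    fix e assume e: "e \<in> E"
    have "{t \<in> {0..1}. e t \<in> X - W} = (if e 0 \<in> R then {} else {0..1})"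
      using W[OF e] edge_in[OF e] by auto
    then show "openin (top_of_set {0..1}) {t \<in> {0..1}. e t \<in> X - W}"
      by simp
  qed auto
  ultimately have "W = {} \<or> W = X"
    using conn WX unfolding connected_clopen by (simp add: closedin_def)
  moreover have "v0 \<in> W"
    using v0 by (auto simp: W_def R_def)
  ultimately have "v \<in> W"
    using v V_sub by auto
  then show ?thesis
    using v edge_interior unfolding W_def R_def by fastforce
qed

end

text \<open>The path \<open>b\<close> is pulled back to its start and then dragged along \<open>h\<close>.\<close>

definition drag :: "(real \<Rightarrow> 'a) \<Rightarrow> (real \<Rightarrow> 'a) \<Rightarrow> real \<times> real \<Rightarrow> 'a" where
  "drag b h z = (let u = - snd z + fst z * (1 + snd z) in if u \<le> 0 then b (- u) else h u)"

text \<open>The last bound mentions \<open>b\<close> only on \<open>{0..s}\<close>. It guarantees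
  later that the outer third of a handle does not enter the middle third while it is dragged
  away.\<close>

lemma drag:
  fixes b h :: "real \<Rightarrow> 'a::topological_space"
  assumes b: "continuous_on {0..1} b" and h: "continuous_on {0..1} h" and bh: "b 0 = h 0"
  shows "continuous_on ({0..1} \<times> {0..1}) (drag b h)"
    and "s \<in> {0..1} \<Longrightarrow> drag b h (0,s) = b s" and "t \<in> {0..1} \<Longrightarrow> drag b h (t,0) = h t"
    and "s \<in> {0..1} \<Longrightarrow> drag b h (1,s) = h 1"
    and "s \<in> {0..1} \<Longrightarrow> t \<in> {0..1} \<Longrightarrow> drag b h (t,s) \<in> b ` {0..s} \<union> h ` {0..1}"
proof -
  \<comment> \<open>For fixed \<open>s\<close> the parameter runs from \<open>- s\<close> at time 0
    to 1 at time 1; negative values lie on \<open>b\<close>, positive ones on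
    \<open>h\<close>.\<close>
  have bound: "- s + t * (1 + s) \<in> {- s..1}" if "s \<in> {0..1}" "t \<in> {0..1}" for s t :: real
  proof -
    have "t * (1 + s) \<le> 1 + s" "0 \<le> t * (1 + s)"
      using that by (auto intro: mult_left_le_one_le)
    then show ?thesis by auto
  qed
  show "continuous_on ({0..1} \<times> {0..1}) (drag b h)"
    unfolding drag_def Let_def
  proof (rule continuous_on_cases_le)
    show "continuous_on {z \<in> {0..1} \<times> {0..1}. - snd z + fst z * (1 + snd z) \<le> 0} (\<lambda>z. b (- (- snd z + fst z * (1 + snd z))))"
      by (rule continuous_on_compose2[OF b]) (use bound in \<open>fastforce intro!: continuous_intros\<close>)+
    show "continuous_on {z \<in> {0..1} \<times> {0..1}. 0 \<le> - snd z + fst z * (1 + snd z)} (\<lambda>z. h (- snd z + fst z * (1 + snd z)))"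
      by (rule continuous_on_compose2[OF h]) (use bound in \<open>fastforce intro!: continuous_intros\<close>)+
  qed (use bh in \<open>auto intro!: continuous_intros\<close>)
  show "drag b h (0,s) = b s" "drag b h (1,s) = h 1" if "s \<in> {0..1}"
    using that bh by (auto simp: drag_def)
  show "drag b h (t,0) = h t" if "t \<in> {0..1}"
    using that bh by (auto simp: drag_def)
  show "drag b h (t,s) \<in> b ` {0..s} \<union> h ` {0..1}" if "s \<in> {0..1}" "t \<in> {0..1}"
    using bound[OF that] by (auto simp: drag_def Let_def)
qed

text \<open>Meant for the edges outside the maximal tree. The outer thirds are dragged to the ends
  of \<open>h0\<close> and \<open>h1\<close>, while the middle third is stretched over the tracks
  that its two end points leave behind.\<close>

lemma drag_edge:
  fixes e h0 h1 :: "real \<Rightarrow> 'a::topological_space"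
  assumes e: "continuous_on {0..1} e" and h0: "continuous_on {0..1} h0" "h0 0 = e 0"
    and h1: "continuous_on {0..1} h1" "h1 0 = e 1"
  obtains k where "continuous_on ({0..1} \<times> {0..1}) k"
    "\<And>s. s \<in> {0..1} \<Longrightarrow> k (0,s) = e s" "\<And>t. t \<in> {0..1} \<Longrightarrow> k (t,0) = h0 t" "\<And>t. t \<in> {0..1} \<Longrightarrow> k (t,1) = h1 t"
    "\<And>s t. t \<in> {0..1} \<Longrightarrow> 0 \<le> s \<Longrightarrow> s \<le> 1/3 \<Longrightarrow> k (1,s) = h0 1 \<and> k (t,s) \<in> e ` {0..1/3} \<union> h0 ` {0..1}"
    "\<And>s t. t \<in> {0..1} \<Longrightarrow> 2/3 \<le> s \<Longrightarrow> s \<le> 1 \<Longrightarrow> k (1,s) = h1 1 \<and> k (t,s) \<in> e ` {2/3..1} \<union> h1 ` {0..1}"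
    "\<And>s t. s \<in> {0..1} \<Longrightarrow> t \<in> {0..1} \<Longrightarrow> k (t,s) \<in> e ` {0..1} \<union> h0 ` {0..1} \<union> h1 ` {0..1}"
proof -
  let ?r = "\<lambda>s. e (1 - s)"
  have r: "continuous_on {0..1} ?r" "?r 0 = h1 0"
    using h1 by (auto intro!: continuous_on_compose2[OF e] continuous_intros)
  let ?A = "drag e h0" and ?B = "drag ?r h1"
  note A = drag[OF e h0(1) h0(2)[symmetric]] and B = drag[OF r(1) h1(1) r(2)]
  \<comment> \<open>\<open>G\<close> is the track of the point 1/3 run backwards on
    \<open>{-1..0}\<close>, the middle third of \<open>e\<close> on \<open>{0..1}\<close>, and the
    track of the point 2/3 on \<open>{1..2}\<close>. At time \<open>t\<close> the middle third
    covers the stretch from \<open>- t\<close> to \<open>1 + t\<close>, which explains the argument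
    given to \<open>G\<close> in \<open>k\<close>.\<close>
  define G where "G u = (if u \<le> 0 then ?A (- u, 1/3) else if u \<le> 1 then e ((1 + u) / 3) else ?B (u - 1, 1/3))" for u
  have G: "continuous_on {-1..2} G"
    unfolding G_def
  proof (rule continuous_on_cases_le)
    show "continuous_on {t \<in> {- 1..2}. t \<le> 0} (\<lambda>u. ?A (- u, 1/3))"
      by (rule continuous_on_compose2[OF A(1)]) (auto intro!: continuous_intros)
    show "continuous_on {t \<in> {- 1..2}. 0 \<le> t} (\<lambda>u. if u \<le> 1 then e ((1 + u) / 3) else ?B (u - 1, 1/3))"
    proof (rule continuous_on_cases_le)
      show "continuous_on {t \<in> {t \<in> {- 1..2}. 0 \<le> t}. t \<le> 1} (\<lambda>u. e ((1 + u) / 3))"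
        by (rule continuous_on_compose2[OF e]) (auto intro!: continuous_intros)
      show "continuous_on {t \<in> {t \<in> {- 1..2}. 0 \<le> t}. 1 \<le> t} (\<lambda>u. ?B (u - 1, 1/3))"
        by (rule continuous_on_compose2[OF B(1)]) (auto intro!: continuous_intros)
    qed (use B(2)[of "1/3"] in \<open>auto intro!: continuous_intros\<close>)
  qed (use A(2)[of "1/3"] in \<open>auto intro!: continuous_intros\<close>)
  have G_in: "G u \<in> e ` {0..1} \<union> h0 ` {0..1} \<union> h1 ` {0..1}" if "u \<in> {-1..2}" for u
    using that A(5)[of "1/3" "- u"] B(5)[of "1/3" "u - 1"] by (auto simp: G_def)
  have gb: "(1 + 2 * t) * (3 * s - 1) - t \<in> {-1..2}" if "t \<in> {0..1}" "1/3 \<le> s" "s \<le> 2/3" for s t :: real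
  proof -
    have "(1 + 2 * t) * (3 * s - 1) \<le> (1 + 2 * t) * 1"
      using that by (intro mult_left_mono) auto
    moreover have "0 \<le> (1 + 2 * t) * (3 * s - 1)"
      using that by (intro mult_nonneg_nonneg) auto
    ultimately have "-1 \<le> (1 + 2 * t) * (3 * s - 1) - t" "(1 + 2 * t) * (3 * s - 1) - t \<le> 2"
      using that(1) by (simp_all add: algebra_simps)
    then show ?thesis by simp
  qed
  define k where "k z = (if snd z \<le> 1/3 then ?A z else if snd z \<le> 2/3 then G ((1 + 2 * fst z) * (3 * snd z - 1) - fst z)
     else ?B (fst z, 1 - snd z))" for z
  have k: "continuous_on ({0..1} \<times> {0..1}) k"
    unfolding k_def
  proof (rule continuous_on_cases_le)
    show "continuous_on {t \<in> {0..1} \<times> {0..1}. snd t \<le> 1 / 3} ?A"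
      by (rule continuous_on_subset[OF A(1)]) auto
    show "continuous_on {t \<in> {0..1} \<times> {0..1}. 1 / 3 \<le> snd t}
      (\<lambda>z. if snd z \<le> 2/3 then G ((1 + 2 * fst z) * (3 * snd z - 1) - fst z) else ?B (fst z, 1 - snd z))"
    proof (rule continuous_on_cases_le)
      show "continuous_on {t \<in> {t \<in> {0..1} \<times> {0..1}. 1 / 3 \<le> snd t}. snd t \<le> 2 / 3} (\<lambda>z. G ((1 + 2 * fst z) * (3 * snd z - 1) - fst z))"
        by (rule continuous_on_compose2[OF G]) (use gb in \<open>auto intro!: continuous_intros\<close>)
      show "continuous_on {t \<in> {t \<in> {0..1} \<times> {0..1}. 1 / 3 \<le> snd t}. 2 / 3 \<le> snd t} (\<lambda>z. ?B (fst z, 1 - snd z))"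
        by (rule continuous_on_compose2[OF B(1)]) (auto intro!: continuous_intros)
      show "G ((1 + 2 * fst z) * (3 * snd z - 1) - fst z) = ?B (fst z, 1 - snd z)"
        if "z \<in> {t \<in> {0..1} \<times> {0..1}. 1 / 3 \<le> snd t}" "snd z = 2 / 3" for z
      proof -
        have "z = (fst z, 2/3)" "0 \<le> fst z" using that by (auto simp: prod_eq_iff mem_Times_iff)
        then obtain t where "z = (t, 2/3)" "0 \<le> t" by blast
        then show ?thesis
          using B(2)[of "1/3"] by (cases "t = 0") (auto simp: G_def)
      qed
    qed (auto intro!: continuous_intros)
    show "?A z = (if snd z \<le> 2/3 then G ((1 + 2 * fst z) * (3 * snd z - 1) - fst z) else ?B (fst z, 1 - snd z))"
      if "z \<in> {0..1} \<times> {0..1}" "snd z = 1 / 3" for z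
    proof -
      have "z = (fst z, 1/3)" "0 \<le> fst z" using that by (auto simp: prod_eq_iff mem_Times_iff)
      then obtain t where "z = (t, 1/3)" "0 \<le> t" by blast
      then show ?thesis
        using A(2)[of "1/3"] by (auto simp: G_def)
    qed
  qed (auto intro!: continuous_intros)
  show ?thesis
  proof (rule that[OF k])
    show "k (0,s) = e s" if "s \<in> {0..1}" for s
      using that A(2)[of "1/3"] A(2)[of s] B(2)[of "1 - s"] by (auto simp: k_def G_def field_simps)
    show "k (t,0) = h0 t" "k (t,1) = h1 t" if "t \<in> {0..1}" for t
      using A(3)[OF that] B(3)[OF that] by (auto simp: k_def)
    show "k (1,s) = h0 1 \<and> k (t,s) \<in> e ` {0..1/3} \<union> h0 ` {0..1}" if "t \<in> {0..1}" "0 \<le> s" "s \<le> 1/3" for s t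
    proof -
      have "e ` {0..s} \<subseteq> e ` {0..1/3}" using that by auto
      then show ?thesis
        using A(4)[of s] A(5)[of s t] that by (auto simp: k_def)
    qed
    show "k (1,s) = h1 1 \<and> k (t,s) \<in> e ` {2/3..1} \<union> h1 ` {0..1}" if "t \<in> {0..1}" "2/3 \<le> s" "s \<le> 1" for s t
    proof -
      have 1: "?r ` {0..1 - s} \<subseteq> e ` {2/3..1}" using that by auto
      have "k (u,s) = ?B (u, 1 - s)" if "u \<in> {0..1}" for u
      proof (cases "s = 2/3")
        case True
        show ?thesis
          unfolding True using that B(2)[of "1/3"] by (cases "u = 0") (auto simp: k_def G_def)
      qed (use \<open>2/3 \<le> s\<close> in \<open>auto simp: k_def\<close>)
      then show ?thesis
        using 1 B(4)[of "1 - s"] B(5)[of "1 - s" t] that by auto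
    qed
    show "k (t,s) \<in> e ` {0..1} \<union> h0 ` {0..1} \<union> h1 ` {0..1}" if "s \<in> {0..1}" "t \<in> {0..1}" for s t
    proof -
      have "e ` {0..s} \<subseteq> e ` {0..1}" "?r ` {0..1 - s} \<subseteq> e ` {0..1}" using that by auto
      then show ?thesis
        using A(5)[of s t] B(5)[of "1 - s" t] G_in[OF gb, of t s] that by (auto simp: k_def)
    qed
  qed
qed

context top_graph
begin

text \<open>A breadth-first tree: \<open>pa v\<close> is the parent of \<open>v\<close> and
  \<open>te v\<close> the edge to it, in either direction. The distance \<open>d\<close> from the
  root drops by one at each step and later governs the recursion along the path to the root.\<close>

lemma tree_exists:
  assumes v0: "v0 \<in> V"
  obtains d :: "'a \<Rightarrow> nat" and te pa where "d v0 = 0"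
    "\<And>v. v \<in> V - {v0} \<Longrightarrow> te v \<in> E \<and> pa v \<in> V \<and> d v = Suc (d (pa v)) \<and>
        ((te v 0 = pa v \<and> te v 1 = v) \<or> (te v 1 = pa v \<and> te v 0 = v))"
proof -
  define d where "d v = (LEAST k. (v0,v) \<in> adj ^^ k)" for v
  have d: "(v0,v) \<in> adj ^^ d v" if "v \<in> V" for v
    unfolding d_def by (rule LeastI_ex) (use adj_reachable[OF v0 that] in \<open>simp add: rtrancl_is_UN_relpow\<close>)
  have d_le: "d v \<le> k" if "(v0,v) \<in> adj ^^ k" for v k
    unfolding d_def using that by (rule Least_le)
  have "\<exists>e u. e \<in> E \<and> u \<in> V \<and> d v = Suc (d u) \<and> ((e 0 = u \<and> e 1 = v) \<or> (e 1 = u \<and> e 0 = v))"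
    if v: "v \<in> V - {v0}" for v
  proof -
    obtain k where k: "d v = Suc k"
      using d[of v] v by (cases "d v") auto
    then obtain u where u: "(v0,u) \<in> adj ^^ k" "(u,v) \<in> adj"
      using d[of v] v by auto
    obtain e where e: "e \<in> E" "(e 0 = u \<and> e 1 = v) \<or> (e 1 = u \<and> e 0 = v)"
      using u(2) unfolding adj_def by blast
    have uV: "u \<in> V" using ends[OF e(1)] e(2) by auto
    have "(v0,v) \<in> adj ^^ Suc (d u)"
      using d[OF uV] u(2) by auto
    then have "Suc k \<le> Suc (d u)"
      using d_le k by metis
    moreover have "d u \<le> k"
      by (rule d_le[OF u(1)])
    ultimately have "d v = Suc (d u)" using k by simp
    with e uV show ?thesis by blast
  qed
  then obtain te pa where "\<And>v. v \<in> V - {v0} \<Longrightarrow> te v \<in> E \<and> pa v \<in> V \<and> d v = Suc (d (pa v)) \<and>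
        ((te v 0 = pa v \<and> te v 1 = v) \<or> (te v 1 = pa v \<and> te v 0 = v))"
    by metis
  moreover have "d v0 = 0"
    using d_le[of v0 0] by simp
  ultimately show ?thesis by (rule that[rotated])
qed

text \<open>\<open>J\<close> consists of the edges outside a maximal tree. All vertices travel to
  the root simultaneously, each in unit time whatever its depth; the depths may be unbounded, and
  the weak topology still makes the result continuous, because continuity is tested on one edge at a
  time.\<close>

proposition collapse_exists:
  assumes v0: "v0 \<in> V"
  obtains J and K :: "real \<times> 'a \<Rightarrow> 'a" where "J \<subseteq> E" "continuous_on ({0..1} \<times> X) K" "\<And>t x. t \<in> {0..1} \<Longrightarrow> x \<in> X \<Longrightarrow> K (t,x) \<in> X"
    "\<And>x. x \<in> X \<Longrightarrow> K (0,x) = x" "\<And>t. t \<in> {0..1} \<Longrightarrow> K (t,v0) = v0"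
    "\<And>t x. t \<in> {0..1} \<Longrightarrow> x \<in> X - (\<Union>e\<in>J. e ` {1/3<..<2/3}) \<Longrightarrow> K (t,x) \<in> X - (\<Union>e\<in>J. e ` {1/3<..<2/3})"
    "\<And>x. x \<in> X - (\<Union>e\<in>J. e ` {1/3<..<2/3}) \<Longrightarrow> K (1,x) = v0"
proof -
  obtain d :: "'a \<Rightarrow> nat" and te pa where d0: "d v0 = 0"
    and tree: "\<And>v. v \<in> V - {v0} \<Longrightarrow> te v \<in> E \<and> pa v \<in> V \<and> d v = Suc (d (pa v)) \<and>
        ((te v 0 = pa v \<and> te v 1 = v) \<or> (te v 1 = pa v \<and> te v 0 = v))"
    using tree_exists[OF v0] by blast
  define J where "J = E - te ` (V - {v0})"
  define C where "C = X - (\<Union>e\<in>J. e ` {1/3<..<2/3})"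
  have JE: "J \<subseteq> E" by (auto simp: J_def)
  have mem_C: "e t \<in> C \<longleftrightarrow> e \<notin> J \<or> t \<notin> {1/3<..<2/3}" if "e \<in> E" "t \<in> {0..1}" for e t
  proof -
    have "e t \<in> e' ` {1/3<..<2/3} \<longleftrightarrow> e = e' \<and> t \<in> {1/3<..<2/3}" if "e' \<in> J" for e'
      by (rule edge_mem_iff) (use that JE \<open>e \<in> E\<close> \<open>t \<in> {0..1}\<close> in auto)
    then show ?thesis
      using edge_in[OF that(1)] that(2) unfolding C_def by auto
  qed
  have tree_C: "e t \<in> C" if "e \<in> E - J" "t \<in> {0..1}" for e t
    using mem_C that by auto
  have J_C: "e t \<in> C" if "e \<in> J" "t \<in> {0..1}" "t \<le> 1/3 \<or> 2/3 \<le> t" for e t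
    using mem_C[of e t] JE that by auto
  have V_C: "v \<in> C" if "v \<in> V" for v
    using that edge_interior V_sub by (fastforce simp: C_def J_def)
  define up where "up v = (if te v 1 = v then reversepath (te v) else te v)" for v
  define tr where "tr = rec_nat (\<lambda>v _. v) (\<lambda>_ f v. up v +++ f (pa v))"
  have tr: "tr 0 = (\<lambda>v _. v)" "tr (Suc k) = (\<lambda>v. up v +++ tr k (pa v))" for k
    by (auto simp: tr_def)
  \<comment> \<open>The path from \<open>v\<close> to the root: the edge to the parent in the first
    half of the time, then the whole path of the parent.\<close>
  define H where "H v = tr (d v) v" for v
  have up: "path (up v) \<and> path_image (up v) \<subseteq> C \<and> up v 0 = v \<and> up v 1 = pa v" if v: "v \<in> V - {v0}" for v
  proof -
    have te: "te v \<in> E - J" using tree[OF v] v by (auto simp: J_def)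
    have ne: "pa v \<noteq> v" using tree[OF v] by auto
    have "path (te v)" using edge_continuous te by (auto simp: path_def)
    moreover have "path_image (te v) \<subseteq> C" using tree_C[OF te] by (auto simp: path_image_def)
    moreover have "reversepath (te v) 0 = te v 1" "reversepath (te v) 1 = te v 0"
      by (auto simp: reversepath_def)
    ultimately show ?thesis
      using tree[OF v] ne unfolding up_def by auto
  qed
  have H_rec: "H v = up v +++ H (pa v)" if "v \<in> V - {v0}" for v
    using tree[OF that] by (simp add: H_def tr)
  have H: "path (H v) \<and> path_image (H v) \<subseteq> C \<and> H v 0 = v \<and> H v 1 = v0" if "v \<in> V" for v
    using that
  proof (induction "d v" arbitrary: v)
    case 0
    then have "v = v0" using tree by force
    then show ?case using V_C[OF v0] by (auto simp: H_def d0 tr path_def path_image_def)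
  next
    case (Suc k)
    then have v: "v \<in> V - {v0}" using d0 by force
    then have "path (H (pa v)) \<and> path_image (H (pa v)) \<subseteq> C \<and> H (pa v) 0 = pa v \<and> H (pa v) 1 = v0"
      using Suc tree[OF v] by auto
    moreover from this have "path (up v +++ H (pa v))"
      using up[OF v] by (intro path_join_imp) (auto simp: pathstart_def pathfinish_def)
    ultimately show ?case
      unfolding H_rec[OF v] using up[OF v] path_image_join_subset[of "up v" "H (pa v)"]
      by (auto simp: joinpaths_def[of "up v" "H (pa v)"])
  qed
  have H0: "H v0 t = v0" for t by (simp add: H_def d0 tr)
  have Hc: "continuous_on {0..1} (H v)" "\<And>t. t \<in> {0..1} \<Longrightarrow> H v t \<in> C" if "v \<in> V" for v
    using H[OF that] by (auto simp: path_def path_image_def)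
  have CX: "C \<subseteq> X" by (auto simp: C_def)
  define P where "P e k \<longleftrightarrow> continuous_on ({0..1} \<times> {0..1}) k \<and>
     (\<forall>s\<in>{0..1}. k (0,s) = e s) \<and> (\<forall>t\<in>{0..1}. k (t,0) = H (e 0) t) \<and> (\<forall>t\<in>{0..1}. k (t,1) = H (e 1) t) \<and>
     (\<forall>s\<in>{0..1}. \<forall>t\<in>{0..1}. k (t,s) \<in> X \<and> (e s \<in> C \<longrightarrow> k (t,s) \<in> C \<and> k (1,s) = v0))" for e :: "real \<Rightarrow> 'a" and k
  have "\<exists>k. P e k" if e: "e \<in> E" for e
  proof (cases "e \<in> J")
    case True
    have V: "e 0 \<in> V" "e 1 \<in> V" using ends[OF e] by auto
    obtain k where k: "continuous_on ({0..1} \<times> {0..1}) k"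
      "\<And>s. s \<in> {0..1} \<Longrightarrow> k (0,s) = e s" "\<And>t. t \<in> {0..1} \<Longrightarrow> k (t,0) = H (e 0) t" "\<And>t. t \<in> {0..1} \<Longrightarrow> k (t,1) = H (e 1) t"
      "\<And>s t. t \<in> {0..1} \<Longrightarrow> 0 \<le> s \<Longrightarrow> s \<le> 1/3 \<Longrightarrow> k (1,s) = H (e 0) 1 \<and> k (t,s) \<in> e ` {0..1/3} \<union> H (e 0) ` {0..1}"
      "\<And>s t. t \<in> {0..1} \<Longrightarrow> 2/3 \<le> s \<Longrightarrow> s \<le> 1 \<Longrightarrow> k (1,s) = H (e 1) 1 \<and> k (t,s) \<in> e ` {2/3..1} \<union> H (e 1) ` {0..1}"
      "\<And>s t. s \<in> {0..1} \<Longrightarrow> t \<in> {0..1} \<Longrightarrow> k (t,s) \<in> e ` {0..1} \<union> H (e 0) ` {0..1} \<union> H (e 1) ` {0..1}"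
      using drag_edge[OF edge_continuous[OF e] Hc(1)[OF V(1)] _ Hc(1)[OF V(2)]] H[OF V(1)] H[OF V(2)] by blast
    have "k (t,s) \<in> X" if "s \<in> {0..1}" "t \<in> {0..1}" for s t
      using k(7)[OF that] edge_in[OF e] Hc(2)[OF V(1)] Hc(2)[OF V(2)] CX by auto
    moreover have "k (t,s) \<in> C \<and> k (1,s) = v0" if "s \<in> {0..1}" "t \<in> {0..1}" "e s \<in> C" for s t
    proof -
      have "s \<notin> {1/3<..<2/3}"
        using that(3) True by (auto simp: C_def)
      then consider "s \<le> 1/3" | "2/3 \<le> s" by force
      then show ?thesis
      proof cases
        case 1
        then show ?thesis
          using k(5)[OF that(2), of s] that H[OF V(1)] Hc(2)[OF V(1)] J_C[OF True] by auto
      next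
        case 2
        then show ?thesis
          using k(6)[OF that(2), of s] that H[OF V(2)] Hc(2)[OF V(2)] J_C[OF True] by auto
      qed
    qed
    ultimately show ?thesis using k(1-4) unfolding P_def by blast
  next
    case False
    then obtain v where v: "v \<in> V - {v0}" "e = te v" using e by (auto simp: J_def)
    have eC: "e t \<in> C" if "t \<in> {0..1}" for t using tree_C[of e t] e False that by auto
    have pV: "pa v \<in> V" using tree[OF v(1)] by blast
    have ne: "pa v \<noteq> v" using tree[OF v(1)] by auto
    have Hp: "H (pa v) 0 = pa v" "H (pa v) 1 = v0" using H[OF pV] by auto
    show ?thesis
    proof (cases "e 1 = v")
      case True
      then have e0: "e 0 = pa v" using tree[OF v(1)] v(2) ne by auto
      note D = drag[OF edge_continuous[OF e] Hc(1)[OF pV], unfolded e0 Hp, OF refl]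
      \<comment> \<open>At \<open>s = 1\<close> the drag parameter is \<open>2 * t - 1\<close>:
        first the edge backwards, then the path of the parent, which is exactly the concatenation
        defining \<open>H v\<close>. So the homotopies on the edges fit together at the
        vertices.\<close>
      have "drag e (H (pa v)) (t,1) = H v t" if "t \<in> {0..1}" for t
        using that True Hp e0 v(2) unfolding H_rec[OF v(1)] up_def drag_def joinpaths_def reversepath_def
        by (auto simp: field_simps)
      moreover have "drag e (H (pa v)) (t,s) \<in> C" if "s \<in> {0..1}" "t \<in> {0..1}" for s t
        using D(5)[OF that] eC Hc(2)[OF pV] that by auto
      ultimately show ?thesis
        using D(1-4) CX unfolding P_def by (intro exI[of _ "drag e (H (pa v))"]) (auto simp: True e0)
    next
      case False
      then have e0: "e 0 = v" "e 1 = pa v" using tree[OF v(1)] v(2) ne by auto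
      let ?r = "\<lambda>s. e (1 - s)"
      have r: "continuous_on {0..1} ?r"
        by (auto intro!: continuous_on_compose2[OF edge_continuous[OF e]] continuous_intros)
      have r0: "?r 0 = H (pa v) 0" using Hp e0 by simp
      note D = drag[OF r Hc(1)[OF pV] r0]
      let ?k = "\<lambda>z. drag ?r (H (pa v)) (fst z, 1 - snd z)"
      have "continuous_on ({0..1} \<times> {0..1}) ?k"
        by (rule continuous_on_compose2[OF D(1)]) (auto intro!: continuous_intros)
      moreover have "?k (t,0) = H v t" if "t \<in> {0..1}" for t
        using that False Hp e0 v(2) unfolding H_rec[OF v(1)] up_def drag_def joinpaths_def reversepath_def
        by (auto simp: field_simps)
      moreover have "?k (t,s) \<in> C" if "s \<in> {0..1}" "t \<in> {0..1}" for s t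
        using D(5)[of "1 - s" t] eC Hc(2)[OF pV] that by auto
      ultimately show ?thesis
        using D(2-4) CX Hp unfolding P_def by (intro exI[of _ ?k]) (auto simp: False e0)
    qed
  qed
  then have some: "e \<in> E \<Longrightarrow> P e (SOME k. P e k)" for e
    by (simp add: someI_ex)
  obtain k where k: "\<And>e. e \<in> E \<Longrightarrow> continuous_on ({0..1} \<times> {0..1}) (k e)"
    "\<And>e s. e \<in> E \<Longrightarrow> s \<in> {0..1} \<Longrightarrow> k e (0,s) = e s"
    "\<And>e t. e \<in> E \<Longrightarrow> t \<in> {0..1} \<Longrightarrow> k e (t,0) = H (e 0) t"
    "\<And>e t. e \<in> E \<Longrightarrow> t \<in> {0..1} \<Longrightarrow> k e (t,1) = H (e 1) t"
    "\<And>e s t. e \<in> E \<Longrightarrow> s \<in> {0..1} \<Longrightarrow> t \<in> {0..1} \<Longrightarrow> k e (t,s) \<in> X \<and> (e s \<in> C \<longrightarrow> k e (t,s) \<in> C \<and> k e (1,s) = v0)"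
  proof -
    assume that: "\<And>k. \<lbrakk>\<And>e. e \<in> E \<Longrightarrow> continuous_on ({0..1} \<times> {0..1}) (k e);
      \<And>e s. e \<in> E \<Longrightarrow> s \<in> {0..1} \<Longrightarrow> k e (0,s) = e s;
      \<And>e t. e \<in> E \<Longrightarrow> t \<in> {0..1} \<Longrightarrow> k e (t,0) = H (e 0) t;
      \<And>e t. e \<in> E \<Longrightarrow> t \<in> {0..1} \<Longrightarrow> k e (t,1) = H (e 1) t;
      \<And>e s t. e \<in> E \<Longrightarrow> s \<in> {0..1} \<Longrightarrow> t \<in> {0..1} \<Longrightarrow> k e (t,s) \<in> X \<and> (e s \<in> C \<longrightarrow> k e (t,s) \<in> C \<and> k e (1,s) = v0)\<rbrakk> \<Longrightarrow> thesis"
    show thesis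
      by (rule that[of "\<lambda>e. SOME k. P e k"]; drule some; unfold P_def) blast+
  qed
  define co where "co = inv_into (E \<times> {0<..<1}) (\<lambda>(e, t::real). e t)"
  have co: "co (e s) = (e,s)" if "e \<in> E" "0 < s" "s < 1" for e s
    unfolding co_def using inv_into_f_f[OF bij_betw_imp_inj_on[OF bij], of "(e,s)"] that by auto
  define K where "K z = (if snd z \<in> V then H (snd z) (fst z) else k (fst (co (snd z))) (fst z, snd (co (snd z))))" for z
  have K_edge: "K (t, e s) = k e (t, s)" if "e \<in> E" "s \<in> {0..1}" "t \<in> {0..1}" for e s t
  proof (cases "s = 0 \<or> s = 1")
    case True
    then show ?thesis using ends[OF that(1)] k(3,4)[OF that(1,3)] by (auto simp: K_def)
  next
    case False
    then have "0 < s" "s < 1" using that by auto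
    then show ?thesis using edge_interior[OF that(1)] co[OF that(1)] by (auto simp: K_def)
  qed
  have K_V: "K (t,v) = H v t" if "v \<in> V" for v t
    using that by (simp add: K_def)
  show ?thesis
  proof (rule that[of J K, folded C_def])
    show "J \<subseteq> E" by (auto simp: J_def)
    show "continuous_on ({0..1} \<times> X) K"
    proof (rule continuous_on_homotopy_edges)
      show "continuous_on ({0..1} \<times> {0..1}) (\<lambda>z. K (fst z, e (snd z)))" if "e \<in> E" for e
        by (rule continuous_on_eq[OF k(1)[OF that]]) (auto simp: K_edge[OF that])
      show "continuous_on {0..1} (\<lambda>t. K (t, v))" if "v \<in> V" for v
        using Hc(1)[OF that] by (simp add: K_V[OF that])
    qed
    show "K (t,x) \<in> X" if "t \<in> {0..1}" "x \<in> X" for t x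
      using that(2)
    proof (cases rule: point_cases)
      case 1 then show ?thesis using K_V Hc(2) CX that by fastforce
    next
      case (2 e s) then show ?thesis using K_edge[of e s t] k(5)[of e s t] that by auto
    qed
    show "K (0,x) = x" if "x \<in> X" for x
      using that
    proof (cases rule: point_cases)
      case 1 then show ?thesis using K_V H by simp
    next
      case (2 e s) then show ?thesis using K_edge[of e s 0] k(2)[of e s] by auto
    qed
    show "K (t,v0) = v0" for t
      using K_V[OF v0] H0 by simp
    show "K (t,x) \<in> C" if "t \<in> {0..1}" "x \<in> C" for t x
    proof -
      from that have "x \<in> X" using CX by auto
      then show ?thesis
      proof (cases rule: point_cases)
        case 1 then show ?thesis using K_V Hc(2) that by fastforce
      next
        case (2 e s) then show ?thesis using K_edge[of e s t] k(5)[of e s t] that by auto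
      qed
    qed
    show "K (1,x) = v0" if "x \<in> C" for x
    proof -
      from that have "x \<in> X" using CX by auto
      then show ?thesis
      proof (cases rule: point_cases)
        case 1 then show ?thesis using K_V H that by fastforce
      next
        case (2 e s) then show ?thesis using K_edge[of e s 1] k(5)[of e s 1] that by auto
      qed
    qed
  qed
qed

end

section \<open>The first homology group of a graph\<close>

lemma homotopic_with_onI:
  fixes h :: "real \<times> 'a::topological_space \<Rightarrow> 'b::topological_space"
  assumes "continuous_on ({0..1} \<times> S) h" "h \<in> ({0..1} \<times> S) \<rightarrow> T"
    "\<And>x. x \<in> S \<Longrightarrow> h (0,x) = f x" "\<And>x. x \<in> S \<Longrightarrow> h (1,x) = g x"
    "\<And>t. t \<in> {0..1} \<Longrightarrow> P (\<lambda>x. h (t,x))"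
    and P: "\<And>h k. (\<And>x. x \<in> S \<Longrightarrow> h x = k x) \<Longrightarrow> P h \<longleftrightarrow> P k"
  shows "homotopic_with P (top_of_set S) (top_of_set T) f g"
proof (subst homotopic_with)
  show "P h \<longleftrightarrow> P k" if "\<And>x. x \<in> topspace (top_of_set S) \<Longrightarrow> h x = k x" for h k
    by (rule P) (use that in auto)
  have "continuous_map (top_of_set ({0..1} \<times> S)) (top_of_set T) h"
    using assms(1,2) by auto
  then show "\<exists>h. continuous_map (prod_topology (top_of_set {0..1::real}) (top_of_set S)) (top_of_set T) h \<and>
        (\<forall>x\<in>topspace (top_of_set S). h (0, x) = f x) \<and>
        (\<forall>x\<in>topspace (top_of_set S). h (1, x) = g x) \<and> (\<forall>t\<in>{0..1}. P (\<lambda>x. h (t, x)))"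
    by (intro exI[of _ h]) (use assms(3-5) in auto)
qed

definition edges :: "(real \<Rightarrow> 'a) set \<Rightarrow> real set \<Rightarrow> 'a set" where
  "edges J U = (\<Union>e\<in>J. e ` U)"

lemma edgesI: "e \<in> J \<Longrightarrow> t \<in> U \<Longrightarrow> e t \<in> edges J U"
  by (auto simp: edges_def)

lemma edgesE: "x \<in> edges J U \<Longrightarrow> (\<And>e t. e \<in> J \<Longrightarrow> t \<in> U \<Longrightarrow> x = e t \<Longrightarrow> P) \<Longrightarrow> P"
  by (auto simp: edges_def)

lemma edges_mono: "J \<subseteq> J' \<Longrightarrow> U \<subseteq> U' \<Longrightarrow> edges J U \<subseteq> edges J' U'"
  by (auto simp: edges_def)

lemma edges_single [simp]: "edges {e} U = e ` U"
  by (auto simp: edges_def)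

context top_graph
begin

lemma mem_edges_iff:
  assumes "J \<subseteq> E" "U \<subseteq> {0<..<1}" "e \<in> E" "t \<in> {0..1}"
  shows "e t \<in> edges J U \<longleftrightarrow> e \<in> J \<and> t \<in> U"
proof
  assume "e t \<in> edges J U"
  then obtain e' where e': "e' \<in> J" "e t \<in> e' ` U"
    by (auto simp: edges_def)
  then show "e \<in> J \<and> t \<in> U"
    using edge_mem_iff[of e' e U t] assms by auto
qed (auto intro: edgesI)

lemma openin_edges_image:
  assumes "J \<subseteq> E" "open U" "U \<subseteq> {0<..<1}"
  shows "openin (top_of_set X) (edges J U)"
  unfolding edges_def by (rule openin_Union) (use assms openin_edge_image in auto)

lemma openin_Diff_edges_image:
  assumes J: "J \<subseteq> E" and D: "closed D" "D \<subseteq> {0<..<1}"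
  shows "openin (top_of_set X) (X - edges J D)"
proof (subst weak, intro conjI ballI)
  fix e assume e: "e \<in> E"
  have "e t \<in> X - edges J D \<longleftrightarrow> e \<notin> J \<or> t \<notin> D" if t: "t \<in> {0..1}" for t
    using mem_edges_iff[OF J D(2) e t] t edge_in[OF e] by auto
  then have "{t \<in> {0..1}. e t \<in> X - edges J D} = {t \<in> {0..1}. e \<notin> J \<or> t \<notin> D}"
    by blast
  also have "\<dots> = {0..1} \<inter> (if e \<in> J then - D else UNIV)"
    by auto
  finally have "{t \<in> {0..1}. e t \<in> X - edges J D} = {0..1} \<inter> (if e \<in> J then - D else UNIV)" .
  then show "openin (top_of_set {0..1}) {t \<in> {0..1}. e t \<in> X - edges J D}"
    using D(1) by (simp add: openin_open_Int open_Compl)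
qed auto

definition edge_coord :: "'a \<Rightarrow> real" where
  "edge_coord x = snd (inv_into (E \<times> {0<..<1}) (\<lambda>(e, t). e t) x)"

lemma edge_coord: "e \<in> E \<Longrightarrow> t \<in> {0<..<1} \<Longrightarrow> edge_coord (e t) = t"
  unfolding edge_coord_def using inv_into_f_f[OF bij_betw_imp_inj_on[OF bij], of "(e,t)"] by auto

lemma continuous_edge_coord:
  assumes J: "J \<subseteq> E"
  shows "continuous_on (edges J {0<..<1}) edge_coord"
proof (subst continuous_openin_preimage_eq, intro allI impI)
  let ?O = "edges J {0<..<1}"
  fix W :: "real set" assume W: "open W"
  have "?O \<inter> edge_coord -` W = edges J (W \<inter> {0<..<1})"
  proof (intro equalityI subsetI)
    fix x assume "x \<in> ?O \<inter> edge_coord -` W"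
    then show "x \<in> edges J (W \<inter> {0<..<1})"
      using J edge_coord by (auto elim!: edgesE intro!: edgesI)
  next
    fix x assume "x \<in> edges J (W \<inter> {0<..<1})"
    then show "x \<in> ?O \<inter> edge_coord -` W"
      using J edge_coord by (auto elim!: edgesE intro!: edgesI)
  qed
  moreover have "openin (top_of_set X) (edges J (W \<inter> {0<..<1}))"
    by (rule openin_edges_image) (use J W in auto)
  ultimately have "openin (top_of_set X) (?O \<inter> edge_coord -` W)" by simp
  then show "openin (top_of_set ?O) (?O \<inter> edge_coord -` W)"
    by (rule openin_subset_trans) (use openin_imp_subset[OF openin_edges_image[OF J, of "{0<..<1}"]] in auto)
qed

text \<open>The open edges deform into their initial thirds \<open>L\<close>, so the pair of
  \<open>O'\<close> and \<open>L\<close> has no homology. The exact sequence of the triple moves the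
  question to degree 0 on \<open>L \<union> R\<close> relative to \<open>L\<close>, excision moves
  it to \<open>R\<close>, and additivity yields one copy of the integers per edge. The basis is
  indexed by the final thirds, because additivity runs over a set of pieces.\<close>

lemma homology_open_edges:
  assumes J: "J \<subseteq> E"
  defines "O' \<equiv> edges J {0<..<1}" and "L \<equiv> edges J {0<..1/3}" and "R \<equiv> edges J {2/3..<1}"
  shows "relative_homology_group 1 (top_of_set O') (L \<union> R) \<cong> free_Abelian_group ((\<lambda>e. e ` {2/3..<1}) ` J)"
proof -
  have O'X: "O' \<subseteq> X"
    using openin_imp_subset[OF openin_edges_image[OF J, of "{0<..<1}"]] unfolding O'_def by auto
  have sub: "L \<subseteq> O'" "R \<subseteq> O'" "L \<union> R \<subseteq> O'"
    unfolding L_def R_def O'_def by (intro edges_mono Un_least; auto)+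
  have openO': "openin (top_of_set O') (edges J' U)" if "J' \<subseteq> J" "open U" "U \<subseteq> {0<..<1}" for J' U
  proof (rule openin_subset_trans[OF openin_edges_image _ O'X])
    show "edges J' U \<subseteq> O'" using that unfolding O'_def by (intro edges_mono)
  qed (use that J in auto)
  have mem: "e t \<in> edges J' U \<longleftrightarrow> e \<in> J' \<and> t \<in> U"
    if "J' \<subseteq> J" "U \<subseteq> {0<..<1}" "e \<in> J" "t \<in> {0<..<1}" for J' U e t
    using mem_edges_iff[of J' U e t] that J by auto
  have O'E: "\<exists>e t. e \<in> J \<and> t \<in> {0<..<1} \<and> x = e t" if "x \<in> O'" for x
    using that unfolding O'_def by (blast elim: edgesE)
  have triv: "trivial_group (relative_homology_group p (top_of_set O') L)" for p
  proof -
    \<comment> \<open>The deformation scales the edge coordinate by a factor that grows from 1/3 to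
      1. At the start the whole edge lies in \<open>L\<close>, and no factor leads out of
      \<open>L\<close>.\<close>
    define h where "h z = (THE y. \<exists>e\<in>J. \<exists>t\<in>{0<..<1}. snd z = e t \<and> y = e (t * (1/3 + 2/3 * fst z)))" for z :: "real \<times> 'a"
    have h: "h (u, e t) = e (t * (1/3 + 2/3 * u))" if "e \<in> J" "t \<in> {0<..<1}" for u e t
      unfolding h_def
    proof (rule the_equality)
      show "\<exists>e'\<in>J. \<exists>t'\<in>{0<..<1}. snd (u, e t) = e' t' \<and> e (t * (1/3 + 2/3 * u)) = e' (t' * (1/3 + 2/3 * fst (u, e t)))"
        by (intro bexI[of _ e] bexI[of _ t]) (use that in auto)
      fix y assume "\<exists>e'\<in>J. \<exists>t'\<in>{0<..<1}. snd (u, e t) = e' t' \<and> y = e' (t' * (1/3 + 2/3 * fst (u, e t)))"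
      then obtain e' t' where "e' \<in> J" "t' \<in> {0<..<1}" "e t = e' t'" "y = e' (t' * (1/3 + 2/3 * u))"
        by auto
      then show "y = e (t * (1/3 + 2/3 * u))"
        using edge_eqD[of e t e' t'] that J by auto
    qed
    have rng: "0 < t * (1/3 + 2/3 * u)" "t * (1/3 + 2/3 * u) \<le> t" if "t \<in> {0<..<1}" "u \<in> {0..1}" for t u :: real
      using that mult_left_le[of "1/3 + 2/3 * u" t] by (auto intro!: mult_pos_pos add_pos_nonneg)
    have hc: "continuous_on ({0..1} \<times> O') h"
    proof (rule continuous_on_local)
      fix z :: "real \<times> 'a" assume z: "z \<in> {0..1} \<times> O'"
      then obtain e t where et: "e \<in> J" "t \<in> {0<..<1}" "snd z = e t"
        using O'E[of "snd z"] by auto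
      let ?U = "e ` {0<..<1}"
      have oU: "openin (top_of_set O') ?U"
        using openO'[of "{e}" "{0<..<1}"] et by auto
      have "continuous_on ({0..1} \<times> ?U) (\<lambda>z. e (edge_coord (snd z) * (1/3 + 2/3 * fst z)))"
      proof (rule continuous_on_compose2[OF edge_continuous])
        show "continuous_on ({0..1} \<times> ?U) (\<lambda>z. edge_coord (snd z) * (1/3 + 2/3 * fst z))"
          by (intro continuous_intros continuous_on_compose2[OF continuous_edge_coord[of "{e}"]])
            (use et J in auto)
        show "(\<lambda>z. edge_coord (snd z) * (1/3 + 2/3 * fst z)) ` ({0..1} \<times> ?U) \<subseteq> {0..1}"
        proof clarsimp
          fix u s :: real assume us: "0 \<le> u" "u \<le> 1" "0 < s" "s < 1"
          then have "edge_coord (e s) = s" using edge_coord et J by auto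
          moreover have "0 \<le> s * (1/3 + 2/3 * u)" "s * (1/3 + 2/3 * u) \<le> 1"
          proof -
            have "0 < s * (1/3 + 2/3 * u)" "s * (1/3 + 2/3 * u) \<le> s"
              using rng[of s u] us unfolding greaterThanLessThan_iff atLeastAtMost_iff by blast+
            then show "0 \<le> s * (1/3 + 2/3 * u)" "s * (1/3 + 2/3 * u) \<le> 1"
              using us by linarith+
          qed
          ultimately show "0 \<le> edge_coord (e s) * (1/3 + 2 * u / 3) \<and> edge_coord (e s) * (1/3 + 2 * u / 3) \<le> 1"
            by simp
        qed
      qed (use et J in auto)
      then have "continuous_on ({0..1} \<times> ?U) h"
        by (rule continuous_on_eq) (use h et J edge_coord in auto)
      moreover have "openin (top_of_set ({0..1} \<times> O')) ({0..1} \<times> ?U)"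
        using oU by (intro openin_Times) auto
      ultimately show "\<exists>U. openin (top_of_set ({0..1} \<times> O')) U \<and> z \<in> U \<and> continuous_on U h"
        using z et by (intro exI[of _ "{0..1} \<times> ?U"]) (auto simp: mem_Times_iff)
    qed
    have hL: "h (u,x) \<in> L" if "u \<in> {0..1}" "x \<in> L" for u x
    proof -
      obtain e t where et: "e \<in> J" "t \<in> {0<..1/3}" "x = e t" using \<open>x \<in> L\<close> unfolding L_def by (blast elim: edgesE)
      then have "t \<in> {0<..<1}" by auto
      then have "h (u,x) = e (t * (1/3 + 2/3 * u))" "t * (1/3 + 2/3 * u) \<in> {0<..1/3}"
        using rng[of t u] h[OF et(1)] et that(1) unfolding greaterThanAtMost_iff by (blast, linarith)
      then show ?thesis
        using et(1) unfolding L_def by (metis edgesI)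
    qed
    have hO: "h (u,x) \<in> O'" if "u \<in> {0..1}" "x \<in> O'" for u x
    proof -
      obtain e t where et: "e \<in> J" "t \<in> {0<..<1}" "x = e t" using O'E[OF \<open>x \<in> O'\<close>] by blast
      then have "h (u,x) = e (t * (1/3 + 2/3 * u))" "t * (1/3 + 2/3 * u) \<in> {0<..<1}"
        using rng[of t u] h[OF et(1)] that(1) unfolding greaterThanLessThan_iff by (blast, linarith)
      then show ?thesis
        using et(1) unfolding O'_def by (metis edgesI)
    qed
    have h0: "h (0,x) \<in> L" if "x \<in> O'" for x
    proof -
      obtain e t where et: "e \<in> J" "t \<in> {0<..<1}" "x = e t" using O'E[OF \<open>x \<in> O'\<close>] by blast
      then show ?thesis
        using h[of e t 0] edgesI[of e J "t / 3" "{0<..1/3}"] unfolding L_def by auto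
    qed
    show ?thesis
    proof (rule trivial_relative_homology_group_alt)
      have "continuous_on O' (\<lambda>x. h (0,x))"
        by (rule continuous_on_compose2[OF hc]) (auto intro!: continuous_intros)
      then show "continuous_map (top_of_set O') (subtopology (top_of_set O') L) (\<lambda>x. h (0,x))"
        using h0 sub(1) by (auto simp: subtopology_subtopology Int_absorb1)
      show "homotopic_with (\<lambda>k. k ` L \<subseteq> L) (top_of_set O') (top_of_set O') (\<lambda>x. h (0,x)) id"
      proof (rule homotopic_with_onI[OF hc])
        show "h (1,x) = id x" if "x \<in> O'" for x
          using O'E[OF that] h by auto
        show "(h ` L \<subseteq> L) \<longleftrightarrow> (k ` L \<subseteq> L)" if "\<And>x. x \<in> O' \<Longrightarrow> h x = k x" for h k :: "'a \<Rightarrow> 'a"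
          using that sub by (auto simp: image_subset_iff subset_iff)
      qed (use hL hO in auto)
    qed
  qed
  let ?Y = "top_of_set O'" and ?B = "top_of_set (L \<union> R)"
  have YB: "subtopology ?Y (L \<union> R) = ?B"
    using sub by (simp add: subtopology_subtopology Int_absorb1)
  have "hom_relboundary 1 ?Y (L \<union> R) L \<in> iso (relative_homology_group 1 ?Y (L \<union> R)) (relative_homology_group 0 ?B L)"
    using very_short_exact_sequence[of "relative_homology_group 0 ?Y L" "relative_homology_group 0 ?B L"
        "relative_homology_group 1 ?Y (L \<union> R)" "relative_homology_group 1 ?Y L"
        "hom_induced 0 ?B L ?Y L id" "hom_relboundary 1 ?Y (L \<union> R) L" "hom_induced 1 ?Y L ?Y (L \<union> R) id"]
      homology_exactness_triple_1[of L "L \<union> R" 1 ?Y] homology_exactness_triple_2[of L "L \<union> R" 1 ?Y] triv YB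
    by simp
  then have 1: "relative_homology_group 1 ?Y (L \<union> R) \<cong> relative_homology_group 0 ?B L"
    by (rule is_isoI)
  have restr: "openin ?B A" if "openin ?Y A'" "A = A' \<inter> (L \<union> R)" for A A'
    using that sub by (metis YB openin_subtopology)

  have LRm: "x \<in> L \<longleftrightarrow> x \<in> edges J {0<..<1/2} \<inter> (L \<union> R)" "x \<in> R \<longleftrightarrow> x \<in> edges J {1/2<..<1} \<inter> (L \<union> R)"
    if x: "x \<in> O'" for x
  proof -
    obtain e t where et: "e \<in> J" "t \<in> {0<..<1}" "x = e t" using O'E[OF x] by blast
    have "x \<in> L \<longleftrightarrow> t \<in> {0<..1/3}" "x \<in> R \<longleftrightarrow> t \<in> {2/3..<1}"
      "x \<in> edges J {0<..<1/2} \<longleftrightarrow> t \<in> {0<..<1/2}" "x \<in> edges J {1/2<..<1} \<longleftrightarrow> t \<in> {1/2<..<1}"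
      unfolding L_def R_def et(3) by (subst mem; use et in force)+
    then show "x \<in> L \<longleftrightarrow> x \<in> edges J {0<..<1/2} \<inter> (L \<union> R)" "x \<in> R \<longleftrightarrow> x \<in> edges J {1/2<..<1} \<inter> (L \<union> R)"
      by auto
  qed
  have iv: "{2/3..<1} \<subseteq> {0<..<1::real}" "{1/2<..<1} \<subseteq> {0<..<1::real}" "{0<..<1/2} \<subseteq> {0<..<1::real}"
    by auto
  \<comment> \<open>The midpoint 1/2 is any value between the thirds; it separates \<open>L\<close>
    and \<open>R\<close> by open sets, so both are open in their union.\<close>
  have "L = edges J {0<..<1/2} \<inter> (L \<union> R)" "R = edges J {1/2<..<1} \<inter> (L \<union> R)"
    using LRm sub by blast+
  note LR_eq = this
  have oL: "openin ?B L"
    by (rule restr[OF openO'[OF order_refl _ iv(3)] LR_eq(1)]) simp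
  have oR: "openin ?B R"
    by (rule restr[OF openO'[OF order_refl _ iv(2)] LR_eq(2)]) simp
  have disj: "L \<inter> R = {}"
  proof -
    have False if "x \<in> L" "x \<in> R" for x
    proof -
      obtain e t where et: "e \<in> J" "t \<in> {0<..1/3}" "x = e t" using \<open>x \<in> L\<close> unfolding L_def by (blast elim: edgesE)
      then have "t \<in> {0<..<1}" "t \<notin> {2/3..<1}" by auto
      then show False
        using that(2) mem[OF order_refl iv(1) et(1)] et(3) unfolding R_def by blast
    qed
    then show ?thesis by blast
  qed
  have BR: "L \<union> R - L = R" "subtopology ?B R = top_of_set R"
    using disj by (auto simp: subtopology_subtopology Int_absorb1)
  have "closedin ?B L"
    using oR BR(1) by (auto simp: closedin_def)
  then have "?B closure_of L \<subseteq> ?B interior_of L"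
    using oL by (simp add: closure_of_closedin interior_of_openin)
  then have "hom_induced 0 (subtopology ?B (L \<union> R - L)) (L - L) (subtopology ?B (L \<union> R)) L id
     \<in> iso (relative_homology_group 0 (subtopology ?B (L \<union> R - L)) (L - L)) (relative_homology_group 0 (subtopology ?B (L \<union> R)) L)"
    by (rule homology_excision_axiom) auto
  then have "homology_group 0 (top_of_set R) \<cong> relative_homology_group 0 ?B L"
    unfolding BR by (auto intro: is_isoI simp: subtopology_subtopology)
  then have 2: "relative_homology_group 0 ?B L \<cong> homology_group 0 (top_of_set R)"
    by (simp add: group.iso_sym)
  let ?\<U> = "(\<lambda>e. e ` {2/3..<1}) ` J"
  have "(\<lambda>x. gfinprod (homology_group 0 (top_of_set R))
                      (\<lambda>v. hom_induced 0 (subtopology (top_of_set R) v) {} (top_of_set R) {} id (x v)) ?\<U>)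
     \<in> iso (sum_group ?\<U> (\<lambda>S. homology_group 0 (subtopology (top_of_set R) S))) (homology_group 0 (top_of_set R))"
  proof (rule homology_additivity_axiom)
    show "pairwise disjnt ?\<U>"
    proof (clarsimp simp: pairwise_def disjnt_def)
      fix e e' assume e: "e \<in> J" "e' \<in> J" "e ` {2/3..<1} \<noteq> e' ` {2/3..<1}"
      have "e' t \<notin> e ` {2/3..<1}" if t: "t \<in> {2/3..<1}" for t
      proof -
        have "e' t \<in> e ` {2/3..<1} \<longleftrightarrow> e' = e \<and> t \<in> {2/3..<1}"
          by (rule edge_mem_iff[OF _ _ iv(1)]) (use e J t in auto)
        then show ?thesis using e(3) by blast
      qed
      note nin = this
      show "e ` {2/3..<1} \<inter> e' ` {2/3..<1} = {}"
      proof (rule equals0I)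
        fix y assume y: "y \<in> e ` {2/3..<1} \<inter> e' ` {2/3..<1}"
        then obtain t where t: "t \<in> {2/3..<1}" "y = e' t" by blast
        then show False using nin[OF t(1)] y by blast
      qed
    qed
    show "\<Union> ?\<U> = topspace (top_of_set R)"
      by (auto simp: R_def edges_def)
    fix v assume "v \<in> ?\<U>"
    then obtain e where e: "e \<in> J" "v = e ` {2/3..<1}" by auto
    have "openin ?Y (e ` {1/2<..<1})"
      using openO'[of "{e}", OF _ _ iv(2)] e by auto
    moreover have "v = e ` {1/2<..<1} \<inter> R"
    proof -
      have "e t \<in> R \<longleftrightarrow> t \<in> {2/3..<1}" if "t \<in> {1/2<..<1}" for t
        unfolding R_def by (subst mem) (use e that in auto)
      then show ?thesis unfolding e(2) by auto
    qed
    ultimately show "openin (top_of_set R) v"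
      using sub by (metis openin_subtopology subtopology_subtopology inf.absorb_iff2)
  qed
  then have "sum_group ?\<U> (\<lambda>S. homology_group 0 (subtopology (top_of_set R) S)) \<cong> homology_group 0 (top_of_set R)"
    by (rule is_isoI)
  then have 3: "homology_group 0 (top_of_set R) \<cong> sum_group ?\<U> (\<lambda>S. homology_group 0 (subtopology (top_of_set R) S))"
    by (rule group.iso_sym[rotated]) (simp add: sum_group)
  have 4: "sum_group ?\<U> (\<lambda>S. homology_group 0 (subtopology (top_of_set R) S)) \<cong> sum_group ?\<U> (\<lambda>S. integer_group)"
  proof (rule iso_sum_groupI)
    fix S assume "S \<in> ?\<U>"
    then obtain e where e: "e \<in> J" "S = e ` {2/3..<1}" by auto
    have "path_connected S"
      unfolding e(2) by (intro path_connected_continuous_image convex_imp_path_connected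
            continuous_on_subset[OF edge_continuous]) (use e J in auto)
    moreover have "S \<subseteq> R" using e R_def edgesI by blast
    ultimately show "homology_group 0 (subtopology (top_of_set R) S) \<cong> integer_group"
      by (intro isomorphic_integer_zeroth_homology_group)
        (use e in \<open>auto simp: subtopology_subtopology Int_absorb1 path_connected_space_euclidean_subtopology\<close>)
  qed auto
  show ?thesis
    by (rule iso_trans[OF 1 iso_trans[OF 2 iso_trans[OF 3 iso_trans[OF 4 isomorphic_sum_integer_group]]]])
qed

text \<open>\<open>C\<close> is contractible, so the homology of \<open>X\<close> is that of
  \<open>X\<close> relative to \<open>C\<close>, and excision leaves only the open edges. Free
  abelian groups determine the size of a basis; thus the genus makes \<open>J\<close> finite even if
  the graph is infinite.\<close>

proposition genus_eq_card:
  fixes K :: "real \<times> 'a \<Rightarrow> 'a"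
  assumes J: "J \<subseteq> E" and v0: "v0 \<in> V"
  defines "C \<equiv> X - edges J {1/3<..<2/3}"
  assumes K: "continuous_on ({0..1} \<times> X) K" "\<And>t x. t \<in> {0..1} \<Longrightarrow> x \<in> C \<Longrightarrow> K (t,x) \<in> C"
    "\<And>x. x \<in> X \<Longrightarrow> K (0,x) = x" "\<And>x. x \<in> C \<Longrightarrow> K (1,x) = v0"
    and genus: "has_genus (top_of_set X) n"
  shows "finite J" "card J = n"
proof -
  have v0C: "v0 \<in> C"
    using v0 V_sub edge_interior J unfolding C_def by (fastforce elim!: edgesE)
  have CX: "C \<subseteq> X" by (auto simp: C_def)
  let ?T = "top_of_set X" and ?O = "edges J {0<..<1}"
  have sC: "subtopology ?T C = top_of_set C"
    using CX by (simp add: subtopology_subtopology Int_absorb1)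
  have contr: "contractible_space (subtopology ?T C)"
    unfolding contractible_space_def sC
    by (intro exI[of _ v0] homotopic_with_onI[of _ K])
      (use K CX in \<open>auto intro: continuous_on_subset[OF K(1)]\<close>)
  have 1: "homology_group 1 ?T \<cong> relative_homology_group 1 ?T C"
    using isomorphic_reduced_homology_by_contractible[OF contr, of 1] v0C CX
    by (auto simp: un_reduced_homology_group)
  have oO: "openin ?T ?O"
    by (rule openin_edges_image[OF J]) auto
  have OX: "?O \<subseteq> X" using oO openin_imp_subset by blast
  \<comment> \<open>This open set lies between the excised set \<open>X - ?O\<close> and
    \<open>C\<close>; it is the room that excision requires.\<close>
  have "openin ?T (X - edges J {1/3..2/3})"
    by (rule openin_Diff_edges_image[OF J]) auto
  moreover have "X - edges J {1/3..2/3} \<subseteq> C"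
    unfolding C_def by (intro Diff_mono edges_mono) auto
  ultimately have "X - edges J {1/3..2/3} \<subseteq> ?T interior_of C"
    by (simp add: interior_of_maximal)
  moreover have "X - ?O \<subseteq> X - edges J {1/3..2/3}"
    by (intro Diff_mono edges_mono) auto
  moreover have "?T closure_of (X - ?O) = X - ?O"
    using oO OX by (intro closure_of_closedin) (auto simp: closedin_def Diff_Diff_Int Int_absorb1)
  ultimately have "?T closure_of (X - ?O) \<subseteq> ?T interior_of C"
    by auto
  then have exc: "hom_induced 1 (subtopology ?T (X - (X - ?O))) (C - (X - ?O)) (subtopology ?T X) C id
    \<in> iso (relative_homology_group 1 (subtopology ?T (X - (X - ?O))) (C - (X - ?O)))
          (relative_homology_group 1 (subtopology ?T X) C)"
    by (rule homology_excision_axiom[OF _ CX])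
  have XO: "subtopology ?T (X - (X - ?O)) = top_of_set ?O" "subtopology ?T X = ?T"
    using OX by (simp_all add: subtopology_subtopology Int_absorb1 double_diff)
  have CO: "C - (X - ?O) = edges J {0<..1/3} \<union> edges J {2/3..<1}" (is "_ = ?LR")
  proof -
    have m: "e t \<in> edges J U \<longleftrightarrow> t \<in> U"
      if "U \<subseteq> {0<..<1}" "e \<in> J" "t \<in> {0<..<1}" for U e t
      using mem_edges_iff[of J U e t] that J by auto
    have "e t \<in> C \<longleftrightarrow> e t \<in> ?LR" if et: "e \<in> J" "t \<in> {0<..<1}" for e t
    proof -
      have "e t \<in> edges J {1/3<..<2/3} \<longleftrightarrow> t \<in> {1/3<..<2/3}"
        "e t \<in> edges J {0<..1/3} \<longleftrightarrow> t \<in> {0<..1/3}"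
        "e t \<in> edges J {2/3..<1} \<longleftrightarrow> t \<in> {2/3..<1}"
        by (rule m; use et in force)+
      moreover have "e t \<in> X" using OX et by (blast intro: edgesI)
      ultimately show ?thesis
        using et unfolding C_def by auto
    qed
    then have "x \<in> C \<longleftrightarrow> x \<in> ?LR" if "x \<in> ?O" for x
      using that by (rule_tac edgesE[OF that]) blast
    moreover have "?LR \<subseteq> ?O" by (intro Un_least edges_mono) auto
    moreover have "C - (X - ?O) = C \<inter> ?O" using CX by auto
    ultimately show ?thesis by blast
  qed
  have "relative_homology_group 1 (top_of_set ?O) ?LR \<cong> relative_homology_group 1 ?T C"
    using exc unfolding XO CO by (rule is_isoI)
  then have 2: "relative_homology_group 1 ?T C \<cong> relative_homology_group 1 (top_of_set ?O) ?LR"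
    by (simp add: group.iso_sym)
  have "homology_group 1 ?T \<cong> free_Abelian_group ((\<lambda>e. e ` {2/3..<1}) ` J)"
    by (rule iso_trans[OF 1 iso_trans[OF 2 homology_open_edges[OF J]]])
  then have "free_Abelian_group {..<n} \<cong> free_Abelian_group ((\<lambda>e. e ` {2/3..<1}) ` J)"
    using genus unfolding has_genus_def by (meson group.iso_sym group_relative_homology_group iso_trans)
  then have eq: "{..<n} \<approx> (\<lambda>e. e ` {2/3..<1}) ` J"
    by (simp add: isomorphic_free_Abelian_groups)
  have "inj_on (\<lambda>e. e ` {2/3..<1}) J"
  proof (rule inj_onI)
    fix e e' assume e: "e \<in> J" "e' \<in> J" "e ` {2/3..<1} = e' ` {2/3..<1}"
    have "e' (2/3) \<in> e ` {2/3..<1}" unfolding e(3) by auto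
    moreover have "e' (2/3) \<in> e ` {2/3..<1} \<longleftrightarrow> e' = e \<and> 2/3 \<in> {2/3..<1::real}"
      by (rule edge_mem_iff) (use e J in auto)
    ultimately show "e = e'" by simp
  qed
  then have "J \<approx> (\<lambda>e. e ` {2/3..<1}) ` J"
    by (simp add: inj_on_image_eqpoll_self eqpoll_sym)
  then have "J \<approx> {..<n}"
    using eq eqpoll_sym eqpoll_trans by blast
  then show fin: "finite J"
    using eqpoll_finite_iff by blast
  show "card J = n"
    using \<open>J \<approx> {..<n}\<close> fin by (simp add: eqpoll_iff_card)
qed

end

section \<open>Paths up to homotopy\<close>

fun path_list :: "'a::topological_space set \<Rightarrow> 'a \<Rightarrow> (real \<Rightarrow> 'a) list \<Rightarrow> 'a \<Rightarrow> bool" where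
  "path_list S x [] y \<longleftrightarrow> x = y \<and> x \<in> S"
| "path_list S x (p # ps) y \<longleftrightarrow> path p \<and> path_image p \<subseteq> S \<and> pathstart p = x \<and> path_list S (pathfinish p) ps y"

fun path_concat :: "'a::topological_space \<Rightarrow> (real \<Rightarrow> 'a) list \<Rightarrow> real \<Rightarrow> 'a" where
  "path_concat x [] = (\<lambda>_. x)"
| "path_concat x (p # ps) = p +++ path_concat (pathfinish p) ps"

lemma path_const [simp]: "path (\<lambda>_. x)" "pathstart (\<lambda>_. x) = x" "pathfinish (\<lambda>_. x) = x"
    "path_image (\<lambda>_. x) = {x}" "reversepath (\<lambda>_. x) = (\<lambda>_. x)"
  by (auto simp: path_def pathstart_def pathfinish_def path_image_def reversepath_def)

text \<open>The library's \<open>subpath\<close> is restricted to normed spaces.\<close>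

definition portion :: "real \<Rightarrow> real \<Rightarrow> (real \<Rightarrow> 'a) \<Rightarrow> real \<Rightarrow> 'a" where
  "portion u v g x = g ((v - u) * x + u)"

lemma portion_01 [simp]: "portion 0 1 g = g" "portion 1 0 g = reversepath g"
  by (auto simp: portion_def reversepath_def fun_eq_iff)

lemma portion_ends [simp]: "pathstart (portion u v g) = g u" "pathfinish (portion u v g) = g v"
  by (auto simp: portion_def pathstart_def pathfinish_def)

lemma portion_range:
  fixes u v s :: real
  assumes "u \<in> {a..b}" "v \<in> {a..b}" "s \<in> {0..1}"
  shows "(v - u) * s + u \<in> {a..b}"
proof -
  have "(1 - s) * u + s * v \<in> {a..b}"
    using convexD_alt[of "{a..b}" u v s] assms by simp
  then show ?thesis by (simp add: algebra_simps)
qed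

lemma path_image_portion:
  assumes "u \<in> {0..1}" "v \<in> {0..1}"
  shows "path_image (portion u v g) \<subseteq> path_image g"
  using portion_range[OF assms] unfolding path_image_def portion_def by blast

lemma continuous_portion_family:
  fixes g :: "real \<Rightarrow> 'a::topological_space"
  assumes g: "path g" and uv: "continuous_on {0..1} u" "continuous_on {0..1} v" "\<And>t. t \<in> {0..1} \<Longrightarrow> u t \<in> {0..1}" "\<And>t. t \<in> {0..1} \<Longrightarrow> v t \<in> {0..1}"
  shows "continuous_on ({0..1} \<times> {0..1}) (\<lambda>y. portion (u (fst y)) (v (fst y)) g (snd y))"
proof -
  have rng: "(v t - u t) * s + u t \<in> {0..1}" if "t \<in> {0..1}" "s \<in> {0..1}" for t s
    by (rule portion_range) (use that uv in auto)
  show ?thesis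
    unfolding portion_def
  proof (rule continuous_on_compose2[of "{0..1}" g])
    show "continuous_on ({0..1} \<times> {0..1}) (\<lambda>y. (v (fst y) - u (fst y)) * snd y + u (fst y))"
      by (intro continuous_intros continuous_on_compose2[OF uv(1)] continuous_on_compose2[OF uv(2)]) auto
    show "(\<lambda>y. (v (fst y) - u (fst y)) * snd y + u (fst y)) ` ({0..1} \<times> {0..1}) \<subseteq> {0..1}"
      using rng by fastforce
  qed (use g in \<open>simp add: path_def\<close>)
qed

lemma homotopic_paths_const_right:
  assumes "path p" "path_image p \<subseteq> S" "pathfinish p = x"
  shows "homotopic_paths S (p +++ (\<lambda>_. x)) p"
proof (rule homotopic_paths_sym, rule homotopic_paths_reparametrize[OF assms(1,2), where f = "\<lambda>t. min (2 * t) 1"])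
  show "(p +++ (\<lambda>_. x)) t = p (min (2 * t) 1)" if "t \<in> {0..1}" for t
    using assms(3) by (auto simp: joinpaths_def pathfinish_def min_def)
qed (auto intro!: continuous_intros)

lemma homotopic_paths_const_left:
  assumes "path p" "path_image p \<subseteq> S" "pathstart p = x"
  shows "homotopic_paths S ((\<lambda>_. x) +++ p) p"
proof (rule homotopic_paths_sym, rule homotopic_paths_reparametrize[OF assms(1,2), where f = "\<lambda>t. max (2 * t - 1) 0"])
  show "((\<lambda>_. x) +++ p) t = p (max (2 * t - 1) 0)" if "t \<in> {0..1}" for t
    using assms(3) by (auto simp: joinpaths_def pathstart_def max_def)
qed (auto intro!: continuous_intros)

lemma homotopic_paths_inverse_right:
  fixes p :: "real \<Rightarrow> 'a::topological_space"
  assumes p: "path p" "path_image p \<subseteq> S" "pathstart p = x"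
  shows "homotopic_paths S (p +++ reversepath p) (\<lambda>_. x)"
proof -
  \<comment> \<open>\<open>M t\<close> walks along \<open>p\<close> up to the parameter
    \<open>t\<close> and returns the same way.\<close>
  define M where "M t = portion 0 t p +++ portion t 0 p" for t
  have M0: "M 0 = (\<lambda>_. x)"
    using p(3) by (auto simp: M_def portion_def joinpaths_def pathstart_def)
  have M1: "M 1 = p +++ reversepath p"
    by (auto simp: M_def portion_def joinpaths_def reversepath_def)
  have c: "continuous_on ({0..1} \<times> {0..1}) (\<lambda>y. M (fst y) (snd y))"
    unfolding M_def
  proof (intro continuous_on_homotopic_join_lemma)
    show "continuous_on ({0..1} \<times> {0..1}) (\<lambda>y. portion 0 (fst y) p (snd y))"
      "continuous_on ({0..1} \<times> {0..1}) (\<lambda>y. portion (fst y) 0 p (snd y))"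
      using continuous_portion_family[OF p(1), of "\<lambda>_. 0" "\<lambda>t. t"] continuous_portion_family[OF p(1), of "\<lambda>t. t" "\<lambda>_. 0"]
      by simp_all
  qed auto
  have MS: "M t s \<in> S" if "t \<in> {0..1}" "s \<in> {0..1}" for t s
  proof -
    have "path_image (portion 0 t p) \<subseteq> S" "path_image (portion t 0 p) \<subseteq> S"
      using path_image_portion[of 0 t p] path_image_portion[of t 0 p] p that by auto
    then have "path_image (M t) \<subseteq> S"
      unfolding M_def by (intro order_trans[OF path_image_join_subset] Un_least)
    then show ?thesis using that by (auto simp: path_image_def)
  qed
  have "M t 0 = x" "M t 1 = x" for t
    using p(3) by (auto simp: M_def joinpaths_def portion_def pathstart_def)
  then have "homotopic_paths S (M 0) (M 1)"
    unfolding homotopic_paths using c MS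
    by (intro exI[of _ "\<lambda>y. M (fst y) (snd y)"]) (auto simp: pathstart_def pathfinish_def)
  then show ?thesis
    unfolding M0 M1 by (rule homotopic_paths_sym)
qed

lemma homotopic_paths_inverse_left:
  assumes "path p" "path_image p \<subseteq> S" "pathfinish p = x"
  shows "homotopic_paths S (reversepath p +++ p) (\<lambda>_. x)"
  using homotopic_paths_inverse_right[of "reversepath p" S x] assms by simp

lemma path_list_concat:
  assumes "path_list S x ps y"
  shows "path (path_concat x ps)" "path_image (path_concat x ps) \<subseteq> S"
    "pathstart (path_concat x ps) = x" "pathfinish (path_concat x ps) = y"
  using assms by (induction ps arbitrary: x) (auto simp: path_image_join)

lemma path_list_append: "path_list S x (ps @ qs) y \<longleftrightarrow> (\<exists>z. path_list S x ps z \<and> path_list S z qs y)"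
proof (induction ps arbitrary: x)
  case Nil
  show ?case by (cases qs) auto
qed auto

lemma path_concat_append:
  assumes "path_list S x ps y" "path_list S y qs z"
  shows "homotopic_paths S (path_concat x ps +++ path_concat y qs) (path_concat x (ps @ qs))"
  using assms
proof (induction ps arbitrary: x)
  case Nil
  then show ?case
    using homotopic_paths_const_left[of "path_concat y qs" S] path_list_concat[OF Nil(2)] by simp
next
  case (Cons p ps)
  note ps = path_list_concat[of S "pathfinish p" ps y] and qs = path_list_concat[OF Cons.prems(2)]
  have "homotopic_paths S ((p +++ path_concat (pathfinish p) ps) +++ path_concat y qs)
          (p +++ (path_concat (pathfinish p) ps +++ path_concat y qs))"
    using Cons.prems ps qs by (intro homotopic_paths_sym[OF homotopic_paths_assoc]) auto
  also have "homotopic_paths S \<dots> (p +++ path_concat (pathfinish p) (ps @ qs))"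
    using Cons ps qs by (intro homotopic_paths_join) auto
  finally show ?case by simp
qed

text \<open>A calculus of words in the fundamental groupoid: passing from \<open>p\<close> to a list
  of paths forgets the bracketing, adjacent inverse entries may be cancelled, and paths with a
  common list are homotopic.\<close>

definition reduces :: "'a::topological_space set \<Rightarrow> 'a \<Rightarrow> 'a \<Rightarrow> (real \<Rightarrow> 'a) \<Rightarrow> (real \<Rightarrow> 'a) list \<Rightarrow> bool" where
  "reduces S x y p ps \<longleftrightarrow> path_list S x ps y \<and> homotopic_paths S p (path_concat x ps)"

lemma reduces_single:
  assumes "path p" "path_image p \<subseteq> S" "pathstart p = x" "pathfinish p = y"
  shows "reduces S x y p [p]"
proof -
  have "y \<in> S" using assms by auto
  moreover have "homotopic_paths S p (p +++ (\<lambda>_. y))"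
    by (rule homotopic_paths_sym[OF homotopic_paths_const_right[OF assms(1,2,4)]])
  ultimately show ?thesis using assms by (simp add: reduces_def)
qed

lemma reduces_join:
  assumes "reduces S x y p ps" "reduces S y z q qs"
  shows "reduces S x z (p +++ q) (ps @ qs)"
proof -
  have l: "path_list S x ps y" "path_list S y qs z"
    using assms by (auto simp: reduces_def)
  have "homotopic_paths S (p +++ q) (path_concat x ps +++ path_concat y qs)"
  proof (rule homotopic_paths_join)
    show p: "homotopic_paths S p (path_concat x ps)" and q: "homotopic_paths S q (path_concat y qs)"
      using assms by (auto simp: reduces_def)
    show "pathfinish p = pathstart q"
      using homotopic_paths_imp_pathfinish[OF p] homotopic_paths_imp_pathstart[OF q]
        path_list_concat(4)[OF l(1)] path_list_concat(3)[OF l(2)] by simp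
  qed
  then show ?thesis
    using l path_concat_append[OF l] by (auto simp: reduces_def path_list_append intro: homotopic_paths_trans)
qed

lemma reduces_homotopic: "homotopic_paths S p q \<Longrightarrow> reduces S x y q ps \<Longrightarrow> reduces S x y p ps"
  by (auto simp: reduces_def intro: homotopic_paths_trans)

lemma reduces_eq: "reduces S x y p ps \<Longrightarrow> reduces S x y q ps \<Longrightarrow> homotopic_paths S p q"
  by (auto simp: reduces_def intro: homotopic_paths_trans homotopic_paths_sym)

lemma path_concat_null:
  assumes ps: "path_list S x ps y" "path_list S y [p,q] y" "path_list S y qs z"
    and null: "homotopic_paths S (p +++ q) (\<lambda>_. y)"
  shows "homotopic_paths S (path_concat x (ps @ p # q # qs)) (path_concat x (ps @ qs))"
proof -
  note Q = path_list_concat[OF ps(3)]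
  have "homotopic_paths S (p +++ (q +++ path_concat (pathfinish q) qs)) ((p +++ q) +++ path_concat (pathfinish q) qs)"
    using ps Q by (intro homotopic_paths_assoc) auto
  also have "homotopic_paths S \<dots> ((\<lambda>_. y) +++ path_concat y qs)"
    using null ps Q by (intro homotopic_paths_join) auto
  also have "homotopic_paths S \<dots> (path_concat y qs)"
    by (rule homotopic_paths_const_left[OF Q(1,2,3)])
  finally have 1: "homotopic_paths S (path_concat y (p # q # qs)) (path_concat y qs)"
    by simp
  have l: "path_list S y (p # q # qs) z"
    using ps by auto
  have "homotopic_paths S (path_concat x (ps @ p # q # qs)) (path_concat x ps +++ path_concat y (p # q # qs))"
    by (rule homotopic_paths_sym[OF path_concat_append[OF ps(1) l]])
  also have "homotopic_paths S \<dots> (path_concat x ps +++ path_concat y qs)"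
    using 1 path_list_concat[OF ps(1)] path_list_concat[OF l] by (intro homotopic_paths_join) auto
  also have "homotopic_paths S \<dots> (path_concat x (ps @ qs))"
    by (rule path_concat_append[OF ps(1,3)])
  finally show ?thesis .
qed

lemma reduces_cancel:
  assumes "reduces S x y p (ps @ q # reversepath q # qs)"
  shows "reduces S x y p (ps @ qs)"
proof -
  have "path_list S x (ps @ q # reversepath q # qs) y" using assms by (simp add: reduces_def)
  then obtain z where z: "path_list S x ps z" "path_list S z [q, reversepath q] z" "path_list S z qs y"
    by (auto simp: path_list_append)
  have "homotopic_paths S (q +++ reversepath q) (\<lambda>_. z)"
    using homotopic_paths_inverse_right[of q S] z by simp
  from path_concat_null[OF z this] assms z show ?thesis
    by (auto simp: reduces_def path_list_append intro: homotopic_paths_trans)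
qed

lemma reduces_cancel':
  assumes "reduces S x y p (ps @ reversepath q # q # qs)"
  shows "reduces S x y p (ps @ qs)"
  using reduces_cancel[of S x y p ps "reversepath q" qs] assms by simp

lemma reduces_split:
  assumes "reduces S x y p (ps @ (q +++ r) # qs)" "path q" "path r" "pathfinish q = pathstart r"
    "path_image q \<subseteq> S" "path_image r \<subseteq> S"
  shows "reduces S x y p (ps @ q # r # qs)"
proof -
  have "path_list S x (ps @ (q +++ r) # qs) y" using assms by (simp add: reduces_def)
  then obtain z where z: "path_list S x ps z" "pathstart q = z" "path_list S (pathfinish r) qs y"
    by (auto simp: path_list_append)
  have l: "path_list S z [q, r] (pathfinish r)" "path_list S z [q +++ r] (pathfinish r)"
    using assms z path_list_concat[OF z(3)] by (auto simp: path_image_join)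
  have "reduces S z (pathfinish r) (q +++ r) ([q] @ [r])"
    by (rule reduces_join[of _ _ "pathstart r"]) (use assms z in \<open>auto intro: reduces_single\<close>)
  moreover have "reduces S z (pathfinish r) (q +++ r) [q +++ r]"
    by (rule reduces_single) (use assms z in \<open>auto simp: path_image_join\<close>)
  ultimately have 1: "homotopic_paths S (path_concat z [q +++ r]) (path_concat z [q,r])"
    by (auto simp: reduces_def intro: homotopic_paths_trans homotopic_paths_sym simp del: path_concat.simps)
  have l': "path_list S z ([q +++ r] @ qs) y" "path_list S z ([q,r] @ qs) y"
    using l z by auto
  have "homotopic_paths S (path_concat z ([q +++ r] @ qs)) (path_concat z [q +++ r] +++ path_concat (pathfinish r) qs)"
    by (rule homotopic_paths_sym[OF path_concat_append[OF l(2) z(3)]])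
  also have "homotopic_paths S \<dots> (path_concat z [q,r] +++ path_concat (pathfinish r) qs)"
    using 1 path_list_concat[OF l(2)] path_list_concat[OF z(3)] by (intro homotopic_paths_join) auto
  also have "homotopic_paths S \<dots> (path_concat z ([q,r] @ qs))"
    by (rule path_concat_append[OF l(1) z(3)])
  finally have 2: "homotopic_paths S (path_concat z ([q +++ r] @ qs)) (path_concat z ([q,r] @ qs))" .
  have "homotopic_paths S (path_concat x (ps @ [q +++ r] @ qs)) (path_concat x ps +++ path_concat z ([q +++ r] @ qs))"
    by (rule homotopic_paths_sym[OF path_concat_append[OF z(1) l'(1)]])
  also have "homotopic_paths S \<dots> (path_concat x ps +++ path_concat z ([q,r] @ qs))"
    using 2 path_list_concat[OF z(1)] path_list_concat[OF l'(1)] by (intro homotopic_paths_join) auto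
  also have "homotopic_paths S \<dots> (path_concat x (ps @ [q,r] @ qs))"
    by (rule path_concat_append[OF z(1) l'(2)])
  finally show ?thesis
    using assms(1) z(1) l'(2) by (auto simp: reduces_def path_list_append intro: homotopic_paths_trans simp del: path_list.simps)
qed

text \<open>The tails \<open>b\<close> and \<open>c\<close> may differ, so \<open>w\<close> need not
  be a loop: consecutive pieces of a loop, each closed up by tails, telescope when they are
  multiplied.\<close>

abbreviation conj_path :: "(real \<Rightarrow> 'a::topological_space) \<Rightarrow> (real \<Rightarrow> 'a) \<Rightarrow> (real \<Rightarrow> 'a) \<Rightarrow> real \<Rightarrow> 'a" where
  "conj_path b w c \<equiv> b +++ (w +++ reversepath c)"

lemma reduces_conj:
  assumes "path b" "path_image b \<subseteq> S" "path w" "path_image w \<subseteq> S" "path c" "path_image c \<subseteq> S"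
    "pathfinish b = pathstart w" "pathfinish w = pathfinish c" "pathstart b = x" "pathstart c = y"
  shows "reduces S x y (conj_path b w c) [b, w, reversepath c]"
proof -
  have "reduces S x y (b +++ (w +++ reversepath c)) ([b] @ ([w] @ [reversepath c]))"
    by (rule reduces_join[OF reduces_single reduces_join[OF reduces_single reduces_single]]) (use assms in auto)
  then show ?thesis by simp
qed

lemma homotopic_conj_join:
  assumes "path b" "path_image b \<subseteq> S" "path c" "path_image c \<subseteq> S" "path d" "path_image d \<subseteq> S"
    "path u" "path_image u \<subseteq> S" "path w" "path_image w \<subseteq> S"
    "pathfinish b = pathstart u" "pathfinish u = pathfinish c" "pathfinish c = pathstart w" "pathfinish w = pathfinish d"
  shows "homotopic_paths S (conj_path b u c +++ conj_path c w d) (conj_path b (u +++ w) d)"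
proof (rule reduces_eq)
  have "reduces S (pathstart b) (pathstart d) (conj_path b u c +++ conj_path c w d) ([b, u, reversepath c] @ [c, w, reversepath d])"
    by (intro reduces_join[of _ _ "pathstart c"] reduces_conj) (use assms in auto)
  then show "reduces S (pathstart b) (pathstart d) (conj_path b u c +++ conj_path c w d) [b, u, w, reversepath d]"
    using reduces_cancel'[of S "pathstart b" "pathstart d" _ "[b,u]" c "[w, reversepath d]"] by simp
  have "reduces S (pathstart b) (pathstart d) (conj_path b (u +++ w) d) [b, u +++ w, reversepath d]"
    by (rule reduces_conj) (use assms in \<open>auto simp: path_image_join\<close>)
  then show "reduces S (pathstart b) (pathstart d) (conj_path b (u +++ w) d) [b, u, w, reversepath d]"
    using reduces_split[of S "pathstart b" "pathstart d" _ "[b]" u w "[reversepath d]"] assms by auto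
qed

lemma homotopic_conj_conj:
  assumes "path b" "path_image b \<subseteq> S" "path c" "path_image c \<subseteq> S"
    "path w" "path_image w \<subseteq> S"
    "pathfinish b = pathstart c" "pathfinish c = pathstart w" "pathfinish w = pathfinish c"
  shows "homotopic_paths S (conj_path b (conj_path c w c) b) (conj_path (b +++ c) w (b +++ c))"
proof (rule reduces_eq)
  have "reduces S (pathstart b) (pathstart b) (conj_path b (conj_path c w c) b) ([b] @ ([c, w, reversepath c] @ [reversepath b]))"
    by (rule reduces_join[OF reduces_single reduces_join[OF reduces_conj reduces_single]]) (use assms in auto)
  then show "reduces S (pathstart b) (pathstart b) (conj_path b (conj_path c w c) b) [b, c, w, reversepath c, reversepath b]"
    by simp
  have "reduces S (pathstart b) (pathstart b) ((b +++ c) +++ (w +++ (reversepath c +++ reversepath b)))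
     (([b] @ [c]) @ ([w] @ ([reversepath c] @ [reversepath b])))"
    by (rule reduces_join[OF reduces_join[OF reduces_single reduces_single]
          reduces_join[OF reduces_single reduces_join[OF reduces_single reduces_single]]]) (use assms in auto)
  then show "reduces S (pathstart b) (pathstart b) (conj_path (b +++ c) w (b +++ c)) [b, c, w, reversepath c, reversepath b]"
    using assms by (simp add: reversepath_joinpaths)
qed

lemma homotopic_conj_change:
  assumes "path b" "path_image b \<subseteq> S" "path c" "path_image c \<subseteq> S"
    "path w" "path_image w \<subseteq> S" "pathstart b = pathstart c"
    "pathfinish b = pathstart w" "pathfinish c = pathstart w" "pathfinish w = pathfinish c"
  shows "homotopic_paths S (conj_path b w b) (conj_path (b +++ reversepath c) (conj_path c w c) (b +++ reversepath c))"
proof (rule reduces_eq)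
  show "reduces S (pathstart b) (pathstart b) (conj_path b w b) [b, w, reversepath b]"
    by (rule reduces_conj) (use assms in auto)
  have "reduces S (pathstart b) (pathstart b) ((b +++ reversepath c) +++ (conj_path c w c +++ (c +++ reversepath b)))
     (([b] @ [reversepath c]) @ ([c, w, reversepath c] @ ([c] @ [reversepath b])))" (is "reduces _ _ _ ?p _")
    by (rule reduces_join[OF reduces_join[OF reduces_single reduces_single]
          reduces_join[OF reduces_conj reduces_join[OF reduces_single reduces_single]]]) (use assms in auto)
  then have "reduces S (pathstart b) (pathstart b) ?p ([b] @ reversepath c # c # [w, reversepath c, c, reversepath b])"
    by simp
  then have "reduces S (pathstart b) (pathstart b) ?p ([b, w] @ reversepath c # c # [reversepath b])"
    using reduces_cancel' by fastforce
  then have "reduces S (pathstart b) (pathstart b) ?p [b, w, reversepath b]"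
    using reduces_cancel' by fastforce
  then show "reduces S (pathstart b) (pathstart b) (conj_path (b +++ reversepath c) (conj_path c w c) (b +++ reversepath c)) [b, w, reversepath b]"
    using assms by (simp add: reversepath_joinpaths)
qed

lemma homotopic_conj_cong:
  assumes "homotopic_paths S w w'" "path b" "path_image b \<subseteq> S" "path c" "path_image c \<subseteq> S"
    "pathfinish b = pathstart w" "pathfinish w = pathfinish c"
  shows "homotopic_paths S (conj_path b w c) (conj_path b w' c)"
  using assms homotopic_paths_imp_pathstart[OF assms(1)] homotopic_paths_imp_pathfinish[OF assms(1)]
  by (intro homotopic_paths_join) auto

lemma homotopic_conj_cong':
  assumes "homotopic_paths S b b'" "homotopic_paths S c c'" "path w" "path_image w \<subseteq> S"
    "pathfinish b = pathstart w" "pathfinish w = pathfinish c"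
  shows "homotopic_paths S (conj_path b w c) (conj_path b' w c')"
  using assms homotopic_paths_imp_pathstart[OF assms(2)] homotopic_paths_imp_pathfinish[OF assms(2)]
  by (intro homotopic_paths_join homotopic_paths_reversepath_D homotopic_paths_reversepath[THEN iffD2]) auto

lemma homotopic_conj_const:
  assumes "path w" "path_image w \<subseteq> S" "pathstart w = x" "pathfinish w = x"
  shows "homotopic_paths S (conj_path (\<lambda>_. x) w (\<lambda>_. x)) w"
proof -
  have "x \<in> S" using assms by auto
  have "homotopic_paths S (w +++ (\<lambda>_. x)) w"
    by (rule homotopic_paths_const_right[OF assms(1,2,4)])
  moreover have "homotopic_paths S ((\<lambda>_. x) +++ (w +++ (\<lambda>_. x))) (w +++ (\<lambda>_. x))"
    using homotopic_paths_const_left[of "w +++ (\<lambda>_. x)" S x] assms \<open>x \<in> S\<close> by (simp add: path_image_join)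
  ultimately show ?thesis by (auto intro: homotopic_paths_trans)
qed

text \<open>Here the homotopy is a named function, in contrast to \<open>homotopic_with\<close>,
  because the track of the base point under it enters the later statements.\<close>

definition htpy :: "'a::topological_space set \<Rightarrow> 'b::topological_space set \<Rightarrow> ('a \<Rightarrow> 'b) \<Rightarrow> ('a \<Rightarrow> 'b) \<Rightarrow> (real \<times> 'a \<Rightarrow> 'b) \<Rightarrow> bool" where
  "htpy S T f g H \<longleftrightarrow> continuous_on ({0..1} \<times> S) H \<and> (\<forall>t\<in>{0..1}. \<forall>x\<in>S. H (t,x) \<in> T) \<and>
     (\<forall>x\<in>S. H (0,x) = f x \<and> H (1,x) = g x)"

definition htpy_join :: "(real \<times> 'a \<Rightarrow> 'b::topological_space) \<Rightarrow> (real \<times> 'a \<Rightarrow> 'b) \<Rightarrow> real \<times> 'a \<Rightarrow> 'b" where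
  "htpy_join H H' z = ((\<lambda>t. H (t, snd z)) +++ (\<lambda>t. H' (t, snd z))) (fst z)"

lemma htpy_join:
  assumes "htpy S T f g H" "htpy S T g k H'"
  shows "htpy S T f k (htpy_join H H')"
proof -
  have "continuous_on ({0..1} \<times> S) (\<lambda>z. if fst z \<le> 1/2 then H (2 * fst z, snd z) else H' (2 * fst z - 1, snd z))"
  proof (rule continuous_on_cases_le)
    show "continuous_on {z \<in> {0..1} \<times> S. fst z \<le> 1/2} (\<lambda>z. H (2 * fst z, snd z))"
      by (rule continuous_on_compose2[of "{0..1} \<times> S" H]) (use assms in \<open>auto simp: htpy_def intro!: continuous_intros\<close>)
    show "continuous_on {z \<in> {0..1} \<times> S. 1/2 \<le> fst z} (\<lambda>z. H' (2 * fst z - 1, snd z))"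
      by (rule continuous_on_compose2[of "{0..1} \<times> S" H']) (use assms in \<open>auto simp: htpy_def intro!: continuous_intros\<close>)
    show "H (2 * fst z, snd z) = H' (2 * fst z - 1, snd z)" if "z \<in> {0..1} \<times> S" "fst z = 1/2" for z
      unfolding that(2) using assms that(1) by (auto simp: htpy_def)
  qed (auto intro!: continuous_intros)
  then have "continuous_on ({0..1} \<times> S) (htpy_join H H')"
    by (simp add: htpy_join_def[abs_def] joinpaths_def)
  moreover have "htpy_join H H' (t,x) \<in> T" if "t \<in> {0..1}" "x \<in> S" for t x
    using assms that by (auto simp: htpy_def htpy_join_def joinpaths_def)
  ultimately show ?thesis
    using assms by (auto simp: htpy_def htpy_join_def joinpaths_def)
qed

lemma htpy_reverse:
  assumes "htpy S T f g H"
  shows "htpy S T g f (\<lambda>z. H (1 - fst z, snd z))"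
proof -
  have "continuous_on ({0..1} \<times> S) (\<lambda>z. H (1 - fst z, snd z))"
    by (rule continuous_on_compose2[of "{0..1} \<times> S" H]) (use assms in \<open>auto simp: htpy_def intro!: continuous_intros\<close>)
  then show ?thesis using assms by (auto simp: htpy_def)
qed

lemma htpy_compose_left:
  assumes "htpy S T f g H" "continuous_on T k" "\<And>x. x \<in> T \<Longrightarrow> k x \<in> U"
  shows "htpy S U (k \<circ> f) (k \<circ> g) (k \<circ> H)"
proof -
  have "continuous_on ({0..1} \<times> S) (k \<circ> H)"
    by (rule continuous_on_compose[OF _ continuous_on_subset[OF assms(2)]]) (use assms in \<open>auto simp: htpy_def\<close>)
  then show ?thesis using assms by (auto simp: htpy_def)
qed

lemma htpy_compose_right:
  assumes "htpy S T f g H" "continuous_on R k" "\<And>x. x \<in> R \<Longrightarrow> k x \<in> S"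
  shows "htpy R T (f \<circ> k) (g \<circ> k) (\<lambda>z. H (fst z, k (snd z)))"
proof -
  have "continuous_on ({0..1} \<times> R) (\<lambda>z. H (fst z, k (snd z)))"
    by (rule continuous_on_compose2[of "{0..1} \<times> S" H])
      (use assms in \<open>auto simp: htpy_def intro!: continuous_intros continuous_on_compose2[OF assms(2)]\<close>)
  then show ?thesis using assms by (auto simp: htpy_def)
qed

lemma htpy_track_path:
  assumes "htpy S T f g H" "x \<in> S"
  shows "path (\<lambda>t. H (t,x))" "path_image (\<lambda>t. H (t,x)) \<subseteq> T" "pathstart (\<lambda>t. H (t,x)) = f x" "pathfinish (\<lambda>t. H (t,x)) = g x"
proof -
  have "continuous_on {0..1} (\<lambda>t. H (t,x))"
    by (rule continuous_on_compose2[of "{0..1} \<times> S" H]) (use assms in \<open>auto simp: htpy_def intro!: continuous_intros\<close>)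
  then show "path (\<lambda>t. H (t,x))" by (simp add: path_def)
qed (use assms in \<open>auto simp: htpy_def path_image_def pathstart_def pathfinish_def\<close>)

lemma htpy_homotopic_with:
  assumes "htpy S T f g H"
  shows "homotopic_with (\<lambda>_. True) (top_of_set S) (top_of_set T) f g"
  by (rule homotopic_with_onI[of _ H]) (use assms in \<open>auto simp: htpy_def\<close>)

lemma homotopic_with_htpy:
  assumes "homotopic_with P (top_of_set S) (top_of_set T) f g"
  obtains H where "htpy S T f g H" "\<And>t. t \<in> {0..1} \<Longrightarrow> P (\<lambda>x. H (t,x))"
proof -
  obtain h where h: "continuous_map (prod_topology (top_of_set {0..1::real}) (top_of_set S)) (top_of_set T) h"
    "\<forall>x. h (0, x) = f x" "\<forall>x. h (1, x) = g x" "\<forall>t\<in>{0..1}. P (\<lambda>x. h (t, x))"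
    using assms unfolding homotopic_with_def by blast
  then have "htpy S T f g h"
    by (auto simp: htpy_def)
  then show ?thesis using h by (intro that) auto
qed

lemma homotopic_paths_htpy:
  assumes "homotopic_paths S p q"
  obtains H where "htpy {0..1} S p q H" "\<And>t. t \<in> {0..1} \<Longrightarrow> H (t,0) = pathstart p \<and> H (t,1) = pathfinish p"
  using assms unfolding homotopic_paths_def
  by (elim homotopic_with_htpy) (auto simp: pathstart_def pathfinish_def)

lemma htpy_homotopic_paths:
  assumes "htpy {0..1} S p q H" "\<And>t. t \<in> {0..1} \<Longrightarrow> H (t,0) = p 0 \<and> H (t,1) = p 1"
  shows "homotopic_paths S p q"
  unfolding homotopic_paths
  by (rule exI[of _ H]) (use assms in \<open>auto simp: htpy_def pathstart_def pathfinish_def\<close>)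

text \<open>At time \<open>t\<close> walk along the side up to \<open>t\<close>, cross the square,
  and walk back. The ends stay fixed; at time 0 this is \<open>p\<close> up to constant pieces, at
  time 1 it is the conjugate of \<open>q\<close>.\<close>

lemma square_homotopic_conj:
  assumes H: "htpy {0..1} S p q H" and sides: "\<And>t. t \<in> {0..1} \<Longrightarrow> H (t,1) = H (t,0)"
  shows "homotopic_paths S p (conj_path (\<lambda>t. H (t,0)) q (\<lambda>t. H (t,0)))"
proof -
  let ?g = "\<lambda>t. H (t,0)"
  have g: "path ?g" "path_image ?g \<subseteq> S" "pathstart ?g = p 0" "pathfinish ?g = q 0"
    using htpy_track_path[OF H, of 0] by auto
  have Hc: "continuous_on ({0..1} \<times> {0..1}) H" using H by (simp add: htpy_def)
  have pq: "p 1 = p 0" "q 1 = q 0" using H sides[of 0] sides[of 1] by (auto simp: htpy_def)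
  have p: "path p" "path_image p \<subseteq> S"
  proof -
    have "continuous_on {0..1} (\<lambda>s. H (0,s))"
      by (rule continuous_on_compose2[OF Hc]) (auto intro!: continuous_intros)
    then show "path p" unfolding path_def by (rule continuous_on_eq) (use H in \<open>auto simp: htpy_def\<close>)
    have "p s \<in> S" if "s \<in> {0..1}" for s
      using H that by (simp add: htpy_def) (metis atLeastAtMost_iff order_refl zero_le_one)
    then show "path_image p \<subseteq> S" by (auto simp: path_image_def)
  qed
  define M where "M t = portion 0 t ?g +++ ((\<lambda>s. H (t,s)) +++ portion t 0 ?g)" for t
  have Mc: "continuous_on ({0..1} \<times> {0..1}) (\<lambda>y. M (fst y) (snd y))"
    unfolding M_def
  proof (intro continuous_on_homotopic_join_lemma)
    show "continuous_on ({0..1} \<times> {0..1}) (\<lambda>y. portion 0 (fst y) ?g (snd y))"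
      "continuous_on ({0..1} \<times> {0..1}) (\<lambda>y. portion (fst y) 0 ?g (snd y))"
      using continuous_portion_family[OF g(1), of "\<lambda>_. 0" "\<lambda>t. t"] continuous_portion_family[OF g(1), of "\<lambda>t. t" "\<lambda>_. 0"]
      by simp_all
    show "continuous_on ({0..1} \<times> {0..1}) (\<lambda>y. H (fst y, snd y))"
      using Hc by simp
  qed (use sides in \<open>auto simp: pathstart_def pathfinish_def portion_def joinpaths_def\<close>)
  have MS: "M t s \<in> S" if "t \<in> {0..1}" "s \<in> {0..1}" for t s
  proof -
    have "path_image (M t) \<subseteq> S"
    proof -
      have "path_image (portion 0 t ?g) \<subseteq> S" "path_image (portion t 0 ?g) \<subseteq> S"
        using path_image_portion[of 0 t ?g] path_image_portion[of t 0 ?g] g that by auto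
      moreover have "path_image (\<lambda>s. H (t,s)) \<subseteq> S"
        using H that by (auto simp: htpy_def path_image_def)
      ultimately show ?thesis
        unfolding M_def by (intro order_trans[OF path_image_join_subset] Un_least)
    qed
    then show ?thesis using that by (auto simp: path_image_def)
  qed
  have M: "htpy {0..1} S (M 0) (M 1) (\<lambda>y. M (fst y) (snd y))"
    unfolding htpy_def using Mc MS by auto
  have ends: "M t 0 = p 0 \<and> M t 1 = p 0" for t
    using g(3) by (auto simp: M_def joinpaths_def portion_def pathstart_def)
  have M1: "M 1 = conj_path ?g (\<lambda>s. H (1,s)) ?g"
    unfolding M_def by simp
  have q: "M 1 s = conj_path ?g q ?g s" if "s \<in> {0..1}" for s
    unfolding M1 using H that by (auto simp: joinpaths_def htpy_def)
  have M0: "M 0 s = conj_path (\<lambda>_. p 0) p (\<lambda>_. p 0) s" if "s \<in> {0..1}" for s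
    unfolding M_def using H that g(3) by (auto simp: joinpaths_def htpy_def portion_def reversepath_def pathstart_def)
  have "homotopic_paths S (M 0) (M 1)"
    by (rule htpy_homotopic_paths[OF M]) (use ends in auto)
  moreover have "homotopic_paths S (M 1) (conj_path ?g q ?g)"
    by (rule homotopic_paths_eq) (use calculation q homotopic_paths_imp_path homotopic_paths_imp_subset in \<open>blast+\<close>)
  moreover have "homotopic_paths S (M 0) (conj_path (\<lambda>_. p 0) p (\<lambda>_. p 0))"
    by (rule homotopic_paths_eq) (use calculation M0 homotopic_paths_imp_path homotopic_paths_imp_subset in \<open>blast+\<close>)
  moreover have "homotopic_paths S (conj_path (\<lambda>_. p 0) p (\<lambda>_. p 0)) p"
    by (rule homotopic_conj_const) (use p pq in \<open>auto simp: pathstart_def pathfinish_def\<close>)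
  ultimately show ?thesis
    by (meson homotopic_paths_sym homotopic_paths_trans)
qed

text \<open>The converse of \<open>square_homotopic_conj\<close>. The sides are \<open>g\<close>
  with a pause before and after, because three homotopies are joined: one with fixed ends, one that
  shortens the tails, and one that removes the remaining constant tails.\<close>

lemma homotopic_conj_square:
  assumes hom: "homotopic_paths S p (conj_path g q g)" and g: "path g" "path_image g \<subseteq> S"
    and q: "path q" "path_image q \<subseteq> S" "pathstart q = pathfinish g" "pathfinish q = pathfinish g"
  obtains H where "htpy {0..1} S p q H"
    "\<And>t s. s = 0 \<or> s = 1 \<Longrightarrow> t \<in> {0..1} \<Longrightarrow> H (t,s) = (((\<lambda>_. pathstart g) +++ g) +++ (\<lambda>_. pathfinish g)) t"
proof -
  obtain H1 where H1: "htpy {0..1} S p (conj_path g q g) H1"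
      "\<And>t. t \<in> {0..1} \<Longrightarrow> H1 (t,0) = pathstart p \<and> H1 (t,1) = pathfinish p"
    using homotopic_paths_htpy[OF hom] by blast
  have pe: "pathstart p = pathstart g" "pathfinish p = pathstart g"
    using homotopic_paths_imp_pathstart[OF hom] homotopic_paths_imp_pathfinish[OF hom] by auto
  define M where "M t = portion t 1 g +++ (q +++ portion 1 t g)" for t
  have qc: "continuous_on ({0..1::real} \<times> {0..1}) (\<lambda>y. q (snd y))"
    by (rule continuous_on_compose2[of "{0..1}" q]) (use q in \<open>auto simp: path_def intro!: continuous_intros\<close>)
  have Mc: "continuous_on ({0..1} \<times> {0..1}) (\<lambda>y. M (fst y) (snd y))"
    unfolding M_def
  proof (intro continuous_on_homotopic_join_lemma qc)
    show "continuous_on ({0..1} \<times> {0..1}) (\<lambda>y. portion (fst y) 1 g (snd y))"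
      "continuous_on ({0..1} \<times> {0..1}) (\<lambda>y. portion 1 (fst y) g (snd y))"
      using continuous_portion_family[OF g(1), of "\<lambda>_. 1" "\<lambda>t. t"] continuous_portion_family[OF g(1), of "\<lambda>t. t" "\<lambda>_. 1"]
      by simp_all
  qed (use q in \<open>auto simp: pathstart_def pathfinish_def portion_def joinpaths_def\<close>)
  have MS: "M t s \<in> S" if "t \<in> {0..1}" "s \<in> {0..1}" for t s
  proof -
    have "path_image (portion 1 t g) \<subseteq> S" "path_image (portion t 1 g) \<subseteq> S"
      using path_image_portion[of 1 t g] path_image_portion[of t 1 g] g that by auto
    then have "path_image (M t) \<subseteq> S"
      unfolding M_def by (intro order_trans[OF path_image_join_subset] Un_least q(2))
    then show ?thesis using that by (auto simp: path_image_def)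
  qed
  have M0: "M 0 = conj_path g q g"
    unfolding M_def by simp
  have M: "htpy {0..1} S (conj_path g q g) (M 1) (\<lambda>y. M (fst y) (snd y))"
    unfolding htpy_def using Mc MS M0 by auto
  have Me: "M t 0 = g t" "M t 1 = g t" for t
    by (auto simp: M_def joinpaths_def portion_def)
  have "M 1 = conj_path (\<lambda>_. pathfinish g) q (\<lambda>_. pathfinish g)"
    unfolding M_def by (auto simp: portion_def fun_eq_iff joinpaths_def reversepath_def pathfinish_def)
  then have "homotopic_paths S (M 1) q"
    using homotopic_conj_const[OF q] by simp
  then obtain H2 where H2: "htpy {0..1} S (M 1) q H2"
      "\<And>t. t \<in> {0..1} \<Longrightarrow> H2 (t,0) = pathstart (M 1) \<and> H2 (t,1) = pathfinish (M 1)"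
    using homotopic_paths_htpy by blast
  let ?H = "htpy_join (htpy_join H1 (\<lambda>y. M (fst y) (snd y))) H2"
  show ?thesis
  proof (rule that)
    show "htpy {0..1} S p q ?H"
      by (rule htpy_join[OF htpy_join[OF H1(1) M] H2(1)])
    show "?H (t,s) = (((\<lambda>_. pathstart g) +++ g) +++ (\<lambda>_. pathfinish g)) t" if "s = 0 \<or> s = 1" "t \<in> {0..1}" for t s
      using that H1(2) H2(2) pe Me unfolding htpy_join_def joinpaths_def
      by (auto simp: pathstart_def pathfinish_def)
  qed
qed

lemma homotopic_const_const:
  assumes "path g" "path_image g \<subseteq> S"
  shows "homotopic_paths S (((\<lambda>_. pathstart g) +++ g) +++ (\<lambda>_. pathfinish g)) g"
proof -
  have s: "pathstart g \<in> S" "pathfinish g \<in> S" using assms by auto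
  have "homotopic_paths S (((\<lambda>_. pathstart g) +++ g) +++ (\<lambda>_. pathfinish g)) ((\<lambda>_. pathstart g) +++ g)"
    using homotopic_paths_const_right[of "(\<lambda>_. pathstart g) +++ g" S "pathfinish g"] assms s
    by (simp add: path_image_join)
  moreover have "homotopic_paths S ((\<lambda>_. pathstart g) +++ g) g"
    using homotopic_paths_const_left[OF assms] by simp
  ultimately show ?thesis by (rule homotopic_paths_trans)
qed

section \<open>The fundamental group\<close>

definition loops_at :: "'a::topological_space set \<Rightarrow> 'a \<Rightarrow> (real \<Rightarrow> 'a) set" where
  "loops_at S x = {p. path p \<and> path_image p \<subseteq> S \<and> pathstart p = x \<and> pathfinish p = x}"

definition hclass :: "'a::topological_space set \<Rightarrow> (real \<Rightarrow> 'a) \<Rightarrow> (real \<Rightarrow> 'a) set" where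
  "hclass S p = {q. homotopic_paths S p q}"

definition pi1 :: "'a::topological_space set \<Rightarrow> 'a \<Rightarrow> (real \<Rightarrow> 'a) set monoid" where
  "pi1 S x = \<lparr>carrier = hclass S ` loops_at S x,
     monoid.mult = (\<lambda>A B. {r. \<exists>p\<in>A. \<exists>q\<in>B. homotopic_paths S (p +++ q) r}), one = hclass S (\<lambda>_. x)\<rparr>"

lemma loops_atD:
  assumes "p \<in> loops_at S x"
  shows "path p" "path_image p \<subseteq> S" "pathstart p = x" "pathfinish p = x"
  using assms by (auto simp: loops_at_def)

lemma loops_at_join [simp]: "p \<in> loops_at S x \<Longrightarrow> q \<in> loops_at S x \<Longrightarrow> p +++ q \<in> loops_at S x"
  by (auto simp: loops_at_def path_image_join)

lemma loops_at_reverse [simp]: "p \<in> loops_at S x \<Longrightarrow> reversepath p \<in> loops_at S x"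
  by (auto simp: loops_at_def)

lemma loops_at_const [simp]: "x \<in> S \<Longrightarrow> (\<lambda>_. x) \<in> loops_at S x"
  by (auto simp: loops_at_def)

lemma hclass_eqI: "homotopic_paths S p q \<Longrightarrow> hclass S p = hclass S q"
  by (auto simp: hclass_def intro: homotopic_paths_trans homotopic_paths_sym)

lemma hclass_eq_iff: "p \<in> loops_at S x \<Longrightarrow> hclass S p = hclass S q \<longleftrightarrow> homotopic_paths S p q"
proof
  assume p: "p \<in> loops_at S x" and "hclass S p = hclass S q"
  moreover have "p \<in> hclass S p" using p by (simp add: hclass_def loops_at_def)
  ultimately show "homotopic_paths S p q"
    by (auto simp: hclass_def intro: homotopic_paths_sym)
qed (rule hclass_eqI)

lemma pi1_carrier: "A \<in> carrier (pi1 S x) \<longleftrightarrow> (\<exists>p\<in>loops_at S x. A = hclass S p)"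
  by (auto simp: pi1_def)

lemma pi1_hclass [simp]: "p \<in> loops_at S x \<Longrightarrow> hclass S p \<in> carrier (pi1 S x)"
  by (auto simp: pi1_def)

lemma pi1_mult:
  assumes "p \<in> loops_at S x" "q \<in> loops_at S x"
  shows "hclass S p \<otimes>\<^bsub>pi1 S x\<^esub> hclass S q = hclass S (p +++ q)"
proof -
  have "homotopic_paths S (p +++ q) r" if "homotopic_paths S p p'" "homotopic_paths S q q'" "homotopic_paths S (p' +++ q') r" for p' q' r
    using homotopic_paths_join[OF that(1,2)] that(3) assms by (auto simp: loops_at_def intro: homotopic_paths_trans)
  moreover have "homotopic_paths S p p" "homotopic_paths S q q"
    using assms by (auto simp: loops_at_def)
  ultimately show ?thesis
    by (simp add: pi1_def hclass_def del: homotopic_paths_refl) blast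
qed

lemma pi1_one: "\<one>\<^bsub>pi1 S x\<^esub> = hclass S (\<lambda>_. x)"
  by (simp add: pi1_def)

lemma pi1_group:
  assumes "x \<in> S"
  shows "group (pi1 S x)"
proof (rule groupI)
  fix A B D assume "A \<in> carrier (pi1 S x)" "B \<in> carrier (pi1 S x)" "D \<in> carrier (pi1 S x)"
  then obtain p q r where *: "p \<in> loops_at S x" "q \<in> loops_at S x" "r \<in> loops_at S x"
    "A = hclass S p" "B = hclass S q" "D = hclass S r"
    by (auto simp: pi1_carrier)
  show "A \<otimes>\<^bsub>pi1 S x\<^esub> B \<in> carrier (pi1 S x)"
    using * by (simp add: pi1_mult)
  have "homotopic_paths S (p +++ (q +++ r)) ((p +++ q) +++ r)"
    using *(1-3) by (intro homotopic_paths_assoc) (auto simp: loops_at_def)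
  then show "A \<otimes>\<^bsub>pi1 S x\<^esub> B \<otimes>\<^bsub>pi1 S x\<^esub> D = A \<otimes>\<^bsub>pi1 S x\<^esub> (B \<otimes>\<^bsub>pi1 S x\<^esub> D)"
    using * by (auto simp: pi1_mult intro!: hclass_eqI homotopic_paths_sym)
next
  fix A assume "A \<in> carrier (pi1 S x)"
  then obtain p where p: "p \<in> loops_at S x" "A = hclass S p"
    by (auto simp: pi1_carrier)
  show "\<one>\<^bsub>pi1 S x\<^esub> \<otimes>\<^bsub>pi1 S x\<^esub> A = A"
    using homotopic_paths_const_left[of p S] p assms
    by (auto simp: pi1_one pi1_mult loops_atD intro!: hclass_eqI)
  show "\<exists>B\<in>carrier (pi1 S x). B \<otimes>\<^bsub>pi1 S x\<^esub> A = \<one>\<^bsub>pi1 S x\<^esub>"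
    using homotopic_paths_inverse_left[of p S] p
    by (intro bexI[of _ "hclass S (reversepath p)"])
      (auto simp: pi1_one pi1_mult loops_atD intro!: hclass_eqI)
qed (use assms in \<open>auto simp: pi1_one\<close>)

lemma pi1_inv:
  assumes "x \<in> S" "p \<in> loops_at S x"
  shows "inv\<^bsub>pi1 S x\<^esub> (hclass S p) = hclass S (reversepath p)"
proof -
  interpret group "pi1 S x" using assms by (intro pi1_group)
  show ?thesis
    using homotopic_paths_inverse_left[of p S] assms
    by (intro inv_equality) (auto simp: pi1_one pi1_mult loops_atD intro!: hclass_eqI)
qed

text \<open>\<open>h\<close> may move the base point, so the induced map needs a path
  \<open>b\<close> from \<open>x\<close> to \<open>h x\<close>. Two such paths \<open>b\<close> and
  \<open>c\<close> give maps that differ by conjugation with the loop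
  \<open>b +++ reversepath c\<close>; varying \<open>b\<close> thus stays in one outer
  class.\<close>

definition pi1_map :: "'a::topological_space set \<Rightarrow> 'a \<Rightarrow> ('a \<Rightarrow> 'a) \<Rightarrow> (real \<Rightarrow> 'a) \<Rightarrow> (real \<Rightarrow> 'a) set \<Rightarrow> (real \<Rightarrow> 'a) set" where
  "pi1_map S x h b A = {q. \<exists>p\<in>A. homotopic_paths S (conj_path b (h \<circ> p) b) q}"

definition path_from_to :: "'a::topological_space set \<Rightarrow> 'a \<Rightarrow> 'a \<Rightarrow> (real \<Rightarrow> 'a) \<Rightarrow> bool" where
  "path_from_to S x y b \<longleftrightarrow> path b \<and> path_image b \<subseteq> S \<and> pathstart b = x \<and> pathfinish b = y"

lemma conj_path_loop:
  assumes "path_from_to S x y b" "w \<in> loops_at S y"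
  shows "conj_path b w b \<in> loops_at S x"
  using assms by (auto simp: path_from_to_def loops_at_def path_image_join)

lemma loop_image:
  assumes "continuous_on S h" "h ` S \<subseteq> T" "p \<in> loops_at S x"
  shows "h \<circ> p \<in> loops_at T (h x)"
  using assms unfolding loops_at_def
  by (auto simp: path_image_compose pathstart_compose pathfinish_compose
      intro!: path_continuous_image intro: continuous_on_subset)

lemma path_from_to_image:
  assumes "continuous_on S h" "h ` S \<subseteq> T" "path_from_to S x y b"
  shows "path_from_to T (h x) (h y) (h \<circ> b)"
  using assms unfolding path_from_to_def
  by (auto simp: path_image_compose pathstart_compose pathfinish_compose
      intro!: path_continuous_image intro: continuous_on_subset)

lemma path_from_to_join: "path_from_to S x y b \<Longrightarrow> path_from_to S y z c \<Longrightarrow> path_from_to S x z (b +++ c)"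
  by (auto simp: path_from_to_def path_image_join)

lemma path_from_to_reverse: "path_from_to S x y b \<Longrightarrow> path_from_to S y x (reversepath b)"
  by (auto simp: path_from_to_def)

lemma path_from_to_loop: "path_from_to S x x b \<longleftrightarrow> b \<in> loops_at S x"
  by (auto simp: path_from_to_def loops_at_def)

context
  fixes S :: "'a::topological_space set" and x :: 'a
  assumes x: "x \<in> S"
begin

lemma pi1_map_hclass:
  assumes h: "continuous_on S h" "h ` S \<subseteq> S" and b: "path_from_to S x (h x) b" and p: "p \<in> loops_at S x"
  shows "pi1_map S x h b (hclass S p) = hclass S (conj_path b (h \<circ> p) b)"
proof -
  have "homotopic_paths S (conj_path b (h \<circ> p) b) (conj_path b (h \<circ> p') b)" if "homotopic_paths S p p'" for p'
  proof (rule homotopic_conj_cong)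
    show "homotopic_paths S (h \<circ> p) (h \<circ> p')"
      by (rule homotopic_paths_continuous_image[OF that h(1)]) (use h in auto)
  qed (use b loop_image[OF h p] in \<open>auto simp: path_from_to_def loops_at_def\<close>)
  moreover have "homotopic_paths S p p" using p by (auto simp: loops_at_def)
  ultimately show ?thesis
    unfolding pi1_map_def hclass_def by (blast intro: homotopic_paths_trans)
qed

lemma pi1_map_hom:
  assumes h: "continuous_on S h" "h ` S \<subseteq> S" and b: "path_from_to S x (h x) b"
  shows "pi1_map S x h b \<in> hom (pi1 S x) (pi1 S x)"
proof (rule homI)
  fix A assume "A \<in> carrier (pi1 S x)"
  then show "pi1_map S x h b A \<in> carrier (pi1 S x)"
    using conj_path_loop[OF b loop_image[OF h]] by (auto simp: pi1_carrier pi1_map_hclass[OF h b])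
next
  fix A B assume "A \<in> carrier (pi1 S x)" "B \<in> carrier (pi1 S x)"
  then obtain p q where pq: "p \<in> loops_at S x" "q \<in> loops_at S x" "A = hclass S p" "B = hclass S q"
    by (auto simp: pi1_carrier)
  note hp = loop_image[OF h pq(1)] and hq = loop_image[OF h pq(2)]
  have "homotopic_paths S (conj_path b (h \<circ> p) b +++ conj_path b (h \<circ> q) b) (conj_path b ((h \<circ> p) +++ (h \<circ> q)) b)"
    by (rule homotopic_conj_join) (use b loops_atD[OF hp] loops_atD[OF hq] in \<open>auto simp: path_from_to_def\<close>)
  then show "pi1_map S x h b (A \<otimes>\<^bsub>pi1 S x\<^esub> B) = pi1_map S x h b A \<otimes>\<^bsub>pi1 S x\<^esub> pi1_map S x h b B"
    using pq conj_path_loop[OF b hp] conj_path_loop[OF b hq]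
    by (simp add: pi1_mult pi1_map_hclass[OF h b] path_compose_join hclass_eqI)
qed

lemma pi1_map_compose:
  assumes h: "continuous_on S h" "h ` S \<subseteq> S" and b: "path_from_to S x (h x) b"
    and h': "continuous_on S h'" "h' ` S \<subseteq> S" and b': "path_from_to S x (h' x) b'"
    and A: "A \<in> carrier (pi1 S x)"
  shows "pi1_map S x (h' \<circ> h) (b' +++ (h' \<circ> b)) A = pi1_map S x h' b' (pi1_map S x h b A)"
proof -
  obtain p where p: "p \<in> loops_at S x" "A = hclass S p"
    using A by (auto simp: pi1_carrier)
  note hp = loop_image[OF h p(1)]
  have hh: "continuous_on S (h' \<circ> h)" "(h' \<circ> h) ` S \<subseteq> S"
    using h h' continuous_on_compose[OF h(1) continuous_on_subset[OF h'(1) h(2)]] by auto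
  have c: "path_from_to S x ((h' \<circ> h) x) (b' +++ (h' \<circ> b))"
    using path_from_to_join[OF b' path_from_to_image[OF h' b]] by simp
  have "homotopic_paths S (conj_path b' (conj_path (h' \<circ> b) (h' \<circ> (h \<circ> p)) (h' \<circ> b)) b')
     (conj_path (b' +++ (h' \<circ> b)) (h' \<circ> (h \<circ> p)) (b' +++ (h' \<circ> b)))"
    by (rule homotopic_conj_conj)
      (use b' path_from_to_image[OF h' b] loops_atD[OF loop_image[OF h' hp]] in \<open>auto simp: path_from_to_def\<close>)
  then show ?thesis
    unfolding p(2) pi1_map_hclass[OF h b p(1)] pi1_map_hclass[OF h' b' conj_path_loop[OF b hp]] pi1_map_hclass[OF hh c p(1)]
    by (simp only: path_compose_join path_compose_reversepath comp_assoc hclass_eqI)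
qed

lemma pi1_map_change:
  assumes h: "continuous_on S h" "h ` S \<subseteq> S" and b: "path_from_to S x (h x) b" and c: "path_from_to S x (h x) c"
    and A: "A \<in> carrier (pi1 S x)"
  defines "g \<equiv> hclass S (b +++ reversepath c)"
  shows "pi1_map S x h b A = g \<otimes>\<^bsub>pi1 S x\<^esub> pi1_map S x h c A \<otimes>\<^bsub>pi1 S x\<^esub> inv\<^bsub>pi1 S x\<^esub> g"
proof -
  interpret group "pi1 S x" using x by (rule pi1_group)
  obtain p where p: "p \<in> loops_at S x" "A = hclass S p"
    using A by (auto simp: pi1_carrier)
  note hp = loop_image[OF h p(1)]
  have bc: "b +++ reversepath c \<in> loops_at S x"
    using path_from_to_join[OF b path_from_to_reverse[OF c]] by (simp add: path_from_to_loop)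
  have "homotopic_paths S (conj_path b (h \<circ> p) b) (conj_path (b +++ reversepath c) (conj_path c (h \<circ> p) c) (b +++ reversepath c))"
    by (rule homotopic_conj_change) (use b c loops_atD[OF hp] in \<open>auto simp: path_from_to_def\<close>)
  then have "pi1_map S x h b A = hclass S (conj_path (b +++ reversepath c) (conj_path c (h \<circ> p) c) (b +++ reversepath c))"
    unfolding p(2) pi1_map_hclass[OF h b p(1)] by (rule hclass_eqI)
  also have "\<dots> = g \<otimes>\<^bsub>pi1 S x\<^esub> (pi1_map S x h c A \<otimes>\<^bsub>pi1 S x\<^esub> inv\<^bsub>pi1 S x\<^esub> g)"
    unfolding p(2) pi1_map_hclass[OF h c p(1)] g_def pi1_inv[OF x bc]
    by (subst pi1_mult, use bc conj_path_loop[OF c hp] in simp_all)+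
  finally show ?thesis
    using bc conj_path_loop[OF c hp] by (simp add: m_assoc g_def p(2) pi1_map_hclass[OF h c p(1)])
qed

text \<open>Over each loop the homotopy is a square whose side is the track of the base point;
  appending the track to the tail absorbs the resulting conjugation. With matched tails, freely
  homotopic maps therefore induce equal homomorphisms, not merely equal outer classes.\<close>

lemma pi1_map_homotopy:
  assumes h: "continuous_on S h" "h ` S \<subseteq> S" and b: "path_from_to S x (h x) b"
    and h': "continuous_on S h'" "h' ` S \<subseteq> S" and H: "htpy S S h h' H" and A: "A \<in> carrier (pi1 S x)"
  shows "pi1_map S x h' (b +++ (\<lambda>t. H (t,x))) A = pi1_map S x h b A"
proof -
  obtain p where p: "p \<in> loops_at S x" "A = hclass S p"
    using A by (auto simp: pi1_carrier)
  note hp = loops_atD[OF loop_image[OF h p(1)]] and hp' = loops_atD[OF loop_image[OF h' p(1)]]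
  note T = htpy_track_path[OF H x]
  let ?t = "\<lambda>t. H (t,x)"
  have bt: "path_from_to S x (h' x) (b +++ ?t)"
    by (rule path_from_to_join[OF b]) (use T in \<open>auto simp: path_from_to_def\<close>)
  have pc: "continuous_on {0..1} p" "\<And>s. s \<in> {0..1} \<Longrightarrow> p s \<in> S" "p 0 = x" "p 1 = x"
    using loops_atD[OF p(1)] by (auto simp: path_def path_image_def pathstart_def pathfinish_def)
  have "homotopic_paths S (h \<circ> p) (conj_path (\<lambda>t. (\<lambda>z. H (fst z, p (snd z))) (t,0)) (h' \<circ> p) (\<lambda>t. (\<lambda>z. H (fst z, p (snd z))) (t,0)))"
    by (rule square_homotopic_conj[OF htpy_compose_right[OF H pc(1,2)]]) (use pc in auto)
  then have "homotopic_paths S (h \<circ> p) (conj_path ?t (h' \<circ> p) ?t)"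
    by (simp add: pc)
  then have "homotopic_paths S (conj_path b (h \<circ> p) b) (conj_path b (conj_path ?t (h' \<circ> p) ?t) b)"
    by (rule homotopic_conj_cong) (use b hp in \<open>auto simp: path_from_to_def\<close>)
  also have "homotopic_paths S \<dots> (conj_path (b +++ ?t) (h' \<circ> p) (b +++ ?t))"
    by (rule homotopic_conj_conj) (use b hp' T in \<open>auto simp: path_from_to_def\<close>)
  finally show ?thesis
    unfolding p(2) pi1_map_hclass[OF h b p(1)] pi1_map_hclass[OF h' bt p(1)]
    by (rule hclass_eqI[symmetric])
qed

lemma pi1_map_id:
  assumes b: "b \<in> loops_at S x" and A: "A \<in> carrier (pi1 S x)"
  shows "pi1_map S x id b A = hclass S b \<otimes>\<^bsub>pi1 S x\<^esub> A \<otimes>\<^bsub>pi1 S x\<^esub> inv\<^bsub>pi1 S x\<^esub> (hclass S b)"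
proof -
  interpret group "pi1 S x" using x by (rule pi1_group)
  obtain p where p: "p \<in> loops_at S x" "A = hclass S p"
    using A by (auto simp: pi1_carrier)
  have "pi1_map S x id b A = hclass S (conj_path b p b)"
    unfolding p(2) by (subst pi1_map_hclass) (use b p in \<open>auto simp: path_from_to_loop\<close>)
  also have "\<dots> = hclass S b \<otimes>\<^bsub>pi1 S x\<^esub> (A \<otimes>\<^bsub>pi1 S x\<^esub> inv\<^bsub>pi1 S x\<^esub> (hclass S b))"
    unfolding p(2) pi1_inv[OF x b] by (subst pi1_mult, use b p in simp_all)+
  finally show ?thesis using b p by (simp add: m_assoc)
qed

end

section \<open>Handles of a graph\<close>

definition core :: "'a set \<Rightarrow> nat \<Rightarrow> (nat \<Rightarrow> real \<Rightarrow> 'a) \<Rightarrow> 'a set" where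
  "core X n ed = X - (\<Union>k<n. ed k ` {1/3<..<2/3})"

text \<open>A graph of genus \<open>n\<close> with handles \<open>ed k\<close>; the map \<open>K\<close> contracts the complement of their middle
  thirds.\<close>

locale graph_handles =
  fixes X :: "'a::topological_space set" and v0 :: 'a and n :: nat and ed :: "nat \<Rightarrow> real \<Rightarrow> 'a"
    and K :: "real \<times> 'a \<Rightarrow> 'a"
  assumes lpc: "locally path_connected X" and pc: "path_connected X" and v0_core: "v0 \<in> core X n ed"
    and ed_cont: "k < n \<Longrightarrow> continuous_on {0..1} (ed k)" and ed_in: "k < n \<Longrightarrow> t \<in> {0..1} \<Longrightarrow> ed k t \<in> X"
    and ed_open: "k < n \<Longrightarrow> open U \<Longrightarrow> U \<subseteq> {0<..<1} \<Longrightarrow> openin (top_of_set X) (ed k ` U)"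
    and ed_closed: "k < n \<Longrightarrow> closed D \<Longrightarrow> D \<subseteq> {0<..<1} \<Longrightarrow> closedin (top_of_set X) (ed k ` D)"
    and ed_inj: "j < n \<Longrightarrow> k < n \<Longrightarrow> s \<in> {0<..<1} \<Longrightarrow> t \<in> {0..1} \<Longrightarrow> ed j s = ed k t \<Longrightarrow> j = k \<and> s = t"
    and K_cont: "continuous_on ({0..1} \<times> X) K" and K_in: "t \<in> {0..1} \<Longrightarrow> x \<in> X \<Longrightarrow> K (t,x) \<in> X"
    and K_0: "x \<in> X \<Longrightarrow> K (0,x) = x" and K_v0: "t \<in> {0..1} \<Longrightarrow> K (t,v0) = v0"
    and K_core: "t \<in> {0..1} \<Longrightarrow> x \<in> core X n ed \<Longrightarrow> K (t,x) \<in> core X n ed"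
    and K_1: "x \<in> core X n ed \<Longrightarrow> K (1,x) = v0"

lemma topological_graph_handles:
  fixes X :: "'a::topological_space set"
  assumes "topological_graph (top_of_set X)" and conn: "connected X" and genus: "has_genus (top_of_set X) n"
    and n: "n > 0"
  shows "\<exists>v0 ed K. graph_handles X v0 n ed K"
proof -
  obtain V E where "top_graph X V (E :: (real \<Rightarrow> 'a) set)"
    using assms(1) conn unfolding topological_graph_def top_graph_def by auto
  then interpret top_graph X V E .
  \<comment> \<open>The empty set counts as connected; it has trivial homology, so positive genus
    excludes it.\<close>
  have "X \<noteq> {}"
  proof
    assume "X = {}"
    then have "free_Abelian_group {..<n} \<cong> homology_group 1 (top_of_set X)" "trivial_group (homology_group 1 (top_of_set X))"
      using genus unfolding has_genus_def by (auto simp: trivial_homology_group_empty group.iso_sym)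
    then have "trivial_group (free_Abelian_group {..<n})"
      using isomorphic_group_triviality by (metis group_free_Abelian_group group_relative_homology_group)
    then have "frag_of (0::nat) = 0"
      using n frag_of_in_free_Abelian_group[of "0::nat" "{..<n}"] by (auto simp: trivial_group_def)
    then show False by simp
  qed
  then obtain v0 where v0: "v0 \<in> V"
    using ends bij_betw_imp_surj_on[OF bij] by fastforce
  obtain J and K :: "real \<times> 'a \<Rightarrow> 'a" where JK: "J \<subseteq> E" "continuous_on ({0..1} \<times> X) K" "\<And>t x. t \<in> {0..1} \<Longrightarrow> x \<in> X \<Longrightarrow> K (t,x) \<in> X"
    "\<And>x. x \<in> X \<Longrightarrow> K (0,x) = x" "\<And>t. t \<in> {0..1} \<Longrightarrow> K (t,v0) = v0"
    "\<And>t x. t \<in> {0..1} \<Longrightarrow> x \<in> X - edges J {1/3<..<2/3} \<Longrightarrow> K (t,x) \<in> X - edges J {1/3<..<2/3}"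
    "\<And>x. x \<in> X - edges J {1/3<..<2/3} \<Longrightarrow> K (1,x) = v0"
    by (rule collapse_exists[OF v0, folded edges_def]) (rule that; assumption)
  have J: "finite J" "card J = n"
    using genus_eq_card[OF JK(1) v0 JK(2,6,4,7) genus] by auto
  obtain ed where ed: "bij_betw ed {..<n} J"
    using ex_bij_betw_nat_finite[OF J(1)] J(2) by (auto simp: atLeast0LessThan)
  have edE: "ed k \<in> E" "ed k \<in> J" if "k < n" for k
    using bij_betwE[OF ed] that JK(1) by auto
  have core: "core X n ed = X - edges J {1/3<..<2/3}"
    using bij_betw_imp_surj_on[OF ed] unfolding core_def edges_def by blast
  have "graph_handles X v0 n ed K"
  proof
    show "locally path_connected X" by (rule locally_path_connected_graph)
    show "path_connected X"
      using conn path_component_eq_connected_component_set[OF locally_path_connected_graph]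
      unfolding path_connected_component_set by (metis connected_component_eq_self)
    show "v0 \<in> core X n ed"
      unfolding core using v0 V_sub edge_interior JK(1) by (fastforce elim!: edgesE)
    show "j = k \<and> s = t" if "j < n" "k < n" "s \<in> {0<..<1}" "t \<in> {0..1}" "ed j s = ed k t" for j k s t
    proof -
      have "ed j = ed k" "s = t"
        using edge_eqD[of "ed j" s "ed k" t] edE that by auto
      then show ?thesis
        using bij_betw_imp_inj_on[OF ed] that by (auto simp: inj_on_def)
    qed
  qed (use JK edE edge_continuous edge_in openin_edge_image closedin_edge_image core in auto)
  then show ?thesis by blast
qed

text \<open>The coordinate of the middle third of a handle, rescaled to the unit interval and frozen
  on the outer thirds.\<close>

definition clamp3 :: "real \<Rightarrow> real" where
  "clamp3 s = max 0 (min 1 (3 * s - 1))"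

lemma clamp3_in: "clamp3 s \<in> {0..1}"
  by (auto simp: clamp3_def)

text \<open>The parameters lie in a convex set of reals, so parameter paths with common ends are
  joined by a straight-line homotopy, which \<open>f\<close> carries to \<open>S\<close>.\<close>

lemma homotopic_paths_real_reparametrize:
  fixes f :: "real \<Rightarrow> 'a::topological_space"
  assumes f: "continuous_on I f" "f ` I \<subseteq> S" and I: "convex I"
    and u: "path u" "path_image u \<subseteq> I" and u': "path u'" "path_image u' \<subseteq> I"
    and e: "pathstart u = pathstart u'" "pathfinish u = pathfinish u'"
  shows "homotopic_paths S (f \<circ> u) (f \<circ> u')"
proof (rule homotopic_paths_continuous_image[OF _ f(1)])
  show "homotopic_paths I u u'"
  proof (rule homotopic_paths_linear[OF u(1) u'(1)])
    show "closed_segment (u t) (u' t) \<subseteq> I" if "t \<in> {0..1}" for t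
    proof (rule closed_segment_subset[OF _ _ I])
      show "u t \<in> I" "u' t \<in> I"
        using u(2) u'(2) that unfolding path_image_def by blast+
    qed
  qed (use e in auto)
qed (use f in auto)

lemma continuous_clamp3: "continuous_on A clamp3"
  unfolding clamp3_def by (intro continuous_intros)

section \<open>Maps and homotopies prescribed on the handles\<close>

context graph_handles
begin

lemma core_sub: "core X n ed \<subseteq> X" by (auto simp: core_def)

lemma v0_in: "v0 \<in> X" using v0_core core_sub by auto

lemma ed_core_iff:
  assumes k: "k < n" and t: "t \<in> {0..1}"
  shows "ed k t \<in> core X n ed \<longleftrightarrow> t \<notin> {1/3<..<2/3}"
proof -
  have "t \<in> {1/3<..<2/3}" if j: "j < n" "ed k t \<in> ed j ` {1/3<..<2/3}" for j
  proof -
    obtain s where s: "s \<in> {1/3<..<2/3}" "ed j s = ed k t" using j by fastforce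
    then have "s \<in> {0<..<1}" by auto
    then show ?thesis using ed_inj[OF j(1) k _ t s(2)] s by blast
  qed
  then show ?thesis
    using ed_in[OF k t] k unfolding core_def by blast
qed

lemma closedin_middles: "closedin (top_of_set X) (\<Union>k\<in>{..<n}. ed k ` {1/3..2/3})"
proof (intro closedin_Union)
  have iv: "{1/3..2/3} \<subseteq> {0<..<1::real}" by auto
  show "closedin (top_of_set X) S" if "S \<in> (\<lambda>k. ed k ` {1/3..2/3}) ` {..<n}" for S
    using that ed_closed[OF _ _ iv] by auto
qed auto

definition handle_at :: "'a \<Rightarrow> nat" where
  "handle_at x = (SOME k. k < n \<and> (\<exists>s\<in>{0<..<1}. x = ed k s))"

definition handle_coord :: "'a \<Rightarrow> real" where
  "handle_coord x = (SOME s. s \<in> {0<..<1} \<and> x = ed (handle_at x) s)"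

lemma handle_unique:
  assumes "k < n" "s \<in> {0<..<1}" "j < n" "t \<in> {0<..<1}" "ed k s = ed j t"
  shows "j = k \<and> t = s"
  using ed_inj[OF assms(1,3,2) _ assms(5)] assms(4) by auto

lemma handle_at: "k < n \<Longrightarrow> s \<in> {0<..<1} \<Longrightarrow> handle_at (ed k s) = k"
  unfolding handle_at_def by (rule some_equality) (use handle_unique in blast)+

lemma handle_coord: "k < n \<Longrightarrow> s \<in> {0<..<1} \<Longrightarrow> handle_coord (ed k s) = s"
proof -
  assume k: "k < n" and s: "s \<in> {0<..<1}"
  have "t = s" if "t \<in> {0<..<1} \<and> ed k s = ed k t" for t
    using handle_unique[OF k s k] that by blast
  then show ?thesis
    unfolding handle_coord_def handle_at[OF k s] using s by (intro some_equality) blast+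
qed

lemma continuous_handle_coord:
  assumes k: "k < n"
  shows "continuous_on (ed k ` {0<..<1}) handle_coord"
proof (subst continuous_openin_preimage_eq, intro allI impI)
  fix W :: "real set" assume W: "open W"
  have eq: "ed k ` {0<..<1} \<inter> handle_coord -` W = ed k ` (W \<inter> {0<..<1})"
    using handle_coord[OF k] by auto
  have "openin (top_of_set X) (ed k ` (W \<inter> {0<..<1}))"
    by (rule ed_open[OF k]) (use W in auto)
  then show "openin (top_of_set (ed k ` {0<..<1})) (ed k ` {0<..<1} \<inter> handle_coord -` W)"
    unfolding eq by (rule openin_subset_trans) (use ed_in[OF k] in auto)
qed

definition on_handle :: "'a \<Rightarrow> bool" where
  "on_handle x \<longleftrightarrow> (\<exists>k<n. \<exists>s\<in>{0<..<1}. x = ed k s)"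

text \<open>The collapse of the core to a point followed by maps \<open>w k\<close> on the resulting
  petals, with a time parameter. At time \<open>t\<close> the core goes to \<open>g t\<close>, and
  \<open>clamp3\<close> makes the outer thirds of a handle behave like the core.\<close>

definition wrap :: "(real \<Rightarrow> 'c) \<Rightarrow> (nat \<Rightarrow> real \<times> real \<Rightarrow> 'c) \<Rightarrow> real \<times> 'a \<Rightarrow> 'c" where
  "wrap g w z = (if on_handle (snd z)
     then w (handle_at (snd z)) (fst z, clamp3 (handle_coord (snd z))) else g (fst z))"

lemma ed_on_handle: "k < n \<Longrightarrow> s \<in> {0<..<1} \<Longrightarrow> on_handle (ed k s)"
  unfolding on_handle_def by blast

lemma wrap_handle: "k < n \<Longrightarrow> s \<in> {0<..<1} \<Longrightarrow> wrap g w (t, ed k s) = w k (t, clamp3 s)"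
  by (simp add: wrap_def ed_on_handle handle_at handle_coord)

lemma X_cases:
  assumes "x \<in> X"
  obtains "x \<in> core X n ed" | k s where "k < n" "s \<in> {1/3<..<2/3}" "x = ed k s"
  using assms unfolding core_def by blast

context
  fixes g :: "real \<Rightarrow> 'c::topological_space" and w :: "nat \<Rightarrow> real \<times> real \<Rightarrow> 'c" and T
  assumes g: "continuous_on {0..1} g" "\<And>t. t \<in> {0..1} \<Longrightarrow> g t \<in> T"
    and w: "\<And>k. k < n \<Longrightarrow> continuous_on ({0..1} \<times> {0..1}) (w k)"
      "\<And>k t s. k < n \<Longrightarrow> t \<in> {0..1} \<Longrightarrow> s \<in> {0..1} \<Longrightarrow> w k (t,s) \<in> T"
      "\<And>k t. k < n \<Longrightarrow> t \<in> {0..1} \<Longrightarrow> w k (t,0) = g t" "\<And>k t. k < n \<Longrightarrow> t \<in> {0..1} \<Longrightarrow> w k (t,1) = g t"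
begin

lemma wrap_core: "t \<in> {0..1} \<Longrightarrow> x \<in> core X n ed \<Longrightarrow> wrap g w (t,x) = g t"
proof (cases "on_handle x")
  case True
  assume t: "t \<in> {0..1}" and x: "x \<in> core X n ed"
  obtain k s where ks: "k < n" "s \<in> {0<..<1}" "x = ed k s" using True by (auto simp: on_handle_def)
  then have "s \<notin> {1/3<..<2/3}" using x ed_core_iff[of k s] by auto
  then have "clamp3 s = 0 \<or> clamp3 s = 1" by (auto simp: clamp3_def)
  then show ?thesis using w(3,4)[OF ks(1) t] ks(3) by (auto simp: wrap_handle[OF ks(1,2)])
qed (simp add: wrap_def)

lemma wrap_in: "t \<in> {0..1} \<Longrightarrow> x \<in> X \<Longrightarrow> wrap g w (t,x) \<in> T"
proof (erule X_cases)
  assume "t \<in> {0..1}" "x \<in> core X n ed"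
  then show "wrap g w (t,x) \<in> T" using g(2) by (simp only: wrap_core)
next
  fix k s assume t: "t \<in> {0..1}" and k: "k < n" and s: "s \<in> {1/3<..<2/3}" and x: "x = ed k s"
  from s have "s \<in> {0<..<1}" by auto
  then show "wrap g w (t,x) \<in> T"
    unfolding x using w(2)[OF k t clamp3_in] by (simp only: wrap_handle[OF k])
qed

lemma wrap_continuous: "continuous_on ({0..1} \<times> X) (wrap g w)"
proof (rule continuous_on_local)
  fix z :: "real \<times> 'a" assume z: "z \<in> {0..1} \<times> X"
  \<comment> \<open>\<open>X\<close> is covered by the complement of the closed middle thirds, where
    \<open>wrap\<close> depends on time alone, and by the open handles, where it is expressed
    through the handle coordinate.\<close>
  let ?U = "X - (\<Union>k<n. ed k ` {1/3..2/3})"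
  have oU: "openin (top_of_set X) ?U"
  proof -
    show ?thesis using closedin_middles by (simp add: closedin_def)
  qed
  show "\<exists>U. openin (top_of_set ({0..1} \<times> X)) U \<and> z \<in> U \<and> continuous_on U (wrap g w)"
  proof (cases "snd z \<in> ?U")
    case True
    have "?U \<subseteq> core X n ed"
      unfolding core_def by fastforce
    then have "g (fst z) = wrap g w z" if "z \<in> {0..1} \<times> ?U" for z
      using wrap_core[of "fst z" "snd z"] subsetD[of ?U "core X n ed" "snd z"] that
      by (simp only: mem_Times_iff prod.collapse)
    moreover have "continuous_on ({0..1} \<times> ?U) (\<lambda>z. g (fst z))"
      by (rule continuous_on_compose2[OF g(1)]) (auto intro!: continuous_intros)
    ultimately have "continuous_on ({0..1} \<times> ?U) (wrap g w)"
      by (rule continuous_on_eq[rotated])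
    moreover have "openin (top_of_set ({0..1} \<times> X)) ({0..1} \<times> ?U)"
      by (rule openin_Times[OF _ oU]) auto
    ultimately show ?thesis
      using z True by (intro exI[of _ "{0..1} \<times> ?U"]) (auto simp: mem_Times_iff)
  next
    case False
    then obtain k s where k: "k < n" and s: "s \<in> {1/3..2/3}" "snd z = ed k s" using z by auto
    have "continuous_on ({0..1} \<times> ed k ` {0<..<1}) (wrap g w)"
    proof (rule continuous_on_eq)
      show "continuous_on ({0..1} \<times> ed k ` {0<..<1}) (\<lambda>z. w k (fst z, clamp3 (handle_coord (snd z))))"
      proof (rule continuous_on_compose2[OF w(1)[OF k]])
        show "continuous_on ({0..1} \<times> ed k ` {0<..<1}) (\<lambda>z. (fst z, clamp3 (handle_coord (snd z))))"
          by (intro continuous_intros continuous_on_compose2[OF continuous_clamp3[of UNIV]]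
              continuous_on_compose2[OF continuous_handle_coord[OF k]]) auto
      qed (use clamp3_in in auto)
    qed (auto simp: wrap_handle[OF k] handle_coord[OF k])
    moreover have "openin (top_of_set ({0..1} \<times> X)) ({0..1} \<times> ed k ` {0<..<1})"
      by (rule openin_Times[OF _ ed_open[OF k]]) auto
    moreover have "snd z \<in> ed k ` {0<..<1}" unfolding s(2) using s(1) by (intro imageI) auto
    ultimately show ?thesis
      using z by (intro exI[of _ "{0..1} \<times> ed k ` {0<..<1}"]) (auto simp: mem_Times_iff)
  qed
qed

end

text \<open>The middle third of handle \<open>k\<close>, seen after the contraction. Its ends lie in
  the core, which the contraction sends to \<open>v0\<close>, so it is a loop.\<close>

definition gam :: "nat \<Rightarrow> real \<Rightarrow> 'a" where
  "gam k t = K (1, ed k ((1 + t) / 3))"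

lemma K_compose_handle:
  assumes "k < n" "continuous_on S f" "continuous_on S u" "\<And>z. z \<in> S \<Longrightarrow> f z \<in> {0..1}" "\<And>z. z \<in> S \<Longrightarrow> u z \<in> {0..1}"
  shows "continuous_on S (\<lambda>z. K (f z, ed k (u z)))"
  by (rule continuous_on_compose2[OF K_cont])
    (use assms ed_in in \<open>auto intro!: continuous_intros continuous_on_compose2[OF ed_cont]\<close>)

lemma gam_loop: "k < n \<Longrightarrow> gam k \<in> loops_at X v0"
proof -
  assume k: "k < n"
  have "path (gam k)"
    unfolding path_def gam_def[abs_def] by (rule K_compose_handle[OF k]) (auto intro!: continuous_intros)
  moreover have "path_image (gam k) \<subseteq> X"
    unfolding path_image_def using K_in ed_in[OF k] by (auto simp: gam_def)
  moreover have "gam k 0 = v0" "gam k 1 = v0"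
    using K_1 ed_core_iff[OF k] by (auto simp: gam_def)
  ultimately show ?thesis
    by (simp add: loops_at_def pathstart_def pathfinish_def)
qed

lemma gam_clamp3: "k < n \<Longrightarrow> s \<in> {0..1} \<Longrightarrow> gam k (clamp3 s) = K (1, ed k s)"
proof -
  assume k: "k < n" and s: "s \<in> {0..1}"
  consider "s \<le> 1/3" | "s \<in> {1/3<..<2/3}" | "2/3 \<le> s" by force
  then show ?thesis
  proof cases
    case 1
    then show ?thesis using K_1 ed_core_iff[OF k s] ed_core_iff[OF k, of "1/3"] by (auto simp: gam_def clamp3_def)
  next
    case 2
    then show ?thesis by (simp add: gam_def clamp3_def)
  next
    case 3
    then show ?thesis using K_1 ed_core_iff[OF k s] ed_core_iff[OF k, of "2/3"] by (auto simp: gam_def clamp3_def)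
  qed
qed

lemma K_htpy: "htpy X X id (\<lambda>x. K (1,x)) K"
  using K_cont K_in K_0 by (auto simp: htpy_def)

text \<open>This is the freeness of the fundamental group in topological form: the loops
  \<open>w k\<close> can be laid on the middle thirds independently of each other. Undoing the
  contraction deforms \<open>h \<circ> gam k\<close> into \<open>w k\<close>; meanwhile the ends
  stay in the core, on which \<open>h\<close> is constant.\<close>

proposition realize_loops:
  fixes T :: "'c::topological_space set"
  assumes y: "y \<in> T" and w: "\<And>k. k < n \<Longrightarrow> w k \<in> loops_at T y"
  obtains h where "continuous_on X h" "h ` X \<subseteq> T" "h v0 = y" "\<And>k. k < n \<Longrightarrow> homotopic_paths T (h \<circ> gam k) (w k)"
proof -
  let ?w = "\<lambda>k z. w k (snd z)"
  define h where "h x = wrap (\<lambda>_. y) ?w (0,x)" for x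
  have wc: "continuous_on ({0..1} \<times> {0..1}) (?w k)" if "k < n" for k
    by (rule continuous_on_compose2[of "{0..1}" "w k"])
      (use loops_atD[OF w[OF that]] in \<open>auto simp: path_def intro!: continuous_intros\<close>)
  have wT: "w k s \<in> T" "w k 0 = y" "w k 1 = y" if "k < n" "s \<in> {0..1}" for k s
    using loops_atD[OF w[OF that(1)]] that(2) by (auto simp: path_image_def pathstart_def pathfinish_def)
  have wrap: "continuous_on ({0..1} \<times> X) (wrap (\<lambda>_. y) ?w)"
    "\<And>t x. t \<in> {0..1} \<Longrightarrow> x \<in> X \<Longrightarrow> wrap (\<lambda>_. y) ?w (t,x) \<in> T"
    "\<And>t x. t \<in> {0..1} \<Longrightarrow> x \<in> core X n ed \<Longrightarrow> wrap (\<lambda>_. y) ?w (t,x) = y"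
    by (rule wrap_continuous[where T = T] wrap_in[where T = T] wrap_core[where T = T]; use y wc wT in auto)+
  have hc: "continuous_on X h"
    unfolding h_def[abs_def] by (rule continuous_on_compose2[OF wrap(1)]) (auto intro!: continuous_intros)
  have hT: "h ` X \<subseteq> T" using wrap(2) by (auto simp: h_def)
  have hcore: "h x = y" if "x \<in> core X n ed" for x using wrap(3)[of 0 x] that by (simp add: h_def)
  have "homotopic_paths T (h \<circ> gam k) (w k)" if k: "k < n" for k
  proof -
    define H where "H z = h (K (fst z, ed k ((1 + snd z) / 3)))" for z
    have "continuous_on ({0..1} \<times> {0..1}) H"
      unfolding H_def[abs_def]
      by (rule continuous_on_compose2[OF hc K_compose_handle[OF k]])
        (use K_in ed_in[OF k] in \<open>auto intro!: continuous_intros\<close>)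
    moreover have "H (0,s) = w k s" if "s \<in> {0..1}" for s
    proof -
      have "H (0,s) = h (ed k ((1 + s) / 3))"
        unfolding H_def using K_0 ed_in[OF k] that by simp
      also have "\<dots> = w k (clamp3 ((1 + s) / 3))"
        unfolding h_def using that by (subst wrap_handle[OF k]) auto
      also have "clamp3 ((1 + s) / 3) = s" using that by (simp add: clamp3_def field_simps)
      finally show ?thesis .
    qed
    ultimately have "htpy {0..1} T (w k) (h \<circ> gam k) H"
      using hT K_in ed_in[OF k] unfolding htpy_def by (auto simp: H_def gam_def image_subset_iff)
    moreover have "H (t,0) = w k 0 \<and> H (t,1) = w k 1" if "t \<in> {0..1}" for t
      unfolding H_def using hcore K_core[OF that] ed_core_iff[OF k] wT[OF k, of 0] by simp
    ultimately have "homotopic_paths T (w k) (h \<circ> gam k)"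
      by (rule htpy_homotopic_paths)
    then show ?thesis by (rule homotopic_paths_sym)
  qed
  then show ?thesis
    using that hc hT hcore[OF v0_core] by blast
qed

text \<open>Both maps may first be composed with the end of the contraction, after which only their
  values on the loops \<open>gam k\<close> matter. There the given conjugations supply squares,
  which \<open>wrap\<close> assembles into one homotopy.\<close>

proposition homotopy_of_loops:
  fixes T :: "'c::topological_space set"
  assumes f: "continuous_on X f" "f ` X \<subseteq> T" and f': "continuous_on X f'" "f' ` X \<subseteq> T"
    and g: "path_from_to T (f v0) (f' v0) g"
    and hom: "\<And>k. k < n \<Longrightarrow> homotopic_paths T (f \<circ> gam k) (conj_path g (f' \<circ> gam k) g)"
  obtains H where "htpy X T f f' H" "homotopic_paths T (\<lambda>t. H (t,v0)) g"
proof -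
  note g' = g[unfolded path_from_to_def]
  \<comment> \<open>The paths \<open>g\<close> with pauses is the side that
    \<open>homotopic_conj_square\<close> delivers. It is the same for every \<open>k\<close>, so the
    squares fit together on the core.\<close>
  let ?\<sigma> = "((\<lambda>_. pathstart g) +++ g) +++ (\<lambda>_. pathfinish g)"
  have \<sigma>: "path ?\<sigma>" "path_image ?\<sigma> \<subseteq> T" "pathstart ?\<sigma> = f v0" "pathfinish ?\<sigma> = f' v0"
    using g' homotopic_paths_imp_path[OF homotopic_const_const[of g T]] homotopic_paths_imp_subset[OF homotopic_const_const[of g T]] by simp_all
  have "\<exists>W. htpy {0..1} T (f \<circ> gam k) (f' \<circ> gam k) W \<and> (\<forall>t s. (s = 0 \<or> s = 1) \<longrightarrow> t \<in> {0..1} \<longrightarrow> W (t,s) = ?\<sigma> t)"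
    if k: "k < n" for k
    using homotopic_conj_square[OF hom[OF k]] g' loops_atD[OF loop_image[OF f' gam_loop[OF k]]] by (metis (no_types, lifting))
  then obtain W where W: "\<And>k. k < n \<Longrightarrow> htpy {0..1} T (f \<circ> gam k) (f' \<circ> gam k) (W k)"
     "\<And>k t s. k < n \<Longrightarrow> s = 0 \<or> s = 1 \<Longrightarrow> t \<in> {0..1} \<Longrightarrow> W k (t,s) = ?\<sigma> t"
    by metis
  have s: "continuous_on {0..1} ?\<sigma>" "\<And>t. t \<in> {0..1} \<Longrightarrow> ?\<sigma> t \<in> T" "?\<sigma> 0 = f v0" "?\<sigma> 1 = f' v0"
    using \<sigma> by (simp add: path_def, auto simp: path_image_def pathstart_def pathfinish_def)
  have wrap: "continuous_on ({0..1} \<times> X) (wrap ?\<sigma> W)"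
    "\<And>t x. t \<in> {0..1} \<Longrightarrow> x \<in> X \<Longrightarrow> wrap ?\<sigma> W (t,x) \<in> T"
    "\<And>t x. t \<in> {0..1} \<Longrightarrow> x \<in> core X n ed \<Longrightarrow> wrap ?\<sigma> W (t,x) = ?\<sigma> t"
    by (rule wrap_continuous[where T = T] wrap_in[where T = T] wrap_core[where T = T];
        use s W in \<open>force simp: htpy_def\<close>)+
  have M: "htpy X T (f \<circ> (\<lambda>x. K (1,x))) (f' \<circ> (\<lambda>x. K (1,x))) (wrap ?\<sigma> W)"
    unfolding htpy_def
  proof (intro conjI ballI wrap(1,2))
    fix x assume "x \<in> X"
    then have "wrap ?\<sigma> W (0, x) = f (K (1,x)) \<and> wrap ?\<sigma> W (1, x) = f' (K (1,x))"
    proof (cases rule: X_cases)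
      case 1
      then show ?thesis using wrap(3) K_1 s by simp
    next
      case (2 k u)
      then have "W k (0, clamp3 u) = f (gam k (clamp3 u))" "W k (1, clamp3 u) = f' (gam k (clamp3 u))"
        using W(1)[OF 2(1)] clamp3_in by (auto simp: htpy_def)
      moreover have "u \<in> {0<..<1}" using 2(2) by auto
      ultimately show ?thesis
        unfolding 2(3) using gam_clamp3[of k u] 2(1) by (simp add: wrap_handle)
    qed
    then show "wrap ?\<sigma> W (0, x) = (f \<circ> (\<lambda>x. K (1,x))) x" "wrap ?\<sigma> W (1, x) = (f' \<circ> (\<lambda>x. K (1,x))) x"
      by auto
  qed
  have F: "htpy X T (f \<circ> id) (f \<circ> (\<lambda>x. K (1,x))) (f \<circ> K)" and F': "htpy X T (f' \<circ> id) (f' \<circ> (\<lambda>x. K (1,x))) (f' \<circ> K)"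
    by (rule htpy_compose_left[OF K_htpy]; use f f' in auto)+
  let ?H = "htpy_join (htpy_join (f \<circ> K) (wrap ?\<sigma> W)) (\<lambda>z. (f' \<circ> K) (1 - fst z, snd z))"
  have H: "htpy X T f f' ?H"
    using htpy_join[OF htpy_join[OF F M] htpy_reverse[OF F']] by simp
  have "homotopic_paths T (\<lambda>t. ?H (t,v0)) (((\<lambda>_. pathstart ?\<sigma>) +++ ?\<sigma>) +++ (\<lambda>_. pathfinish ?\<sigma>))"
  proof (rule homotopic_paths_eq)
    show "path (\<lambda>t. ?H (t,v0))" "path_image (\<lambda>t. ?H (t,v0)) \<subseteq> T"
      using htpy_track_path[OF H v0_in] by auto
    show "?H (t,v0) = (((\<lambda>_. pathstart ?\<sigma>) +++ ?\<sigma>) +++ (\<lambda>_. pathfinish ?\<sigma>)) t" if "t \<in> {0..1}" for t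
      unfolding htpy_join_def fst_conv snd_conv
      using that K_v0 wrap(3)[OF _ v0_core] \<sigma>(3,4) by (auto simp: joinpaths_def)
  qed
  also have "homotopic_paths T \<dots> ?\<sigma>"
    by (rule homotopic_const_const[OF \<sigma>(1,2)])
  also have "homotopic_paths T \<dots> g"
    by (rule homotopic_const_const) (use g' in auto)
  finally show ?thesis using that H by blast
qed

text \<open>The asphericity of graphs: an equality on generators yields a homotopy. Its track is
  controlled as well, because the track decides where a lifted homotopy takes the base point of a
  covering.\<close>

corollary homotopy_of_pi1_maps:
  assumes h: "continuous_on X h" "h ` X \<subseteq> X" and h': "continuous_on X h'" "h' ` X \<subseteq> X"
    and b: "path_from_to X v0 (h v0) b" and b': "path_from_to X v0 (h' v0) b'"
    and eq: "\<And>k. k < n \<Longrightarrow> pi1_map X v0 h b (hclass X (gam k)) = pi1_map X v0 h' b' (hclass X (gam k))"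
  obtains H where "htpy X X h h' H" "homotopic_paths X (\<lambda>t. H (t,v0)) (reversepath b +++ b')"
proof (rule homotopy_of_loops[OF h h', of "reversepath b +++ b'"])
  show "path_from_to X (h v0) (h' v0) (reversepath b +++ b')"
    by (rule path_from_to_join[OF path_from_to_reverse[OF b] b'])
  fix k assume k: "k < n"
  note B = b[unfolded path_from_to_def] and B' = b'[unfolded path_from_to_def]
  note l = loop_image[OF h gam_loop[OF k]] and l' = loop_image[OF h' gam_loop[OF k]]
  note L = loops_atD[OF l] and L' = loops_atD[OF l'] and cl = loops_atD[OF conj_path_loop[OF b l]]
  have "homotopic_paths X (conj_path b (h \<circ> gam k) b) (conj_path b' (h' \<circ> gam k) b')"
    using eq[OF k] hclass_eq_iff[OF conj_path_loop[OF b l]]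
    by (simp add: pi1_map_hclass[OF v0_in h b gam_loop[OF k]] pi1_map_hclass[OF v0_in h' b' gam_loop[OF k]])
  then have 1: "homotopic_paths X (conj_path (reversepath b) (conj_path b (h \<circ> gam k) b) (reversepath b))
     (conj_path (reversepath b) (conj_path b' (h' \<circ> gam k) b') (reversepath b))"
    by (rule homotopic_conj_cong) (use B cl in auto)
  have 2: "homotopic_paths X (conj_path (reversepath b) (conj_path b (h \<circ> gam k) b) (reversepath b))
    (conj_path (reversepath b +++ b) (h \<circ> gam k) (reversepath b +++ b))"
    by (rule homotopic_conj_conj) (use B L in auto)
  have 3: "homotopic_paths X (conj_path (reversepath b +++ b) (h \<circ> gam k) (reversepath b +++ b))
     (conj_path (\<lambda>_. h v0) (h \<circ> gam k) (\<lambda>_. h v0))"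
    by (rule homotopic_conj_cong'; (rule homotopic_paths_inverse_left)?) (use B L in auto)
  have 4: "homotopic_paths X (conj_path (\<lambda>_. h v0) (h \<circ> gam k) (\<lambda>_. h v0)) (h \<circ> gam k)"
    by (rule homotopic_conj_const) (use L in auto)
  have 5: "homotopic_paths X (conj_path (reversepath b) (conj_path b' (h' \<circ> gam k) b') (reversepath b))
     (conj_path (reversepath b +++ b') (h' \<circ> gam k) (reversepath b +++ b'))"
    by (rule homotopic_conj_conj) (use B B' L' in auto)
  from 1 2 3 4 5 show "homotopic_paths X (h \<circ> gam k) (conj_path (reversepath b +++ b') (h' \<circ> gam k) (reversepath b +++ b'))"
    by (meson homotopic_paths_sym homotopic_paths_trans)
qed (rule that)

section \<open>Generators of the fundamental group\<close>

definition stem :: "nat \<Rightarrow> real \<Rightarrow> real \<Rightarrow> 'a" where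
  "stem k s = (\<lambda>u. K (1, ed k u)) \<circ> linepath (1/3) s"

lemma K1_handle: "k < n \<Longrightarrow> continuous_on {0..1} (\<lambda>u. K (1, ed k u))" "k < n \<Longrightarrow> (\<lambda>u. K (1, ed k u)) ` {0..1} \<subseteq> X"
  using K_compose_handle[of k "{0..1}" "\<lambda>_. 1" "\<lambda>u. u"] K_in ed_in by auto

lemma K1_third: "k < n \<Longrightarrow> K (1, ed k (1/3)) = v0"
  using K_1 ed_core_iff by simp

lemma linepath_unit: "s \<in> {0..1::real} \<Longrightarrow> t \<in> {0..1} \<Longrightarrow> path_image (linepath s t) \<subseteq> {0..1}"
  by (auto simp: closed_segment_eq_real_ivl split: if_splits)

lemma stem_path:
  assumes k: "k < n" and s: "s \<in> {0..1}"
  shows "path_from_to X v0 (K (1, ed k s)) (stem k s)"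
proof -
  have "path_image (linepath (1/3) s) \<subseteq> {0..1}" by (rule linepath_unit) (use s in auto)
  then show ?thesis
    unfolding path_from_to_def stem_def
    using K1_handle[OF k] K1_third[OF k]
    by (auto simp: pathstart_compose pathfinish_compose path_image_compose
        intro!: path_continuous_image intro: continuous_on_subset)
qed

text \<open>A chosen path from \<open>v0\<close> to the contracted image of each point, without
  continuity in the point. Loops will be cut into pieces that tethers close up.\<close>

definition tether :: "'a \<Rightarrow> real \<Rightarrow> 'a" where
  "tether x = (if x \<in> core X n ed then (\<lambda>_. v0) else stem (handle_at x) (handle_coord x))"

lemma tether_path:
  assumes "x \<in> X"
  shows "path_from_to X v0 (K (1,x)) (tether x)"
  using assms
proof (cases rule: X_cases)
  case 1
  then show ?thesis using K_1 v0_in by (auto simp: tether_def path_from_to_def)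
next
  case (2 k s)
  then have "s \<in> {0<..<1}" "x \<notin> core X n ed" using ed_core_iff[of k s] by auto
  with 2 show ?thesis
    using stem_path[of k s] handle_at[of k s] handle_coord[of k s] by (simp add: tether_def)
qed

definition gens :: "(real \<Rightarrow> 'a) set set" where
  "gens = generate (pi1 X v0) ((\<lambda>k. hclass X (gam k)) ` {..<n})"

interpretation G: group "pi1 X v0"
  by (rule pi1_group[OF v0_in])

lemma gens_subgroup: "subgroup gens (pi1 X v0)"
  unfolding gens_def by (rule G.generate_is_subgroup) (use gam_loop in auto)

lemma gens_mult:
  assumes "p \<in> loops_at X v0" "q \<in> loops_at X v0" "hclass X p \<in> gens" "hclass X q \<in> gens"
  shows "hclass X (p +++ q) \<in> gens"
  using subgroup.m_closed[OF gens_subgroup assms(3,4)] pi1_mult[OF assms(1,2)] by simp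

lemma gens_reverse:
  assumes "p \<in> loops_at X v0" "hclass X p \<in> gens"
  shows "hclass X (reversepath p) \<in> gens"
  using subgroup.m_inv_closed[OF gens_subgroup assms(2)] pi1_inv[OF v0_in assms(1)] by simp

lemma gens_one: "hclass X (\<lambda>_. v0) \<in> gens"
  using subgroup.one_closed[OF gens_subgroup] by (simp add: pi1_one)

lemma gens_gam: "k < n \<Longrightarrow> hclass X (gam k) \<in> gens"
  unfolding gens_def by (rule generate.incl) auto

text \<open>This measures the jump of the tethers where a handle meets the core. Before 1/3 the stem
  is null-homotopic, in the middle third it is the tether itself, and after 2/3 it is homotopic to
  \<open>gam k\<close>; so the jump is trivial or the inverse of a generator.\<close>

lemma tether_stem:
  assumes k: "k < n" and s: "s \<in> {0<..<1}"
  shows "hclass X (tether (ed k s) +++ reversepath (stem k s)) \<in> gens"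
    and "tether (ed k s) +++ reversepath (stem k s) \<in> loops_at X v0"
proof -
  have s': "s \<in> {0..1}" using s by auto
  note S = stem_path[OF k s', unfolded path_from_to_def]
  have e: "ed k s \<in> X" using ed_in[OF k s'] .
  show L: "tether (ed k s) +++ reversepath (stem k s) \<in> loops_at X v0"
    using path_from_to_join[OF tether_path[OF e] path_from_to_reverse[OF stem_path[OF k s']]] by (simp add: path_from_to_loop)
  have core: "hclass X (tether (ed k s) +++ reversepath (stem k s)) \<in> gens"
    if c: "ed k s \<in> core X n ed" and st: "hclass X (stem k s) \<in> gens"
  proof -
    have "K (1, ed k s) = v0" using K_1 c by simp
    then have "stem k s \<in> loops_at X v0"
      using stem_path[OF k s'] by (simp add: path_from_to_loop)
    then show ?thesis
      using gens_mult[OF _ _ gens_one] gens_reverse[OF _ st] v0_in c by (simp add: tether_def)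
  qed
  consider "s \<le> 1/3" | "s \<in> {1/3<..<2/3}" | "2/3 \<le> s" by force
  then show "hclass X (tether (ed k s) +++ reversepath (stem k s)) \<in> gens"
  proof cases
    case 1
    have "stem k s t = v0" if "t \<in> {0..1}" for t
    proof -
      have "linepath (1/3) s t \<in> closed_segment (1/3) s" using linepath_in_path that by blast
      then have "linepath (1/3) s t \<in> {0..1/3}" using 1 s by (auto simp: closed_segment_eq_real_ivl split: if_splits)
      then show ?thesis unfolding stem_def using K_1 ed_core_iff[OF k, of "linepath (1/3) s t"] by simp
    qed
    then have "homotopic_paths X (stem k s) (\<lambda>_. v0)"
      using S by (intro homotopic_paths_eq) auto
    then show ?thesis
      using core gens_one hclass_eqI 1 ed_core_iff[OF k s'] by fastforce
  next
    case 2
    then have "ed k s \<notin> core X n ed" using ed_core_iff[OF k s'] by auto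
    then have "tether (ed k s) = stem k s"
      using handle_at[OF k s] handle_coord[OF k s] by (simp add: tether_def)
    then show ?thesis
      using homotopic_paths_inverse_right[of "stem k s" X v0] S gens_one hclass_eqI by fastforce
  next
    case 3
    have "homotopic_paths X (gam k) (stem k s)"
    proof (rule homotopic_paths_reparametrize[where f = "\<lambda>t. min 1 (t * (3 * s - 1))"])
      show "(\<lambda>t. min 1 (t * (3 * s - 1))) \<in> {0..1} \<rightarrow> {0..1}"
        using 3 by auto
      show "stem k s t = gam k (min 1 (t * (3 * s - 1)))" if t: "t \<in> {0..1}" for t
      proof -
        have "linepath (1/3) s t \<in> {0..1}"
          using linepath_in_path[OF t, of "1/3" s] s by (auto simp: closed_segment_eq_real_ivl split: if_splits)
        moreover have "clamp3 (linepath (1/3) s t) = min 1 (t * (3 * s - 1))"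
        proof -
          have "3 * linepath (1/3) s t - 1 = t * (3 * s - 1)"
            by (simp add: linepath_def field_simps)
          moreover have "0 \<le> t * (3 * s - 1)" using t 3 by simp
          ultimately show ?thesis by (simp add: clamp3_def)
        qed
        ultimately show ?thesis using gam_clamp3[OF k, of "linepath (1/3) s t"] unfolding stem_def by simp
      qed
      show "min 1 (1 * (3 * s - 1)) = 1" using 3 by simp
    qed (use loops_atD[OF gam_loop[OF k]] in \<open>auto intro!: continuous_intros\<close>)
    then have "hclass X (stem k s) \<in> gens"
      using gens_gam[OF k] hclass_eqI by metis
    then show ?thesis
      using core 3 ed_core_iff[OF k s'] by auto
  qed
qed

lemma homotopic_portion_join:
  assumes f: "path f" "path_image f \<subseteq> S" and abc: "a \<in> {0..1}" "b \<in> {0..1}" "c \<in> {0..1}"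
  shows "homotopic_paths S (portion a b f +++ portion b c f) (portion a c f)"
proof -
  have p: "portion u v f = f \<circ> linepath u v" for u v
    by (auto simp: portion_def linepath_def fun_eq_iff algebra_simps)
  have "homotopic_paths S (f \<circ> (linepath a b +++ linepath b c)) (f \<circ> linepath a c)"
  proof (rule homotopic_paths_real_reparametrize[of "{0..1}"])
    have "path_image (linepath a b) \<subseteq> {0..1}" "path_image (linepath b c) \<subseteq> {0..1}"
      using linepath_unit abc by blast+
    then show "path_image (linepath a b +++ linepath b c) \<subseteq> {0..1}"
      by (intro order_trans[OF path_image_join_subset] Un_least)
    show "path_image (linepath a c) \<subseteq> {0..1}"
      using linepath_unit abc by blast
    show "path (linepath a b +++ linepath b c)" by simp
  qed (use f in \<open>auto simp: path_def[of f] path_image_def[of f]\<close>)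
  then show ?thesis by (simp add: p path_compose_join)
qed

text \<open>A van Kampen argument by subdivision: the contracted loop is cut into short pieces, each
  coming from the core or from one handle. Closed up by tethers, a piece from the core is constant,
  and a piece in a handle is a quotient of two tether jumps.\<close>

proposition pi1_generated: "carrier (pi1 X v0) = gens"
proof
  show "gens \<subseteq> carrier (pi1 X v0)"
    using subgroup.subset[OF gens_subgroup] .
  show "carrier (pi1 X v0) \<subseteq> gens"
  proof
    fix A assume "A \<in> carrier (pi1 X v0)"
    then obtain w where w: "w \<in> loops_at X v0" "A = hclass X w" by (auto simp: pi1_carrier)
    note W = loops_atD[OF w(1)]
    have wX: "w t \<in> X" if "t \<in> {0..1}" for t using W that by (auto simp: path_image_def)
    have wc: "continuous_on {0..1} w" using W by (simp add: path_def)
    let ?f = "\<lambda>t. K (1, w t)"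
    have K1c: "continuous_on X (\<lambda>x. K (1,x))"
      by (rule continuous_on_compose2[OF K_cont]) (auto intro!: continuous_intros)
    have f: "path ?f" "path_image ?f \<subseteq> X"
    proof -
      show "path ?f"
        unfolding path_def by (rule continuous_on_compose2[OF K1c wc]) (use wX in auto)
      show "path_image ?f \<subseteq> X"
        using K_in wX by (auto simp: path_image_def)
    qed
    have pf: "path (portion a b ?f)" "path_image (portion a b ?f) \<subseteq> X" if "a \<in> {0..1}" "b \<in> {0..1}" for a b
    proof -
      show "path (portion a b ?f)"
        unfolding path_def portion_def
        by (rule continuous_on_compose2[of "{0..1}" ?f])
          (use f portion_range[OF that] in \<open>auto simp: path_def intro!: continuous_intros\<close>)
      show "path_image (portion a b ?f) \<subseteq> X"
        using path_image_portion[OF that] f(2) by blast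
    qed
    note T = tether_path[OF wX, unfolded path_from_to_def]
    define c where "c a b = conj_path (tether (w a)) (portion a b ?f) (tether (w b))" for a b
    have cl: "c a b \<in> loops_at X v0" if "a \<in> {0..1}" "b \<in> {0..1}" for a b
      unfolding c_def loops_at_def using T[OF that(1)] T[OF that(2)] pf[OF that]
      by (auto simp: path_image_join)
    define P where "P a b \<longleftrightarrow> (0 \<le> a \<longrightarrow> a \<le> b \<longrightarrow> b \<le> 1 \<longrightarrow> hclass X (c a b) \<in> gens)" for a b
    have "P 0 1"
    proof (rule Bolzano)
      fix a b d :: real assume P: "P a b" "P b d" and ab: "a \<le> b" "b \<le> d"
      show "P a d"
        unfolding P_def
      proof (intro impI)
        assume 0: "0 \<le> a" "d \<le> 1"
        then have I: "a \<in> {0..1}" "b \<in> {0..1}" "d \<in> {0..1}" using ab by auto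
        have "homotopic_paths X (c a b +++ c b d) (conj_path (tether (w a)) (portion a b ?f +++ portion b d ?f) (tether (w d)))"
          unfolding c_def
          by (rule homotopic_conj_join) (use T[OF I(1)] T[OF I(2)] T[OF I(3)] pf[OF I(1,2)] pf[OF I(2,3)] in auto)
        also have "homotopic_paths X \<dots> (c a d)"
          unfolding c_def
          by (rule homotopic_conj_cong[OF homotopic_portion_join[OF f I]]) (use T[OF I(1)] T[OF I(3)] in auto)
        finally have "hclass X (c a b +++ c b d) = hclass X (c a d)" by (rule hclass_eqI)
        moreover have "hclass X (c a b +++ c b d) \<in> gens"
          by (rule gens_mult) (use cl[OF I(1,2)] cl[OF I(2,3)] P ab 0 in \<open>auto simp: P_def\<close>)
        ultimately show "hclass X (c a d) \<in> gens" by simp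
      qed
    next
      fix x :: real assume x: "0 \<le> x" "x \<le> 1"
      let ?U = "X - (\<Union>k<n. ed k ` {1/3..2/3})"
      have near: "\<exists>d>0. \<forall>t\<in>{0..1}. \<bar>t - x\<bar> < d \<longrightarrow> w t \<in> U" if "openin (top_of_set X) U" "w x \<in> U" for U
      proof -
        have "openin (top_of_set {0..1}) ({0..1} \<inter> w -` U)"
          by (rule continuous_openin_preimage[OF wc _ that(1)]) (use wX in auto)
        then show ?thesis
          using x that(2) unfolding openin_euclidean_subtopology_iff dist_real_def by (metis (no_types, lifting) Int_iff atLeastAtMost_iff vimage_eq)
      qed
      show "\<exists>d>0. \<forall>a b. a \<le> x \<and> x \<le> b \<and> b - a < d \<longrightarrow> P a b"
      proof (cases "w x \<in> ?U")
        case True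
        have "openin (top_of_set X) ?U" using closedin_middles by (simp add: closedin_def)
        then obtain d where d: "d > 0" "\<And>t. t \<in> {0..1} \<Longrightarrow> \<bar>t - x\<bar> < d \<Longrightarrow> w t \<in> ?U"
          using near True by metis
        have Uc: "?U \<subseteq> core X n ed" unfolding core_def by fastforce
        show ?thesis
        proof (intro exI[of _ d] conjI allI impI d(1))
          fix a b assume ab: "a \<le> x \<and> x \<le> b \<and> b - a < d"
          show "P a b"
            unfolding P_def
          proof (intro impI)
            assume 0: "0 \<le> a" "a \<le> b" "b \<le> 1"
            have wco: "w t \<in> core X n ed" if "t \<in> {a..b}" for t
              using d(2)[of t] Uc ab 0 that by force
            have "portion a b ?f t = v0" if "t \<in> {0..1}" for t
              using K_1 wco[OF portion_range[of a a b b t]] 0 that by (simp add: portion_def)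
            then have "c a b t = v0" if "t \<in> {0..1}" for t
              using wco[of a] wco[of b] 0 that unfolding c_def tether_def
              by (auto simp: joinpaths_def)
            then have "homotopic_paths X (c a b) (\<lambda>_. v0)"
              using loops_atD[OF cl[of a b]] 0 by (intro homotopic_paths_eq) auto
            then show "hclass X (c a b) \<in> gens"
              using gens_one hclass_eqI by metis
          qed
        qed
      next
        case False
        then obtain k s where k: "k < n" and s: "s \<in> {1/3..2/3}" "w x = ed k s" using wX[of x] x by auto
        let ?O = "ed k ` {0<..<1}"
        have "openin (top_of_set X) ?O" by (rule ed_open[OF k]) auto
        moreover have "w x \<in> ?O" unfolding s(2) using s(1) by (intro imageI) auto
        ultimately obtain d where d: "d > 0" "\<And>t. t \<in> {0..1} \<Longrightarrow> \<bar>t - x\<bar> < d \<Longrightarrow> w t \<in> ?O"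
          using near by metis
        show ?thesis
        proof (intro exI[of _ d] conjI allI impI d(1))
          fix a b assume ab: "a \<le> x \<and> x \<le> b \<and> b - a < d"
          show "P a b"
            unfolding P_def
          proof (intro impI)
            assume 0: "0 \<le> a" "a \<le> b" "b \<le> 1"
            then have I: "a \<in> {0..1}" "b \<in> {0..1}" by auto
            have wO: "w t \<in> ?O" if "t \<in> {a..b}" for t
              using d(2)[of t] ab 0 that by force
            define u where "u = handle_coord \<circ> portion a b w"
            have pw: "portion a b w t \<in> ?O" if "t \<in> {0..1}" for t
              unfolding portion_def by (rule wO, rule portion_range) (use 0 that in auto)
            have u_eq: "u t \<in> {0<..<1} \<and> ed k (u t) = portion a b w t" if "t \<in> {0..1}" for t
              using pw[OF that] handle_coord[OF k] by (auto simp: u_def)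
            have uc: "path u"
            proof -
              have "continuous_on {0..1} (portion a b w)"
                unfolding portion_def
                by (rule continuous_on_compose2[OF wc]) (use portion_range[OF I] in \<open>auto intro!: continuous_intros\<close>)
              then show ?thesis
                unfolding path_def u_def
                by (intro continuous_on_compose continuous_on_subset[OF continuous_handle_coord[OF k]]) (use pw in auto)
            qed
            have ui: "path_image u \<subseteq> {0<..<1}" using u_eq by (auto simp: path_image_def)
            let ?s = "u 0" and ?s' = "u 1"
            have us: "?s \<in> {0<..<1}" "?s' \<in> {0<..<1}" "ed k ?s = w a" "ed k ?s' = w b"
              using u_eq[of 0] u_eq[of 1] by (auto simp: portion_def)
            have us': "?s \<in> {0..1}" "?s' \<in> {0..1}" using us by auto
            note S = stem_path[OF k us'(1), unfolded path_from_to_def] and S' = stem_path[OF k us'(2), unfolded path_from_to_def]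
            let ?g = "\<lambda>u. K (1, ed k u)"
            \<comment> \<open>A path inside a handle is a path of real parameters, so only its ends
              matter: it is homotopic to going back along one stem and out along the other.\<close>
            have "homotopic_paths X (?g \<circ> u) (?g \<circ> (reversepath (linepath (1/3) ?s) +++ linepath (1/3) ?s'))"
            proof (rule homotopic_paths_real_reparametrize[OF K1_handle[OF k]])
              have "path_image (linepath (1/3) ?s) \<subseteq> {0..1}" "path_image (linepath (1/3) ?s') \<subseteq> {0..1}"
                by (rule linepath_unit; use us' in simp)+
              then show "path_image (reversepath (linepath (1/3) ?s) +++ linepath (1/3) ?s') \<subseteq> {0..1}"
                by (intro order_trans[OF path_image_join_subset] Un_least) (simp_all only: path_image_reversepath)
              show "path (reversepath (linepath (1/3) ?s) +++ linepath (1/3) ?s')" by simp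
              show "path_image u \<subseteq> {0..1}" using ui by (auto simp: subset_iff)
            qed (use uc in \<open>auto simp: pathstart_def pathfinish_def linepath_def reversepath_def joinpaths_def\<close>)
            then have g1: "homotopic_paths X (?g \<circ> u) (reversepath (stem k ?s) +++ stem k ?s')"
              by (simp only: path_compose_join path_compose_reversepath stem_def)
            have "homotopic_paths X (portion a b ?f) (?g \<circ> u)"
              by (rule homotopic_paths_eq[OF pf[OF I]]) (use u_eq in \<open>auto simp: portion_def\<close>)
            then have g2: "homotopic_paths X (portion a b ?f) (reversepath (stem k ?s) +++ stem k ?s')"
              using g1 by (rule homotopic_paths_trans)
            let ?l = "tether (w a) +++ reversepath (stem k ?s)" and ?l' = "tether (w b) +++ reversepath (stem k ?s')"
            have l: "?l \<in> loops_at X v0" "?l' \<in> loops_at X v0" "hclass X ?l \<in> gens" "hclass X ?l' \<in> gens"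
              using tether_stem[OF k us(1)] tether_stem[OF k us(2)] us by auto
            have "homotopic_paths X (c a b) (?l +++ reversepath ?l')"
            proof (rule reduces_eq)
              note Ta = T[OF I(1)] and Tb = T[OF I(2)]
              have "reduces X v0 v0 (tether (w a) +++ ((reversepath (stem k ?s) +++ stem k ?s') +++ reversepath (tether (w b))))
                 ([tether (w a)] @ (([reversepath (stem k ?s)] @ [stem k ?s']) @ [reversepath (tether (w b))]))"
                by (intro reduces_join[of _ _ "K (1, w a)"] reduces_join[of _ _ "K (1, w b)"] reduces_join[of _ _ v0] reduces_single)
                  (use Ta Tb S S' us in auto)
              moreover have "homotopic_paths X (c a b) (tether (w a) +++ ((reversepath (stem k ?s) +++ stem k ?s') +++ reversepath (tether (w b))))"
                unfolding c_def by (rule homotopic_conj_cong[OF g2]) (use Ta Tb in auto)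
              ultimately show "reduces X v0 v0 (c a b) ([tether (w a)] @ (([reversepath (stem k ?s)] @ [stem k ?s']) @ [reversepath (tether (w b))]))"
                by (rule reduces_homotopic[rotated])
              have "reduces X v0 v0 (?l +++ (stem k ?s' +++ reversepath (tether (w b))))
                 (([tether (w a)] @ [reversepath (stem k ?s)]) @ ([stem k ?s'] @ [reversepath (tether (w b))]))"
                by (rule reduces_join[OF reduces_join[of _ _ "K (1, w a)"] reduces_join[of _ _ "K (1, w b)"]]; rule reduces_single)
                  (use Ta Tb S S' us in auto)
              then show "reduces X v0 v0 (?l +++ reversepath ?l') ([tether (w a)] @ (([reversepath (stem k ?s)] @ [stem k ?s']) @ [reversepath (tether (w b))]))"
                using Tb S' us by (simp add: reversepath_joinpaths)
            qed
            then have "hclass X (c a b) = hclass X (?l +++ reversepath ?l')" by (rule hclass_eqI)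
            then show "hclass X (c a b) \<in> gens"
              using gens_mult[OF l(1) loops_at_reverse[OF l(2)] l(3) gens_reverse[OF l(2,4)]] by simp
          qed
        qed
      qed
    qed simp
    then have "hclass X (c 0 1) \<in> gens" by (simp add: P_def)
    \<comment> \<open>The tethers at both ends of the loop are constant, so the undivided piece is
      the contracted loop, and the contraction connects that to \<open>w\<close>.\<close>
    moreover have "homotopic_paths X (c 0 1) ?f"
    proof -
      have "w 0 = v0" "w 1 = v0" using W by (auto simp: pathstart_def pathfinish_def)
      then show ?thesis
        unfolding c_def tether_def using v0_core homotopic_conj_const[OF f, of v0] K_v0[of 1]
        by (simp add: pathstart_def pathfinish_def)
    qed
    moreover have "homotopic_paths X w ?f"
    proof (rule htpy_homotopic_paths)
      show "htpy {0..1} X w ?f (\<lambda>z. K (fst z, w (snd z)))"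
        using htpy_compose_right[OF K_htpy wc] wX by (simp add: comp_def)
      show "K (fst (t, 0), w (snd (t, 0))) = w 0 \<and> K (fst (t, 1), w (snd (t, 1))) = w 1" if "t \<in> {0..1}" for t
        using W K_v0[OF that] by (simp add: pathstart_def pathfinish_def)
    qed
    ultimately show "A \<in> gens"
      unfolding w(2) using hclass_eqI by metis
  qed
qed

end

section \<open>Heisenberg-valued invariants of loops\<close>

text \<open>The covering with fibre the integral Heisenberg group that is developed by two circle-valued
  functions with lifts \<open>f\<close> and \<open>g\<close> and with \<open>df \<and> dg = 0\<close>.\<close>

definition heis_total :: "'a set \<Rightarrow> ('a \<Rightarrow> real) \<Rightarrow> ('a \<Rightarrow> real) \<Rightarrow> ('a \<times> real \<times> real \<times> real) set" where
  "heis_total X f g = {(x,a,b,c). x \<in> X \<and> a - f x \<in> \<int> \<and> b - g x \<in> \<int> \<and> c - a * g x \<in> \<int>}"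

lemma Ints_half: "a \<in> \<int> \<Longrightarrow> \<bar>a - of_int m\<bar> < (1/2::real) \<Longrightarrow> a = of_int m"
proof -
  assume "a \<in> \<int>" "\<bar>a - of_int m\<bar> < (1/2::real)"
  then obtain k where "a = of_int k" by (auto elim: Ints_cases)
  with \<open>\<bar>a - of_int m\<bar> < 1/2\<close> have "k = m" by linarith
  with \<open>a = of_int k\<close> show ?thesis by simp
qed

text \<open>Locally \<open>f\<close> and \<open>g\<close> are replaced by continuous functions that
  agree with them modulo the integers. The last condition ensures that integrality of
  \<open>c - a * g\<close> is not affected by the replacement.\<close>

lemma heis_covering:
  fixes X :: "'a::topological_space set"
  assumes loc: "\<And>x. x \<in> X \<Longrightarrow> \<exists>T f' g'. x \<in> T \<and> openin (top_of_set X) T \<and> continuous_on T f' \<and> continuous_on T g' \<and>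
     (\<forall>y\<in>T. f' y - f y \<in> \<int> \<and> g' y - g y \<in> \<int> \<and> f' y * (g y - g' y) \<in> \<int>)"
  shows "covering_space (heis_total X f g) fst X"
proof
  let ?Z = "heis_total X f g"
  show "continuous_on ?Z fst" by (intro continuous_intros)
  have "(x, f x, g x, f x * g x) \<in> ?Z" if "x \<in> X" for x using that by (simp add: heis_total_def)
  then have "X \<subseteq> fst ` ?Z" by (metis fst_conv image_eqI subsetI)
  moreover have "fst ` ?Z \<subseteq> X" by (auto simp: heis_total_def)
  ultimately show "fst ` ?Z = X" by (rule equalityI[rotated])
  fix x assume "x \<in> X"
  then obtain T f' g' where T: "x \<in> T" "openin (top_of_set X) T" "continuous_on T f'" "continuous_on T g'"
     and fg: "\<And>y. y \<in> T \<Longrightarrow> f' y - f y \<in> \<int>" "\<And>y. y \<in> T \<Longrightarrow> g' y - g y \<in> \<int>" "\<And>y. y \<in> T \<Longrightarrow> f' y * (g y - g' y) \<in> \<int>"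
    using loc[of x] by blast
  have TX: "T \<subseteq> X" using T(2) openin_imp_subset by blast
  define s where "s m y = (case m of (m1,m2,m3) \<Rightarrow>
    (y, of_int m1 + f' y, of_int m2 + g' y, of_int m3 + (of_int m1 + f' y) * g' y))" for m :: "int \<times> int \<times> int" and y
  have mem: "(y,a,b,c) \<in> ?Z \<longleftrightarrow> a - f' y \<in> \<int> \<and> b - g' y \<in> \<int> \<and> c - a * g' y \<in> \<int>" if y: "y \<in> T" for y a b c
  proof -
    have 1: "a - f y \<in> \<int> \<longleftrightarrow> a - f' y \<in> \<int>"
      using Ints_add[OF _ fg(1)[OF y], of "a - f' y"] Ints_diff[OF _ fg(1)[OF y], of "a - f y"] by auto
    have 2: "b - g y \<in> \<int> \<longleftrightarrow> b - g' y \<in> \<int>"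
      using Ints_add[OF _ fg(2)[OF y], of "b - g' y"] Ints_diff[OF _ fg(2)[OF y], of "b - g y"] by auto
    have 3: "c - a * g y \<in> \<int> \<longleftrightarrow> c - a * g' y \<in> \<int>" if a: "a - f' y \<in> \<int>"
    proof -
      have "(a - f' y) * (g' y - g y) - f' y * (g y - g' y) \<in> \<int>"
        by (intro Ints_diff Ints_mult a fg y)
      moreover have "(a - f' y) * (g' y - g y) - f' y * (g y - g' y) = (c - a * g y) - (c - a * g' y)"
        by (simp add: algebra_simps)
      ultimately have "(c - a * g y) - (c - a * g' y) \<in> \<int>" by simp
      then show ?thesis
        using Ints_add[of "(c - a * g y) - (c - a * g' y)" "c - a * g' y"] Ints_diff[of "c - a * g y" "(c - a * g y) - (c - a * g' y)"]
        by auto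
    qed
    show ?thesis using y TX 1 2 3 by (auto simp: heis_total_def)
  qed
  have cs: "continuous_on T (s m)" for m
    unfolding s_def by (cases m) (auto intro!: continuous_intros T)
  let ?v = "range (\<lambda>m. s m ` T)"
  show "\<exists>T. x \<in> T \<and> openin (top_of_set X) T \<and> (\<exists>v. \<Union>v = ?Z \<inter> fst -` T \<and> (\<forall>u \<in> v. openin (top_of_set ?Z) u) \<and>
             pairwise disjnt v \<and> (\<forall>u \<in> v. \<exists>q. homeomorphism u T fst q))"
  proof (intro exI[of _ T] exI[of _ ?v] conjI ballI T(1,2))
    show "\<Union>?v = ?Z \<inter> fst -` T"
    proof (intro equalityI subsetI)
      fix z assume "z \<in> \<Union>?v"
      then obtain m y where "y \<in> T" "z = s m y" by auto
      then show "z \<in> ?Z \<inter> fst -` T" using mem by (cases m) (auto simp: s_def)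
    next
      fix z assume z: "z \<in> ?Z \<inter> fst -` T"
      obtain y a b c where zz: "z = (y,a,b,c)" by (cases z)
      then have y: "y \<in> T" and "a - f' y \<in> \<int>" "b - g' y \<in> \<int>" "c - a * g' y \<in> \<int>"
        using z mem[of y a b c] by auto
      then obtain m1 m2 m3 where "a - f' y = of_int m1" "b - g' y = of_int m2" "c - a * g' y = of_int m3"
        by (auto elim!: Ints_cases)
      then have "z = s (m1,m2,m3) y" by (auto simp: zz s_def algebra_simps)
      then show "z \<in> \<Union>?v" using y by blast
    qed
    \<comment> \<open>Fibre coordinates are integral up to the local functions, so being within 1/2
      of a value means equality. Each sheet is thereby cut out by open conditions.\<close>
    have sm: "z \<in> s (m1,m2,m3) ` T \<longleftrightarrow> z \<in> ?Z \<and> fst z \<in> T \<and>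
        \<bar>fst (snd z) - f' (fst z) - of_int m1\<bar> < 1/2 \<and> \<bar>fst (snd (snd z)) - g' (fst z) - of_int m2\<bar> < 1/2 \<and>
        \<bar>snd (snd (snd z)) - fst (snd z) * g' (fst z) - of_int m3\<bar> < 1/2" for z m1 m2 m3
    proof
      assume "z \<in> s (m1,m2,m3) ` T"
      then show "z \<in> ?Z \<and> fst z \<in> T \<and>
        \<bar>fst (snd z) - f' (fst z) - of_int m1\<bar> < 1/2 \<and> \<bar>fst (snd (snd z)) - g' (fst z) - of_int m2\<bar> < 1/2 \<and>
        \<bar>snd (snd (snd z)) - fst (snd z) * g' (fst z) - of_int m3\<bar> < 1/2"
        using mem by (auto simp: s_def)
    next
      assume *: "z \<in> ?Z \<and> fst z \<in> T \<and>
        \<bar>fst (snd z) - f' (fst z) - of_int m1\<bar> < 1/2 \<and> \<bar>fst (snd (snd z)) - g' (fst z) - of_int m2\<bar> < 1/2 \<and>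
        \<bar>snd (snd (snd z)) - fst (snd z) * g' (fst z) - of_int m3\<bar> < 1/2"
      obtain y a b c where z: "z = (y,a,b,c)" by (cases z)
      have "a - f' y = of_int m1" "b - g' y = of_int m2" "c - a * g' y = of_int m3"
        using * mem[of y a b c] unfolding z by (auto intro!: Ints_half)
      then have "z = s (m1,m2,m3) y" by (auto simp: z s_def algebra_simps)
      moreover have "y \<in> T" using * z by simp
      ultimately show "z \<in> s (m1,m2,m3) ` T" by (rule image_eqI)
    qed
    show "openin (top_of_set ?Z) u" if uv: "u \<in> ?v" for u
    proof -
      obtain m where m: "u = s m ` T" using uv by blast
      obtain m1 m2 m3 where "m = (m1,m2,m3)" by (cases m)
      with m have u: "u = s (m1,m2,m3) ` T" by simp
      have oT: "openin (top_of_set ?Z) (?Z \<inter> fst -` T)"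
        by (rule continuous_openin_preimage[OF _ _ T(2)]) (auto intro!: continuous_intros simp: heis_total_def)
      let ?h = "\<lambda>z. max (max \<bar>fst (snd z) - f' (fst z) - of_int m1\<bar> \<bar>fst (snd (snd z)) - g' (fst z) - of_int m2\<bar>)
        \<bar>snd (snd (snd z)) - fst (snd z) * g' (fst z) - of_int m3\<bar>"
      have "continuous_on (?Z \<inter> fst -` T) ?h"
        by (intro continuous_intros continuous_on_compose2[OF T(3)] continuous_on_compose2[OF T(4)]) auto
      then have "openin (top_of_set (?Z \<inter> fst -` T)) ((?Z \<inter> fst -` T) \<inter> ?h -` {..<1/2})"
        using continuous_openin_preimage_eq open_lessThan by blast
      then have "openin (top_of_set ?Z) ((?Z \<inter> fst -` T) \<inter> ?h -` {..<1/2})"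
        using oT by (rule openin_trans)
      moreover have "(?Z \<inter> fst -` T) \<inter> ?h -` {..<1/2} = u"
      proof (rule subset_antisym; rule subsetI)
        fix z assume z: "z \<in> (?Z \<inter> fst -` T) \<inter> ?h -` {..<1/2}"
        then show "z \<in> u" unfolding u sm vimage_eq Int_iff lessThan_iff max_less_iff_conj by blast
      next
        fix z assume "z \<in> u"
        then show "z \<in> (?Z \<inter> fst -` T) \<inter> ?h -` {..<1/2}"
          unfolding u sm vimage_eq Int_iff lessThan_iff max_less_iff_conj by blast
      qed

      ultimately show ?thesis by simp
    qed
    show "pairwise disjnt ?v"
    proof (rule pairwiseI)
      fix u u' assume u: "u \<in> ?v" "u' \<in> ?v" "u \<noteq> u'"
      obtain m where m: "u = s m ` T" using u(1) by blast
      obtain m' where m': "u' = s m' ` T" using u(2) by blast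
      note mm = m m'
      have "m = m'" if "s m y = s m' y'" for y y'
        using that by (cases m; cases m') (auto simp: s_def)
      then show "disjnt u u'" using u(3) unfolding mm disjnt_def by blast
    qed
    show "\<exists>q. homeomorphism u T fst q" if uv: "u \<in> ?v" for u
    proof -
      obtain m where u: "u = s m ` T" using uv by blast
      have "fst (s m y) = y" for y by (cases m) (simp add: s_def)
      then show ?thesis
        unfolding u using cs[of m] by (intro exI[of _ "s m"]) (auto simp: homeomorphism_def image_image intro!: continuous_intros)
    qed
  qed
qed

text \<open>Left multiplication by an integral element of the Heisenberg group, with the third
  coordinate as the corner entry of a unitriangular matrix. It preserves \<open>heis_total\<close>
  and commutes with the lifting of paths.\<close>

definition heis_act :: "int \<times> int \<times> int \<Rightarrow> 'a \<times> real \<times> real \<times> real \<Rightarrow> 'a \<times> real \<times> real \<times> real" where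
  "heis_act m z = (case m of (m1,m2,m3) \<Rightarrow> (fst z, of_int m1 + fst (snd z), of_int m2 + fst (snd (snd z)),
     of_int m3 + snd (snd (snd z)) + of_int m1 * fst (snd (snd z))))"

lemma heis_act_total: "z \<in> heis_total X f g \<Longrightarrow> heis_act m z \<in> heis_total X f g"
proof -
  assume z: "z \<in> heis_total X f g"
  obtain x a b c where zz: "z = (x,a,b,c)" by (cases z)
  obtain m1 m2 m3 where m: "m = (m1,m2,m3)" by (cases m)
  have *: "x \<in> X" "a - f x \<in> \<int>" "b - g x \<in> \<int>" "c - a * g x \<in> \<int>" using z by (auto simp: zz heis_total_def)
  have "of_int m1 + (a - f x) \<in> \<int>" "of_int m2 + (b - g x) \<in> \<int>" "of_int m3 + (c - a * g x) + of_int m1 * (b - g x) \<in> \<int>"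
    by (intro Ints_add Ints_mult Ints_of_int *)+
  then show ?thesis using *(1) by (simp add: zz m heis_act_def heis_total_def algebra_simps)
qed

lemma continuous_heis_act: "continuous_on A (heis_act m)"
  unfolding heis_act_def by (cases m) (auto intro!: continuous_intros)

lemma lift_end_heis_act:
  assumes cov: "covering_space (heis_total X f g) fst X" and p: "path p" "path_image p \<subseteq> X"
    and z: "z \<in> heis_total X f g" "fst z = pathstart p"
  shows "lift_end (heis_total X f g) fst p (heis_act m z) = heis_act m (lift_end (heis_total X f g) fst p z)"
proof -
  obtain h where h: "path h" "path_image h \<subseteq> heis_total X f g" "pathstart h = z"
     "pathfinish h = lift_end (heis_total X f g) fst p z" "\<And>t. t \<in> {0..1} \<Longrightarrow> fst (h t) = p t"
    by (rule lift_end_obtain[OF cov p z]) blast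
  have "lift_end (heis_total X f g) fst p (heis_act m z) = pathfinish (heis_act m \<circ> h)"
  proof (rule lift_end_eq[OF cov])
    show "path (heis_act m \<circ> h)" by (rule path_continuous_image[OF h(1) continuous_heis_act])
    show "path_image (heis_act m \<circ> h) \<subseteq> heis_total X f g"
      using h(2) heis_act_total unfolding path_image_compose by blast
    show "pathstart (heis_act m \<circ> h) = heis_act m z" using h(3) by (simp add: pathstart_compose)
    show "fst ((heis_act m \<circ> h) t) = p t" if "t \<in> {0..1}" for t
      using h(5)[OF that] by (cases m) (simp add: heis_act_def)
  qed
  then show ?thesis using h(4) by (simp add: pathfinish_compose)
qed

section \<open>The Heisenberg coverings of a graph\<close>

context graph_handles
begin

text \<open>The lift of a circle-valued function that winds once around handle \<open>i\<close>. It
  is continuous only modulo 1: it drops from 1 to 0 where the far end of the handle meets the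
  core.\<close>

definition wind :: "nat \<Rightarrow> 'a \<Rightarrow> real" where
  "wind i x = (if on_handle x \<and> handle_at x = i then clamp3 (handle_coord x) else 0)"

lemma wind_handle: "k < n \<Longrightarrow> s \<in> {0<..<1} \<Longrightarrow> wind i (ed k s) = (if k = i then clamp3 s else 0)"
  by (simp add: wind_def ed_on_handle handle_at handle_coord)

lemma wind_core: "x \<in> core X n ed \<Longrightarrow> wind i x \<in> {0,1}"
proof (cases "on_handle x")
  case True
  assume x: "x \<in> core X n ed"
  obtain k s where ks: "k < n" "s \<in> {0<..<1}" "x = ed k s" using True by (auto simp: on_handle_def)
  then have "s \<notin> {1/3<..<2/3}" using x ed_core_iff[of k s] by auto
  then have "clamp3 s = 0 \<or> clamp3 s = 1" by (auto simp: clamp3_def)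
  then show ?thesis using ks by (auto simp: wind_handle)
qed (simp add: wind_def)

lemma wind_covering: "covering_space (heis_total X (wind i) (wind j)) fst X"
proof (rule heis_covering)
  fix x assume x: "x \<in> X"
  let ?U = "X - (\<Union>k<n. ed k ` {1/3..2/3})"
  show "\<exists>T f' g'. x \<in> T \<and> openin (top_of_set X) T \<and> continuous_on T f' \<and> continuous_on T g' \<and>
     (\<forall>y\<in>T. f' y - wind i y \<in> \<int> \<and> g' y - wind j y \<in> \<int> \<and> f' y * (wind j y - g' y) \<in> \<int>)"
  proof (cases "x \<in> ?U")
    case True
    have oU: "openin (top_of_set X) ?U" using closedin_middles by (simp add: closedin_def)
    have "?U \<subseteq> core X n ed" unfolding core_def by fastforce
    then have "wind i y \<in> {0,1} \<and> wind j y \<in> {0,1}" if "y \<in> ?U" for y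
      using wind_core that by blast
    \<comment> \<open>Away from the closed middle thirds both functions are integers and are
      represented by 0; on an open handle they are continuous and represent themselves.\<close>
    then have "\<forall>y\<in>?U. 0 - wind i y \<in> \<int> \<and> 0 - wind j y \<in> \<int> \<and> 0 * (wind j y - 0) \<in> \<int>"
      by fastforce
    then show ?thesis
      using True oU by (intro exI[of _ ?U] exI[of _ "\<lambda>_. 0"]) auto
  next
    case False
    then obtain k s where k: "k < n" and s: "s \<in> {1/3..2/3}" "x = ed k s" using x by auto
    let ?O = "ed k ` {0<..<1}"
    have xO: "x \<in> ?O" unfolding s(2) using s(1) by (intro imageI) auto
    have oO: "openin (top_of_set X) ?O" by (rule ed_open[OF k]) auto
    have c: "continuous_on ?O (\<lambda>x. clamp3 (handle_coord x))"
      by (rule continuous_on_compose2[OF continuous_clamp3[of UNIV] continuous_handle_coord[OF k]]) auto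
    have wc: "continuous_on ?O (wind i)" for i
    proof (rule continuous_on_eq[of _ "if k = i then (\<lambda>x. clamp3 (handle_coord x)) else (\<lambda>_. 0)"])
      fix x assume "x \<in> ?O"
      then obtain s where s: "s \<in> {0<..<1}" "x = ed k s" by blast
      then show "(if k = i then (\<lambda>x. clamp3 (handle_coord x)) else (\<lambda>_. 0)) x = wind i x"
        by (simp only: wind_handle[OF k] handle_coord[OF k] if_distribR)
    qed (use c in auto)
    show ?thesis
      using xO oO wc by (intro exI[of _ ?O] exI[of _ "wind i"] exI[of _ "wind j"]) auto
  qed
qed

lemma heis_total_core:
  assumes "x \<in> core X n ed"
  shows "(x,a,b,c) \<in> heis_total X (wind i) (wind j) \<longleftrightarrow> a \<in> \<int> \<and> b \<in> \<int> \<and> c \<in> \<int>"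
proof -
  have x: "x \<in> X" using assms core_sub by auto
  have "wind i x = 0 \<or> wind i x = 1" "wind j x = 0 \<or> wind j x = 1"
    using wind_core[OF assms] by auto
  moreover have "u - 1 \<in> \<int> \<longleftrightarrow> u \<in> \<int>" for u :: real
    using Ints_add[of "u - 1" 1] by (auto intro: Ints_diff)
  moreover have "c - a \<in> \<int> \<longleftrightarrow> c \<in> \<int>" if "a \<in> \<int>"
    using Ints_add[OF _ that, of "c - a"] Ints_diff[OF _ that, of c] unfolding diff_add_cancel by blast
  ultimately show ?thesis
    using x unfolding heis_total_def by auto
qed

definition heis_end :: "nat \<Rightarrow> nat \<Rightarrow> (real \<Rightarrow> 'a) \<Rightarrow> real \<times> real \<times> real" where
  "heis_end i j p = snd (lift_end (heis_total X (wind i) (wind j)) fst p (v0,0,0,0))"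

lemma heis_base: "(v0,0,0,0) \<in> heis_total X (wind i) (wind j)"
  by (simp add: heis_total_core[OF v0_core])

lemma heis_end_ints:
  assumes p: "p \<in> loops_at X v0"
  obtains a b c :: int where "heis_end i j p = (of_int a, of_int b, of_int c)"
    "lift_end (heis_total X (wind i) (wind j)) fst p (v0,0,0,0) = (v0, of_int a, of_int b, of_int c)"
proof -
  note P = loops_atD[OF p]
  let ?e = "lift_end (heis_total X (wind i) (wind j)) fst p (v0,0,0,0)"
  have "?e \<in> heis_total X (wind i) (wind j)" "fst ?e = v0"
    using lift_end_in[OF wind_covering P(1,2) heis_base] P by auto
  moreover obtain a b c where e: "?e = (v0,a,b,c)" using calculation(2) by (cases ?e) auto
  ultimately have "a \<in> \<int>" "b \<in> \<int>" "c \<in> \<int>" using heis_total_core[OF v0_core] by auto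
  then show ?thesis using that e by (auto simp: heis_end_def elim!: Ints_cases)
qed

text \<open>By equivariance, the lift of \<open>q\<close> from the end of \<open>p\<close> is a
  translate of its lift from the base. The term \<open>a * b'\<close> is the origin of the quadratic
  law of \<open>\<theta>\<close>.\<close>

lemma heis_end_join:
  assumes p: "p \<in> loops_at X v0" "heis_end i j p = (of_int a, of_int b, of_int c)"
    and q: "q \<in> loops_at X v0" "heis_end i j q = (of_int a', of_int b', of_int c')"
  shows "heis_end i j (p +++ q) = (of_int (a + a'), of_int (b + b'), of_int (c + c' + a * b'))"
proof -
  let ?Z = "heis_total X (wind i) (wind j)"
  note P = loops_atD[OF p(1)] and Q = loops_atD[OF q(1)]
  have ep: "lift_end ?Z fst p (v0,0,0,0) = heis_act (a,b,c) (v0,0,0,0)"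
    using heis_end_ints[OF p(1), of i j] p(2) by (auto simp: heis_act_def)
  have eq: "lift_end ?Z fst q (v0,0,0,0) = (v0, of_int a', of_int b', of_int c')"
    using heis_end_ints[OF q(1), of i j] q(2) by auto
  have "lift_end ?Z fst (p +++ q) (v0,0,0,0) = lift_end ?Z fst q (lift_end ?Z fst p (v0,0,0,0))"
    by (rule lift_end_join[OF wind_covering P(1,2) heis_base]) (use P Q in auto)
  also have "\<dots> = heis_act (a,b,c) (v0, of_int a', of_int b', of_int c')"
    unfolding ep eq[symmetric] by (rule lift_end_heis_act[OF wind_covering Q(1,2) heis_base]) (use Q in auto)
  finally show ?thesis by (simp add: heis_end_def heis_act_def)
qed

lemma heis_end_homotopic:
  assumes "homotopic_paths X p q" "p \<in> loops_at X v0"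
  shows "heis_end i j p = heis_end i j q"
  unfolding heis_end_def
  using lift_end_homotopic[OF wind_covering assms(1) heis_base] loops_atD[OF assms(2)] by simp

text \<open>The uncontracted middle third has an explicit lift, and the lifted contraction carries
  it to a lift of \<open>gam k\<close>. The ends remain in the core, where the fibre coordinates are
  integers and hence cannot move.\<close>

lemma heis_end_gam:
  assumes k: "k < n"
  shows "heis_end i j (gam k) = (of_bool (k = i), of_bool (k = j), of_bool (k = i \<and> k = j))"
proof -
  let ?Z = "heis_total X (wind i) (wind j)"
  let ?H = "\<lambda>z. K (fst z, ed k ((1 + snd z) / 3))"
  let ?d = "of_bool (k = i) :: real" and ?e = "of_bool (k = j) :: real"
  \<comment> \<open>The third coordinate is the product of the other two, as integrality of
    \<open>c - a * g\<close> allows. For \<open>k = i\<close> and \<open>k = j\<close> it ends at 1,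
    which is what the diagonal correction removes later.\<close>
  let ?l = "\<lambda>s. (ed k ((1 + s) / 3), ?d * s, ?e * s, ?d * ?e * s * s)"
  have lZ: "?l s \<in> ?Z" if "s \<in> {0..1}" for s
  proof -
    have "(1 + s) / 3 \<in> {0<..<1}" "clamp3 ((1 + s) / 3) = s" using that by (auto simp: clamp3_def field_simps)
    then show ?thesis
      using ed_in[OF k, of "(1 + s) / 3"] by (auto simp: heis_total_def wind_handle[OF k])
  qed
  have third: "(1 + s) / 3 \<in> {0..1}" if "s \<in> {0..1}" for s :: real using that by auto
  obtain L where L: "continuous_on ({0..1} \<times> {0..1}) L" "L \<in> ({0..1} \<times> {0..1}) \<rightarrow> ?Z"
     "\<And>s. s \<in> {0..1} \<Longrightarrow> L (0,s) = ?l s" "\<And>t s. t \<in> {0..1} \<Longrightarrow> s \<in> {0..1} \<Longrightarrow> fst (L (t,s)) = ?H (t,s)"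
  proof (rule covering_lift_homotopy[OF wind_covering, of "{0..1}" ?H ?l])
    show "continuous_on ({0..1} \<times> {0..1}) ?H"
      by (rule K_compose_handle[OF k]) (auto intro!: continuous_intros)
    show "?H \<in> {0..1} \<times> {0..1} \<rightarrow> X" using K_in ed_in[OF k] by auto
    show "continuous_on {0..1} ?l"
      by (intro continuous_intros continuous_on_compose2[OF ed_cont[OF k]]) auto
    show "?l \<in> {0..1} \<rightarrow> ?Z" using lZ by auto
    show "fst (?l s) = ?H (0,s)" if "s \<in> {0..1}" for s using K_0 ed_in[OF k third[OF that]] by simp
  qed blast
  have side: "L (1,s) = (v0, ?d * s, ?e * s, ?d * ?e * s * s)" if s: "s = 0 \<or> s = 1" for s
  proof -
    have sI: "s \<in> {0..1}" using s by auto
    have co: "ed k ((1 + s) / 3) \<in> core X n ed" using ed_core_iff[OF k third[OF sI]] s by auto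
    let ?c = "\<lambda>t. (K (t, ed k ((1 + s) / 3)), ?d * s, ?e * s, ?d * ?e * s * s)"
    have "L (1,s) = ?c 1"
    proof (rule covering_lift_unique[OF wind_covering, where Y = "{0..1::real}" and a = 0 and f = "\<lambda>t. L (t,s)" and g = ?c])
      show "continuous_on {0..1} (\<lambda>t. L (t,s))"
        by (rule continuous_on_compose2[OF L(1)]) (use sI in \<open>auto intro!: continuous_intros\<close>)
      show "continuous_on {0..1} ?c"
        using K_compose_handle[OF k, of "{0..1}" "\<lambda>t. t" "\<lambda>_. (1 + s) / 3"] third[OF sI] by (auto intro!: continuous_intros)
      show "(\<lambda>t. L (t,s)) \<in> {0..1} \<rightarrow> ?Z" using L(2) sI by auto
      show "?c \<in> {0..1} \<rightarrow> ?Z"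
      proof
        fix t :: real assume "t \<in> {0..1}"
        then show "?c t \<in> ?Z" using heis_total_core[OF K_core[OF _ co]] s by auto
      qed
      show "fst (L (t,s)) = fst (?c t)" if "t \<in> {0..1}" for t using L(4)[OF that sI] by simp
      show "L (0,s) = ?c 0" using L(3)[OF sI] K_0 ed_in[OF k third[OF sI]] by simp
    qed auto
    then show ?thesis using K_1[OF co] by simp
  qed
  have "lift_end ?Z fst (gam k) (v0,0,0,0) = pathfinish (\<lambda>s. L (1,s))"
  proof (rule lift_end_eq[OF wind_covering])
    show "path (\<lambda>s. L (1,s))"
      unfolding path_def by (rule continuous_on_compose2[OF L(1)]) (auto intro!: continuous_intros)
    show "path_image (\<lambda>s. L (1,s)) \<subseteq> ?Z" using L(2) by (auto simp: path_image_def)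
    show "pathstart (\<lambda>s. L (1,s)) = (v0,0,0,0)" using side[of 0] by (simp add: pathstart_def)
    show "fst (L (1,t)) = gam k t" if "t \<in> {0..1}" for t using L(4)[of 1 t] that by (simp add: gam_def)
  qed
  then show ?thesis
    using side[of 1] by (auto simp: heis_end_def pathfinish_def)
qed

text \<open>The third coordinate is corrected on the diagonal so that it vanishes on all generators.\<close>

proposition heisenberg_invariants:
  obtains \<alpha> :: "nat \<Rightarrow> (real \<Rightarrow> 'a) set \<Rightarrow> int" and \<theta> :: "nat \<Rightarrow> nat \<Rightarrow> (real \<Rightarrow> 'a) set \<Rightarrow> int" where
    "\<And>i u v. u \<in> carrier (pi1 X v0) \<Longrightarrow> v \<in> carrier (pi1 X v0) \<Longrightarrow> \<alpha> i (u \<otimes>\<^bsub>pi1 X v0\<^esub> v) = \<alpha> i u + \<alpha> i v"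
    "\<And>i j u v. u \<in> carrier (pi1 X v0) \<Longrightarrow> v \<in> carrier (pi1 X v0) \<Longrightarrow>
       \<theta> i j (u \<otimes>\<^bsub>pi1 X v0\<^esub> v) = \<theta> i j u + \<theta> i j v + \<alpha> i u * \<alpha> j v"
    "\<And>i k. k < n \<Longrightarrow> \<alpha> i (hclass X (gam k)) = of_bool (k = i)"
    "\<And>i j k. k < n \<Longrightarrow> \<theta> i j (hclass X (gam k)) = 0"
proof -
  interpret G: group "pi1 X v0" by (rule pi1_group[OF v0_in])
  define h where "h i j A = heis_end i j (SOME p. p \<in> loops_at X v0 \<and> A = hclass X p)" for i j A
  have h: "h i j (hclass X p) = heis_end i j p" if p: "p \<in> loops_at X v0" for i j p
  proof -
    let ?q = "SOME q. q \<in> loops_at X v0 \<and> hclass X p = hclass X q"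
    have q: "?q \<in> loops_at X v0 \<and> hclass X p = hclass X ?q"
      by (rule someI[of _ p]) (use p in simp)
    then have "homotopic_paths X p ?q" using hclass_eq_iff[OF p] by simp
    then show ?thesis using heis_end_homotopic[OF _ p] by (simp add: h_def)
  qed
  define a where "a i j A = \<lfloor>fst (h i j A)\<rfloor>" for i j A
  define b where "b i j A = \<lfloor>fst (snd (h i j A))\<rfloor>" for i j A
  define c where "c i j A = \<lfloor>snd (snd (h i j A))\<rfloor>" for i j A
  have abc: "a i j (u \<otimes>\<^bsub>pi1 X v0\<^esub> v) = a i j u + a i j v \<and> b i j (u \<otimes>\<^bsub>pi1 X v0\<^esub> v) = b i j u + b i j v \<and>
     c i j (u \<otimes>\<^bsub>pi1 X v0\<^esub> v) = c i j u + c i j v + a i j u * b i j v"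
    if uv: "u \<in> carrier (pi1 X v0)" "v \<in> carrier (pi1 X v0)" for i j u v
  proof -
    obtain p q where pq: "p \<in> loops_at X v0" "q \<in> loops_at X v0" "u = hclass X p" "v = hclass X q"
      using uv by (auto simp: pi1_carrier)
    obtain x y z :: int where P: "heis_end i j p = (of_int x, of_int y, of_int z)" by (rule heis_end_ints[OF pq(1)])
    obtain x' y' z' :: int where Q: "heis_end i j q = (of_int x', of_int y', of_int z')" by (rule heis_end_ints[OF pq(2)])
    have PQ: "h i j (hclass X (p +++ q)) = (of_int (x + x'), of_int (y + y'), of_int (z + z' + x * y'))"
      using h[of "p +++ q" i j] heis_end_join[OF pq(1) P pq(2) Q] pq by simp
    show ?thesis
      unfolding pq(3,4) pi1_mult[OF pq(1,2)] a_def b_def c_def PQ h[OF pq(1)] h[OF pq(2)] P Q fst_conv snd_conv floor_of_int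
      by simp
  qed
  have gam: "a i j (hclass X (gam k)) = of_bool (k = i)" "b i j (hclass X (gam k)) = of_bool (k = j)"
    "c i j (hclass X (gam k)) = of_bool (k = i \<and> k = j)" if "k < n" for i j k
    unfolding a_def b_def c_def h[OF gam_loop[OF that]] heis_end_gam[OF that] by auto
  have uniq: "f u = f' u"
    if f: "\<And>u v. u \<in> carrier (pi1 X v0) \<Longrightarrow> v \<in> carrier (pi1 X v0) \<Longrightarrow> f (u \<otimes>\<^bsub>pi1 X v0\<^esub> v) = f u + f v"
      and f': "\<And>u v. u \<in> carrier (pi1 X v0) \<Longrightarrow> v \<in> carrier (pi1 X v0) \<Longrightarrow> f' (u \<otimes>\<^bsub>pi1 X v0\<^esub> v) = f' u + f' v"
      and gen: "\<And>k. k < n \<Longrightarrow> f (hclass X (gam k)) = f' (hclass X (gam k))" and u: "u \<in> carrier (pi1 X v0)"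
    for f f' :: "(real \<Rightarrow> 'a) set \<Rightarrow> int" and u
  proof -
    have one0: "f \<one>\<^bsub>pi1 X v0\<^esub> = 0" if "\<And>u v. u \<in> carrier (pi1 X v0) \<Longrightarrow> v \<in> carrier (pi1 X v0) \<Longrightarrow> f (u \<otimes>\<^bsub>pi1 X v0\<^esub> v) = f u + f v"
      for f :: "(real \<Rightarrow> 'a) set \<Rightarrow> int" using that[of "\<one>\<^bsub>pi1 X v0\<^esub>" "\<one>\<^bsub>pi1 X v0\<^esub>"] by simp
    have inv0: "f (inv\<^bsub>pi1 X v0\<^esub> u) = - f u" if "\<And>u v. u \<in> carrier (pi1 X v0) \<Longrightarrow> v \<in> carrier (pi1 X v0) \<Longrightarrow> f (u \<otimes>\<^bsub>pi1 X v0\<^esub> v) = f u + f v"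
      "u \<in> carrier (pi1 X v0)" for f :: "(real \<Rightarrow> 'a) set \<Rightarrow> int" and u
      using that(1)[of "inv\<^bsub>pi1 X v0\<^esub> u" u] that(2) one0[OF that(1)] by simp
    have "u \<in> generate (pi1 X v0) ((\<lambda>k. hclass X (gam k)) ` {..<n})"
      using u pi1_generated by (simp add: gens_def)
    then show ?thesis
    proof (induction rule: generate.induct)
      case one then show ?case using one0[of f, OF f] one0[of f', OF f'] by simp
    next
      case (incl h) then show ?case using gen by auto
    next
      case (inv h)
      then obtain k where k: "k < n" "h = hclass X (gam k)" by auto
      then have "h \<in> carrier (pi1 X v0)" using gam_loop by simp
      then show ?case using inv0[of f, OF f] inv0[of f', OF f'] gen k by simp
    next
      case (eng h1 h2)
      then have "h1 \<in> carrier (pi1 X v0)" "h2 \<in> carrier (pi1 X v0)"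
        using pi1_generated by (auto simp: gens_def)
      then show ?case using f f' eng by simp
    qed
  qed
  \<comment> \<open>Each pair of indices has its own covering, so the first coordinate could depend
    on \<open>j\<close>. It does not, since additive functions are determined on the
    generators.\<close>
  have ab: "a i j u = a i i u" "b i j u = a j j u" if "u \<in> carrier (pi1 X v0)" for i j u
    by (rule uniq[OF _ _ _ that]; use abc gam in simp)+
  show ?thesis
  proof (rule that[of "\<lambda>i. a i i" "\<lambda>i j u. c i j u - (if i = j then a i i u else 0)"])
    fix i j u v assume uv: "u \<in> carrier (pi1 X v0)" "v \<in> carrier (pi1 X v0)"
    show "a i i (u \<otimes>\<^bsub>pi1 X v0\<^esub> v) = a i i u + a i i v" using abc[OF uv] by simp
    show "c i j (u \<otimes>\<^bsub>pi1 X v0\<^esub> v) - (if i = j then a i i (u \<otimes>\<^bsub>pi1 X v0\<^esub> v) else 0) =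
      c i j u - (if i = j then a i i u else 0) + (c i j v - (if i = j then a i i v else 0)) + a i i u * a j j v"
      using abc[OF uv] ab[OF uv(1), of i j] ab[OF uv(2), of i j] by auto
  qed (use gam in auto)
qed

end

section \<open>Endomorphisms of a group with Heisenberg invariants\<close>

text \<open>\<open>\<alpha>\<close> is the abelianisation of a group that is freely generated by the \<open>x k\<close>, and \<open>\<theta>\<close> is the
  quadratic part of its Magnus expansion.\<close>

locale magnus_group = group G for G :: "('g, 'm) monoid_scheme" (structure) +
  fixes n :: nat and x :: "nat \<Rightarrow> 'g" and \<alpha> :: "nat \<Rightarrow> 'g \<Rightarrow> int" and \<theta> :: "nat \<Rightarrow> nat \<Rightarrow> 'g \<Rightarrow> int"
  assumes n2: "n \<ge> 2" and x_closed: "k < n \<Longrightarrow> x k \<in> carrier G"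
    and generated: "carrier G = generate G (x ` {..<n})"
    and alpha_mult: "u \<in> carrier G \<Longrightarrow> v \<in> carrier G \<Longrightarrow> \<alpha> i (u \<otimes> v) = \<alpha> i u + \<alpha> i v"
    and theta_mult: "u \<in> carrier G \<Longrightarrow> v \<in> carrier G \<Longrightarrow> \<theta> i j (u \<otimes> v) = \<theta> i j u + \<theta> i j v + \<alpha> i u * \<alpha> j v"
    and alpha_x: "k < n \<Longrightarrow> \<alpha> i (x k) = of_bool (k = i)"
    and theta_x: "k < n \<Longrightarrow> \<theta> i j (x k) = 0"
begin

lemma gen_induct [consumes 1, case_names one mult]:
  assumes u: "u \<in> carrier G" and one: "P \<one>"
    and mult: "\<And>k u. k < n \<Longrightarrow> u \<in> carrier G \<Longrightarrow> P u \<Longrightarrow> P (x k \<otimes> u) \<and> P (inv (x k) \<otimes> u)"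
  shows "P u"
proof -
  have "\<forall>v\<in>carrier G. P v \<longrightarrow> P (u \<otimes> v)"
    using u[unfolded generated]
  proof (induction rule: generate.induct)
    case one then show ?case by simp
  next
    case (incl h) then show ?case using mult by auto
  next
    case (inv h) then show ?case using mult by auto
  next
    case (eng h1 h2)
    then have "h1 \<in> carrier G" "h2 \<in> carrier G" by (auto simp: generated)
    then show ?case using eng.IH by (auto simp: m_assoc)
  qed
  then show ?thesis using one u r_one by fastforce
qed

lemma alpha_one: "\<alpha> i \<one> = 0"
  using alpha_mult[of \<one> \<one> i] by simp

lemma alpha_inv: "u \<in> carrier G \<Longrightarrow> \<alpha> i (inv u) = - \<alpha> i u"
  using alpha_mult[of "inv u" u i] alpha_one by simp

lemma theta_one: "\<theta> i j \<one> = 0"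
  using theta_mult[of \<one> \<one> i j] alpha_one by simp

lemma theta_inv: "u \<in> carrier G \<Longrightarrow> \<theta> i j (inv u) = \<alpha> i u * \<alpha> j u - \<theta> i j u"
  using theta_mult[of "inv u" u i j] theta_one alpha_inv by simp

lemma alpha_pow: "u \<in> carrier G \<Longrightarrow> \<alpha> i (u [^] (k::int)) = k * \<alpha> i u"
proof -
  assume u: "u \<in> carrier G"
  have nat: "\<alpha> i (u [^] (m::nat)) = int m * \<alpha> i u" for m
    by (induction m) (use u in \<open>auto simp: alpha_mult alpha_one algebra_simps\<close>)
  show ?thesis
    by (cases k rule: int_cases2) (use nat u in \<open>auto simp: int_pow_neg_int int_pow_int alpha_inv\<close>)
qed

text \<open>Both sides are additive and agree on the generators. So \<open>\<alpha>\<close> is the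
  universal additive invariant, on which the matrices of endomorphisms rest.\<close>

lemma additive_eq:
  fixes f :: "'g \<Rightarrow> int"
  assumes f: "\<And>u v. u \<in> carrier G \<Longrightarrow> v \<in> carrier G \<Longrightarrow> f (u \<otimes> v) = f u + f v" and u: "u \<in> carrier G"
  shows "f u = (\<Sum>k<n. \<alpha> k u * f (x k))"
  using u
proof (induction rule: gen_induct)
  case one
  then show ?case using f[of \<one> \<one>] by (simp add: alpha_one)
next
  case (mult k u)
  have 0: "f \<one> = 0" using f[of \<one> \<one>] by simp
  have i: "f (inv (x k)) = - f (x k)"
    using f[of "inv (x k)" "x k"] mult(1) x_closed 0 by simp
  have s: "(\<Sum>j<n. of_bool (k = j) * f (x j)) = f (x k)"
    using mult(1) by (simp add: of_bool_def if_distrib[of "\<lambda>c. c * _"] cong: if_cong)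
  show ?case
    using mult x_closed[OF mult(1)] s
    by (simp add: f alpha_mult alpha_inv alpha_x i distrib_right left_diff_distrib sum.distrib sum_subtractf)
qed

text \<open>For a second generator \<open>x j\<close>, the quadratic law contributes
  \<open>\<alpha> i g\<close> to \<open>\<theta> i j\<close> of \<open>g \<otimes> x j\<close> and 0
  to that of \<open>x j \<otimes> g\<close>. The bound \<open>n2\<close> supplies the index
  \<open>j\<close>.\<close>

lemma central_alpha:
  assumes g: "g \<in> carrier G" and c: "\<And>k. k < n \<Longrightarrow> g \<otimes> x k = x k \<otimes> g" and i: "i < n"
  shows "\<alpha> i g = 0"
proof -
  obtain j where j: "j < n" "j \<noteq> i"
  proof (cases "i = 0")
    case True then show ?thesis using that[of 1] n2 by auto
  next
    case False then show ?thesis using that[of 0] n2 by auto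
  qed
  have "\<theta> i j (g \<otimes> x j) = \<theta> i j (x j \<otimes> g)" using c[OF j(1)] by simp
  then show ?thesis
    using j x_closed[OF j(1)] g by (simp add: theta_mult alpha_x theta_x)
qed

text \<open>Row \<open>k\<close> belongs to the image of generator \<open>k\<close>; composition of
  maps therefore multiplies the matrices in reverse order.\<close>

definition jac :: "('g \<Rightarrow> 'g) \<Rightarrow> nat \<Rightarrow> nat \<Rightarrow> int" where
  "jac \<phi> k a = \<alpha> a (\<phi> (x k))"

lemma alpha_hom:
  assumes \<phi>: "\<phi> \<in> hom G G" and u: "u \<in> carrier G"
  shows "\<alpha> a (\<phi> u) = (\<Sum>k<n. \<alpha> k u * jac \<phi> k a)"
proof -
  have "(\<lambda>u. \<alpha> a (\<phi> u)) u = (\<Sum>k<n. \<alpha> k u * (\<lambda>u. \<alpha> a (\<phi> u)) (x k))"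
    by (rule additive_eq[OF _ u]) (use \<phi> in \<open>auto simp: hom_def alpha_mult Pi_iff\<close>)
  then show ?thesis by (simp add: jac_def)
qed

text \<open>The difference from the bilinear transformation of \<open>\<theta>\<close> is additive
  in \<open>u\<close>, since the cross terms cancel. It is hence determined by the generators, where
  \<open>\<theta>\<close> vanishes and only \<open>\<theta> a b (\<phi> (x k))\<close>
  remains.\<close>

lemma theta_hom:
  assumes \<phi>: "\<phi> \<in> hom G G" and u: "u \<in> carrier G"
  shows "\<theta> a b (\<phi> u) = (\<Sum>i<n. \<Sum>j<n. jac \<phi> i a * jac \<phi> j b * \<theta> i j u) + (\<Sum>k<n. \<alpha> k u * \<theta> a b (\<phi> (x k)))"
proof -
  define f where "f u = \<theta> a b (\<phi> u) - (\<Sum>i<n. \<Sum>j<n. jac \<phi> i a * jac \<phi> j b * \<theta> i j u)" for u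
  have "f u = (\<Sum>k<n. \<alpha> k u * f (x k))"
  proof (rule additive_eq[OF _ u])
    fix u v assume uv: "u \<in> carrier G" "v \<in> carrier G"
    have c: "\<phi> u \<in> carrier G" "\<phi> v \<in> carrier G" "\<phi> (u \<otimes> v) = \<phi> u \<otimes> \<phi> v"
      using \<phi> uv by (auto simp: hom_def Pi_iff)
    have "(\<Sum>i<n. \<Sum>j<n. jac \<phi> i a * jac \<phi> j b * (\<alpha> i u * \<alpha> j v)) = \<alpha> a (\<phi> u) * \<alpha> b (\<phi> v)"
      unfolding alpha_hom[OF \<phi> uv(1)] alpha_hom[OF \<phi> uv(2)] sum_product
      by (intro sum.cong refl) (simp add: algebra_simps)
    then show "f (u \<otimes> v) = f u + f v"
      unfolding f_def c(3) theta_mult[OF c(1,2)]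
      by (simp add: theta_mult[OF uv] distrib_left sum.distrib)
  qed
  moreover have "f (x k) = \<theta> a b (\<phi> (x k))" if "k < n" for k
    using that by (simp add: f_def theta_x)
  ultimately have "f u = (\<Sum>k<n. \<alpha> k u * \<theta> a b (\<phi> (x k)))"
    by simp
  then show ?thesis by (simp add: f_def)
qed

lemma jac_compose:
  assumes "\<phi> \<in> hom G G" "\<psi> \<in> hom G G" "k < n"
  shows "jac (\<phi> \<circ> \<psi>) k b = (\<Sum>a<n. jac \<psi> k a * jac \<phi> a b)"
proof -
  have "\<psi> (x k) \<in> carrier G" using assms x_closed by (auto simp: hom_def Pi_iff)
  then show ?thesis unfolding jac_def[of "\<phi> \<circ> \<psi>"] jac_def[of \<psi>] by (simp add: alpha_hom[OF assms(1)])
qed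

text \<open>\<open>kappa\<close> uses an integral inverse of the matrix, not an inverse of
  \<open>\<phi>\<close>. For maps induced by equivalences the matrix of a homotopy inverse
  serves.\<close>

definition jac_inverse :: "('g \<Rightarrow> 'g) \<Rightarrow> (nat \<Rightarrow> nat \<Rightarrow> int) \<Rightarrow> bool" where
  "jac_inverse \<phi> N \<longleftrightarrow> (\<forall>k<n. \<forall>l<n. (\<Sum>a<n. jac \<phi> k a * N a l) = of_bool (k = l)) \<and>
     (\<forall>k<n. \<forall>l<n. (\<Sum>a<n. N k a * jac \<phi> a l) = of_bool (k = l))"

text \<open>Morita's crossed homomorphism: the quadratic part of \<open>\<phi>\<close>, with its first index moved back by
  \<open>\<phi>\<inverse>\<close> and contracted.\<close>

definition kappa :: "('g \<Rightarrow> 'g) \<Rightarrow> (nat \<Rightarrow> nat \<Rightarrow> int) \<Rightarrow> nat \<Rightarrow> int" where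
  "kappa \<phi> N b = (\<Sum>a<n. \<Sum>k<n. N a k * \<theta> a b (\<phi> (x k)))"

lemma sum_delta: "k < n \<Longrightarrow> (\<Sum>j<n. of_bool (k = j) * f j) = (f k :: int)" "k < n \<Longrightarrow> (\<Sum>j<n. of_bool (j = k) * f j) = (f k :: int)"
  by (simp_all add: of_bool_def if_distrib[of "\<lambda>c. c * _"] cong: if_cong)

lemma sum_delta': "k < n \<Longrightarrow> (\<Sum>j<n. f j * of_bool (k = j)) = (f k :: int)" "k < n \<Longrightarrow> (\<Sum>j<n. f j * of_bool (j = k)) = (f k :: int)"
  using sum_delta[of k f] by (simp_all add: mult.commute)

lemma jac_inverse_unique:
  assumes N: "jac_inverse \<phi> N" and N': "jac_inverse \<psi> N'" and eq: "\<And>k a. k < n \<Longrightarrow> a < n \<Longrightarrow> jac \<phi> k a = jac \<psi> k a"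
    and kl: "k < n" "l < n"
  shows "N k l = N' k l"
proof -
  have "N k l = (\<Sum>b<n. N k b * of_bool (b = l))"
    using kl sum_delta'(2)[of l "N k"] by simp
  also have "\<dots> = (\<Sum>b<n. N k b * (\<Sum>a<n. jac \<psi> b a * N' a l))"
    using N' kl by (intro sum.cong refl) (simp add: jac_inverse_def)
  also have "\<dots> = (\<Sum>b<n. \<Sum>a<n. N k b * (jac \<phi> b a * N' a l))"
    using eq by (simp add: sum_distrib_left)
  also have "\<dots> = (\<Sum>a<n. \<Sum>b<n. N k b * (jac \<phi> b a * N' a l))"
    by (rule sum.swap)
  also have "\<dots> = (\<Sum>a<n. (\<Sum>b<n. N k b * jac \<phi> b a) * N' a l)"
    by (simp add: sum_distrib_right mult.assoc)
  also have "\<dots> = (\<Sum>a<n. of_bool (k = a) * N' a l)"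
    using N kl by (intro sum.cong refl) (simp add: jac_inverse_def)
  also have "\<dots> = N' k l" using kl sum_delta(1)[of k "\<lambda>a. N' a l"] by simp
  finally show ?thesis .
qed

lemma jac_inverse_compose:
  assumes \<phi>: "\<phi> \<in> hom G G" "jac_inverse \<phi> N" and \<psi>: "\<psi> \<in> hom G G" "jac_inverse \<psi> N'"
  shows "jac_inverse (\<phi> \<circ> \<psi>) (\<lambda>a k. \<Sum>c<n. N a c * N' c k)"
  unfolding jac_inverse_def
proof (intro conjI allI impI)
  fix k l assume kl: "k < n" "l < n"
  have "(\<Sum>a<n. jac (\<phi> \<circ> \<psi>) k a * (\<Sum>c<n. N a c * N' c l)) = (\<Sum>a<n. \<Sum>b<n. \<Sum>c<n. jac \<psi> k b * (jac \<phi> b a * N a c) * N' c l)"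
    using kl by (simp add: jac_compose[OF \<phi>(1) \<psi>(1)] sum_product mult.assoc)
  also have "\<dots> = (\<Sum>b<n. \<Sum>a<n. \<Sum>c<n. jac \<psi> k b * (jac \<phi> b a * N a c) * N' c l)"
    by (rule sum.swap)
  also have "\<dots> = (\<Sum>b<n. \<Sum>c<n. \<Sum>a<n. jac \<psi> k b * (jac \<phi> b a * N a c) * N' c l)"
    by (intro sum.cong refl sum.swap)
  also have "\<dots> = (\<Sum>b<n. \<Sum>c<n. jac \<psi> k b * of_bool (b = c) * N' c l)"
  proof (intro sum.cong refl)
    fix b c assume "b \<in> {..<n}" "c \<in> {..<n}"
    then have "(\<Sum>a<n. jac \<phi> b a * N a c) = of_bool (b = c)" using \<phi>(2) by (simp add: jac_inverse_def)
    then show "(\<Sum>a<n. jac \<psi> k b * (jac \<phi> b a * N a c) * N' c l) = jac \<psi> k b * of_bool (b = c) * N' c l"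
      by (simp only: sum_distrib_left[symmetric] sum_distrib_right[symmetric])
  qed
  also have "\<dots> = (\<Sum>b<n. jac \<psi> k b * N' b l)"
    using sum_delta(1) by (intro sum.cong refl) (simp add: mult.assoc sum_distrib_left[symmetric])
  also have "\<dots> = of_bool (k = l)" using \<psi>(2) kl by (simp add: jac_inverse_def)
  finally show "(\<Sum>a<n. jac (\<phi> \<circ> \<psi>) k a * (\<Sum>c<n. N a c * N' c l)) = of_bool (k = l)" .
next
  fix k l assume kl: "k < n" "l < n"
  have "(\<Sum>a<n. (\<Sum>c<n. N k c * N' c a) * jac (\<phi> \<circ> \<psi>) a l) = (\<Sum>a<n. \<Sum>c<n. \<Sum>b<n. N k c * (N' c a * jac \<psi> a b) * jac \<phi> b l)"
    using kl by (simp add: jac_compose[OF \<phi>(1) \<psi>(1)] sum_product mult.assoc)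
  also have "\<dots> = (\<Sum>c<n. \<Sum>a<n. \<Sum>b<n. N k c * (N' c a * jac \<psi> a b) * jac \<phi> b l)"
    by (rule sum.swap)
  also have "\<dots> = (\<Sum>c<n. \<Sum>b<n. \<Sum>a<n. N k c * (N' c a * jac \<psi> a b) * jac \<phi> b l)"
    by (intro sum.cong refl sum.swap)
  also have "\<dots> = (\<Sum>c<n. \<Sum>b<n. N k c * of_bool (c = b) * jac \<phi> b l)"
  proof (intro sum.cong refl)
    fix b c assume "c \<in> {..<n}" "b \<in> {..<n}"
    then have "(\<Sum>a<n. N' c a * jac \<psi> a b) = of_bool (c = b)" using \<psi>(2) by (simp add: jac_inverse_def)
    then show "(\<Sum>a<n. N k c * (N' c a * jac \<psi> a b) * jac \<phi> b l) = N k c * of_bool (c = b) * jac \<phi> b l"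
      by (simp only: sum_distrib_left[symmetric] sum_distrib_right[symmetric])
  qed
  also have "\<dots> = (\<Sum>c<n. N k c * jac \<phi> c l)"
    using sum_delta(1) by (intro sum.cong refl) (simp add: mult.assoc sum_distrib_left[symmetric])
  also have "\<dots> = of_bool (k = l)" using \<phi>(2) kl by (simp add: jac_inverse_def)
  finally show "(\<Sum>a<n. (\<Sum>c<n. N k c * N' c a) * jac (\<phi> \<circ> \<psi>) a l) = of_bool (k = l)" .
qed

text \<open>The law of a crossed homomorphism. Of the two terms in \<open>theta_hom\<close>, the
  linear one loses the matrix of \<open>\<psi>\<close> against \<open>N'\<close> and becomes
  \<open>kappa \<phi> N\<close>; in the quadratic one the first index cancels against
  \<open>N\<close>, and the matrix of \<open>\<phi>\<close> survives on the second.\<close>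

lemma kappa_compose:
  assumes \<phi>: "\<phi> \<in> hom G G" "jac_inverse \<phi> N" and \<psi>: "\<psi> \<in> hom G G" "jac_inverse \<psi> N'"
  shows "kappa (\<phi> \<circ> \<psi>) (\<lambda>a k. \<Sum>c<n. N a c * N' c k) b = kappa \<phi> N b + (\<Sum>j<n. kappa \<psi> N' j * jac \<phi> j b)"
proof -
  let ?NN = "\<lambda>a k. \<Sum>c<n. N a c * N' c k"
  have \<psi>x: "\<psi> (x k) \<in> carrier G" if "k < n" for k using \<psi> x_closed that by (auto simp: hom_def Pi_iff)
  have "kappa (\<phi> \<circ> \<psi>) ?NN b = (\<Sum>a<n. \<Sum>k<n. ?NN a k * (\<Sum>i<n. \<Sum>j<n. jac \<phi> i a * jac \<phi> j b * \<theta> i j (\<psi> (x k))))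
     + (\<Sum>a<n. \<Sum>k<n. ?NN a k * (\<Sum>l<n. jac \<psi> k l * \<theta> a b (\<phi> (x l))))"
    unfolding kappa_def sum.distrib[symmetric]
    by (intro sum.cong refl) (simp add: theta_hom[OF \<phi>(1) \<psi>x] distrib_left jac_def)
  also have "(\<Sum>a<n. \<Sum>k<n. ?NN a k * (\<Sum>l<n. jac \<psi> k l * \<theta> a b (\<phi> (x l)))) = kappa \<phi> N b"
    unfolding kappa_def
  proof (rule sum.cong[OF refl])
    fix a assume a: "a \<in> {..<n}"
    have "(\<Sum>k<n. ?NN a k * (\<Sum>l<n. jac \<psi> k l * \<theta> a b (\<phi> (x l)))) = (\<Sum>k<n. \<Sum>l<n. \<Sum>c<n. N a c * (N' c k * jac \<psi> k l) * \<theta> a b (\<phi> (x l)))"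
      by (simp add: sum_distrib_left sum_distrib_right mult.assoc)
    also have "\<dots> = (\<Sum>l<n. \<Sum>k<n. \<Sum>c<n. N a c * (N' c k * jac \<psi> k l) * \<theta> a b (\<phi> (x l)))"
      by (rule sum.swap)
    also have "\<dots> = (\<Sum>l<n. \<Sum>c<n. \<Sum>k<n. N a c * (N' c k * jac \<psi> k l) * \<theta> a b (\<phi> (x l)))"
      by (intro sum.cong refl sum.swap)
    also have "\<dots> = (\<Sum>l<n. \<Sum>c<n. N a c * of_bool (c = l) * \<theta> a b (\<phi> (x l)))"
    proof (intro sum.cong refl)
      fix l c assume "l \<in> {..<n}" "c \<in> {..<n}"
      then have "(\<Sum>k<n. N' c k * jac \<psi> k l) = of_bool (c = l)" using \<psi>(2) by (simp add: jac_inverse_def)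
      then show "(\<Sum>k<n. N a c * (N' c k * jac \<psi> k l) * \<theta> a b (\<phi> (x l))) = N a c * of_bool (c = l) * \<theta> a b (\<phi> (x l))"
        by (simp only: sum_distrib_left[symmetric] sum_distrib_right[symmetric])
    qed
    also have "\<dots> = (\<Sum>l<n. N a l * \<theta> a b (\<phi> (x l)))"
      using sum_delta'(2) by (intro sum.cong refl) (simp add: sum_distrib_right[symmetric])
    finally show "(\<Sum>k<n. ?NN a k * (\<Sum>l<n. jac \<psi> k l * \<theta> a b (\<phi> (x l)))) = (\<Sum>l<n. N a l * \<theta> a b (\<phi> (x l)))" .
  qed
  also have "(\<Sum>a<n. \<Sum>k<n. ?NN a k * (\<Sum>i<n. \<Sum>j<n. jac \<phi> i a * jac \<phi> j b * \<theta> i j (\<psi> (x k)))) = (\<Sum>j<n. kappa \<psi> N' j * jac \<phi> j b)"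
  proof -
    have "(\<Sum>a<n. \<Sum>k<n. ?NN a k * (\<Sum>i<n. \<Sum>j<n. jac \<phi> i a * jac \<phi> j b * \<theta> i j (\<psi> (x k))))
       = (\<Sum>a<n. \<Sum>k<n. \<Sum>i<n. (\<Sum>c<n. jac \<phi> i a * N a c * N' c k) * (\<Sum>j<n. jac \<phi> j b * \<theta> i j (\<psi> (x k))))"
    proof (intro sum.cong refl)
      fix a k
      have "q * (\<Sum>i<n. \<Sum>j<n. jac \<phi> i a * jac \<phi> j b * \<theta> i j (\<psi> (x k))) =
         (\<Sum>i<n. jac \<phi> i a * q * (\<Sum>j<n. jac \<phi> j b * \<theta> i j (\<psi> (x k))))" for q
        by (simp add: sum_distrib_left ac_simps)
      moreover have "(\<Sum>c<n. jac \<phi> i a * N a c * N' c k) = jac \<phi> i a * ?NN a k" for i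
        by (simp add: sum_distrib_left mult.assoc)
      ultimately show "?NN a k * (\<Sum>i<n. \<Sum>j<n. jac \<phi> i a * jac \<phi> j b * \<theta> i j (\<psi> (x k))) =
         (\<Sum>i<n. (\<Sum>c<n. jac \<phi> i a * N a c * N' c k) * (\<Sum>j<n. jac \<phi> j b * \<theta> i j (\<psi> (x k))))"
        by simp
    qed
    also have "\<dots> = (\<Sum>k<n. \<Sum>a<n. \<Sum>i<n. (\<Sum>c<n. jac \<phi> i a * N a c * N' c k) * (\<Sum>j<n. jac \<phi> j b * \<theta> i j (\<psi> (x k))))"
      by (rule sum.swap)
    also have "\<dots> = (\<Sum>k<n. \<Sum>i<n. \<Sum>a<n. (\<Sum>c<n. jac \<phi> i a * N a c * N' c k) * (\<Sum>j<n. jac \<phi> j b * \<theta> i j (\<psi> (x k))))"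
      by (intro sum.cong refl sum.swap)
    also have "\<dots> = (\<Sum>k<n. \<Sum>i<n. N' i k * (\<Sum>j<n. jac \<phi> j b * \<theta> i j (\<psi> (x k))))"
    proof (intro sum.cong refl)
      fix k i assume i: "k \<in> {..<n}" "i \<in> {..<n}"
      have "(\<Sum>a<n. \<Sum>c<n. jac \<phi> i a * N a c * N' c k) = (\<Sum>c<n. \<Sum>a<n. jac \<phi> i a * N a c * N' c k)"
        by (rule sum.swap)
      also have "\<dots> = (\<Sum>c<n. of_bool (i = c) * N' c k)"
      proof (intro sum.cong refl)
        fix c assume "c \<in> {..<n}"
        then have "(\<Sum>a<n. jac \<phi> i a * N a c) = of_bool (i = c)" using \<phi>(2) i by (simp add: jac_inverse_def)
        then show "(\<Sum>a<n. jac \<phi> i a * N a c * N' c k) = of_bool (i = c) * N' c k"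
          by (metis sum_distrib_right)
      qed
      also have "\<dots> = N' i k" using sum_delta(1)[of i "\<lambda>c. N' c k"] i by simp
      finally show "(\<Sum>a<n. (\<Sum>c<n. jac \<phi> i a * N a c * N' c k) * (\<Sum>j<n. jac \<phi> j b * \<theta> i j (\<psi> (x k)))) =
         N' i k * (\<Sum>j<n. jac \<phi> j b * \<theta> i j (\<psi> (x k)))"
        by (simp only: sum_distrib_right[symmetric])
    qed
    also have "\<dots> = (\<Sum>k<n. \<Sum>i<n. \<Sum>j<n. N' i k * \<theta> i j (\<psi> (x k)) * jac \<phi> j b)"
      by (simp add: sum_distrib_left ac_simps)
    also have "\<dots> = (\<Sum>i<n. \<Sum>k<n. \<Sum>j<n. N' i k * \<theta> i j (\<psi> (x k)) * jac \<phi> j b)"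
      by (rule sum.swap)
    also have "\<dots> = (\<Sum>i<n. \<Sum>j<n. \<Sum>k<n. N' i k * \<theta> i j (\<psi> (x k)) * jac \<phi> j b)"
      by (intro sum.cong refl sum.swap)
    also have "\<dots> = (\<Sum>j<n. \<Sum>i<n. \<Sum>k<n. N' i k * \<theta> i j (\<psi> (x k)) * jac \<phi> j b)"
      by (rule sum.swap)
    finally show ?thesis unfolding kappa_def by (simp add: sum_distrib_right)
  qed
  finally show ?thesis by (simp only: add.commute)
qed

section \<open>Inner automorphisms and balanced endomorphisms\<close>

abbreviation inner :: "'g \<Rightarrow> 'g \<Rightarrow> 'g" where
  "inner g u \<equiv> g \<otimes> u \<otimes> inv g"

lemma alpha_inner: "g \<in> carrier G \<Longrightarrow> u \<in> carrier G \<Longrightarrow> \<alpha> i (inner g u) = \<alpha> i u"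
  by (simp add: alpha_mult alpha_inv)

lemma inner_hom: "g \<in> carrier G \<Longrightarrow> inner g \<in> hom G G"
proof (rule homI)
  fix u v assume g: "g \<in> carrier G" and uv: "u \<in> carrier G" "v \<in> carrier G"
  have "inv g \<otimes> (g \<otimes> (v \<otimes> inv g)) = v \<otimes> inv g"
    using g uv by (simp add: m_assoc[symmetric])
  then show "inner g (u \<otimes> v) = inner g u \<otimes> inner g v"
    using g uv by (simp add: m_assoc)
qed auto

lemma jac_inner: "g \<in> carrier G \<Longrightarrow> k < n \<Longrightarrow> jac (inner g) k a = of_bool (k = a)"
  by (simp add: jac_def alpha_inner x_closed alpha_x)

lemma jac_inverse_inner: "g \<in> carrier G \<Longrightarrow> jac_inverse (inner g) (\<lambda>a k. of_bool (a = k))"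
  by (auto simp: jac_inverse_def jac_inner sum_delta)

text \<open>The quadratic part of the conjugation on generator \<open>k\<close> is \<open>\<alpha> a
  g * of_bool (k = b) - of_bool (k = a) * \<alpha> b g\<close>. In the sum over \<open>k = a\<close>
  the first term survives once and the second one \<open>n\<close> times.\<close>

lemma kappa_inner:
  assumes g: "g \<in> carrier G" and b: "b < n"
  shows "kappa (inner g) (\<lambda>a k. of_bool (a = k)) b = (1 - int n) * \<alpha> b g"
proof -
  have t: "\<theta> a b (inner g (x k)) = \<alpha> a g * of_bool (k = b) - of_bool (k = a) * \<alpha> b g" if "k < n" for a k
    using g x_closed[OF that] that
    by (simp add: theta_mult theta_inv theta_x alpha_mult alpha_inv alpha_x algebra_simps)
  have "kappa (inner g) (\<lambda>a k. of_bool (a = k)) b = (\<Sum>a<n. \<theta> a b (inner g (x a)))"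
    unfolding kappa_def by (intro sum.cong refl sum_delta(1)) auto
  also have "\<dots> = (\<Sum>a<n. of_bool (a = b) * \<alpha> a g - \<alpha> b g)"
    by (intro sum.cong refl) (simp add: t)
  also have "\<dots> = \<alpha> b g - int n * \<alpha> b g"
    using b by (simp add: sum_subtractf sum_delta)
  finally show ?thesis by (simp add: algebra_simps)
qed

text \<open>The zeros of the crossed homomorphism modulo \<open>r\<close>. The existential over
  \<open>N\<close> is harmless, because the entries of the inverse matrix are unique.\<close>

definition balanced :: "int \<Rightarrow> ('g \<Rightarrow> 'g) \<Rightarrow> bool" where
  "balanced r \<phi> \<longleftrightarrow> (\<exists>N. jac_inverse \<phi> N \<and> (\<forall>b<n. r dvd kappa \<phi> N b))"

lemma balanced_compose:
  assumes "\<phi> \<in> hom G G" "\<psi> \<in> hom G G" "balanced r \<phi>" "balanced r \<psi>"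
  shows "balanced r (\<phi> \<circ> \<psi>)"
proof -
  obtain N N' where N: "jac_inverse \<phi> N" "\<forall>b<n. r dvd kappa \<phi> N b" "jac_inverse \<psi> N'" "\<forall>b<n. r dvd kappa \<psi> N' b"
    using assms(3,4) by (auto simp: balanced_def)
  have "r dvd kappa (\<phi> \<circ> \<psi>) (\<lambda>a k. \<Sum>c<n. N a c * N' c k) b" if "b < n" for b
    unfolding kappa_compose[OF assms(1) N(1) assms(2) N(3)]
    using N(2,4) that by (intro dvd_add dvd_sum dvd_mult2) auto
  then show ?thesis
    using jac_inverse_compose[OF assms(1) N(1) assms(2) N(3)] unfolding balanced_def by blast
qed

lemma kappa_inner_compose:
  assumes \<phi>: "\<phi> \<in> hom G G" "jac_inverse \<phi> N" and g: "g \<in> carrier G"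
  shows "\<exists>N'. jac_inverse (inner g \<circ> \<phi>) N' \<and> (\<forall>b<n. kappa (inner g \<circ> \<phi>) N' b = (1 - int n) * \<alpha> b g + kappa \<phi> N b)"
proof (intro exI conjI allI impI)
  show "jac_inverse (inner g \<circ> \<phi>) (\<lambda>a k. \<Sum>c<n. of_bool (a = c) * N c k)"
    by (rule jac_inverse_compose[OF inner_hom[OF g] jac_inverse_inner[OF g] \<phi>])
  fix b assume b: "b < n"
  have "(\<Sum>j<n. kappa \<phi> N j * jac (inner g) j b) = (\<Sum>j<n. kappa \<phi> N j * of_bool (j = b))"
    by (intro sum.cong refl) (simp add: jac_inner[OF g])
  also have "\<dots> = kappa \<phi> N b" using b by (rule sum_delta')
  finally show "kappa (inner g \<circ> \<phi>) (\<lambda>a k. \<Sum>c<n. of_bool (a = c) * N c k) b = (1 - int n) * \<alpha> b g + kappa \<phi> N b"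
    unfolding kappa_compose[OF inner_hom[OF g] jac_inverse_inner[OF g] \<phi>] kappa_inner[OF g b] by simp
qed

lemma kappa_cong:
  assumes "\<And>k. k < n \<Longrightarrow> \<phi> (x k) = \<psi> (x k)" "jac_inverse \<phi> N" "jac_inverse \<psi> N'"
  shows "kappa \<phi> N b = kappa \<psi> N' b"
proof -
  have j: "jac \<phi> k a = jac \<psi> k a" if "k < n" for k a using assms(1)[OF that] by (simp add: jac_def)
  show ?thesis
    unfolding kappa_def
    by (intro sum.cong refl) (use jac_inverse_unique[OF assms(2,3) j] assms(1) in auto)
qed

lemma balanced_cong:
  assumes "\<And>k. k < n \<Longrightarrow> \<phi> (x k) = \<psi> (x k)" "balanced r \<phi>"
  shows "balanced r \<psi>"
proof -
  obtain N where N: "jac_inverse \<phi> N" "\<forall>b<n. r dvd kappa \<phi> N b" using assms(2) by (auto simp: balanced_def)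
  have "jac \<phi> k a = jac \<psi> k a" if "k < n" for k a using assms(1)[OF that] by (simp add: jac_def)
  then have "jac_inverse \<psi> N" using N(1) by (simp add: jac_inverse_def)
  then show ?thesis
    using N kappa_cong[OF assms(1) N(1)] by (auto simp: balanced_def)
qed

text \<open>Conjugation shifts the invariant by \<open>(1 - int n) * \<alpha> b g\<close>, and a
  factor coprime to \<open>r\<close> does not influence divisibility by \<open>r\<close>. Only
  conjugations that a monodromy in (Z/r)^n cannot see preserve balance.\<close>

lemma balanced_inner_compose:
  assumes \<phi>: "\<phi> \<in> hom G G" "balanced r \<phi>" and g: "g \<in> carrier G" and cop: "coprime r (int n - 1)"
  shows "balanced r (inner g \<circ> \<phi>) \<longleftrightarrow> (\<forall>b<n. r dvd \<alpha> b g)"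
proof -
  obtain N where N: "jac_inverse \<phi> N" "\<forall>b<n. r dvd kappa \<phi> N b" using \<phi>(2) by (auto simp: balanced_def)
  obtain N' where N': "jac_inverse (inner g \<circ> \<phi>) N'"
    "\<And>b. b < n \<Longrightarrow> kappa (inner g \<circ> \<phi>) N' b = (1 - int n) * \<alpha> b g + kappa \<phi> N b"
    using kappa_inner_compose[OF \<phi>(1) N(1) g] by blast
  have eq: "r dvd kappa (inner g \<circ> \<phi>) N' b \<longleftrightarrow> r dvd \<alpha> b g" if "b < n" for b
  proof -
    have "r dvd kappa (inner g \<circ> \<phi>) N' b \<longleftrightarrow> r dvd (1 - int n) * \<alpha> b g"
      unfolding N'(2)[OF that] using N(2) that by (simp add: dvd_add_left_iff)
    also have "\<dots> \<longleftrightarrow> r dvd (int n - 1) * \<alpha> b g"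
      by (metis dvd_minus_iff minus_diff_eq mult_minus_left)
    also have "\<dots> \<longleftrightarrow> r dvd \<alpha> b g"
      using cop by (simp add: coprime_dvd_mult_right_iff)
    finally show ?thesis .
  qed
  show ?thesis
  proof
    assume "balanced r (inner g \<circ> \<phi>)"
    then obtain M where M: "jac_inverse (inner g \<circ> \<phi>) M" "\<forall>b<n. r dvd kappa (inner g \<circ> \<phi>) M b"
      by (auto simp: balanced_def)
    then show "\<forall>b<n. r dvd \<alpha> b g"
      using eq kappa_cong[OF refl M(1) N'(1)] by auto
  next
    assume "\<forall>b<n. r dvd \<alpha> b g"
    then show "balanced r (inner g \<circ> \<phi>)" using N' eq by (auto simp: balanced_def)
  qed
qed

lemma alpha_surj:
  obtains g where "g \<in> carrier G" "\<And>i. i < n \<Longrightarrow> \<alpha> i g = m i"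
proof -
  have "\<exists>g\<in>carrier G. \<forall>i. \<alpha> i g = (\<Sum>k<l. m k * of_bool (k = i))" if "l \<le> n" for l
    using that
  proof (induction l)
    case 0 then show ?case by (intro bexI[of _ \<one>]) (auto simp: alpha_one)
  next
    case (Suc l)
    then obtain g where g: "g \<in> carrier G" "\<forall>i. \<alpha> i g = (\<Sum>k<l. m k * of_bool (k = i))" by auto
    have l: "l < n" using Suc by simp
    show ?case
      using g x_closed[OF l] l by (intro bexI[of _ "g \<otimes> x l [^] m l"]) (auto simp: alpha_mult alpha_pow alpha_x)
  qed
  then obtain g where "g \<in> carrier G" "\<forall>i. \<alpha> i g = (\<Sum>k<n. m k * of_bool (k = i))" by blast
  then show ?thesis using that[of g] sum_delta'(2) by metis
qed

lemma balance_exists: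
  assumes \<phi>: "\<phi> \<in> hom G G" "jac_inverse \<phi> N" and cop: "coprime r (int n - 1)"
  obtains g where "g \<in> carrier G" "balanced r (inner g \<circ> \<phi>)"
proof -
  obtain s t where st: "s * r + t * (int n - 1) = 1"
    using cop bezout_int[of r "int n - 1"] by (metis coprime_imp_gcd_eq_1)
  \<comment> \<open>The Bezout coefficient \<open>t\<close> inverts \<open>n - 1\<close> modulo
    \<open>r\<close>, so conjugation by this \<open>g\<close> shifts the invariant by its own
    negative modulo \<open>r\<close>.\<close>
  obtain g where g: "g \<in> carrier G" "\<And>b. b < n \<Longrightarrow> \<alpha> b g = t * kappa \<phi> N b"
    using alpha_surj[of "\<lambda>b. t * kappa \<phi> N b"] by metis
  obtain N' where N': "jac_inverse (inner g \<circ> \<phi>) N'"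
    "\<And>b. b < n \<Longrightarrow> kappa (inner g \<circ> \<phi>) N' b = (1 - int n) * \<alpha> b g + kappa \<phi> N b"
    using kappa_inner_compose[OF \<phi> g(1)] by blast
  have "kappa (inner g \<circ> \<phi>) N' b = r * (s * kappa \<phi> N b)" if "b < n" for b
  proof -
    have "kappa (inner g \<circ> \<phi>) N' b = (1 - t * (int n - 1)) * kappa \<phi> N b"
      unfolding N'(2)[OF that] g(2)[OF that] by (simp add: algebra_simps)
    also have "1 - t * (int n - 1) = s * r" using st by simp
    finally show ?thesis by (simp only: ac_simps)
  qed
  then have "balanced r (inner g \<circ> \<phi>)" using N'(1) by (auto simp: balanced_def)
  then show ?thesis using that g(1) by blast
qed

end

section \<open>Deck transformations and monodromy\<close>

locale graph_cover = graph_handles X v0 n ed K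
  for X :: "'a::topological_space set" and v0 n ed K +
  fixes Xhat :: "'b::topological_space set" and p :: "'b \<Rightarrow> 'a"
    and \<alpha> :: "nat \<Rightarrow> (real \<Rightarrow> 'a) set \<Rightarrow> int" and \<theta> :: "nat \<Rightarrow> nat \<Rightarrow> (real \<Rightarrow> 'a) set \<Rightarrow> int"
  assumes Xhat_conn: "connected Xhat" and normal: "normal_covering Xhat p X"
    and deck_comm: "comm_group (deck_group Xhat p)"
    and magnus: "magnus_group (pi1 X v0) n (\<lambda>k. hclass X (gam k)) \<alpha> \<theta>"
begin

sublocale magnus_group "pi1 X v0" n "\<lambda>k. hclass X (gam k)" \<alpha> \<theta>
  by (rule magnus)

abbreviation "D \<equiv> deck_group Xhat p"

sublocale deck: comm_group D
  by (rule deck_comm)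

lemma cov: "covering_space Xhat p X"
  using normal by (simp add: normal_covering_def)

lemma p_cont: "continuous_on Xhat p" and p_image: "p ` Xhat = X"
  using cov by (auto simp: covering_space_def)

lemma p_in: "x \<in> Xhat \<Longrightarrow> p x \<in> X"
  using p_image by auto

lemma Xhat_lpc: "locally path_connected Xhat"
  by (rule covering_locally_path_connected[OF cov lpc])

lemma Xhat_pc: "path_connected Xhat"
  using Xhat_conn path_component_eq_connected_component_set[OF Xhat_lpc]
  unfolding path_connected_component_set by (metis connected_component_eq_self)

lemma deck_carrier: "carrier D = deck_transformations Xhat p"
  by (simp add: deck_group_def)

lemma deckD:
  assumes "d \<in> carrier D"
  shows "continuous_on Xhat d" "x \<in> Xhat \<Longrightarrow> d x \<in> Xhat" "x \<in> Xhat \<Longrightarrow> p (d x) = p x" "d \<in> extensional Xhat" "d \<in> Bij Xhat"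
  using assms homeomorphic_imp_continuous_map[of "top_of_set Xhat" "top_of_set Xhat" d]
  by (auto simp: deck_carrier deck_transformations_def Bij_def)

lemma deck_mult: "d \<in> carrier D \<Longrightarrow> e \<in> carrier D \<Longrightarrow> x \<in> Xhat \<Longrightarrow> (d \<otimes>\<^bsub>D\<^esub> e) x = d (e x)"
  using deckD(5)[of d] deckD(5)[of e] by (simp add: deck_group_def BijGroup_def compose_def)

lemma deck_one: "x \<in> Xhat \<Longrightarrow> \<one>\<^bsub>D\<^esub> x = x"
  by (simp add: deck_group_def BijGroup_def)

lemma lift_unique:
  assumes "continuous_on Xhat f" "f ` Xhat \<subseteq> Xhat" "continuous_on Xhat g" "g ` Xhat \<subseteq> Xhat"
    "\<And>x. x \<in> Xhat \<Longrightarrow> p (f x) = p (g x)" "a \<in> Xhat" "f a = g a" "x \<in> Xhat"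
  shows "f x = g x"
  by (rule covering_lift_unique[OF cov Xhat_conn assms(1) _ assms(3) _ assms(5-8)]) (use assms in auto)

lemma deck_eq:
  assumes d: "d \<in> carrier D" and e: "e \<in> carrier D" and x: "x \<in> Xhat" "d x = e x"
  shows "d = e"
proof (rule extensionalityI[OF deckD(4)[OF d] deckD(4)[OF e]])
  fix y assume "y \<in> Xhat"
  then show "d y = e y"
    using lift_unique[of d e x y] deckD[OF d] deckD[OF e] x by auto
qed

lemma deck_transitive: "x \<in> Xhat \<Longrightarrow> y \<in> Xhat \<Longrightarrow> p x = p y \<Longrightarrow> \<exists>d\<in>carrier D. d x = y"
  using normal by (auto simp: normal_covering_def deck_carrier)

definition base :: 'b where "base = (SOME x. x \<in> Xhat \<and> p x = v0)"

lemma base: "base \<in> Xhat" "p base = v0"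
proof -
  have "\<exists>x. x \<in> Xhat \<and> p x = v0" using p_image v0_in by auto
  then have "base \<in> Xhat \<and> p base = v0" unfolding base_def by (rule someI_ex)
  then show "base \<in> Xhat" "p base = v0" by auto
qed

abbreviation "lend \<equiv> lift_end Xhat p"

lemma lend_deck:
  assumes w: "path w" "path_image w \<subseteq> X" and x: "x \<in> Xhat" "p x = pathstart w" and d: "d \<in> carrier D"
  shows "lend w (d x) = d (lend w x)"
proof -
  obtain h where h: "path h" "path_image h \<subseteq> Xhat" "pathstart h = x" "pathfinish h = lend w x"
     "\<And>t. t \<in> {0..1} \<Longrightarrow> p (h t) = w t"
    by (rule lift_end_obtain[OF cov w x]) blast
  have "lend w (d x) = pathfinish (d \<circ> h)"
  proof (rule lift_end_eq[OF cov])
    show "path (d \<circ> h)" by (rule path_continuous_image[OF h(1) continuous_on_subset[OF deckD(1)[OF d] h(2)]])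
    show "path_image (d \<circ> h) \<subseteq> Xhat" using h(2) deckD(2)[OF d] by (auto simp: path_image_compose)
    show "p ((d \<circ> h) t) = w t" if "t \<in> {0..1}" for t
    proof -
      have "h t \<in> Xhat" using h(2) that by (auto simp: path_image_def)
      then show ?thesis using h(5)[OF that] deckD(3)[OF d] by simp
    qed
  qed (use h in \<open>simp add: pathstart_compose\<close>)
  then show ?thesis using h by (simp add: pathfinish_compose)
qed

text \<open>The deck transformation that moves \<open>base\<close> to the end of the lifted loop.
  Normality provides it, and a deck transformation is determined by one value.\<close>

definition mon :: "(real \<Rightarrow> 'a) set \<Rightarrow> 'b \<Rightarrow> 'b" where
  "mon u = (SOME d. d \<in> carrier D \<and> (\<exists>w\<in>loops_at X v0. u = hclass X w \<and> d base = lend w base))"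

lemma mon_hclass:
  assumes w: "w \<in> loops_at X v0"
  shows "mon (hclass X w) \<in> carrier D" "mon (hclass X w) base = lend w base"
proof -
  note W = loops_atD[OF w]
  have "\<exists>d\<in>carrier D. d base = lend w base"
    using deck_transitive lift_end_in[OF cov W(1,2)] base W by simp
  then have "\<exists>d. d \<in> carrier D \<and> (\<exists>w'\<in>loops_at X v0. hclass X w = hclass X w' \<and> d base = lend w' base)"
    using w by blast
  then have m: "mon (hclass X w) \<in> carrier D \<and> (\<exists>w'\<in>loops_at X v0. hclass X w = hclass X w' \<and> mon (hclass X w) base = lend w' base)"
    unfolding mon_def by (rule someI_ex)
  then show "mon (hclass X w) \<in> carrier D" by blast
  from m show "mon (hclass X w) base = lend w base"
    using lift_end_homotopic[OF cov _ base(1)] base(2) W(3) hclass_eq_iff[OF w] by metis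
qed

lemma mon_in: "u \<in> carrier (pi1 X v0) \<Longrightarrow> mon u \<in> carrier D"
  using mon_hclass by (auto simp: pi1_carrier)

text \<open>Deck transformations commute with path lifting: lifting the second loop from
  \<open>mon u base\<close> gives \<open>mon u\<close> of its lift from \<open>base\<close>. This
  keeps the order of the factors.\<close>

lemma mon_mult:
  assumes "u \<in> carrier (pi1 X v0)" "v \<in> carrier (pi1 X v0)"
  shows "mon (u \<otimes>\<^bsub>pi1 X v0\<^esub> v) = mon u \<otimes>\<^bsub>D\<^esub> mon v"
proof -
  obtain w z where wz: "w \<in> loops_at X v0" "z \<in> loops_at X v0" "u = hclass X w" "v = hclass X z"
    using assms by (auto simp: pi1_carrier)
  note W = loops_atD[OF wz(1)] and Z = loops_atD[OF wz(2)]
  have "mon (hclass X (w +++ z)) base = lend z (lend w base)"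
    using mon_hclass(2)[of "w +++ z"] lift_end_join[OF cov W(1,2) base(1) _ Z(1,2)] wz base W Z by simp
  also have "\<dots> = lend z (mon u base)" using mon_hclass(2)[OF wz(1)] wz by simp
  also have "\<dots> = mon u (mon v base)"
    using lend_deck[OF Z(1,2) base(1) _ mon_in[OF assms(1)]] base(2) Z mon_hclass(2)[OF wz(2)] wz by simp
  also have "\<dots> = (mon u \<otimes>\<^bsub>D\<^esub> mon v) base"
    using deck_mult mon_in assms base by simp
  finally show ?thesis
    using deck_eq[OF _ _ base(1)] mon_in assms mon_hclass(1)[of "w +++ z"] wz pi1_mult[OF wz(1,2)] by simp
qed

lemma mon_hom: "mon \<in> hom (pi1 X v0) D"
  by (rule homI) (auto simp: mon_in mon_mult)

sublocale mon: group_hom "pi1 X v0" D mon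
  by (unfold_locales) (rule mon_hom)

lemma mon_surj:
  assumes d: "d \<in> carrier D"
  obtains u where "u \<in> carrier (pi1 X v0)" "mon u = d"
proof -
  obtain h where h: "path h" "path_image h \<subseteq> Xhat" "pathstart h = base" "pathfinish h = d base"
    using Xhat_pc base(1) deckD(2)[OF d base(1)] unfolding path_connected_def by blast
  have l: "p \<circ> h \<in> loops_at X v0"
    using h p_image base deckD(3)[OF d base(1)] path_continuous_image[OF h(1) continuous_on_subset[OF p_cont h(2)]]
    by (auto simp: loops_at_def path_image_compose pathstart_compose pathfinish_compose)
  have "lend (p \<circ> h) base = d base"
    using lift_end_eq[OF cov h(1-3), of "p \<circ> h"] h by simp
  then have "mon (hclass X (p \<circ> h)) = d"
    using mon_hclass[OF l] by (intro deck_eq[OF _ d base(1)]) auto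
  then show ?thesis using that[of "hclass X (p \<circ> h)"] pi1_hclass[OF l] by blast
qed

section \<open>Lifts of self-maps and their effect on the monodromy\<close>

definition covers :: "('a \<Rightarrow> 'a) \<Rightarrow> ('b \<Rightarrow> 'b) \<Rightarrow> bool" where
  "covers h f \<longleftrightarrow> continuous_on X h \<and> h ` X \<subseteq> X \<and> continuous_on Xhat f \<and> f ` Xhat \<subseteq> Xhat \<and>
     (\<forall>x\<in>Xhat. p (f x) = h (p x))"

lemma coversD:
  assumes "covers h f"
  shows "continuous_on X h" "h ` X \<subseteq> X" "continuous_on Xhat f" "f ` Xhat \<subseteq> Xhat" "x \<in> Xhat \<Longrightarrow> f x \<in> Xhat"
    "x \<in> Xhat \<Longrightarrow> p (f x) = h (p x)"
  using assms by (auto simp: covers_def)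

lemma covers_fiber_preserving: "covers h f \<Longrightarrow> fiber_preserving Xhat p f"
  by (auto simp: covers_def fiber_preserving_def)

lemma covers_compose: "covers h f \<Longrightarrow> covers h' f' \<Longrightarrow> covers (h' \<circ> h) (f' \<circ> f)"
  using continuous_on_compose[OF _ continuous_on_subset, of X h X h'] continuous_on_compose[OF _ continuous_on_subset, of Xhat f Xhat f']
  unfolding covers_def by (simp add: image_subset_iff)

lemma covers_id: "covers id id"
  by (auto simp: covers_def)

lemma covers_deck: "covers h f \<Longrightarrow> d \<in> carrier D \<Longrightarrow> covers h (d \<circ> f)"
  using continuous_on_compose[OF _ continuous_on_subset, of Xhat f Xhat d] deckD[of d] unfolding covers_def
  by (simp add: image_subset_iff)

text \<open>Normality supplies a deck transformation that matches the two lifts at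
  \<open>base\<close>, and unique lifting spreads the agreement to all of
  \<open>Xhat\<close>.\<close>

lemma covers_unique:
  assumes f: "covers h f" and f': "covers h f'"
  obtains d where "d \<in> carrier D" "\<And>x. x \<in> Xhat \<Longrightarrow> f' x = d (f x)"
proof -
  obtain d where d: "d \<in> carrier D" "d (f base) = f' base"
    using deck_transitive[of "f base" "f' base"] coversD[OF f] coversD[OF f'] base by auto
  have "f' x = (d \<circ> f) x" if "x \<in> Xhat" for x
    by (rule lift_unique[of f' "d \<circ> f" base x])
      (use coversD[OF f'] coversD[OF covers_deck[OF f d(1)]] d base that in auto)
  then show ?thesis using that d(1) by simp
qed

text \<open>\<open>b\<close> is the projection of a path in the covering from the base point to its image under \<open>f\<close>.\<close>

definition adapted :: "('b \<Rightarrow> 'b) \<Rightarrow> (real \<Rightarrow> 'a) \<Rightarrow> bool" where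
  "adapted f b \<longleftrightarrow> path_from_to X v0 (p (f base)) b \<and> lend b base = f base"

lemma adapted_exists:
  assumes "covers h f"
  obtains b where "adapted f b"
proof -
  obtain c where c: "path c" "path_image c \<subseteq> Xhat" "pathstart c = base" "pathfinish c = f base"
    using Xhat_pc base(1) coversD(5)[OF assms base(1)] unfolding path_connected_def by blast
  have "path_from_to X v0 (p (f base)) (p \<circ> c)"
    using c p_image base path_continuous_image[OF c(1) continuous_on_subset[OF p_cont c(2)]]
    by (auto simp: path_from_to_def path_image_compose pathstart_compose pathfinish_compose)
  moreover have "lend (p \<circ> c) base = f base"
    using lift_end_eq[OF cov c(1-3), of "p \<circ> c"] c by simp
  ultimately show ?thesis using that by (simp add: adapted_def)
qed

lemma adapted_path: "covers h f \<Longrightarrow> adapted f b \<Longrightarrow> path_from_to X v0 (h v0) b"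
  using coversD(6)[of h f base] base by (simp add: adapted_def)

lemma lend_path: "path_from_to X v0 y b \<Longrightarrow> x \<in> Xhat \<Longrightarrow> p x = v0 \<Longrightarrow> lend b x \<in> Xhat \<and> p (lend b x) = y"
  using lift_end_in[OF cov, of b x] by (auto simp: path_from_to_def)

lemma lend_conj:
  assumes b: "path_from_to X v0 y b" and w: "w \<in> loops_at X y" and c: "path_from_to X v0 y c" and x: "x \<in> Xhat" "p x = v0"
  shows "lend (conj_path b w c) x = lend (reversepath c) (lend w (lend b x))"
proof -
  note B = b[unfolded path_from_to_def] and C = c[unfolded path_from_to_def] and W = loops_atD[OF w]
  have 1: "lend b x \<in> Xhat \<and> p (lend b x) = y" by (rule lend_path[OF b x])
  have "lend (conj_path b w c) x = lend (w +++ reversepath c) (lend b x)"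
    by (rule lift_end_join[OF cov]) (use B C W x in \<open>auto simp: path_image_join\<close>)
  also have "\<dots> = lend (reversepath c) (lend w (lend b x))"
    by (rule lift_end_join[OF cov]) (use B C W 1 in auto)
  finally show ?thesis .
qed

lemma lend_reverse: "path_from_to X v0 y b \<Longrightarrow> x \<in> Xhat \<Longrightarrow> p x = v0 \<Longrightarrow> lend (reversepath b) (lend b x) = x"
  using lift_end_reversepath[OF cov, of b x] by (auto simp: path_from_to_def)

lemma lend_covers:
  assumes f: "covers h f" and w: "path w" "path_image w \<subseteq> X" and x: "x \<in> Xhat" "p x = pathstart w"
  shows "lend (h \<circ> w) (f x) = f (lend w x)"
proof -
  obtain c where c: "path c" "path_image c \<subseteq> Xhat" "pathstart c = x" "pathfinish c = lend w x"
     "\<And>t. t \<in> {0..1} \<Longrightarrow> p (c t) = w t"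
    by (rule lift_end_obtain[OF cov w x]) blast
  have "lend (h \<circ> w) (f x) = pathfinish (f \<circ> c)"
  proof (rule lift_end_eq[OF cov])
    show "path (f \<circ> c)" by (rule path_continuous_image[OF c(1) continuous_on_subset[OF coversD(3)[OF f] c(2)]])
    show "path_image (f \<circ> c) \<subseteq> Xhat" using c(2) coversD(5)[OF f] by (auto simp: path_image_compose)
    show "p ((f \<circ> c) t) = (h \<circ> w) t" if "t \<in> {0..1}" for t
    proof -
      have "c t \<in> Xhat" using c(2) that by (auto simp: path_image_def)
      then show ?thesis using c(5)[OF that] coversD(6)[OF f] by simp
    qed
  qed (use c in \<open>simp add: pathstart_compose\<close>)
  then show ?thesis using c by (simp add: pathfinish_compose)
qed

abbreviation "ind \<equiv> pi1_map X v0"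

lemma ind_hom: "covers h f \<Longrightarrow> adapted f b \<Longrightarrow> ind h b \<in> hom (pi1 X v0) (pi1 X v0)"
  by (rule pi1_map_hom[OF v0_in coversD(1,2) adapted_path]) auto

text \<open>The equivariance of a lift: \<open>f\<close> intertwines the deck transformations of
  \<open>u\<close> and of its image. An adapted tail lifts to a path that ends at
  \<open>f base\<close>, which is what makes the tails cancel.\<close>

lemma mon_ind:
  assumes f: "covers h f" and b: "adapted f b" and u: "u \<in> carrier (pi1 X v0)"
  shows "mon (ind h b u) (f base) = f (mon u base)"
proof -
  note h = coversD(1,2)[OF f] and bp = adapted_path[OF f b]
  obtain w where w: "w \<in> loops_at X v0" "u = hclass X w" using u by (auto simp: pi1_carrier)
  note W = loops_atD[OF w(1)] and hw = loop_image[OF h w(1)]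
  have c: "conj_path b (h \<circ> w) b \<in> loops_at X v0" by (rule conj_path_loop[OF bp hw])
  have bb: "lend b base = f base" using b by (simp add: adapted_def)
  have fb: "f base \<in> Xhat" "p (f base) = h v0" using coversD[OF f] base by auto
  have fm: "f (mon u base) \<in> Xhat" "p (f (mon u base)) = h v0"
    using coversD[OF f] deckD[OF mon_in[OF u]] base by auto
  obtain e where e: "e \<in> carrier D" "e (f base) = f (mon u base)"
    using deck_transitive[OF fb(1) fm(1)] fb fm by auto
  have "mon (ind h b u) base = lend (conj_path b (h \<circ> w) b) base"
    unfolding w(2) pi1_map_hclass[OF v0_in h bp w(1)] by (rule mon_hclass(2)[OF c])
  also have "\<dots> = lend (reversepath b) (lend (h \<circ> w) (f base))"
    using lend_conj[OF bp hw bp base] bb by simp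
  also have "lend (h \<circ> w) (f base) = f (mon u base)"
    using lend_covers[OF f W(1,2) base(1)] base W mon_hclass(2)[OF w(1)] w(2) by simp
  also have "\<dots> = e (lend b base)" using e bb by simp
  also have "lend (reversepath b) (e (lend b base)) = e (lend (reversepath b) (lend b base))"
    by (rule lend_deck[OF _ _ _ _ e(1)]) (use bp bb fb in \<open>auto simp: path_from_to_def\<close>)
  also have "\<dots> = e base" using lend_reverse[OF bp base] by simp
  finally have "mon (ind h b u) = e"
    using deck_eq[OF _ e(1) base(1)] mon_in hom_in_carrier[OF ind_hom[OF f b] u] by blast
  then show ?thesis using e by simp
qed

lemma mon_ind_one:
  assumes f: "covers h f" and b: "adapted f b" and u: "u \<in> carrier (pi1 X v0)" "mon u = \<one>\<^bsub>D\<^esub>"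
  shows "mon (ind h b u) = \<one>\<^bsub>D\<^esub>"
proof (rule deck_eq[of _ _ "f base"])
  show "mon (ind h b u) (f base) = \<one>\<^bsub>D\<^esub> (f base)"
    using mon_ind[OF f b u(1)] u(2) coversD(5)[OF f] base by (simp add: deck_one)
qed (use mon_in hom_in_carrier[OF ind_hom[OF f b] u(1)] coversD(5)[OF f] base in auto)

text \<open>Loops in \<open>Xhat\<close> project to the kernel of the monodromy, so preservation of
  the kernel is the hypothesis of the lifting criterion for \<open>\<lambda>x. h (p x)\<close>; by
  \<open>mon_ind_one\<close> it is also necessary. The lift starts at the end of the lifted tail,
  and is therefore adapted to it.\<close>

proposition lift_exists:
  assumes h: "continuous_on X h" "h ` X \<subseteq> X" and b: "path_from_to X v0 (h v0) b"
    and ker: "\<And>u. u \<in> carrier (pi1 X v0) \<Longrightarrow> mon u = \<one>\<^bsub>D\<^esub> \<Longrightarrow> mon (ind h b u) = \<one>\<^bsub>D\<^esub>"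
  obtains f where "covers h f" "adapted f b"
proof -
  let ?a = "lend b base"
  have a: "?a \<in> Xhat" "p ?a = h v0" using lend_path[OF b base] by auto
  obtain f where f: "continuous_on Xhat f" "f \<in> Xhat \<rightarrow> Xhat" "f base = ?a" "\<And>x. x \<in> Xhat \<Longrightarrow> p (f x) = h (p x)"
  proof (rule covering_lift_general[OF cov a(1) base(1) Xhat_pc Xhat_lpc, of "\<lambda>x. h (p x)"])
    show "continuous_on Xhat (\<lambda>x. h (p x))"
      by (rule continuous_on_compose2[OF h(1) p_cont]) (use p_image in auto)
    show "(\<lambda>x. h (p x)) \<in> Xhat \<rightarrow> X" using h p_image by auto
    show "h (p base) = p ?a" using a base by simp
    fix r assume r: "path r" "path_image r \<subseteq> Xhat" "pathstart r = base" "pathfinish r = base"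
    let ?w = "p \<circ> r"
    have w: "?w \<in> loops_at X v0"
      using r p_image base path_continuous_image[OF r(1) continuous_on_subset[OF p_cont r(2)]]
      by (auto simp: loops_at_def path_image_compose pathstart_compose pathfinish_compose)
    have "lend ?w base = base" using lift_end_eq[OF cov r(1-3), of ?w] r by simp
    then have "mon (hclass X ?w) = \<one>\<^bsub>D\<^esub>"
      using mon_hclass[OF w] by (intro deck_eq[OF _ _ base(1)]) (auto simp: deck_one base)
    then have "mon (ind h b (hclass X ?w)) = \<one>\<^bsub>D\<^esub>" using ker w by simp
    note hw = loop_image[OF h w]
    have "lend (conj_path b (h \<circ> ?w) b) base = base"
      using mon_hclass(2)[OF conj_path_loop[OF b hw]] \<open>mon (ind h b (hclass X ?w)) = \<one>\<^bsub>D\<^esub>\<close>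
      by (simp add: pi1_map_hclass[OF v0_in h b w] deck_one base)
    then have 1: "lend (reversepath b) (lend (h \<circ> ?w) ?a) = base"
      using lend_conj[OF b hw b base] by simp
    let ?c = "lend (h \<circ> ?w) ?a"
    have c: "?c \<in> Xhat" "p ?c = h v0"
      using lift_end_in[OF cov, of "h \<circ> ?w" ?a] loops_atD[OF hw] a by auto
    have "lend (reversepath (reversepath b)) (lend (reversepath b) ?c) = ?c"
      by (rule lift_end_reversepath[OF cov]) (use b c in \<open>auto simp: path_from_to_def\<close>)
    then have "?c = ?a" using 1 by simp
    then show "lend ((\<lambda>x. h (p x)) \<circ> r) ?a = ?a" by (simp add: comp_def)
  qed blast
  have "covers h f" using f h by (auto simp: covers_def)
  moreover have "adapted f b" using b f(3) a by (simp add: adapted_def)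
  ultimately show ?thesis by (rule that)
qed

text \<open>The homotopy is lifted after composition with \<open>p\<close>. Each stage then lies
  over a stage of \<open>H\<close>, so the lifted homotopy preserves fibres throughout.\<close>

lemma lift_htpy:
  assumes H: "htpy X X h h' H" and f: "covers h f" and h': "continuous_on X h'" "h' ` X \<subseteq> X"
  obtains f' k where "covers h' f'" "htpy Xhat Xhat f f' k" "\<And>t x. t \<in> {0..1} \<Longrightarrow> x \<in> Xhat \<Longrightarrow> p (k (t,x)) = H (t, p x)"
proof -
  have Hc: "continuous_on ({0..1} \<times> Xhat) (\<lambda>z. H (fst z, p (snd z)))"
    by (rule continuous_on_compose2[of "{0..1} \<times> X" H])
      (use H p_in in \<open>auto simp: htpy_def intro!: continuous_intros continuous_on_compose2[OF p_cont]\<close>)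
  obtain k where k: "continuous_on ({0..1} \<times> Xhat) k" "k \<in> ({0..1} \<times> Xhat) \<rightarrow> Xhat"
    "\<And>y. y \<in> Xhat \<Longrightarrow> k (0,y) = f y" "\<And>t y. t \<in> {0..1} \<Longrightarrow> y \<in> Xhat \<Longrightarrow> p (k (t,y)) = H (t, p y)"
  proof (rule covering_lift_homotopy[OF cov Hc])
    show "p (f y) = H (fst (0, y), p (snd (0, y)))" if "y \<in> Xhat" for y
      using coversD(6)[OF f that] H p_in[OF that] by (simp add: htpy_def)
  qed (use coversD[OF f] H p_in in \<open>auto simp: htpy_def\<close>)
  have "continuous_on Xhat (\<lambda>x. k (1,x))"
    by (rule continuous_on_compose2[OF k(1)]) (auto intro!: continuous_intros)
  then have "covers h' (\<lambda>x. k (1,x))"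
    using k h' H p_in by (auto simp: covers_def htpy_def)
  moreover have "htpy Xhat Xhat f (\<lambda>x. k (1,x)) k"
    using k by (auto simp: htpy_def)
  ultimately show ?thesis using that k(4) by blast
qed

text \<open>Continuity downstairs comes from the openness of \<open>p\<close>, which persists for
  products with the interval. The auxiliary \<open>sec\<close> is a mere choice of points, not a
  continuous section.\<close>

lemma descend:
  assumes k: "continuous_on ({0..1} \<times> Xhat) k" "\<And>t x. t \<in> {0..1} \<Longrightarrow> x \<in> Xhat \<Longrightarrow> k (t,x) \<in> Xhat"
    and fp: "\<And>t. t \<in> {0..1::real} \<Longrightarrow> fiber_preserving Xhat p (\<lambda>x. k (t,x))"
  obtains H :: "real \<times> 'a \<Rightarrow> 'a" where "continuous_on ({0..1} \<times> X) H" "\<And>t y. t \<in> {0..1} \<Longrightarrow> y \<in> X \<Longrightarrow> H (t,y) \<in> X"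
    "\<And>t x. t \<in> {0..1} \<Longrightarrow> x \<in> Xhat \<Longrightarrow> H (t, p x) = p (k (t,x))"
proof -
  define sec where "sec y = (SOME x. x \<in> Xhat \<and> p x = y)" for y
  have sec: "sec y \<in> Xhat \<and> p (sec y) = y" if "y \<in> X" for y
    unfolding sec_def by (rule someI_ex) (use that p_image in auto)
  define H where "H z = p (k (fst z, sec (snd z)))" for z
  have Hp: "H (t, p x) = p (k (t,x))" if "t \<in> {0..1}" "x \<in> Xhat" for t x
  proof -
    have s: "sec (p x) \<in> Xhat" "p (sec (p x)) = p x" using sec[OF p_in[OF that(2)]] by auto
    have "p (k (t, sec (p x))) = p (k (t, x))"
      using fp[OF that(1)] s that(2) unfolding fiber_preserving_def by blast
    then show ?thesis by (simp only: H_def fst_conv snd_conv)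
  qed
  have pk: "continuous_on ({0..1} \<times> Xhat) (\<lambda>z. p (k z))"
    by (rule continuous_on_compose2[OF p_cont k(1)]) (use k(2) in auto)
  have "continuous_on ({0..1} \<times> X) H"
  proof (subst continuous_openin_preimage_eq, intro allI impI)
    fix W :: "'a set" assume W: "open W"
    let ?Q = "({0..1} \<times> Xhat) \<inter> (\<lambda>z. p (k z)) -` W"
    have oQ: "openin (top_of_set ({0..1} \<times> Xhat)) ?Q"
      using pk W continuous_openin_preimage_eq by metis
    show "openin (top_of_set ({0..1} \<times> X)) (({0..1} \<times> X) \<inter> H -` W)"
    proof (subst openin_subopen, intro ballI)
      fix z assume z: "z \<in> ({0..1} \<times> X) \<inter> H -` W"
      obtain t y where ty: "z = (t,y)" "t \<in> {0..1}" "y \<in> X" using z by (cases z) auto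
      have "(t, sec y) \<in> ?Q" using z ty sec[OF ty(3)] by (auto simp: H_def)
      then obtain A B where AB: "openin (top_of_set {0..1}) A" "t \<in> A" "openin (top_of_set Xhat) B" "sec y \<in> B" "A \<times> B \<subseteq> ?Q"
        by (rule Times_in_interior_subtopology[OF _ oQ]) blast
      have "openin (top_of_set ({0..1} \<times> X)) (A \<times> p ` B)"
        by (rule openin_Times[OF AB(1) covering_open_map[OF cov AB(3)]])
      moreover have "z \<in> A \<times> p ` B" using ty AB sec[OF ty(3)] by (metis image_eqI mem_Sigma_iff)
      moreover have "A \<times> p ` B \<subseteq> ({0..1} \<times> X) \<inter> H -` W"
      proof clarify
        fix s x assume "s \<in> A" "x \<in> B"
        then have "(s,x) \<in> ?Q" using AB(5) by auto
        then show "(s, p x) \<in> ({0..1} \<times> X) \<inter> H -` W" using Hp p_in by auto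
      qed
      ultimately show "\<exists>T. openin (top_of_set ({0..1} \<times> X)) T \<and> z \<in> T \<and> T \<subseteq> ({0..1} \<times> X) \<inter> H -` W" by blast
    qed
  qed
  moreover have "H (t,y) \<in> X" if "t \<in> {0..1}" "y \<in> X" for t y
    using k(2) sec that p_in by (simp add: H_def)
  ultimately show ?thesis using that Hp by blast
qed

lemma descend_htpy:
  assumes k: "htpy Xhat Xhat f f' k" and fp: "\<And>t. t \<in> {0..1} \<Longrightarrow> fiber_preserving Xhat p (\<lambda>x. k (t,x))"
  obtains h h' H where "covers h f" "covers h' f'" "htpy X X h h' H"
    "\<And>t x. t \<in> {0..1} \<Longrightarrow> x \<in> Xhat \<Longrightarrow> H (t, p x) = p (k (t,x))"
proof -
  have k': "continuous_on ({0..1} \<times> Xhat) k" "\<And>t x. t \<in> {0..1} \<Longrightarrow> x \<in> Xhat \<Longrightarrow> k (t,x) \<in> Xhat"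
    using k by (auto simp: htpy_def)
  obtain H :: "real \<times> 'a \<Rightarrow> 'a" where H: "continuous_on ({0..1} \<times> X) H" "\<And>t y. t \<in> {0..1} \<Longrightarrow> y \<in> X \<Longrightarrow> H (t,y) \<in> X"
    "\<And>t x. t \<in> {0..1} \<Longrightarrow> x \<in> Xhat \<Longrightarrow> H (t, p x) = p (k (t,x))"
  proof (rule descend[OF k' fp])
    fix H :: "real \<times> 'a \<Rightarrow> 'a"
    assume 1: "continuous_on ({0..1} \<times> X) H" and 2: "\<And>t y. t \<in> {0..1} \<Longrightarrow> y \<in> X \<Longrightarrow> H (t,y) \<in> X"
      and 3: "\<And>t x. t \<in> {0..1} \<Longrightarrow> x \<in> Xhat \<Longrightarrow> H (t, p x) = p (k (t,x))"
    show thesis by (rule that[OF 1 2 3])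
  qed
  have slice: "continuous_on X (\<lambda>y. H (t,y))" "continuous_on Xhat (\<lambda>x. k (t,x))" if "t \<in> {0..1}" for t
  proof -
    show "continuous_on X (\<lambda>y. H (t,y))"
      by (rule continuous_on_compose2[OF H(1)]) (use that in \<open>auto intro!: continuous_intros\<close>)
    show "continuous_on Xhat (\<lambda>x. k (t,x))"
      by (rule continuous_on_compose2[of "{0..1} \<times> Xhat" k]) (use k that in \<open>auto simp: htpy_def intro!: continuous_intros\<close>)
  qed
  have c: "continuous_on Xhat f" "continuous_on Xhat f'"
    using slice(2)[of 0] slice(2)[of 1] k by (auto simp: htpy_def cong: continuous_on_cong)
  have "f x \<in> Xhat \<and> f' x \<in> Xhat" if "x \<in> Xhat" for x
    using k that unfolding htpy_def by (metis atLeastAtMost_iff order_refl zero_le_one)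
  then have "covers (\<lambda>y. H (0,y)) f" "covers (\<lambda>y. H (1,y)) f'"
    using c slice(1) H(2,3) k by (auto simp: covers_def htpy_def)
  moreover have "htpy X X (\<lambda>y. H (0,y)) (\<lambda>y. H (1,y)) H"
    using H by (auto simp: htpy_def)
  ultimately show ?thesis using that H(3) by blast
qed

lemma covers_base_unique:
  assumes "covers h f" "covers h' f" "y \<in> X"
  shows "h y = h' y"
  using assms p_image unfolding covers_def by (metis imageE)

text \<open>The homotopy moves \<open>f base\<close> along a path that lifts the track of
  \<open>v0\<close>; appending this track to the tail therefore leads to
  \<open>f' base\<close>.\<close>

lemma adapted_htpy:
  assumes k: "htpy Xhat Xhat f f' k" and f: "covers h f" "adapted f b"
    and H: "\<And>t. t \<in> {0..1} \<Longrightarrow> H (t, v0) = p (k (t, base))"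
  shows "adapted f' (b +++ (\<lambda>t. H (t, v0)))"
proof -
  let ?\<tau> = "\<lambda>t. k (t, base)" and ?c = "\<lambda>t. H (t, v0)"
  note T = htpy_track_path[OF k base(1)]
  have pc: "path (p \<circ> ?\<tau>)" "path_image (p \<circ> ?\<tau>) \<subseteq> X"
    using path_continuous_image[OF T(1) continuous_on_subset[OF p_cont T(2)]] T(2) p_in
    by (auto simp: path_image_compose)
  have ce: "?c t = (p \<circ> ?\<tau>) t" if "t \<in> {0..1}" for t using H[OF that] by simp
  have "path ?c"
    using pc(1) continuous_on_cong[of "{0..1}" "{0..1}" ?c "p \<circ> ?\<tau>"] ce unfolding path_def by blast
  moreover have "path_image ?c \<subseteq> X" using pc(2) ce by (simp add: path_image_def)
  moreover have "?c 0 = p (f base)" "?c 1 = p (f' base)"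
    using ce[of 0] ce[of 1] T(3,4) by (auto simp: pathstart_def pathfinish_def)
  ultimately have c: "path_from_to X (p (f base)) (p (f' base)) ?c"
    by (simp add: path_from_to_def pathstart_def pathfinish_def)
  have b: "path_from_to X v0 (p (f base)) b" "lend b base = f base" using f(2) by (auto simp: adapted_def)
  have "lend (b +++ ?c) base = lend ?c (f base)"
    using lift_end_join[OF cov, of b base ?c] b c base by (auto simp: path_from_to_def)
  also have "\<dots> = pathfinish ?\<tau>"
    by (rule lift_end_eq[OF cov T(1,2,3)]) (use ce in simp)
  finally have "lend (b +++ ?c) base = f' base" using T(4) by simp
  then show ?thesis using path_from_to_join[OF b(1) c] by (simp add: adapted_def)
qed

lemma adapted_compose:
  assumes f: "covers h f" "adapted f b" and f': "covers h' f'" "adapted f' b'"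
  shows "adapted (f' \<circ> f) (b' +++ (h' \<circ> b))"
proof -
  note h' = coversD(1,2)[OF f'(1)]
  note bp = adapted_path[OF f] and b'p = adapted_path[OF f']
  have q: "path_from_to X v0 ((h' \<circ> h) v0) (b' +++ (h' \<circ> b))"
    using path_from_to_join[OF b'p path_from_to_image[OF h' bp]] by simp
  have pf: "p (f' (f base)) = h' (h v0)"
    using coversD[OF f(1)] coversD[OF f'(1)] base by simp
  have "lend (b' +++ (h' \<circ> b)) base = lend (h' \<circ> b) (f' base)"
    using lift_end_join[OF cov, of b' base "h' \<circ> b"] b'p path_from_to_image[OF h' bp] base f'(2)
    by (auto simp: path_from_to_def adapted_def)
  also have "\<dots> = f' (lend b base)"
    by (rule lend_covers[OF f'(1)]) (use bp base in \<open>auto simp: path_from_to_def\<close>)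
  finally show ?thesis using q pf f(2) by (simp add: adapted_def)
qed

text \<open>Half of the dictionary between tails and lifts: the class of
  \<open>b' +++ reversepath b\<close>, which by \<open>pi1_map_change\<close> conjugates the induced
  map, moves the image of \<open>base\<close> by its monodromy.\<close>

lemma adapted_change:
  assumes f: "covers h f" "adapted f b" and b': "path_from_to X v0 (h v0) b'"
  shows "lend b' base = mon (hclass X (b' +++ reversepath b)) (f base)"
proof -
  note bp = adapted_path[OF f]
  let ?g = "b' +++ reversepath b"
  have g: "?g \<in> loops_at X v0"
    using path_from_to_join[OF b' path_from_to_reverse[OF bp]] by (simp add: path_from_to_loop)
  note B = bp[unfolded path_from_to_def] and B' = b'[unfolded path_from_to_def]
  have e: "lend b' base \<in> Xhat \<and> p (lend b' base) = h v0" by (rule lend_path[OF b' base])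
  have "mon (hclass X ?g) base = lend (reversepath b) (lend b' base)"
    using mon_hclass(2)[OF g] lift_end_join[OF cov, of b' base "reversepath b"] B B' base by simp
  moreover have "lend (reversepath (reversepath b)) (lend (reversepath b) (lend b' base)) = lend b' base"
    by (rule lift_end_reversepath[OF cov]) (use B e in auto)
  ultimately have "lend b' base = lend b (mon (hclass X ?g) base)" by simp
  also have "\<dots> = mon (hclass X ?g) (lend b base)"
    by (rule lend_deck[OF _ _ _ _ mon_hclass(1)[OF g]]) (use B base in auto)
  finally show ?thesis using f(2) by (simp add: adapted_def)
qed

text \<open>The Galois group is abelian, so a loop acts through its exponent sums
  \<open>\<alpha> k u\<close> alone. This is what lets divisibility of exponents describe the
  kernel.\<close>

lemma mon_gens:
  assumes u: "u \<in> carrier (pi1 X v0)"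
  shows "mon u = (\<Otimes>\<^bsub>D\<^esub>k\<in>{..<n}. mon (hclass X (gam k)) [^]\<^bsub>D\<^esub> \<alpha> k u)"
  using u
proof (induction rule: gen_induct)
  case one
  then show ?case by (simp add: alpha_one)
next
  case (mult k u)
  let ?m = "\<lambda>j. mon (hclass X (gam j))"
  have m: "?m j \<in> carrier D" if "j < n" for j using mon_in x_closed that by simp
  have gk: "hclass X (gam k) \<in> carrier (pi1 X v0)" using x_closed mult by simp
  have single: "(\<Otimes>\<^bsub>D\<^esub>j\<in>{..<n}. ?m j [^]\<^bsub>D\<^esub> (c * of_bool (k = j))) = ?m k [^]\<^bsub>D\<^esub> c" for c :: int
  proof -
    have "(\<Otimes>\<^bsub>D\<^esub>j\<in>{..<n}. ?m j [^]\<^bsub>D\<^esub> (c * of_bool (k = j))) = (\<Otimes>\<^bsub>D\<^esub>j\<in>{..<n}. if k = j then ?m j [^]\<^bsub>D\<^esub> c else \<one>\<^bsub>D\<^esub>)"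
      by (intro deck.finprod_cong') (use m in auto)
    also have "\<dots> = ?m k [^]\<^bsub>D\<^esub> c"
      by (rule deck.finprod_singleton) (use m mult in auto)
    finally show ?thesis .
  qed
  have prod: "(\<Otimes>\<^bsub>D\<^esub>j\<in>{..<n}. ?m j [^]\<^bsub>D\<^esub> (c j + c' j)) = (\<Otimes>\<^bsub>D\<^esub>j\<in>{..<n}. ?m j [^]\<^bsub>D\<^esub> c j) \<otimes>\<^bsub>D\<^esub> (\<Otimes>\<^bsub>D\<^esub>j\<in>{..<n}. ?m j [^]\<^bsub>D\<^esub> c' j)"
    for c c' :: "nat \<Rightarrow> int"
  proof -
    have "(\<Otimes>\<^bsub>D\<^esub>j\<in>{..<n}. ?m j [^]\<^bsub>D\<^esub> (c j + c' j)) = (\<Otimes>\<^bsub>D\<^esub>j\<in>{..<n}. ?m j [^]\<^bsub>D\<^esub> c j \<otimes>\<^bsub>D\<^esub> ?m j [^]\<^bsub>D\<^esub> c' j)"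
      by (intro deck.finprod_cong') (use m in \<open>auto simp: deck.int_pow_mult\<close>)
    also have "\<dots> = (\<Otimes>\<^bsub>D\<^esub>j\<in>{..<n}. ?m j [^]\<^bsub>D\<^esub> c j) \<otimes>\<^bsub>D\<^esub> (\<Otimes>\<^bsub>D\<^esub>j\<in>{..<n}. ?m j [^]\<^bsub>D\<^esub> c' j)"
      by (rule deck.finprod_multf) (use m in auto)
    finally show ?thesis .
  qed
  have a1: "\<alpha> j (hclass X (gam k) \<otimes>\<^bsub>pi1 X v0\<^esub> u) = 1 * of_bool (k = j) + \<alpha> j u"
    and a2: "\<alpha> j (inv\<^bsub>pi1 X v0\<^esub> (hclass X (gam k)) \<otimes>\<^bsub>pi1 X v0\<^esub> u) = (-1) * of_bool (k = j) + \<alpha> j u" for j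
    using mult gk by (auto simp: alpha_mult alpha_inv alpha_x)
  show ?case
    unfolding a1 a2 prod single using mult gk m
    by (simp add: mon.hom_inv deck.int_pow_neg)
qed

end

section \<open>Classes of homotopy equivalences\<close>

definition map_class :: "(('a::topological_space \<Rightarrow> 'a) \<Rightarrow> bool) \<Rightarrow> 'a set \<Rightarrow> ('a \<Rightarrow> 'a) \<Rightarrow> ('a \<Rightarrow> 'a) set" where
  "map_class P S f = {g. homotopic_with P (top_of_set S) (top_of_set S) f g}"

lemma map_class_eq: "homotopic_with P (top_of_set S) (top_of_set S) f g \<Longrightarrow> map_class P S f = map_class P S g"
  by (auto simp: map_class_def intro: homotopic_with_trans homotopic_with_symD)

lemma HE_with_carrier:
  "C \<in> carrier (HE_with P (top_of_set S)) \<longleftrightarrow>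
     (\<exists>f. self_homotopy_equivalence (top_of_set S) f \<and> P f \<and> C = map_class P S f)"
  by (auto simp: HE_with_def quotient_def map_class_def)

text \<open>The product in \<open>HE_with\<close> collects all representatives. That it is a single
  class rests on composing two homotopies at equal times, where \<open>P\<close> must survive
  composition.\<close>

lemma HE_with_mult:
  fixes S :: "'a::topological_space set"
  assumes P: "\<And>f g. P f \<Longrightarrow> P g \<Longrightarrow> f ` S \<subseteq> S \<Longrightarrow> g ` S \<subseteq> S \<Longrightarrow> P (f \<circ> g)"
    and cong: "\<And>f g. (\<And>x. x \<in> S \<Longrightarrow> f x = g x) \<Longrightarrow> P f \<longleftrightarrow> P g"
    and f: "continuous_on S f" "f ` S \<subseteq> S" "P f" and g: "continuous_on S g" "g ` S \<subseteq> S" "P g"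
  shows "map_class P S f \<otimes>\<^bsub>HE_with P (top_of_set S)\<^esub> map_class P S g = map_class P S (f \<circ> g)"
proof -
  have c: "homotopic_with P (top_of_set S) (top_of_set S) (f \<circ> g) (f' \<circ> g')"
    if ff: "homotopic_with P (top_of_set S) (top_of_set S) f f'" and gg: "homotopic_with P (top_of_set S) (top_of_set S) g g'" for f' g'
  proof -
    obtain H :: "real \<times> 'a \<Rightarrow> 'a" where H: "htpy S S f f' H" "\<And>t. t \<in> {0..1} \<Longrightarrow> P (\<lambda>x. H (t,x))"
      by (rule homotopic_with_htpy[OF ff]) blast
    obtain K :: "real \<times> 'a \<Rightarrow> 'a" where K: "htpy S S g g' K" "\<And>t. t \<in> {0..1} \<Longrightarrow> P (\<lambda>x. K (t,x))"
      by (rule homotopic_with_htpy[OF gg]) blast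
    let ?L = "\<lambda>z. H (fst z, K z)"
    have "continuous_on ({0..1} \<times> S) ?L"
      by (rule continuous_on_compose2[of "{0..1} \<times> S" H])
        (use H(1) K(1) in \<open>auto simp: htpy_def intro!: continuous_intros\<close>)
    then show ?thesis
    proof (rule homotopic_with_onI)
      show "P (\<lambda>x. ?L (t,x))" if t: "t \<in> {0..1}" for t
        using P[OF H(2)[OF t] K(2)[OF t]] H(1) K(1) t by (auto simp: htpy_def comp_def image_subset_iff)
      show "P u = P v" if "\<And>x. x \<in> S \<Longrightarrow> u x = v x" for u v
        by (rule cong) (rule that)
      have "g x \<in> S" "g' x \<in> S" if "x \<in> S" for x
        using K(1) that unfolding htpy_def by (metis atLeastAtMost_iff order_refl zero_le_one)+
      then show "?L (0,x) = (f \<circ> g) x" "?L (1,x) = (f' \<circ> g') x" if "x \<in> S" for x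
        using H(1) K(1) that by (auto simp: htpy_def)
    qed (use H(1) K(1) in \<open>auto simp: htpy_def\<close>)
  qed
  have "homotopic_with P (top_of_set S) (top_of_set S) f f" "homotopic_with P (top_of_set S) (top_of_set S) g g"
    using f g by (auto simp: image_subset_iff)
  then have "(\<exists>f'\<in>map_class P S f. \<exists>g'\<in>map_class P S g. homotopic_with P (top_of_set S) (top_of_set S) (f' \<circ> g') h)
      \<longleftrightarrow> homotopic_with P (top_of_set S) (top_of_set S) (f \<circ> g) h" for h
    unfolding map_class_def mem_Collect_eq by (blast intro: homotopic_with_trans c)
  then show ?thesis
    by (simp add: HE_with_def map_class_def[of P S "f \<circ> g"])
qed

lemma map_class_compose:
  fixes S :: "'a::topological_space set"
  assumes "continuous_on S f" "f ` S \<subseteq> S" "continuous_on S g" "g ` S \<subseteq> S"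
  shows "map_class (\<lambda>_. True) S f \<otimes>\<^bsub>HE S\<^esub> map_class (\<lambda>_. True) S g = map_class (\<lambda>_. True) S (f \<circ> g)"
  unfolding HE_def by (rule HE_with_mult) (use assms in auto)

lemma fiber_map_class_compose:
  fixes S :: "'b::topological_space set"
  assumes "continuous_on S f" "f ` S \<subseteq> S" "fiber_preserving S p f" "continuous_on S g" "g ` S \<subseteq> S" "fiber_preserving S p g"
  shows "map_class (fiber_preserving S p) S f \<otimes>\<^bsub>FHE S p\<^esub> map_class (fiber_preserving S p) S g
    = map_class (fiber_preserving S p) S (f \<circ> g)"
  unfolding FHE_def
proof (rule HE_with_mult)
  show "fiber_preserving S p (f \<circ> g)" if f: "fiber_preserving S p f" and g: "fiber_preserving S p g" "g ` S \<subseteq> S" for f g :: "'b \<Rightarrow> 'b"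
    unfolding fiber_preserving_def comp_apply
  proof (intro ballI impI)
    fix x y assume xy: "x \<in> S" "y \<in> S" "p x = p y"
    then have "p (g x) = p (g y)" using g(1) unfolding fiber_preserving_def by blast
    moreover have "g x \<in> S" "g y \<in> S" using xy g(2) by auto
    ultimately show "p (f (g x)) = p (f (g y))" using f unfolding fiber_preserving_def by blast
  qed
  show "fiber_preserving S p f = fiber_preserving S p g" if "\<And>x. x \<in> S \<Longrightarrow> f x = g x" for f g :: "'b \<Rightarrow> 'b"
    using that by (simp add: fiber_preserving_def)
qed (use assms in auto)

lemma self_homotopy_equivalenceI:
  fixes S :: "'a::topological_space set"
  assumes "continuous_on S f" "f ` S \<subseteq> S" "continuous_on S g" "g ` S \<subseteq> S" "htpy S S (g \<circ> f) id H" "htpy S S (f \<circ> g) id K"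
  shows "self_homotopy_equivalence (top_of_set S) f"
  using htpy_homotopic_with[OF assms(5)] htpy_homotopic_with[OF assms(6)] assms(1-4)
  unfolding self_homotopy_equivalence_def by (auto simp: image_subset_iff Pi_iff)

lemma self_homotopy_equivalence_compose:
  assumes "self_homotopy_equivalence Y f" "self_homotopy_equivalence Y g"
  shows "self_homotopy_equivalence Y (f \<circ> g)"
proof -
  obtain f' where f: "continuous_map Y Y f" "continuous_map Y Y f'" "homotopic_with (\<lambda>_. True) Y Y (f' \<circ> f) id" "homotopic_with (\<lambda>_. True) Y Y (f \<circ> f') id"
    using assms(1) by (auto simp: self_homotopy_equivalence_def)
  obtain g' where g: "continuous_map Y Y g" "continuous_map Y Y g'" "homotopic_with (\<lambda>_. True) Y Y (g' \<circ> g) id" "homotopic_with (\<lambda>_. True) Y Y (g \<circ> g') id"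
    using assms(2) by (auto simp: self_homotopy_equivalence_def)
  have *: "homotopic_with (\<lambda>_. True) Y Y ((b' \<circ> a') \<circ> (a \<circ> b)) id"
    if "continuous_map Y Y b" "continuous_map Y Y b'" "homotopic_with (\<lambda>_. True) Y Y (a' \<circ> a) id"
      "homotopic_with (\<lambda>_. True) Y Y (b' \<circ> b) id" for a a' b b'
  proof -
    have "homotopic_with (\<lambda>_. True) Y Y (b' \<circ> ((a' \<circ> a) \<circ> b)) (b' \<circ> (id \<circ> b))"
      by (rule homotopic_with_compose_continuous_map_left[OF homotopic_with_compose_continuous_map_right[OF that(3,1)] that(2)]) auto
    then show ?thesis using that(4) homotopic_with_trans by (fastforce simp: comp_assoc)
  qed
  show ?thesis
    unfolding self_homotopy_equivalence_def
    using continuous_map_compose f g *[OF g(1,2) f(3) g(3)] *[OF f(2,1) g(4) f(4)] by blast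
qed

lemma continuous_on_funpow:
  assumes "continuous_on S h" "h ` S \<subseteq> S"
  shows "continuous_on S (h ^^ j) \<and> (h ^^ j) ` S \<subseteq> S"
proof (induction j)
  case (Suc j)
  then show ?case
    using continuous_on_compose[OF _ continuous_on_subset[OF assms(1)], of S "h ^^ j"] assms(2)
    by (auto simp: image_comp[symmetric])
qed auto

section \<open>Based self-maps of a graph\<close>

context graph_handles
begin

abbreviation "bind h \<equiv> pi1_map X v0 h (\<lambda>_. v0)"

lemma based_path: "h v0 = v0 \<Longrightarrow> path_from_to X v0 (h v0) (\<lambda>_. v0)"
  using v0_in by (simp add: path_from_to_loop)

lemma bind_hom: "continuous_on X h \<Longrightarrow> h ` X \<subseteq> X \<Longrightarrow> h v0 = v0 \<Longrightarrow> bind h \<in> hom (pi1 X v0) (pi1 X v0)"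
  using pi1_map_hom[OF v0_in, of h] based_path[of h] by blast

lemma bind_compose:
  assumes "continuous_on X h" "h ` X \<subseteq> X" "h v0 = v0" "continuous_on X h'" "h' ` X \<subseteq> X" "h' v0 = v0" "A \<in> carrier (pi1 X v0)"
  shows "bind (h' \<circ> h) A = bind h' (bind h A)"
proof -
  have "(\<lambda>_. v0) +++ (h' \<circ> (\<lambda>_. v0)) = (\<lambda>_. v0)" using assms(6) by (simp add: fun_eq_iff joinpaths_def)
  then show ?thesis
    using pi1_map_compose[OF v0_in assms(1,2) based_path[of h, OF assms(3)] assms(4,5) based_path[of h', OF assms(6)] assms(7)] by simp
qed

lemma bind_id: "A \<in> carrier (pi1 X v0) \<Longrightarrow> bind id A = A"
proof -
  interpret G: group "pi1 X v0" by (rule pi1_group[OF v0_in])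
  assume "A \<in> carrier (pi1 X v0)"
  then show ?thesis using pi1_map_id[OF v0_in, of "\<lambda>_. v0" A] v0_in by (simp add: pi1_one[symmetric])
qed

lemma realize_endomorphism:
  assumes "\<And>k. k < n \<Longrightarrow> y k \<in> carrier (pi1 X v0)"
  obtains h where "continuous_on X h" "h ` X \<subseteq> X" "h v0 = v0" "\<And>k. k < n \<Longrightarrow> bind h (hclass X (gam k)) = y k"
proof -
  have "\<forall>k. \<exists>w. k < n \<longrightarrow> w \<in> loops_at X v0 \<and> y k = hclass X w" using assms by (auto simp: pi1_carrier)
  then obtain w where w: "\<And>k. k < n \<Longrightarrow> w k \<in> loops_at X v0 \<and> y k = hclass X (w k)" by metis
  obtain h where h: "continuous_on X h" "h ` X \<subseteq> X" "h v0 = v0" "\<And>k. k < n \<Longrightarrow> homotopic_paths X (h \<circ> gam k) (w k)"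
    by (rule realize_loops[OF v0_in, of w]) (use w in auto)
  interpret G: group "pi1 X v0" by (rule pi1_group[OF v0_in])
  have "bind h (hclass X (gam k)) = y k" if k: "k < n" for k
  proof -
    have l: "h \<circ> gam k \<in> loops_at X v0" using loop_image[OF h(1,2) gam_loop[OF k]] h(3) by simp
    have c: "(\<lambda>_. v0) \<in> loops_at X v0" using v0_in by simp
    have "bind h (hclass X (gam k)) = hclass X (conj_path (\<lambda>_. v0) (h \<circ> gam k) (\<lambda>_. v0))"
      by (rule pi1_map_hclass[OF v0_in h(1,2) based_path[of h, OF h(3)] gam_loop[OF k]])
    also have "\<dots> = bind id (hclass X (h \<circ> gam k))"
      using pi1_map_hclass[OF v0_in, of id "\<lambda>_. v0" "h \<circ> gam k"] based_path[of id] l by simp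
    also have "\<dots> = hclass X (h \<circ> gam k)" using l by (simp add: bind_id)
    also have "\<dots> = y k" using h(4)[OF k] w[OF k] hclass_eqI by blast
    finally show ?thesis .
  qed
  then show ?thesis using that h by blast
qed

text \<open>Conjugation by the class of \<open>b\<close> is what the identity induces with tail
  \<open>b\<close>. So \<open>homotopy_of_pi1_maps\<close> applies, and it also determines the class
  of the track.\<close>

lemma homotopic_id_of_inner:
  assumes h: "continuous_on X h" "h ` X \<subseteq> X" "h v0 = v0" and b: "b \<in> loops_at X v0"
    and eq: "\<And>k. k < n \<Longrightarrow> bind h (hclass X (gam k)) = hclass X b \<otimes>\<^bsub>pi1 X v0\<^esub> hclass X (gam k) \<otimes>\<^bsub>pi1 X v0\<^esub> inv\<^bsub>pi1 X v0\<^esub> (hclass X b)"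
  obtains H where "htpy X X h id H" "hclass X (\<lambda>t. H (t,v0)) = hclass X b"
proof -
  have i: "continuous_on X id" "id ` X \<subseteq> X" by auto
  have bp: "path_from_to X v0 (id v0) b" using b by (simp add: path_from_to_loop)
  obtain H where H: "htpy X X h id H" "homotopic_paths X (\<lambda>t. H (t,v0)) (reversepath (\<lambda>_. v0) +++ b)"
  proof (rule homotopy_of_pi1_maps[OF h(1,2) i based_path[of h, OF h(3)] bp])
    show "pi1_map X v0 h (\<lambda>_. v0) (hclass X (gam k)) = pi1_map X v0 id b (hclass X (gam k))" if "k < n" for k
      using eq[OF that] pi1_map_id[OF v0_in b, of "hclass X (gam k)"] gam_loop[OF that] by simp
  qed blast
  interpret G: group "pi1 X v0" by (rule pi1_group[OF v0_in])
  have "hclass X (\<lambda>t. H (t,v0)) = hclass X ((\<lambda>_. v0) +++ b)"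
    using hclass_eqI[OF H(2)] by (simp add: reversepath_def)
  also have "\<dots> = hclass X b" using pi1_mult[of "\<lambda>_. v0" X v0 b] b v0_in by (simp add: pi1_one[symmetric])
  finally show ?thesis using that H(1) by blast
qed

end

section \<open>Necessity\<close>

context graph_cover
begin

abbreviation "cls \<equiv> map_class (\<lambda>_. True) X"
abbreviation "fcls \<equiv> map_class (fiber_preserving Xhat p) Xhat"
abbreviation "selfeq \<equiv> self_homotopy_equivalence (top_of_set X)"
abbreviation "xg k \<equiv> hclass X (gam k)"

end

locale lifting_section = graph_cover X v0 n ed K Xhat p \<alpha> \<theta>
  for X :: "'a::topological_space set" and v0 n ed K and Xhat :: "'b::topological_space set" and p \<alpha> \<theta> +
  fixes s
  assumes s_hom: "s \<in> hom (HE X) (FHE Xhat p)"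
    and s_section: "c \<in> carrier (HE X) \<Longrightarrow> FHE_to_HE Xhat p X (s c) = c"
begin

lemma cls_in: "selfeq h \<Longrightarrow> cls h \<in> carrier (HE X)"
  unfolding HE_def HE_with_carrier by blast

lemma section_class:
  assumes h: "selfeq h" and f: "f \<in> s (cls h)"
  shows "s (cls h) = fcls f"
proof -
  have "s (cls h) \<in> carrier (FHE Xhat p)" using s_hom cls_in[OF h] by (rule hom_in_carrier)
  then obtain f0 where "s (cls h) = fcls f0" unfolding FHE_def HE_with_carrier by blast
  moreover from this have "homotopic_with (fiber_preserving Xhat p) (top_of_set Xhat) (top_of_set Xhat) f0 f"
    using f by (simp add: map_class_def)
  ultimately show ?thesis using map_class_eq by metis
qed

text \<open>\<open>FHE_to_HE\<close> yields only a member of the class over some map homotopic to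
  \<open>h\<close>. Lifting that homotopy moves it within its class to a lift of \<open>h\<close>
  itself.\<close>

lemma section_lift:
  assumes h: "selfeq h"
  obtains f where "f \<in> s (cls h)" "covers h f"
proof -
  have hc: "continuous_on X h" "h ` X \<subseteq> X" using h by (auto simp: self_homotopy_equivalence_def)
  have "h \<in> cls h" using hc by (auto simp: map_class_def)
  then have "h \<in> FHE_to_HE Xhat p X (s (cls h))" using s_section[OF cls_in[OF h]] by simp
  then obtain f h' where f: "f \<in> s (cls h)" "\<And>x. x \<in> Xhat \<Longrightarrow> h' (p x) = p (f x)"
      "homotopic_with (\<lambda>_. True) (top_of_set X) (top_of_set X) h' h"
    unfolding FHE_to_HE_def by blast
  note sc = section_class[OF h f(1)]
  have "homotopic_with (fiber_preserving Xhat p) (top_of_set Xhat) (top_of_set Xhat) f f"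
    using f(1) unfolding sc by (simp add: map_class_def)
  then have fc: "continuous_on Xhat f" "f ` Xhat \<subseteq> Xhat"
    using homotopic_with_imp_continuous_maps by fastforce+
  have "continuous_on X h'" "h' ` X \<subseteq> X" using homotopic_with_imp_continuous_maps[OF f(3)] by auto
  then have cov': "covers h' f" using fc f(2) by (simp add: covers_def)
  obtain H :: "real \<times> 'a \<Rightarrow> 'a" where H: "htpy X X h' h H"
    by (rule homotopic_with_htpy[OF f(3)]) blast
  obtain f' and k :: "real \<times> 'b \<Rightarrow> 'b" where f': "covers h f'" "htpy Xhat Xhat f f' k"
    "\<And>t x. t \<in> {0..1} \<Longrightarrow> x \<in> Xhat \<Longrightarrow> p (k (t,x)) = H (t, p x)"
    by (rule lift_htpy[OF H cov' hc]) blast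
  have "homotopic_with (fiber_preserving Xhat p) (top_of_set Xhat) (top_of_set Xhat) f f'"
    by (rule homotopic_with_onI[of _ k]) (use f'(2,3) in \<open>auto simp: htpy_def fiber_preserving_def\<close>)
  then have "f' \<in> s (cls h)" unfolding sc by (simp add: map_class_def)
  then show ?thesis using that f'(1) by blast
qed

lemma section_compose:
  assumes h: "selfeq h" "f \<in> s (cls h)" "covers h f" and h': "selfeq h'" "f' \<in> s (cls h')" "covers h' f'"
  shows "f \<circ> f' \<in> s (cls (h \<circ> h'))"
proof -
  note c = coversD[OF h(3)] and c' = coversD[OF h'(3)]
  have "s (cls (h \<circ> h')) = s (cls h \<otimes>\<^bsub>HE X\<^esub> cls h')"
    using map_class_compose[OF c(1,2) c'(1,2)] by simp
  also have "\<dots> = fcls f \<otimes>\<^bsub>FHE Xhat p\<^esub> fcls f'"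
    using s_hom cls_in[OF h(1)] cls_in[OF h'(1)] section_class[OF h(1,2)] section_class[OF h'(1,2)] by (simp add: hom_def)
  also have "\<dots> = fcls (f \<circ> f')"
    by (rule fiber_map_class_compose) (use c c' covers_fiber_preserving[OF h(3)] covers_fiber_preserving[OF h'(3)] in auto)
  finally show ?thesis
    using covers_compose[OF h'(3) h(3)] covers_fiber_preserving[OF covers_compose[OF h'(3) h(3)]]
    by (auto simp: map_class_def covers_def)
qed

text \<open>The homomorphism property makes \<open>f\<close> fiber-preservingly homotopic to
  \<open>f \<circ> f\<close>, and this homotopy descends to one from the identity to itself. Its
  track is central and hence acts trivially on the fibre, so \<open>f\<close> and
  \<open>f \<circ> f\<close> agree at \<open>base\<close>. As \<open>f\<close> is a deck
  transformation, it is then trivial.\<close>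

lemma section_id_fixes_base:
  assumes f: "f \<in> s (cls id)" "covers id f"
  shows "f base = base"
proof -
  have i: "selfeq id"
    unfolding self_homotopy_equivalence_def by (intro conjI exI[of _ id]) auto
  have ff: "f \<circ> f \<in> s (cls id)" using section_compose[OF i f i f] by simp
  have hff: "homotopic_with (fiber_preserving Xhat p) (top_of_set Xhat) (top_of_set Xhat) f (f \<circ> f)"
    using ff unfolding section_class[OF i f(1)] by (simp add: map_class_def)
  obtain k :: "real \<times> 'b \<Rightarrow> 'b" where k: "htpy Xhat Xhat f (f \<circ> f) k"
    "\<And>t. t \<in> {0..1} \<Longrightarrow> fiber_preserving Xhat p (\<lambda>x. k (t,x))"
    by (rule homotopic_with_htpy[OF hff]) blast
  obtain h h' and H :: "real \<times> 'a \<Rightarrow> 'a" where H: "covers h f" "covers h' (f \<circ> f)" "htpy X X h h' H"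
    "\<And>t x. t \<in> {0..1} \<Longrightarrow> x \<in> Xhat \<Longrightarrow> H (t, p x) = p (k (t,x))"
  proof (rule descend_htpy[OF k])
    fix h h' :: "'a \<Rightarrow> 'a" and H :: "real \<times> 'a \<Rightarrow> 'a"
    assume 1: "covers h f" and 2: "covers h' (f \<circ> f)" and 3: "htpy X X h h' H"
      and 4: "\<And>t x. t \<in> {0..1} \<Longrightarrow> x \<in> Xhat \<Longrightarrow> H (t, p x) = p (k (t,x))"
    show thesis by (rule that[OF 1 2 3 4])
  qed
  have ff': "covers id (f \<circ> f)" using covers_compose[OF f(2) f(2)] by simp
  have "h y = id y" "h' y = id y" if "y \<in> X" for y
    using covers_base_unique[OF H(1) f(2) that] covers_base_unique[OF H(2) ff' that] by auto
  then have Hid: "htpy X X id id H" using H(3) by (simp add: htpy_def)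
  obtain b where b: "adapted f b" by (rule adapted_exists[OF f(2)])
  let ?t = "\<lambda>t. H (t,v0)" and ?G = "pi1 X v0"
  have bl: "b \<in> loops_at X v0" using adapted_path[OF f(2) b] by (simp add: path_from_to_loop)
  have tl: "?t \<in> loops_at X v0" using htpy_track_path[OF Hid v0_in] by (simp add: loops_at_def)
  let ?u = "hclass X b" and ?g = "hclass X ?t"
  have ug: "?u \<in> carrier ?G" "?g \<in> carrier ?G" using bl tl by auto
  have bt: "hclass X (b +++ ?t) = ?u \<otimes>\<^bsub>?G\<^esub> ?g" using pi1_mult[OF bl tl] by simp
  have ad: "adapted (f \<circ> f) (b +++ ?t)"
    by (rule adapted_htpy[OF k(1) f(2) b]) (use H(4)[OF _ base(1)] base in simp)
  \<comment> \<open>The tail \<open>b\<close> and the tail \<open>b\<close> followed by the track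
    induce the same map from the identity. So two conjugations coincide, which makes the class of
    the track central.\<close>
  have central: "?g \<otimes>\<^bsub>?G\<^esub> A = A \<otimes>\<^bsub>?G\<^esub> ?g" if A: "A \<in> carrier ?G" for A
  proof -
    have "ind id (b +++ ?t) A = ind id b A"
      by (rule pi1_map_homotopy[OF v0_in _ _ _ _ _ Hid A]) (use bl in \<open>auto simp: path_from_to_loop\<close>)
    then have "inner (?u \<otimes>\<^bsub>?G\<^esub> ?g) A = inner ?u A"
      using pi1_map_id[OF v0_in _ A] bl tl bt by simp
    then have "?u \<otimes>\<^bsub>?G\<^esub> (?g \<otimes>\<^bsub>?G\<^esub> A \<otimes>\<^bsub>?G\<^esub> inv\<^bsub>?G\<^esub> ?g) \<otimes>\<^bsub>?G\<^esub> inv\<^bsub>?G\<^esub> ?u = ?u \<otimes>\<^bsub>?G\<^esub> A \<otimes>\<^bsub>?G\<^esub> inv\<^bsub>?G\<^esub> ?u"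
      using ug A by (simp add: inv_mult_group m_assoc)
    then have "?g \<otimes>\<^bsub>?G\<^esub> A \<otimes>\<^bsub>?G\<^esub> inv\<^bsub>?G\<^esub> ?g = A" using ug A by simp
    then have "?g \<otimes>\<^bsub>?G\<^esub> A \<otimes>\<^bsub>?G\<^esub> inv\<^bsub>?G\<^esub> ?g \<otimes>\<^bsub>?G\<^esub> ?g = A \<otimes>\<^bsub>?G\<^esub> ?g" by simp
    then show ?thesis using ug A by (simp add: m_assoc)
  qed
  have a0: "\<alpha> i ?g = 0" if "i < n" for i
    by (rule central_alpha[OF ug(2) central that]) (rule x_closed)
  have g1: "mon ?g = \<one>\<^bsub>D\<^esub>"
    unfolding mon_gens[OF ug(2)] by (rule deck.finprod_one_eqI) (use a0 in simp)
  have m: "mon ?u base = f base" using mon_hclass(2)[OF bl] b by (simp add: adapted_def)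
  have "mon (?u \<otimes>\<^bsub>?G\<^esub> ?g) base = f (f base)"
    using mon_hclass(2)[of "b +++ ?t"] bl tl bt ad by (simp add: adapted_def)
  \<comment> \<open>The tails of \<open>f\<close> and \<open>f \<circ> f\<close> differ by the
    track, whose monodromy is trivial.\<close>
  then have 1: "f (f base) = mon ?u base" using ug g1 mon_in by (simp add: mon_mult)
  obtain d where d: "d \<in> carrier D" "\<And>x. x \<in> Xhat \<Longrightarrow> f x = d (id x)"
    by (rule covers_unique[OF covers_id f(2)]) blast
  have "d (d base) = d base" using 1 m d(2) base coversD(5)[OF f(2)] by simp
  moreover have db: "d base \<in> Xhat" using deckD(2)[OF d(1)] base by blast
  ultimately have "d = \<one>\<^bsub>D\<^esub>"
    using deck_eq[OF d(1) deck.one_closed db] deck_one[OF db] by simp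
  then show ?thesis using d(2)[OF base(1)] deck_one base by simp
qed

text \<open>With inverse actions on the generators, both composites induce the identity with
  constant tail, and maps of a graph with equal action are homotopic.\<close>

lemma selfeq_of_inverse:
  assumes h: "continuous_on X h" "h ` X \<subseteq> X" "h v0 = v0" and h': "continuous_on X h'" "h' ` X \<subseteq> X" "h' v0 = v0"
    and inv: "\<And>k. k < n \<Longrightarrow> bind h' (bind h (xg k)) = xg k" "\<And>k. k < n \<Longrightarrow> bind h (bind h' (xg k)) = xg k"
  shows "selfeq h"
proof -
  have *: "\<exists>H. htpy X X (a' \<circ> a) id H"
    if a: "continuous_on X a" "a ` X \<subseteq> X" "a v0 = v0" and a': "continuous_on X a'" "a' ` X \<subseteq> X" "a' v0 = v0"
      and e: "\<And>k. k < n \<Longrightarrow> bind a' (bind a (xg k)) = xg k" for a a'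
  proof -
    have "continuous_on X (a' \<circ> a)" "(a' \<circ> a) ` X \<subseteq> X" "(a' \<circ> a) v0 = v0"
      using a a' continuous_on_compose[OF a(1) continuous_on_subset[OF a'(1) a(2)]] by auto
    then obtain H where "htpy X X (a' \<circ> a) id H"
    proof (rule homotopic_id_of_inner)
      show "(\<lambda>_. v0) \<in> loops_at X v0" using v0_in by simp
      show "bind (a' \<circ> a) (xg k) = inner (hclass X (\<lambda>_. v0)) (xg k)" if "k < n" for k
        using bind_compose[OF a a' x_closed[OF that]] e[OF that] x_closed[OF that] by (simp add: pi1_one[symmetric])
    qed blast
    then show ?thesis by blast
  qed
  obtain H where H: "htpy X X (h' \<circ> h) id H" using *[OF h h' inv(1)] by blast
  obtain H' where H': "htpy X X (h \<circ> h') id H'" using *[OF h' h inv(2)] by blast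
  show ?thesis by (rule self_homotopy_equivalenceI[OF h(1,2) h'(1,2) H H'])
qed

lemma mon_inner: "g \<in> carrier (pi1 X v0) \<Longrightarrow> u \<in> carrier (pi1 X v0) \<Longrightarrow> mon (inner g u) = mon u"
  using mon_in[of g] mon_in[of u] by (simp add: deck.m_comm[of "mon g" "mon u"] deck.m_assoc)

lemma ind_bind:
  assumes h: "continuous_on X h" "h ` X \<subseteq> X" "h v0 = v0" and b: "b \<in> loops_at X v0" and u: "u \<in> carrier (pi1 X v0)"
  obtains g where "g \<in> carrier (pi1 X v0)" "ind h b u = inner g (bind h u)"
proof -
  have c: "path_from_to X v0 (h v0) (\<lambda>_. v0)" "path_from_to X v0 (h v0) b" using b h(3) v0_in by (auto simp: path_from_to_loop)
  have "b +++ reversepath (\<lambda>_. v0) \<in> loops_at X v0" using b v0_in by (intro loops_at_join loops_at_reverse) auto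
  then show ?thesis
    using that[of "hclass X (b +++ reversepath (\<lambda>_. v0))"] pi1_map_change[OF v0_in h(1,2) c(2,1) u] pi1_hclass by blast
qed

lemma mon_bind_one:
  assumes f: "covers h f" and h: "h v0 = v0" and u: "u \<in> carrier (pi1 X v0)" "mon u = \<one>\<^bsub>D\<^esub>"
  shows "mon (bind h u) = \<one>\<^bsub>D\<^esub>"
proof -
  note hc = coversD(1,2)[OF f]
  obtain b where b: "adapted f b" by (rule adapted_exists[OF f])
  have bl: "b \<in> loops_at X v0" using adapted_path[OF f b] h by (simp add: path_from_to_loop)
  obtain g where g: "g \<in> carrier (pi1 X v0)" "ind h b u = inner g (bind h u)"
    by (rule ind_bind[OF hc h bl u(1)]) blast
  then show ?thesis
    using mon_ind_one[OF f b u] mon_inner[OF g(1) hom_in_carrier[OF bind_hom[OF hc h] u(1)]] by simp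
qed

lemma mon_eq_of_alpha:
  assumes "u \<in> carrier (pi1 X v0)" "v \<in> carrier (pi1 X v0)" "\<And>k. k < n \<Longrightarrow> \<alpha> k u = \<alpha> k v"
  shows "mon u = mon v"
  unfolding mon_gens[OF assms(1)] mon_gens[OF assms(2)]
  by (rule deck.finprod_cong') (use assms(3) mon_in x_closed in auto)

lemma mon_pow: "u \<in> carrier (pi1 X v0) \<Longrightarrow> mon (u [^]\<^bsub>pi1 X v0\<^esub> (m::int)) = mon u [^]\<^bsub>D\<^esub> m"
  by (rule mon.hom_int_pow)

text \<open>The equivalence \<open>h\<close> multiplies generator \<open>i\<close> by generator
  \<open>k\<close> on the right; its inverse divides instead. Since the section provides a lift of
  \<open>h\<close>, the kernel of the monodromy is preserved, and \<open>w\<close> is the image of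
  \<open>u\<close>.\<close>

lemma transvection:
  assumes ik: "i < n" "k < n" "i \<noteq> k" and u: "u \<in> carrier (pi1 X v0)" "mon u = \<one>\<^bsub>D\<^esub>"
  obtains w where "w \<in> carrier (pi1 X v0)" "mon w = \<one>\<^bsub>D\<^esub>" "\<And>j. j < n \<Longrightarrow> \<alpha> j w = \<alpha> j u + of_bool (j = k) * \<alpha> i u"
proof -
  let ?G = "pi1 X v0"
  have xi: "xg i \<in> carrier ?G" "xg k \<in> carrier ?G" using x_closed ik by auto
  obtain h where h: "continuous_on X h" "h ` X \<subseteq> X" "h v0 = v0"
    "\<And>j. j < n \<Longrightarrow> bind h (xg j) = (if j = i then xg i \<otimes>\<^bsub>?G\<^esub> xg k else xg j)"
    by (rule realize_endomorphism[of "\<lambda>j. if j = i then xg i \<otimes>\<^bsub>?G\<^esub> xg k else xg j"]) (use x_closed ik in auto)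
  obtain h' where h': "continuous_on X h'" "h' ` X \<subseteq> X" "h' v0 = v0"
    "\<And>j. j < n \<Longrightarrow> bind h' (xg j) = (if j = i then xg i \<otimes>\<^bsub>?G\<^esub> inv\<^bsub>?G\<^esub> xg k else xg j)"
    by (rule realize_endomorphism[of "\<lambda>j. if j = i then xg i \<otimes>\<^bsub>?G\<^esub> inv\<^bsub>?G\<^esub> xg k else xg j"]) (use x_closed ik in auto)
  interpret \<phi>: group_hom ?G ?G "bind h" by unfold_locales (rule bind_hom[OF h(1-3)])
  interpret \<psi>: group_hom ?G ?G "bind h'" by unfold_locales (rule bind_hom[OF h'(1-3)])
  have "selfeq h"
    by (rule selfeq_of_inverse[OF h(1-3) h'(1-3)]) (use h(4) h'(4) ik xi in \<open>auto simp: m_assoc\<close>)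
  then obtain f where f: "covers h f" by (rule section_lift)
  have a: "\<alpha> j (bind h u) = \<alpha> j u + of_bool (j = k) * \<alpha> i u" if j: "j < n" for j
  proof -
    have "jac (bind h) l j = of_bool (l = j) + of_bool (l = i) * of_bool (j = k)" if "l < n" for l
      using h(4)[OF that] that xi ik by (auto simp: jac_def alpha_mult alpha_x)
    then have "\<alpha> j (bind h u) = (\<Sum>l<n. \<alpha> l u * of_bool (l = j) + (\<alpha> l u * of_bool (j = k)) * of_bool (l = i))"
      unfolding alpha_hom[OF bind_hom[OF h(1-3)] u(1)] by (intro sum.cong refl) (simp add: algebra_simps)
    also have "\<dots> = \<alpha> j u + \<alpha> i u * of_bool (j = k)"
      unfolding sum.distrib using sum_delta'(2)[OF j] sum_delta'(2)[OF ik(1), of "\<lambda>l. \<alpha> l u * of_bool (j = k)"] by simp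
    finally show ?thesis by (simp add: mult.commute)
  qed
  show ?thesis
    by (rule that[OF _ mon_bind_one[OF f h(3) u] a]) (use u in auto)
qed

text \<open>A transvection alters a kernel element \<open>u\<close>, up to abelian class, by
  generator \<open>k\<close> to the power \<open>\<alpha> i u\<close>, and stays in the kernel. So
  the order of generator \<open>k\<close> in the Galois group divides every
  \<open>\<alpha> i u\<close>. Applied to powers of generators this makes all orders equal; their
  common value is \<open>r\<close>.\<close>

lemma kernel_exponent: "\<exists>r::nat. \<forall>u\<in>carrier (pi1 X v0). mon u = \<one>\<^bsub>D\<^esub> \<longleftrightarrow> (\<forall>k<n. int r dvd \<alpha> k u)"
proof -
  let ?G = "pi1 X v0"
  \<comment> \<open>\<open>ord\<close> is 0 for elements of infinite order, and 0 divides only 0;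
    this is how the value r = 0 arises.\<close>
  define od where "od k = int (deck.ord (mon (xg k)))" for k
  have od: "mon (xg k) [^]\<^bsub>D\<^esub> m = \<one>\<^bsub>D\<^esub> \<longleftrightarrow> od k dvd m" if "k < n" for k and m :: int
    unfolding od_def by (rule deck.int_pow_eq_id) (use mon_in x_closed that in auto)
  have off: "od k dvd \<alpha> i u" if ik: "i < n" "k < n" "i \<noteq> k" and u: "u \<in> carrier ?G" "mon u = \<one>\<^bsub>D\<^esub>" for i k u
  proof -
    obtain w where w: "w \<in> carrier ?G" "mon w = \<one>\<^bsub>D\<^esub>" "\<And>j. j < n \<Longrightarrow> \<alpha> j w = \<alpha> j u + of_bool (j = k) * \<alpha> i u"
      by (rule transvection[OF ik u]) blast
    have xk: "xg k \<in> carrier ?G" using x_closed ik by blast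
    have "mon (u \<otimes>\<^bsub>?G\<^esub> xg k [^]\<^bsub>?G\<^esub> \<alpha> i u) = mon w"
      by (rule mon_eq_of_alpha) (use u w xk ik in \<open>auto simp: alpha_mult alpha_pow alpha_x\<close>)
    then have "mon (xg k) [^]\<^bsub>D\<^esub> \<alpha> i u = \<one>\<^bsub>D\<^esub>" using u w(2) xk mon_in by (simp add: mon_mult mon_pow)
    then show ?thesis using od ik by simp
  qed
  have all: "od k dvd \<alpha> i u" if ik: "i < n" "k < n" and u: "u \<in> carrier ?G" "mon u = \<one>\<^bsub>D\<^esub>" for i k u
  proof (cases "i = k")
    case True
    obtain j where j: "j < n" "j \<noteq> k"
      using n2 by (cases "k = 0") (auto intro: that[of 1] that[of 0])
    \<comment> \<open>For equal indices a transvection first copies \<open>\<alpha> k u\<close> into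
      another coordinate \<open>j\<close>, to which the case of different indices applies, for
      \<open>w\<close> and for \<open>u\<close>.\<close>
    obtain w where w: "w \<in> carrier ?G" "mon w = \<one>\<^bsub>D\<^esub>" "\<And>l. l < n \<Longrightarrow> \<alpha> l w = \<alpha> l u + of_bool (l = j) * \<alpha> k u"
      by (rule transvection[OF ik(2) j(1) j(2)[symmetric] u]) blast
    have "od k dvd \<alpha> j u + \<alpha> k u" using off[OF j(1) ik(2) j(2) w(1,2)] w(3)[OF j(1)] by simp
    then show ?thesis using off[OF j(1) ik(2) j(2) u] True by (simp add: dvd_add_right_iff)
  qed (use off ik u in blast)
  have "od k dvd od i" if ik: "i < n" "k < n" for i k
  proof -
    have xi: "xg i \<in> carrier ?G" using x_closed ik by blast
    have "mon (xg i [^]\<^bsub>?G\<^esub> od i) = \<one>\<^bsub>D\<^esub>" using od[OF ik(1), of "od i"] xi by (simp add: mon_pow)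
    then show ?thesis using all[OF ik, of "xg i [^]\<^bsub>?G\<^esub> od i"] xi ik by (simp add: alpha_pow alpha_x)
  qed
  then have eq: "od k = od 0" if "k < n" for k
    using that n2 zdvd_antisym_nonneg[of "od k" "od 0"] by (simp add: od_def)
  show ?thesis
  proof (intro exI ballI)
    fix u assume u: "u \<in> carrier ?G"
    show "mon u = \<one>\<^bsub>D\<^esub> \<longleftrightarrow> (\<forall>k<n. int (deck.ord (mon (xg 0))) dvd \<alpha> k u)"
    proof
      assume "mon u = \<one>\<^bsub>D\<^esub>"
      then show "\<forall>k<n. int (deck.ord (mon (xg 0))) dvd \<alpha> k u" using all[OF _ _ u] n2 by (simp add: od_def)
    next
      assume "\<forall>k<n. int (deck.ord (mon (xg 0))) dvd \<alpha> k u"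
      then have "mon (xg k) [^]\<^bsub>D\<^esub> \<alpha> k u = \<one>\<^bsub>D\<^esub>" if "k < n" for k
        using od[OF that] eq[OF that] that by (simp add: od_def)
      then show "mon u = \<one>\<^bsub>D\<^esub>" unfolding mon_gens[OF u] by (intro deck.finprod_one_eqI) auto
    qed
  qed
qed

end

section \<open>The twisted cycle and coprimality\<close>

context lifting_section
begin

lemma bind_funpow:
  assumes h: "continuous_on X h" "h ` X \<subseteq> X" "h v0 = v0"
  shows "(h ^^ j) v0 = v0" "u \<in> carrier (pi1 X v0) \<Longrightarrow> bind (h ^^ j) u = (bind h ^^ j) u"
proof -
  have v: "(h ^^ j) v0 = v0" for j by (induction j) (use h in auto)
  then show "(h ^^ j) v0 = v0" .
  have "bind (h ^^ j) u = (bind h ^^ j) u \<and> (bind h ^^ j) u \<in> carrier (pi1 X v0)" if u: "u \<in> carrier (pi1 X v0)"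
  proof (induction j)
    case 0 then show ?case using bind_id[OF u] u by (simp add: id_def)
  next
    case (Suc j)
    have "bind (h \<circ> h ^^ j) u = bind h (bind (h ^^ j) u)"
      by (rule bind_compose) (use continuous_on_funpow[OF h(1,2)] v h u in auto)
    then have "bind (h ^^ Suc j) u = (bind h ^^ Suc j) u"
      using Suc by (simp only: funpow.simps(2) comp_apply)
    moreover have "(bind h ^^ Suc j) u \<in> carrier (pi1 X v0)"
      using Suc hom_in_carrier[OF bind_hom[OF h]] by simp
    ultimately show ?case by blast
  qed
  then show "u \<in> carrier (pi1 X v0) \<Longrightarrow> bind (h ^^ j) u = (bind h ^^ j) u" by blast
qed

lemma section_funpow:
  assumes h: "selfeq h" "f \<in> s (cls h)" "covers h f"
  shows "selfeq (h ^^ Suc j) \<and> f ^^ Suc j \<in> s (cls (h ^^ Suc j)) \<and> covers (h ^^ Suc j) (f ^^ Suc j)"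
proof (induction j)
  case 0 then show ?case using h by simp
next
  case (Suc j)
  have e: "h ^^ Suc (Suc j) = h \<circ> h ^^ Suc j" "f ^^ Suc (Suc j) = f \<circ> f ^^ Suc j"
    by (rule funpow.simps(2))+
  show ?case
    unfolding e
    using Suc self_homotopy_equivalence_compose[OF h(1), of "h ^^ Suc j"] section_compose[OF h, of "h ^^ Suc j" "f ^^ Suc j"]
      covers_compose[of "h ^^ Suc j" "f ^^ Suc j" h f] h(3) by blast
qed

text \<open>The map permutes the last \<open>n - 1\<close> generators cyclically, except that it conjugates by the first
  one on passing the end of the cycle; so its power \<open>n - 1\<close> is freely homotopic to the identity.\<close>

lemma twisted_cycle:
  obtains h where "continuous_on X h" "h ` X \<subseteq> X" "h v0 = v0" "\<And>k. k < n \<Longrightarrow> \<alpha> 0 (bind h (xg k)) = of_bool (k = 0)"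
    "\<And>k. k < n \<Longrightarrow> bind (h ^^ (n - 1)) (xg k) = inner (xg 0) (xg k)"
proof -
  let ?G = "pi1 X v0"
  \<comment> \<open>For \<open>n = 2\<close> the cycle has length one, and generator 1 goes directly
    to its conjugate.\<close>
  define y where "y k = (if k = 0 then xg 0 else if k < n - 1 then xg (Suc k) else inner (xg 0) (xg 1))" for k
  have xc: "xg k \<in> carrier ?G" if "k < n" for k using x_closed that by blast
  have c01: "xg 0 \<in> carrier ?G" "xg 1 \<in> carrier ?G" using xc n2 by auto
  have c0: "xg (Suc 0) \<in> carrier ?G" using c01(2) by simp
  obtain h where h: "continuous_on X h" "h ` X \<subseteq> X" "h v0 = v0" "\<And>k. k < n \<Longrightarrow> bind h (xg k) = y k"
    by (rule realize_endomorphism[of y]) (use xc c01 c0 in \<open>auto simp: y_def\<close>)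
  interpret \<phi>: group_hom ?G ?G "bind h" by unfold_locales (rule bind_hom[OF h(1-3)])
  let ?f = "bind h"
  have f0: "?f (xg 0) = xg 0" using h(4)[of 0] n2 by (simp add: y_def)
  have fS: "?f (xg k) = xg (Suc k)" if "0 < k" "Suc k < n" for k
  proof -
    have "k < n - 1" using that by linarith
    then show ?thesis using h(4)[of k] that by (simp add: y_def)
  qed
  have fe: "?f (xg (n - 1)) = inner (xg 0) (xg 1)" using h(4)[of "n - 1"] n2 by (simp add: y_def)
  have a: "(?f ^^ j) (xg i) = xg (i + j)" if "0 < i" "i + j < n" for i j
    using that by (induction j) (auto simp: fS)
  have b: "(?f ^^ j) (inner (xg 0) (xg 1)) = inner (xg 0) (xg (Suc j))" if "Suc j < n" for j
    using that
  proof (induction j)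
    case (Suc j)
    then have "xg (Suc j) \<in> carrier ?G" using xc by simp
    with Suc show ?case using c01 f0 fS[of "Suc j"] by simp
  qed simp
  have "(?f ^^ (n - 1)) (xg k) = inner (xg 0) (xg k)" if k: "k < n" for k
  proof (cases "k = 0")
    case True
    have "(?f ^^ j) (xg 0) = xg 0" for j by (induction j) (auto simp: f0)
    then show ?thesis using True c01 by (simp add: m_assoc)
  next
    case False
    \<comment> \<open>The \<open>n - 1\<close> steps are split at the end of the cycle:
      \<open>n - 1 - k\<close> steps up to the last generator, one step with the conjugation, and
      \<open>k - 1\<close> steps back up to index \<open>k\<close>.\<close>
    have "(?f ^^ (n - 1)) (xg k) = (?f ^^ (k - 1)) (?f ((?f ^^ (n - 1 - k)) (xg k)))"
    proof -
      have "n - 1 = (k - 1) + (1 + (n - 1 - k))" using False k by simp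
      then have "?f ^^ (n - 1) = ?f ^^ (k - 1) \<circ> (?f ^^ 1 \<circ> ?f ^^ (n - 1 - k))" using funpow_add by metis
      then show ?thesis by simp
    qed
    also have "(?f ^^ (n - 1 - k)) (xg k) = xg (n - 1)" using a[of k "n - 1 - k"] False k by simp
    also have "(?f ^^ (k - 1)) (?f (xg (n - 1))) = inner (xg 0) (xg k)" unfolding fe using b[of "k - 1"] False k by simp
    finally show ?thesis .
  qed
  then have "bind (h ^^ (n - 1)) (xg k) = inner (xg 0) (xg k)" if "k < n" for k
    using bind_funpow(2)[OF h(1-3) xc[OF that]] that by simp
  moreover have "\<alpha> 0 (bind h (xg k)) = of_bool (k = 0)" if k: "k < n" for k
    using h(4)[OF k] c01 k n2 by (auto simp: y_def alpha_x alpha_inner c0)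
  ultimately show ?thesis using that h(1-3) by blast
qed

text \<open>Coordinate 0 of the abelianisation is followed, because the twisted cycle preserves it;
  the translation of the lift \<open>f\<close> therefore adds up along its powers. The homotopy from
  the power \<open>n - 1\<close> to the identity has the class of generator 0 as its track and
  contributes 1, and the total must vanish modulo \<open>r\<close>.\<close>

lemma exponent_coprime:
  assumes r: "\<And>u. u \<in> carrier (pi1 X v0) \<Longrightarrow> mon u = \<one>\<^bsub>D\<^esub> \<longleftrightarrow> (\<forall>k<n. int r dvd \<alpha> k u)"
  shows "coprime r (n - 1)"
proof -
  let ?G = "pi1 X v0" and ?m = "n - 1"
  obtain h where h: "continuous_on X h" "h ` X \<subseteq> X" "h v0 = v0" and h0: "\<And>k. k < n \<Longrightarrow> \<alpha> 0 (bind h (xg k)) = of_bool (k = 0)"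
    and hm: "\<And>k. k < n \<Longrightarrow> bind (h ^^ ?m) (xg k) = inner (xg 0) (xg k)"
    by (rule twisted_cycle) blast
  have x0: "xg 0 \<in> carrier ?G" and g0: "gam 0 \<in> loops_at X v0" using x_closed gam_loop n2 by auto
  obtain l where l: "?m = Suc l" using n2 by (cases ?m) auto
  note hmc = continuous_on_funpow[OF h(1,2)]
  obtain H :: "real \<times> 'a \<Rightarrow> 'a" where H: "htpy X X (h ^^ ?m) id H" "hclass X (\<lambda>t. H (t,v0)) = xg 0"
    by (rule homotopic_id_of_inner[of "h ^^ ?m" "gam 0"]) (use hmc bind_funpow(1)[OF h] g0 hm in auto)
  have he: "selfeq h"
  proof (rule self_homotopy_equivalenceI[OF h(1,2)])
    show "htpy X X ((h ^^ l) \<circ> h) id H" using H(1) unfolding l by (simp add: funpow_Suc_right del: funpow.simps)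
    show "htpy X X (h \<circ> (h ^^ l)) id H" using H(1) unfolding l by simp
  qed (use hmc in auto)
  obtain f where f: "f \<in> s (cls h)" "covers h f" by (rule section_lift[OF he])
  obtain b where b: "adapted f b" by (rule adapted_exists[OF f(2)])
  have bl: "b \<in> loops_at X v0" using adapted_path[OF f(2) b] h(3) by (simp add: path_from_to_loop)
  let ?u = "hclass X b"
  have u: "?u \<in> carrier ?G" "mon ?u base = f base" using bl mon_hclass(2)[OF bl] b by (auto simp: adapted_def)
  \<comment> \<open>\<open>w\<close> is the accumulated translation of \<open>f ^^ j\<close>. A
    further step applies the induced map, which keeps \<open>\<alpha> 0\<close>, and multiplies by
    \<open>?u\<close>.\<close>
  have "\<exists>w\<in>carrier ?G. (f ^^ j) base = mon w base \<and> \<alpha> 0 w = int j * \<alpha> 0 ?u" for j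
  proof (induction j)
    case 0
    then show ?case by (intro bexI[of _ "\<one>\<^bsub>?G\<^esub>"]) (auto simp: alpha_one deck_one base)
  next
    case (Suc j)
    then obtain w where w: "w \<in> carrier ?G" "(f ^^ j) base = mon w base" "\<alpha> 0 w = int j * \<alpha> 0 ?u" by blast
    obtain g where g: "g \<in> carrier ?G" "ind h b w = inner g (bind h w)"
      by (rule ind_bind[OF h bl w(1)]) blast
    have bw: "bind h w \<in> carrier ?G" by (rule hom_in_carrier[OF bind_hom[OF h] w(1)])
    have iw: "ind h b w \<in> carrier ?G" by (rule hom_in_carrier[OF ind_hom[OF f(2) b] w(1)])
    have "\<alpha> 0 (bind h w) = (\<Sum>k<n. \<alpha> k w * of_bool (k = 0))"
      unfolding alpha_hom[OF bind_hom[OF h] w(1)] by (intro sum.cong refl) (use h0 in \<open>simp add: jac_def\<close>)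
    also have "\<dots> = \<alpha> 0 w" using sum_delta'(2) n2 by simp
    finally have "\<alpha> 0 (ind h b w) = \<alpha> 0 w"
      using g(2) alpha_inner[OF g(1) bw] by simp
    then have "\<alpha> 0 (ind h b w \<otimes>\<^bsub>?G\<^esub> ?u) = int (Suc j) * \<alpha> 0 ?u"
      unfolding alpha_mult[OF iw u(1)] w(3) by (simp add: algebra_simps)
    moreover have "(f ^^ Suc j) base = mon (ind h b w \<otimes>\<^bsub>?G\<^esub> ?u) base"
      using mon_ind[OF f(2) b w(1)] w(2) u iw deck_mult[OF mon_in[OF iw] mon_in[OF u(1)] base(1)] by (simp add: mon_mult)
    ultimately show ?case using iw u(1) by (intro bexI[of _ "ind h b w \<otimes>\<^bsub>?G\<^esub> ?u"]) auto
  qed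
  then obtain w where w: "w \<in> carrier ?G" "(f ^^ ?m) base = mon w base" "\<alpha> 0 w = int ?m * \<alpha> 0 ?u" by blast
  have F: "selfeq (h ^^ ?m)" "f ^^ ?m \<in> s (cls (h ^^ ?m))" "covers (h ^^ ?m) (f ^^ ?m)"
    using section_funpow[OF he f, of l] unfolding l by auto
  obtain f' and k :: "real \<times> 'b \<Rightarrow> 'b" where f': "covers id f'" "htpy Xhat Xhat (f ^^ ?m) f' k"
    "\<And>t x. t \<in> {0..1} \<Longrightarrow> x \<in> Xhat \<Longrightarrow> p (k (t,x)) = H (t, p x)"
    by (rule lift_htpy[OF H(1) F(3)]) auto
  have "homotopic_with (fiber_preserving Xhat p) (top_of_set Xhat) (top_of_set Xhat) (f ^^ ?m) f'"
    by (rule homotopic_with_onI[of _ k]) (use f'(2,3) in \<open>auto simp: htpy_def fiber_preserving_def\<close>)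
  then have "f' \<in> s (cls (h ^^ ?m))" unfolding section_class[OF F(1,2)] by (simp add: map_class_def)
  also have "cls (h ^^ ?m) = cls id" by (rule map_class_eq[OF htpy_homotopic_with[OF H(1)]])
  finally have fb: "f' base = base" using section_id_fixes_base f'(1) by blast
  obtain c where c: "c \<in> loops_at X v0" "w = hclass X c" using w(1) by (auto simp: pi1_carrier)
  have "p ((f ^^ ?m) base) = v0" using coversD(6)[OF F(3) base(1)] base bind_funpow(1)[OF h] by simp
  then have ac: "adapted (f ^^ ?m) c"
    using c mon_hclass(2)[OF c(1)] w(2) by (simp add: adapted_def path_from_to_loop)
  have tl: "(\<lambda>t. H (t,v0)) \<in> loops_at X v0"
    using htpy_track_path[OF H(1) v0_in] bind_funpow(1)[OF h] by (simp add: loops_at_def)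
  \<comment> \<open>\<open>f'\<close> lies over the identity in the class of the section there, so
    it fixes \<open>base\<close>. Its tail, namely \<open>c\<close> followed by the track, hence has
    trivial monodromy.\<close>
  have "adapted f' (c +++ (\<lambda>t. H (t,v0)))"
    by (rule adapted_htpy[OF f'(2) F(3) ac]) (use f'(3)[OF _ base(1)] base in simp)
  then have "mon (w \<otimes>\<^bsub>?G\<^esub> xg 0) base = base"
    using mon_hclass(2)[of "c +++ (\<lambda>t. H (t,v0))"] c tl fb pi1_mult[OF c(1) tl] H(2) by (simp add: adapted_def)
  then have "mon (w \<otimes>\<^bsub>?G\<^esub> xg 0) = \<one>\<^bsub>D\<^esub>"
    using w(1) x0 mon_in by (intro deck_eq[OF _ _ base(1)]) (auto simp: deck_one base)
  then have "int r dvd \<alpha> 0 (w \<otimes>\<^bsub>?G\<^esub> xg 0)" using r[of "w \<otimes>\<^bsub>?G\<^esub> xg 0"] w(1) x0 n2 by simp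
  then have d: "int r dvd int ?m * \<alpha> 0 ?u + 1" using w x0 n2 by (simp add: alpha_mult alpha_x)
  show ?thesis
  proof (rule coprimeI)
    fix e assume e: "e dvd r" "e dvd ?m"
    have "int e dvd int ?m * \<alpha> 0 ?u + 1" using e(1) d by (metis dvd_trans int_dvd_int_iff)
    moreover have "int e dvd int ?m * \<alpha> 0 ?u" using e(2) by (metis dvd_mult2 int_dvd_int_iff)
    ultimately have "int e dvd 1" by (simp add: dvd_add_right_iff)
    then show "is_unit e" by simp
  qed
qed

end

section \<open>The Galois group as a group of residues\<close>

context graph_cover
begin

definition residues :: "nat \<Rightarrow> (real \<Rightarrow> 'a) set \<Rightarrow> nat \<Rightarrow> int" where
  "residues r u = (\<lambda>k\<in>{..<n}. \<alpha> k u mod int r)"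

abbreviation "residue_product r \<equiv> product_group {..<n} (\<lambda>_. integer_mod_group r)"

lemma residues_hom: "residues r \<in> hom (pi1 X v0) (residue_product r)"
  by (rule homI) (auto simp: residues_def carrier_integer_mod_group product_group_def alpha_mult mod_simps fun_eq_iff)

lemma residues_surj: "residues r ` carrier (pi1 X v0) = carrier (residue_product r)"
proof
  show "carrier (residue_product r) \<subseteq> residues r ` carrier (pi1 X v0)"
  proof
    fix v assume v: "v \<in> carrier (residue_product r)"
    obtain g where g: "g \<in> carrier (pi1 X v0)" "\<And>i. i < n \<Longrightarrow> \<alpha> i g = v i" by (rule alpha_surj[of v]) blast
    have "residues r g = v"
    proof (rule extensionalityI[of _ "{..<n}"])
      fix k assume k: "k \<in> {..<n}"
      then have "v k \<in> carrier (integer_mod_group r)" using v by auto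
      then show "residues r g k = v k" using k g(2) by (simp add: residues_def carrier_integer_mod_group split: if_splits)
    qed (use v in \<open>auto simp: residues_def PiE_def\<close>)
    then show "v \<in> residues r ` carrier (pi1 X v0)" using g(1) by blast
  qed
qed (use hom_in_carrier[OF residues_hom] in blast)

lemma residues_one: "residues r u = \<one>\<^bsub>residue_product r\<^esub> \<longleftrightarrow> (\<forall>k<n. int r dvd \<alpha> k u)"
  by (auto simp: residues_def fun_eq_iff restrict_def dvd_eq_mod_eq_0)

lemma group_residue_product: "group (residue_product r)"
  by (intro product_group) simp

text \<open>\<open>mon\<close> and \<open>residues r\<close> are surjections from the same group
  with the same kernel, so their images are isomorphic.\<close>

lemma deck_iso_residues:
  assumes r: "\<And>u. u \<in> carrier (pi1 X v0) \<Longrightarrow> mon u = \<one>\<^bsub>D\<^esub> \<longleftrightarrow> (\<forall>k<n. int r dvd \<alpha> k u)"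
  shows "D \<cong> residue_product r"
proof -
  interpret R: group_hom "pi1 X v0" "residue_product r" "residues r"
    by (intro group_hom.intro group_hom_axioms.intro residues_hom group_residue_product is_group)
  have "kernel (pi1 X v0) D mon = kernel (pi1 X v0) (residue_product r) (residues r)"
    using r residues_one by (auto simp: kernel_def)
  moreover have "mon ` carrier (pi1 X v0) = carrier D"
    using mon_in mon_surj by (metis image_eqI image_subsetI subsetI subset_antisym)
  ultimately show ?thesis
    using mon.FactGroup_iso R.FactGroup_iso[OF residues_surj] group.iso_sym iso_trans
    by (metis mon.normal_kernel normal.factorgroup_is_group)
qed

end

context lifting_section
begin

theorem necessity: "\<exists>r. D \<cong> residue_product r \<and> coprime r (n - 1)"
  using kernel_exponent exponent_coprime deck_iso_residues by blast

end

section \<open>Sufficiency\<close>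

context graph_cover
begin

text \<open>The given isomorphism has no relation to \<open>mon\<close>. By
  \<open>deck_trivial\<close> the monodromy factors through the residues, and it remains to see that
  nothing more is killed. For r > 0 a surjection between finite sets of equal size is injective; for
  r = 0 and n = 2 the monodromy is a surjective integral 2 by 2 matrix, whose determinant cannot
  vanish.\<close>

lemma kernel_of_iso:
  assumes iso: "D \<cong> residue_product r" and n: "r = 0 \<Longrightarrow> n = 2" and u: "u \<in> carrier (pi1 X v0)"
  shows "mon u = \<one>\<^bsub>D\<^esub> \<longleftrightarrow> (\<forall>k<n. int r dvd \<alpha> k u)"
proof -
  let ?G = "pi1 X v0" and ?P = "residue_product r"
  obtain \<rho> where \<rho>: "\<rho> \<in> hom D ?P" "bij_betw \<rho> (carrier D) (carrier ?P)" using iso by (auto simp: is_iso_def iso_def)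
  interpret P: group ?P by (rule group_residue_product)
  interpret \<rho>: group_hom D ?P \<rho> by unfold_locales (rule \<rho>(1))
  interpret R: group_hom ?G ?P "residues r" by unfold_locales (rule residues_hom)
  have pow: "d [^]\<^bsub>D\<^esub> int r = \<one>\<^bsub>D\<^esub>" if d: "d \<in> carrier D" for d
  proof -
    have "\<rho> d \<in> carrier ?P" using d by (rule \<rho>.hom_closed)
    then obtain v where v: "v \<in> carrier ?G" "\<rho> d = residues r v" using residues_surj by (metis imageE)
    have "\<rho> (d [^]\<^bsub>D\<^esub> int r) = residues r (v [^]\<^bsub>?G\<^esub> int r)"
      using \<rho>.hom_int_pow[OF d] R.hom_int_pow[OF v(1)] v(2) by metis
    also have "\<dots> = \<one>\<^bsub>?P\<^esub>" unfolding residues_one using v(1) by (simp add: alpha_pow)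
    finally have "\<rho> (d [^]\<^bsub>D\<^esub> int r) = \<rho> \<one>\<^bsub>D\<^esub>" by (simp only: \<rho>.hom_one)
    then show ?thesis using inj_onD[OF bij_betw_imp_inj_on[OF \<rho>(2)]] d by simp
  qed
  have deck_trivial: "mon v = \<one>\<^bsub>D\<^esub>" if v: "v \<in> carrier ?G" "\<And>k. k < n \<Longrightarrow> int r dvd \<alpha> k v" for v
    unfolding mon_gens[OF v(1)]
  proof (rule deck.finprod_one_eqI)
    fix k assume "k \<in> {..<n}"
    then have k: "k < n" and a: "mon (xg k) \<in> carrier D" using x_closed mon_in by auto
    show "mon (xg k) [^]\<^bsub>D\<^esub> \<alpha> k v = \<one>\<^bsub>D\<^esub>"
      using pow[OF a] v(2)[OF k] deck.int_pow_eq_id[OF a] by (blast intro: dvd_trans)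
  qed
  have "int r dvd \<alpha> k u" if one: "mon u = \<one>\<^bsub>D\<^esub>" and k: "k < n" for k
  proof (cases "r = 0")
    case False
    \<comment> \<open>The map that \<open>mon\<close> induces on residues; elements with equal
      residues have equal monodromy by \<open>deck_trivial\<close>.\<close>
    define F where "F x = mon (SOME v. v \<in> carrier ?G \<and> residues r v = x)" for x
    have F: "F (residues r v) = mon v" if v: "v \<in> carrier ?G" for v
    proof -
      let ?w = "SOME w. w \<in> carrier ?G \<and> residues r w = residues r v"
      have w: "?w \<in> carrier ?G \<and> residues r ?w = residues r v" by (rule someI[of _ v]) (use v in simp)
      have "residues r (?w \<otimes>\<^bsub>?G\<^esub> inv\<^bsub>?G\<^esub> v) = residues r ?w \<otimes>\<^bsub>?P\<^esub> inv\<^bsub>?P\<^esub> residues r v"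
        by (simp only: R.hom_mult[OF conjunct1[OF w] inv_closed[OF v]] R.hom_inv[OF v])
      also have "\<dots> = \<one>\<^bsub>?P\<^esub>"
        unfolding conjunct2[OF w] by (rule P.r_inv[OF R.hom_closed[OF v]])
      finally have "residues r (?w \<otimes>\<^bsub>?G\<^esub> inv\<^bsub>?G\<^esub> v) = \<one>\<^bsub>?P\<^esub>" .
      then have "mon (?w \<otimes>\<^bsub>?G\<^esub> inv\<^bsub>?G\<^esub> v) = \<one>\<^bsub>D\<^esub>" unfolding residues_one using w v by (intro deck_trivial) auto
      then have "mon ?w \<otimes>\<^bsub>D\<^esub> inv\<^bsub>D\<^esub> mon v = \<one>\<^bsub>D\<^esub>" using w v by simp
      then show ?thesis using w v mon_in deck.inv_equality[of "mon ?w" "inv\<^bsub>D\<^esub> mon v"] by (simp add: F_def)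
    qed
    have "F ` carrier ?P = carrier D"
      unfolding residues_surj[symmetric] image_image using F mon_in mon_surj by (auto simp: image_iff) metis
    moreover have "finite (carrier ?P)" "card (carrier ?P) = card (carrier D)"
      using False bij_betw_same_card[OF \<rho>(2)] by (auto simp: carrier_integer_mod_group intro!: finite_PiE)
    ultimately have inj: "inj_on F (carrier ?P)" by (intro eq_card_imp_inj_on) auto
    have "F (residues r u) = F \<one>\<^bsub>?P\<^esub>"
      using F[OF u] F[OF one_closed] one R.hom_one mon.hom_one by (simp del: one_product_group)
    then have "residues r u = \<one>\<^bsub>?P\<^esub>" by (rule inj_onD[OF inj]) (use u in \<open>simp_all del: one_product_group carrier_product_group\<close>)
    then show ?thesis unfolding residues_one using k by blast
  next
    case True
    \<comment> \<open>The monodromy in the coordinates of the isomorphism, which for r = 0 are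
      integers.\<close>
    define \<beta> where "\<beta> i v = \<rho> (mon v) i" for i v
    have n2: "n = 2" using n True by blast
    have add: "\<beta> i (v \<otimes>\<^bsub>?G\<^esub> w) = \<beta> i v + \<beta> i w" if "i < n" "v \<in> carrier ?G" "w \<in> carrier ?G" for i v w
      using that mon_in by (simp add: \<beta>_def mon_mult product_group_def True)
    have lin: "\<beta> i v = \<alpha> 0 v * \<beta> i (xg 0) + \<alpha> 1 v * \<beta> i (xg 1)" if "i < n" "v \<in> carrier ?G" for i v
      using additive_eq[of "\<beta> i" v] add that by (simp add: n2 numeral_2_eq_2)
    have surj: "\<exists>v\<in>carrier ?G. \<forall>i<n. \<beta> i v = of_bool (i = j)" for j
    proof -
      have "(\<lambda>i\<in>{..<n}. of_bool (i = j)) \<in> carrier ?P" by (simp add: True carrier_integer_mod_group)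
      then obtain d where d: "d \<in> carrier D" "\<rho> d = (\<lambda>i\<in>{..<n}. of_bool (i = j))"
        using bij_betw_imp_surj_on[OF \<rho>(2)] by (metis imageE)
      obtain v where v: "v \<in> carrier ?G" "mon v = d" by (rule mon_surj[OF d(1)])
      then have "\<forall>i<n. \<beta> i v = of_bool (i = j)" using d(2) by (simp add: \<beta>_def)
      then show ?thesis using \<open>v \<in> carrier ?G\<close> by blast
    qed
    obtain v where v: "v \<in> carrier ?G" "\<beta> 0 v = 1" "\<beta> 1 v = 0" using surj[of 0] n2 by auto
    obtain w where w: "w \<in> carrier ?G" "\<beta> 0 w = 0" "\<beta> 1 w = 1" using surj[of 1] n2 by auto
    have z: "\<beta> 0 u = 0" "\<beta> 1 u = 0" using one \<rho>.hom_one n2 by (auto simp: \<beta>_def)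
    define a b c d where "a = \<beta> 0 (xg 0)" and "b = \<beta> 1 (xg 0)" and "c = \<beta> 0 (xg 1)" and "d = \<beta> 1 (xg 1)"
    have n01: "0 < n" "1 < n" using n2 by auto
    note L = lin[OF n01(1), folded a_def c_def] lin[OF n01(2), folded b_def d_def]
    \<comment> \<open>\<open>v\<close> and \<open>w\<close> are sent to the two unit vectors, so the
      determinant of their exponents times that of the monodromy is 1.\<close>
    have "(\<alpha> 0 v * a + \<alpha> 1 v * c) * (\<alpha> 0 w * b + \<alpha> 1 w * d) - (\<alpha> 0 v * b + \<alpha> 1 v * d) * (\<alpha> 0 w * a + \<alpha> 1 w * c) = 1"
      using L[OF v(1)] L[OF w(1)] v w by simp
    then have "(\<alpha> 0 v * \<alpha> 1 w - \<alpha> 1 v * \<alpha> 0 w) * (a * d - b * c) = 1" by (simp add: algebra_simps)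
    then have det: "a * d - b * c \<noteq> 0" by auto
    have e: "\<alpha> 0 u * a + \<alpha> 1 u * c = 0" "\<alpha> 0 u * b + \<alpha> 1 u * d = 0" using L[OF u] z by auto
    have "\<alpha> 0 u * (a * d - b * c) = d * (\<alpha> 0 u * a + \<alpha> 1 u * c) - c * (\<alpha> 0 u * b + \<alpha> 1 u * d)"
      "\<alpha> 1 u * (a * d - b * c) = a * (\<alpha> 0 u * b + \<alpha> 1 u * d) - b * (\<alpha> 0 u * a + \<alpha> 1 u * c)"
      by (simp_all add: algebra_simps)
    then have "\<alpha> 0 u = 0" "\<alpha> 1 u = 0" using e det by auto
    moreover have "k = 0 \<or> k = 1" using k n2 by auto
    ultimately show ?thesis by auto
  qed
  then show ?thesis using deck_trivial u by blast
qed

end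

section \<open>The section formed by the balanced lifts\<close>

locale balanced_cover = graph_cover X v0 n ed K Xhat p \<alpha> \<theta>
  for X :: "'a::topological_space set" and v0 n ed K and Xhat :: "'b::topological_space set" and p \<alpha> \<theta> +
  fixes r :: nat
  assumes ker: "u \<in> carrier (pi1 X v0) \<Longrightarrow> mon u = \<one>\<^bsub>D\<^esub> \<longleftrightarrow> (\<forall>k<n. int r dvd \<alpha> k u)"
    and cop: "coprime (int r) (int n - 1)"
begin

text \<open>Lifts of \<open>h\<close> correspond to tails modulo the kernel of the monodromy, and
  balance fixes the tail modulo the same kernel. So this condition singles out one lift.\<close>

definition good :: "('a \<Rightarrow> 'a) \<Rightarrow> ('b \<Rightarrow> 'b) \<Rightarrow> bool" where
  "good h f \<longleftrightarrow> covers h f \<and> (\<exists>b. adapted f b \<and> balanced (int r) (ind h b))"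

text \<open>Conjugation by the class of \<open>b' +++ reversepath b\<close> relates two balanced
  maps. Hence \<open>r\<close> divides its exponents, its monodromy is trivial, and the lifts agree
  at \<open>base\<close>.\<close>

lemma good_unique:
  assumes f: "good h f" and f': "good h f'" and x: "x \<in> Xhat"
  shows "f x = f' x"
proof -
  obtain b where b: "covers h f" "adapted f b" "balanced (int r) (ind h b)" using f by (auto simp: good_def)
  obtain b' where b': "covers h f'" "adapted f' b'" "balanced (int r) (ind h b')" using f' by (auto simp: good_def)
  note h = coversD(1,2)[OF b(1)] and bp = adapted_path[OF b(1,2)] and bp' = adapted_path[OF b'(1,2)]
  let ?g = "hclass X (b' +++ reversepath b)"
  have g: "?g \<in> carrier (pi1 X v0)"
    using path_from_to_join[OF bp' path_from_to_reverse[OF bp]] by (simp add: path_from_to_loop)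
  have "balanced (int r) (inner ?g \<circ> ind h b)"
    by (rule balanced_cong[OF _ b'(3)]) (use pi1_map_change[OF v0_in h bp' bp] x_closed in auto)
  then have "\<forall>k<n. int r dvd \<alpha> k ?g"
    using balanced_inner_compose[OF ind_hom[OF b(1,2)] b(3) g cop] by blast
  then have "mon ?g = \<one>\<^bsub>D\<^esub>" using ker[OF g] by blast
  then have "f' base = f base"
    using adapted_change[OF b(1,2) bp'] b'(2) coversD(5)[OF b(1) base(1)] by (simp add: adapted_def deck_one)
  then show ?thesis
    using lift_unique[of f f' base x] coversD[OF b(1)] coversD[OF b'(1)] base x by simp
qed

lemma good_compose:
  assumes f: "good h f" and f': "good h' f'"
  shows "good (h' \<circ> h) (f' \<circ> f)"
proof -
  obtain b where b: "covers h f" "adapted f b" "balanced (int r) (ind h b)" using f by (auto simp: good_def)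
  obtain b' where b': "covers h' f'" "adapted f' b'" "balanced (int r) (ind h' b')" using f' by (auto simp: good_def)
  have "balanced (int r) (ind (h' \<circ> h) (b' +++ (h' \<circ> b)))"
  proof (rule balanced_cong[OF _ balanced_compose[OF ind_hom[OF b'(1,2)] ind_hom[OF b(1,2)] b'(3) b(3)]])
    show "(ind h' b' \<circ> ind h b) (xg k) = ind (h' \<circ> h) (b' +++ (h' \<circ> b)) (xg k)" if "k < n" for k
      using pi1_map_compose[OF v0_in coversD(1,2)[OF b(1)] adapted_path[OF b(1,2)] coversD(1,2)[OF b'(1)] adapted_path[OF b'(1,2)] x_closed[OF that]]
      by simp
  qed
  then show ?thesis
    using covers_compose[OF b(1) b'(1)] adapted_compose[OF b(1,2) b'(1,2)] by (auto simp: good_def)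
qed

lemma good_id: "good id id"
proof -
  have 0: "lend (\<lambda>_. v0) base = base" using lift_end_const[OF cov base(1)] base(2) by simp
  have c: "(\<lambda>_. v0) \<in> loops_at X v0" using v0_in by simp
  have "balanced (int r) (inner \<one>\<^bsub>pi1 X v0\<^esub>)"
    using jac_inverse_inner[OF one_closed] kappa_inner[OF one_closed] alpha_one unfolding balanced_def
    by (metis (no_types, lifting) dvd_0_right mult_zero_right)
  then have "balanced (int r) (ind id (\<lambda>_. v0))"
    by (rule balanced_cong[rotated]) (use pi1_map_id[OF v0_in c] x_closed in \<open>auto simp: pi1_one\<close>)
  then show ?thesis
    using covers_id base c 0 by (auto simp: good_def adapted_def path_from_to_loop)
qed

text \<open>Appending the track of the base point to the tail leaves the induced map unchanged, so a
  lifted homotopy that starts at a good lift ends at one. \<open>good_homotopic\<close> does the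
  same for homotopies given upstairs.\<close>

lemma good_lift:
  assumes f: "good h f" and H: "htpy X X h h' H" and h': "continuous_on X h'" "h' ` X \<subseteq> X"
  obtains f' where "good h' f'" "homotopic_with (fiber_preserving Xhat p) (top_of_set Xhat) (top_of_set Xhat) f f'"
proof -
  obtain b where b: "covers h f" "adapted f b" "balanced (int r) (ind h b)" using f by (auto simp: good_def)
  obtain f' and k :: "real \<times> 'b \<Rightarrow> 'b" where f': "covers h' f'" "htpy Xhat Xhat f f' k"
    "\<And>t x. t \<in> {0..1} \<Longrightarrow> x \<in> Xhat \<Longrightarrow> p (k (t,x)) = H (t, p x)"
    by (rule lift_htpy[OF H b(1) h']) blast
  have "adapted f' (b +++ (\<lambda>t. H (t,v0)))"
    by (rule adapted_htpy[OF f'(2) b(1,2)]) (use f'(3)[OF _ base(1)] base in simp)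
  moreover have "balanced (int r) (ind h' (b +++ (\<lambda>t. H (t,v0))))"
    by (rule balanced_cong[OF _ b(3)])
      (use pi1_map_homotopy[OF v0_in coversD(1,2)[OF b(1)] adapted_path[OF b(1,2)] h' H] x_closed in auto)
  moreover have "homotopic_with (fiber_preserving Xhat p) (top_of_set Xhat) (top_of_set Xhat) f f'"
    by (rule homotopic_with_onI[of _ k]) (use f'(2,3) in \<open>auto simp: htpy_def fiber_preserving_def\<close>)
  ultimately show ?thesis using that f'(1) by (auto simp: good_def)
qed

lemma good_homotopic:
  assumes f: "good h f" and ff: "homotopic_with (fiber_preserving Xhat p) (top_of_set Xhat) (top_of_set Xhat) f f'"
  obtains h' where "good h' f'" "homotopic_with (\<lambda>_. True) (top_of_set X) (top_of_set X) h h'"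
proof -
  obtain b where b: "covers h f" "adapted f b" "balanced (int r) (ind h b)" using f by (auto simp: good_def)
  obtain k :: "real \<times> 'b \<Rightarrow> 'b" where k: "htpy Xhat Xhat f f' k" "\<And>t. t \<in> {0..1} \<Longrightarrow> fiber_preserving Xhat p (\<lambda>x. k (t,x))"
    by (rule homotopic_with_htpy[OF ff]) blast
  obtain h1 h' and H :: "real \<times> 'a \<Rightarrow> 'a" where H: "covers h1 f" "covers h' f'" "htpy X X h1 h' H"
    "\<And>t x. t \<in> {0..1} \<Longrightarrow> x \<in> Xhat \<Longrightarrow> H (t, p x) = p (k (t,x))"
  proof (rule descend_htpy[OF k])
    fix h1 h' :: "'a \<Rightarrow> 'a" and H :: "real \<times> 'a \<Rightarrow> 'a"
    assume 1: "covers h1 f" and 2: "covers h' f'" and 3: "htpy X X h1 h' H"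
      and 4: "\<And>t x. t \<in> {0..1} \<Longrightarrow> x \<in> Xhat \<Longrightarrow> H (t, p x) = p (k (t,x))"
    show thesis by (rule that[OF 1 2 3 4])
  qed
  have H': "htpy X X h h' H" using H(3) covers_base_unique[OF H(1) b(1)] by (simp add: htpy_def)
  have "adapted f' (b +++ (\<lambda>t. H (t,v0)))"
    by (rule adapted_htpy[OF k(1) b(1,2)]) (use H(4)[OF _ base(1)] base in simp)
  moreover have "balanced (int r) (ind h' (b +++ (\<lambda>t. H (t,v0))))"
    by (rule balanced_cong[OF _ b(3)])
      (use pi1_map_homotopy[OF v0_in coversD(1,2)[OF b(1)] adapted_path[OF b(1,2)] coversD(1,2)[OF H(2)] H'] x_closed in auto)
  ultimately show ?thesis using that H(2) htpy_homotopic_with[OF H'] by (auto simp: good_def)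
qed

text \<open>A map freely homotopic to the identity acts by a conjugation, which the abelian class
  does not see.\<close>

lemma jac_one_of_homotopy:
  assumes h: "continuous_on X h" "h ` X \<subseteq> X" "path_from_to X v0 (h v0) b" and h': "continuous_on X h'" "h' ` X \<subseteq> X" "path_from_to X v0 (h' v0) b'"
    and H: "htpy X X (h' \<circ> h) id H" and kl: "k < n"
  shows "(\<Sum>a<n. jac (ind h b) k a * jac (ind h' b') a l) = of_bool (k = l)"
proof -
  let ?c = "b' +++ (h' \<circ> b)"
  have hh: "continuous_on X (h' \<circ> h)" "(h' \<circ> h) ` X \<subseteq> X"
    using h h' continuous_on_compose[OF h(1) continuous_on_subset[OF h'(1) h(2)]] by auto
  have c: "path_from_to X v0 ((h' \<circ> h) v0) ?c"
    using path_from_to_join[OF h'(3) path_from_to_image[OF h'(1,2) h(3)]] by simp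
  have t: "?c +++ (\<lambda>t. H (t,v0)) \<in> loops_at X v0"
    using path_from_to_join[OF c, of v0 "\<lambda>t. H (t,v0)"] htpy_track_path[OF H v0_in] by (simp add: path_from_to_def loops_at_def)
  have "(ind h' b' \<circ> ind h b) (xg k) = inner (hclass X (?c +++ (\<lambda>t. H (t,v0)))) (xg k)"
    using pi1_map_compose[OF v0_in h h' x_closed[OF kl]] pi1_map_homotopy[OF v0_in hh c _ _ H x_closed[OF kl]]
      pi1_map_id[OF v0_in t x_closed[OF kl]] by simp
  then have "jac (ind h' b' \<circ> ind h b) k l = of_bool (k = l)"
    using t x_closed[OF kl] kl by (simp add: jac_def alpha_inner alpha_x)
  then show ?thesis
    using jac_compose[OF pi1_map_hom[OF v0_in h'] pi1_map_hom[OF v0_in h] kl] by simp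
qed

text \<open>A homotopy inverse supplies the inverse matrix, \<open>balance_exists\<close> the
  conjugation that balances the induced map; prefixing a loop \<open>w\<close> to the tail realises
  this conjugation.\<close>

lemma good_exists:
  assumes "selfeq h"
  obtains f where "good h f"
proof -
  obtain h' where h: "continuous_on X h" "h ` X \<subseteq> X" and h': "continuous_on X h'" "h' ` X \<subseteq> X"
    and hom: "homotopic_with (\<lambda>_. True) (top_of_set X) (top_of_set X) (h' \<circ> h) id"
      "homotopic_with (\<lambda>_. True) (top_of_set X) (top_of_set X) (h \<circ> h') id"
    using assms by (auto simp: self_homotopy_equivalence_def)
  obtain H :: "real \<times> 'a \<Rightarrow> 'a" where H: "htpy X X (h' \<circ> h) id H" by (rule homotopic_with_htpy[OF hom(1)]) blast
  obtain H' :: "real \<times> 'a \<Rightarrow> 'a" where H': "htpy X X (h \<circ> h') id H'" by (rule homotopic_with_htpy[OF hom(2)]) blast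
  have path: "\<exists>b. path_from_to X v0 (g v0) b" if "g ` X \<subseteq> X" for g
    using pc v0_in that unfolding path_connected_def path_from_to_def by (metis image_subset_iff)
  obtain b where b: "path_from_to X v0 (h v0) b" using path h by blast
  obtain b' where b': "path_from_to X v0 (h' v0) b'" using path h' by blast
  let ?\<phi> = "ind h b"
  have \<phi>: "?\<phi> \<in> hom (pi1 X v0) (pi1 X v0)" by (rule pi1_map_hom[OF v0_in h b])
  have "jac_inverse ?\<phi> (jac (ind h' b'))"
    using jac_one_of_homotopy[OF h b h' b' H] jac_one_of_homotopy[OF h' b' h b H'] by (simp add: jac_inverse_def)
  then obtain g where g: "g \<in> carrier (pi1 X v0)" "balanced (int r) (inner g \<circ> ?\<phi>)"
    by (rule balance_exists[OF \<phi> _ cop]) blast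
  obtain w where w: "w \<in> loops_at X v0" "g = hclass X w" using g(1) by (auto simp: pi1_carrier)
  have wp: "path_from_to X v0 (id v0) w" using w by (simp add: path_from_to_loop)
  have i: "continuous_on X id" "id ` X \<subseteq> X" by auto
  let ?c = "w +++ b"
  have c: "path_from_to X v0 (h v0) ?c" using path_from_to_join[OF _ b] w by (simp add: path_from_to_loop)
  have "ind h ?c u = inner g (?\<phi> u)" if u: "u \<in> carrier (pi1 X v0)" for u
  proof -
    have "ind (id \<circ> h) (w +++ (id \<circ> b)) u = ind id w (?\<phi> u)"
      by (rule pi1_map_compose[OF v0_in h b i wp u])
    then show ?thesis using pi1_map_id[OF v0_in w(1) hom_in_carrier[OF \<phi> u]] w(2) by (simp only: id_comp)
  qed
  then have bal: "balanced (int r) (ind h ?c)"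
    by (intro balanced_cong[OF _ g(2)]) (use x_closed in auto)
  obtain f where "covers h f" "adapted f ?c"
  proof (rule lift_exists[OF h c])
    fix u assume u: "u \<in> carrier (pi1 X v0)" "mon u = \<one>\<^bsub>D\<^esub>"
    have ch: "ind h ?c \<in> hom (pi1 X v0) (pi1 X v0)" by (rule pi1_map_hom[OF v0_in h c])
    \<comment> \<open>Any endomorphism acts linearly on exponents and so preserves divisibility by
      \<open>r\<close>. This is why such a kernel never obstructs a lift.\<close>
    have "int r dvd \<alpha> k (ind h ?c u)" for k
      unfolding alpha_hom[OF ch u(1)] by (intro dvd_sum dvd_mult2) (use ker[OF u(1)] u(2) in auto)
    then show "mon (ind h ?c u) = \<one>\<^bsub>D\<^esub>" using ker[OF hom_in_carrier[OF ch u(1)]] by blast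
  qed blast
  then show ?thesis using that bal by (auto simp: good_def)
qed

text \<open>The homotopy downstairs lifts to one from \<open>f' \<circ> f\<close> to a good lift of
  the identity, and by uniqueness that is the identity.\<close>

lemma good_inverse:
  assumes f: "good h f" and f': "good h' f'" and H: "htpy X X (h' \<circ> h) id H"
  shows "homotopic_with (\<lambda>_. True) (top_of_set Xhat) (top_of_set Xhat) (f' \<circ> f) id"
proof -
  obtain g where g: "good id g" "homotopic_with (fiber_preserving Xhat p) (top_of_set Xhat) (top_of_set Xhat) (f' \<circ> f) g"
    by (rule good_lift[OF good_compose[OF f f'] H]) auto
  obtain k :: "real \<times> 'b \<Rightarrow> 'b" where "htpy Xhat Xhat (f' \<circ> f) g k"
    by (rule homotopic_with_htpy[OF g(2)]) blast
  then have "htpy Xhat Xhat (f' \<circ> f) id k" using good_unique[OF g(1) good_id] by (simp add: htpy_def)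
  then show ?thesis by (rule htpy_homotopic_with)
qed

lemma good_equivalence:
  assumes h: "selfeq h" and f: "good h f"
  shows "self_homotopy_equivalence (top_of_set Xhat) f"
proof -
  obtain h' where hc: "continuous_on X h" "h ` X \<subseteq> X" and h': "continuous_on X h'" "h' ` X \<subseteq> X"
    and hom: "homotopic_with (\<lambda>_. True) (top_of_set X) (top_of_set X) (h' \<circ> h) id"
      "homotopic_with (\<lambda>_. True) (top_of_set X) (top_of_set X) (h \<circ> h') id"
    using h by (auto simp: self_homotopy_equivalence_def)
  have "selfeq h'" using hc h' hom by (auto simp: self_homotopy_equivalence_def)
  then obtain f' where f': "good h' f'" by (rule good_exists)
  obtain H :: "real \<times> 'a \<Rightarrow> 'a" where H: "htpy X X (h' \<circ> h) id H" by (rule homotopic_with_htpy[OF hom(1)]) blast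
  obtain H' :: "real \<times> 'a \<Rightarrow> 'a" where H': "htpy X X (h \<circ> h') id H'" by (rule homotopic_with_htpy[OF hom(2)]) blast
  have "continuous_on Xhat f" "f ` Xhat \<subseteq> Xhat" "continuous_on Xhat f'" "f' ` Xhat \<subseteq> Xhat"
    using f f' by (auto simp: good_def covers_def)
  then show ?thesis
    using good_inverse[OF f f' H] good_inverse[OF f' f H']
    unfolding self_homotopy_equivalence_def by (intro conjI exI[of _ f']) auto
qed

text \<open>All members of the class are used, so no representative has to be chosen;
  \<open>sec_class\<close> shows that the result is again a single class.\<close>

definition sec :: "('a \<Rightarrow> 'a) set \<Rightarrow> ('b \<Rightarrow> 'b) set" where
  "sec c = {f. \<exists>h\<in>c. good h f}"

text \<open>A fiber-preserving homotopy descends and keeps goodness. Conversely, a homotopy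
  downstairs lifts to one that ends at a good lift of \<open>h\<close>, which can only be
  \<open>f\<close>.\<close>

lemma sec_class:
  assumes f: "good h f"
  shows "sec (cls h) = fcls f"
proof (intro equalityI subsetI)
  fix f' assume "f' \<in> fcls f"
  then have "homotopic_with (fiber_preserving Xhat p) (top_of_set Xhat) (top_of_set Xhat) f f'" by (simp add: map_class_def)
  then obtain h' where "good h' f'" "homotopic_with (\<lambda>_. True) (top_of_set X) (top_of_set X) h h'"
    by (rule good_homotopic[OF f])
  then show "f' \<in> sec (cls h)" by (auto simp: sec_def map_class_def)
next
  fix f' assume "f' \<in> sec (cls h)"
  then obtain h' where h': "homotopic_with (\<lambda>_. True) (top_of_set X) (top_of_set X) h h'" "good h' f'"
    by (auto simp: sec_def map_class_def)
  have hc: "continuous_on X h" "h ` X \<subseteq> X" using f by (auto simp: good_def covers_def)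
  obtain H :: "real \<times> 'a \<Rightarrow> 'a" where H: "htpy X X h' h H" by (rule homotopic_with_htpy[OF homotopic_with_symD[OF h'(1)]]) blast
  obtain g where g: "good h g" "homotopic_with (fiber_preserving Xhat p) (top_of_set Xhat) (top_of_set Xhat) f' g"
    by (rule good_lift[OF h'(2) H hc])
  obtain k :: "real \<times> 'b \<Rightarrow> 'b" where k: "htpy Xhat Xhat f' g k" "\<And>t. t \<in> {0..1} \<Longrightarrow> fiber_preserving Xhat p (\<lambda>x. k (t,x))"
    by (rule homotopic_with_htpy[OF g(2)]) blast
  have "homotopic_with (fiber_preserving Xhat p) (top_of_set Xhat) (top_of_set Xhat) f' f"
  proof (rule homotopic_with_onI[of _ k])
    show "fiber_preserving Xhat p (\<lambda>x. k (t,x))" if "t \<in> {0..1}" for t by (rule k(2)[OF that])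
    show "fiber_preserving Xhat p u = fiber_preserving Xhat p v" if "\<And>x. x \<in> Xhat \<Longrightarrow> u x = v x" for u v
      using that by (simp add: fiber_preserving_def)
  qed (use k(1) good_unique[OF g(1) f] in \<open>auto simp: htpy_def\<close>)
  then show "f' \<in> fcls f" by (simp add: map_class_def homotopic_with_symD)
qed

lemma HE_cases:
  assumes "c \<in> carrier (HE X)"
  obtains h f where "selfeq h" "c = cls h" "good h f"
  using assms good_exists unfolding HE_def HE_with_carrier by metis

lemma sec_hom: "sec \<in> hom (HE X) (FHE Xhat p)"
proof (rule homI)
  fix c assume "c \<in> carrier (HE X)"
  then obtain h f where h: "selfeq h" "c = cls h" "good h f" by (rule HE_cases)
  have "fiber_preserving Xhat p f" using h(3) covers_fiber_preserving by (auto simp: good_def)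
  then show "sec c \<in> carrier (FHE Xhat p)"
    using good_equivalence[OF h(1,3)] sec_class[OF h(3)] h(2) unfolding FHE_def HE_with_carrier by blast
next
  fix c c' assume "c \<in> carrier (HE X)" "c' \<in> carrier (HE X)"
  note cc = this
  obtain h f where h: "c = cls h" "good h f" by (rule HE_cases[OF cc(1)])
  obtain h' f' where h': "c' = cls h'" "good h' f'" by (rule HE_cases[OF cc(2)])
  have c: "covers h f" "covers h' f'" using h h' by (auto simp: good_def)
  note C = coversD[OF c(1)] and C' = coversD[OF c(2)]
  have "sec (c \<otimes>\<^bsub>HE X\<^esub> c') = sec (cls (h \<circ> h'))"
    unfolding h(1) h'(1) map_class_compose[OF C(1,2) C'(1,2)] ..
  also have "\<dots> = fcls (f \<circ> f')" by (rule sec_class[OF good_compose[OF h'(2) h(2)]])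
  also have "\<dots> = fcls f \<otimes>\<^bsub>FHE Xhat p\<^esub> fcls f'"
    by (rule fiber_map_class_compose[OF C(3,4) covers_fiber_preserving[OF c(1)] C'(3,4) covers_fiber_preserving[OF c(2)], symmetric])
  finally show "sec (c \<otimes>\<^bsub>HE X\<^esub> c') = sec c \<otimes>\<^bsub>FHE Xhat p\<^esub> sec c'"
    unfolding h(1) h'(1) sec_class[OF h(2)] sec_class[OF h'(2)] .
qed

lemma sec_section:
  assumes "c \<in> carrier (HE X)"
  shows "FHE_to_HE Xhat p X (sec c) = c"
proof -
  obtain h f where h: "selfeq h" "c = cls h" "good h f" by (rule HE_cases[OF assms])
  have c: "covers h f" using h(3) by (simp add: good_def)
  have ff: "f \<in> sec c"
    unfolding h(2) sec_class[OF h(3)]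
    using covers_fiber_preserving[OF c] coversD(3,4)[OF c] by (auto simp: map_class_def)
  show ?thesis
  proof (intro equalityI subsetI)
    fix g assume "g \<in> c"
    then show "g \<in> FHE_to_HE Xhat p X (sec c)"
    proof -
      have "\<forall>x\<in>Xhat. h (p x) = p (f x)" using coversD(6)[OF c] by simp
      moreover have "homotopic_with (\<lambda>_. True) (top_of_set X) (top_of_set X) h g"
        using \<open>g \<in> c\<close> unfolding h(2) by (simp add: map_class_def)
      ultimately show ?thesis using ff unfolding FHE_to_HE_def by blast
    qed
  next
    fix g assume "g \<in> FHE_to_HE Xhat p X (sec c)"
    then obtain f' h' where f': "f' \<in> sec c" "\<And>x. x \<in> Xhat \<Longrightarrow> h' (p x) = p (f' x)"
      "homotopic_with (\<lambda>_. True) (top_of_set X) (top_of_set X) h' g"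
      unfolding FHE_to_HE_def by blast
    then obtain h1 where h1: "h1 \<in> c" "good h1 f'" by (auto simp: sec_def)
    have c1: "covers h1 f'" using h1(2) by (simp add: good_def)
    have eq: "h1 y = h' y" if "y \<in> X" for y
      using that p_image f'(2) coversD(6)[OF c1] by (metis imageE)
    obtain H :: "real \<times> 'a \<Rightarrow> 'a" where "htpy X X h' g H" by (rule homotopic_with_htpy[OF f'(3)]) blast
    then have "htpy X X h1 g H" using eq by (simp add: htpy_def)
    then have "homotopic_with (\<lambda>_. True) (top_of_set X) (top_of_set X) h1 g" by (rule htpy_homotopic_with)
    then show "g \<in> c" using h1(1) unfolding h(2) map_class_def by (auto intro: homotopic_with_trans)
  qed
qed

theorem sufficiency: "Out_action_lifts Xhat p X"
  unfolding Out_action_lifts_def using sec_hom sec_section by blast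

end

theorem theorem1:
  fixes X :: "'a::topological_space set"
    and Xhat :: "'b::topological_space set"
    and p :: "'b \<Rightarrow> 'a"
    and n :: nat
  assumes "topological_graph (top_of_set X)"
    and "connected X"
    and "has_genus (top_of_set X) n"
    and "n \<ge> 2"
    and "connected Xhat"
    and "normal_covering Xhat p X"
    and "comm_group (deck_group Xhat p)"
  shows "Out_action_lifts Xhat p X \<longleftrightarrow>
    (\<exists>r::nat. deck_group Xhat p \<cong> product_group {..<n} (\<lambda>_. integer_mod_group r) \<and>
              coprime r (n - 1))"
proof -
  obtain v0 ed and K :: "real \<times> 'a \<Rightarrow> 'a" where G: "graph_handles X v0 n ed K"
    using topological_graph_handles[OF assms(1-3)] assms(4) by auto
  interpret graph_handles X v0 n ed K by (rule G)
  obtain \<alpha> :: "nat \<Rightarrow> (real \<Rightarrow> 'a) set \<Rightarrow> int" and \<theta> :: "nat \<Rightarrow> nat \<Rightarrow> (real \<Rightarrow> 'a) set \<Rightarrow> int"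
    where inv: "\<And>i u v. u \<in> carrier (pi1 X v0) \<Longrightarrow> v \<in> carrier (pi1 X v0) \<Longrightarrow> \<alpha> i (u \<otimes>\<^bsub>pi1 X v0\<^esub> v) = \<alpha> i u + \<alpha> i v"
    "\<And>i j u v. u \<in> carrier (pi1 X v0) \<Longrightarrow> v \<in> carrier (pi1 X v0) \<Longrightarrow>
       \<theta> i j (u \<otimes>\<^bsub>pi1 X v0\<^esub> v) = \<theta> i j u + \<theta> i j v + \<alpha> i u * \<alpha> j v"
    "\<And>i k. k < n \<Longrightarrow> \<alpha> i (hclass X (gam k)) = of_bool (k = i)"
    "\<And>i j k. k < n \<Longrightarrow> \<theta> i j (hclass X (gam k)) = 0"
  proof (rule heisenberg_invariants)
    fix \<alpha> :: "nat \<Rightarrow> (real \<Rightarrow> 'a) set \<Rightarrow> int" and \<theta> :: "nat \<Rightarrow> nat \<Rightarrow> (real \<Rightarrow> 'a) set \<Rightarrow> int"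
    assume 1: "\<And>i u v. u \<in> carrier (pi1 X v0) \<Longrightarrow> v \<in> carrier (pi1 X v0) \<Longrightarrow> \<alpha> i (u \<otimes>\<^bsub>pi1 X v0\<^esub> v) = \<alpha> i u + \<alpha> i v"
      and 2: "\<And>i j u v. u \<in> carrier (pi1 X v0) \<Longrightarrow> v \<in> carrier (pi1 X v0) \<Longrightarrow>
       \<theta> i j (u \<otimes>\<^bsub>pi1 X v0\<^esub> v) = \<theta> i j u + \<theta> i j v + \<alpha> i u * \<alpha> j v"
      and 3: "\<And>i k. k < n \<Longrightarrow> \<alpha> i (hclass X (gam k)) = of_bool (k = i)"
      and 4: "\<And>i j k. k < n \<Longrightarrow> \<theta> i j (hclass X (gam k)) = 0"
    show thesis by (rule that[OF 1 2 3 4])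
  qed
  have "magnus_group (pi1 X v0) n (\<lambda>k. hclass X (gam k)) \<alpha> \<theta>"
    unfolding magnus_group_def magnus_group_axioms_def
    using pi1_group[OF v0_in] assms(4) gam_loop inv pi1_generated by (auto simp: gens_def)
  then interpret graph_cover X v0 n ed K Xhat p \<alpha> \<theta>
    using assms(5-7) by (intro graph_cover.intro graph_cover_axioms.intro G)
  show ?thesis
  proof
    assume "Out_action_lifts Xhat p X"
    then obtain s where "s \<in> hom (HE X) (FHE Xhat p)" "\<forall>c\<in>carrier (HE X). FHE_to_HE Xhat p X (s c) = c"
      by (auto simp: Out_action_lifts_def)
    then interpret lifting_section X v0 n ed K Xhat p \<alpha> \<theta> s by unfold_locales auto
    show "\<exists>r. D \<cong> residue_product r \<and> coprime r (n - 1)" by (rule necessity)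
  next
    assume "\<exists>r. D \<cong> residue_product r \<and> coprime r (n - 1)"
    then obtain r where r: "D \<cong> residue_product r" "coprime r (n - 1)" by blast
    \<comment> \<open>For r = 0 coprimality means that \<open>n - 1\<close> is 1.\<close>
    have "n = 2" if "r = 0" using r(2) that assms(4) by simp
    moreover have "coprime (int r) (int n - 1)"
    proof -
      have "int n - 1 = int (n - 1)" using assms(4) by simp
      then show ?thesis using r(2) by (simp only: coprime_int_iff)
    qed
    ultimately interpret balanced_cover X v0 n ed K Xhat p \<alpha> \<theta> r
      using kernel_of_iso[OF r(1)] by unfold_locales auto
    show "Out_action_lifts Xhat p X" by (rule sufficiency)
  qed
qed

end
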